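(* Let $1/2<p<\infty$, $0<q\leq\infty$, and $1/p-1<s<\min\{1/p,1\}$. Then there is a constant $C:=C(p,q,s)>0$ such that for all $f\in F^s_{p,q}(\mathbb{R})$ $$\sup_{N\in\mathbb{N}}\|\mathbb{E}_N f\|_{F^s_{p,q}}\leq C\,\|f\|_{F^s_{p,q}}.$$
   Context: $\mathbb{N}=\{1,2,\dots\}$. For $N\in\mathbb{N}$ and $\mu\in\mathbb{Z}$ let $I_{N,\mu}=[2^{-N}\mu,2^{-N}(\mu+1))$. The dyadic averaging operator (conditional expectation with respect to the $\sigma$-algebra generated by the dyadic intervals of length $2^{-N}$) is $$\mathbb{E}_N f(x)=\sum_{\mu\in\mathbb{Z}}\mathbf{1}_{I_{N,\mu}}(x)\,2^N\int_{I_{N,\mu}}f(t)\,dt .$$ $F^s_{p,q}=F^s_{p,q}(\mathbb{R})$ is the usual inhomogeneous Triebel-Lizorkin space of tempered distributions on the real line, with its usual (quasi-)norm. It has the following equivalent wavelet description. Let $\psi_0,\psi$ be an orthogonal compactly supported Daubechies scaling function and its corresponding wavelet, both of class $C^K$ and with $\psi$ having $L$ vanishing moments. Put $\psi_{0,\nu}(x)=\psi_0(x-\nu)$, $\psi_{j,\nu}(x)=\frac1{\sqrt2}\psi(2^{j-1}x-\nu)$ for $j\in\mathbb{N}$, $\nu\in\mathbb{Z}$, and $\lambda_{j,\nu}(f)=2^j\langle f,\psi_{j,\nu}\rangle$. If $K,L$ are large enough (depending on $p,q,s$), then $$\|f\|_{F^s_{p,q}}\asymp\Big\|\Big(\sum_{j=0}^\infty\Big|2^{js}\sum_{\nu\in\mathbb{Z}}\lambda_{j,\nu}(f)\mathbf{1}_{[2^{-j}\nu,2^{-j}(\nu+1)]}\Big|^q\Big)^{1/q}\Big\|_{L_p(\mathbb{R})}$$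 (usual modification if $q=\infty$). For distributions $f$ that are not locally integrable, $\int_{I_{N,\mu}}f(t)\,dt$ is the usual pairing of $f$ with $\mathbf{1}_{I_{N,\mu}}$, i.e. $\int_{I_{N,\mu}} f(t)\,dt=\sum_{j\ge0}\int_{I_{N,\mu}}f_j(t)\,dt$ with $f_j=\sum_{\nu\in\mathbb{Z}}\lambda_{j,\nu}(f)\psi_{j,\nu}$ (the series converges absolutely because $s>1/p-1$). *)

theory Defs
  imports "HOL-Analysis.Analysis"
begin

section \<open>Schwartz functions and tempered distributions on the real line\<close>

definition vderiv :: "nat \<Rightarrow> (real \<Rightarrow> 'a::real_normed_vector) \<Rightarrow> real \<Rightarrow> 'a" where
  "vderiv n g = ((\<lambda>h x. vector_derivative h (at x)) ^^ n) g"

definition C_k :: "nat \<Rightarrow> (real \<Rightarrow> 'a::real_normed_vector) \<Rightarrow> bool" where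
  "C_k k g \<longleftrightarrow> (\<forall>n<k. \<forall>x. vderiv n g differentiable (at x)) \<and> continuous_on UNIV (vderiv k g)"

definition compactly_supported :: "(real \<Rightarrow> 'a::zero) \<Rightarrow> bool" where
  "compactly_supported g \<longleftrightarrow> (\<exists>R. \<forall>x. \<bar>x\<bar> > R \<longrightarrow> g x = 0)"

definition schwartz :: "(real \<Rightarrow> complex) \<Rightarrow> bool" where
  "schwartz \<phi> \<longleftrightarrow> (\<forall>k. C_k k \<phi>) \<and>
     (\<forall>k m. bdd_above (range (\<lambda>x. \<bar>x\<bar> ^ k * cmod (vderiv m \<phi> x))))"

definition schwartz_seminorm :: "nat \<Rightarrow> nat \<Rightarrow> (real \<Rightarrow> complex) \<Rightarrow> real" where
  "schwartz_seminorm k m \<phi> = (SUP x. \<bar>x\<bar> ^ k * cmod (vderiv m \<phi> x))"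

definition test_function :: "(real \<Rightarrow> complex) \<Rightarrow> bool" where
  "test_function \<phi> \<longleftrightarrow> (\<forall>k. C_k k \<phi>) \<and> compactly_supported \<phi>"

text \<open>Distributions are total functionals on all functions \<open>real \<Rightarrow> complex\<close>; only their
  values on Schwartz functions carry meaning, and nothing below uses the other values.
  The pairing is bilinear (no complex conjugation).\<close>

type_synonym distribution = "(real \<Rightarrow> complex) \<Rightarrow> complex"

definition tempered_distribution :: "distribution \<Rightarrow> bool" where
  "tempered_distribution f \<longleftrightarrow>
     (\<forall>\<phi> \<eta>. schwartz \<phi> \<longrightarrow> schwartz \<eta> \<longrightarrow> f (\<lambda>x. \<phi> x + \<eta> x) = f \<phi> + f \<eta>) \<and>
     (\<forall>c \<phi>. schwartz \<phi> \<longrightarrow> f (\<lambda>x. c * \<phi> x) = c * f \<phi>) \<and>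
     (\<exists>B n. \<forall>\<phi>. schwartz \<phi> \<longrightarrow> cmod (f \<phi>) \<le> B * (\<Sum>k\<le>n. \<Sum>m\<le>n. schwartz_seminorm k m \<phi>))"

definition function_distribution :: "(real \<Rightarrow> complex) \<Rightarrow> distribution" where
  "function_distribution g = (\<lambda>\<phi>. LINT x|lborel. g x * \<phi> x)"

text \<open>The distribution \<open>f\<close> is locally integrable, and equal to the function \<open>g\<close>
  (which is then unique up to null sets).\<close>

definition represented_by :: "distribution \<Rightarrow> (real \<Rightarrow> complex) \<Rightarrow> bool" where
  "represented_by f g \<longleftrightarrow> (\<forall>a b. set_integrable lborel {a..b} g) \<and>
     (\<forall>\<phi>. test_function \<phi> \<longrightarrow> f \<phi> = function_distribution g \<phi>)"


section \<open>Triebel-Lizorkin spaces\<close>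

definition lp_generator :: "(real \<Rightarrow> complex) \<Rightarrow> bool" where
  "lp_generator \<phi> \<longleftrightarrow> schwartz \<phi> \<and>
     (\<forall>\<xi>. \<bar>\<xi>\<bar> \<le> 1 \<longrightarrow> \<phi> \<xi> = 1) \<and> (\<forall>\<xi>. \<bar>\<xi>\<bar> \<ge> 2 \<longrightarrow> \<phi> \<xi> = 0)"

definition lp_symbol :: "(real \<Rightarrow> complex) \<Rightarrow> nat \<Rightarrow> real \<Rightarrow> complex" where
  "lp_symbol \<phi> j \<xi> = (if j = 0 then \<phi> \<xi> else \<phi> (\<xi> / 2 ^ j) - \<phi> (2 * \<xi> / 2 ^ j))"

definition lp_kernel :: "(real \<Rightarrow> complex) \<Rightarrow> nat \<Rightarrow> real \<Rightarrow> complex" where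
  "lp_kernel \<phi> j x = 1 / (2 * pi) * (LINT \<xi>|lborel. lp_symbol \<phi> j \<xi> * cis (x * \<xi>))"

text \<open>The smooth function \<open>\<F>\<^sup>-\<^sup>1[\<phi>\<^sub>j \<F> f]\<close>, i.e. the convolution of the distribution \<open>f\<close>
  with the Schwartz function \<open>(1/2\<pi>) \<integral> \<phi>\<^sub>j(\<xi>) exp(i x \<xi>) d\<xi>\<close>.\<close>

definition lp_block :: "(real \<Rightarrow> complex) \<Rightarrow> nat \<Rightarrow> distribution \<Rightarrow> real \<Rightarrow> complex" where
  "lp_block \<phi> j f x = f (\<lambda>y. lp_kernel \<phi> j (x - y))"

text \<open>Powers with a positive real exponent.\<close>

definition ennpowr :: "ennreal \<Rightarrow> real \<Rightarrow> ennreal" where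
  "ennpowr a r = (if a = \<infinity> then \<infinity> else ennreal (enn2real a powr r))"

definition lq_norm :: "ennreal \<Rightarrow> (nat \<Rightarrow> ennreal) \<Rightarrow> ennreal" where
  "lq_norm q a = (if q = \<infinity> then (SUP j. a j)
     else ennpowr (\<Sum>j. ennpowr (a j) (enn2real q)) (1 / enn2real q))"

definition Lp_norm :: "real \<Rightarrow> (real \<Rightarrow> ennreal) \<Rightarrow> ennreal" where
  "Lp_norm p u = ennpowr (\<integral>\<^sup>+ x. ennpowr (u x) p \<partial>lborel) (1 / p)"

definition TL_norm :: "(real \<Rightarrow> complex) \<Rightarrow> real \<Rightarrow> real \<Rightarrow> ennreal \<Rightarrow> distribution \<Rightarrow> ennreal" where
  "TL_norm \<phi> s p q f =
     Lp_norm p (\<lambda>x. lq_norm q (\<lambda>j. ennreal (2 powr (real j * s) * cmod (lp_block \<phi> j f x))))"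

definition TL_space :: "(real \<Rightarrow> complex) \<Rightarrow> real \<Rightarrow> real \<Rightarrow> ennreal \<Rightarrow> distribution set" where
  "TL_space \<phi> s p q = {f. tempered_distribution f \<and> TL_norm \<phi> s p q f < \<infinity>}"


section \<open>Daubechies wavelets\<close>

definition vanishing_moments :: "nat \<Rightarrow> (real \<Rightarrow> real) \<Rightarrow> bool" where
  "vanishing_moments L \<psi> \<longleftrightarrow> (\<forall>l<L. (LINT x|lborel. x ^ l * \<psi> x) = 0)"

text \<open>Daubechies' compactly supported orthogonal wavelets of order \<open>M\<close>: the filter has the
  minimal length \<open>2 M\<close> that is compatible with \<open>M\<close> vanishing moments. The coefficients \<open>c\<close>
  are \<open>\<surd>2\<close> times the \<open>\<ell>\<^sub>2\<close>-normalised filter.\<close>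

definition daubechies :: "nat \<Rightarrow> (real \<Rightarrow> real) \<Rightarrow> (real \<Rightarrow> real) \<Rightarrow> bool" where
  "daubechies M \<psi>0 \<psi> \<longleftrightarrow> M \<ge> 1 \<and>
     \<psi>0 \<in> borel_measurable borel \<and> compactly_supported \<psi>0 \<and> (LINT x|lborel. \<psi>0 x) = 1 \<and>
     (\<forall>k::int. (LINT x|lborel. \<psi>0 x * \<psi>0 (x - of_int k)) = (if k = 0 then 1 else 0)) \<and>
     (\<exists>c :: nat \<Rightarrow> real.
        (\<forall>x. \<psi>0 x = (\<Sum>k<2*M. c k * \<psi>0 (2 * x - real k))) \<and>
        (\<forall>x. \<psi> x = (\<Sum>k<2*M. (-1) ^ k * c (2*M - 1 - k) * \<psi>0 (2 * x - real k)))) \<and>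
     vanishing_moments M \<psi>"

definition wavelet :: "(real \<Rightarrow> real) \<Rightarrow> (real \<Rightarrow> real) \<Rightarrow> nat \<Rightarrow> int \<Rightarrow> real \<Rightarrow> real" where
  "wavelet \<psi>0 \<psi> j \<nu> x = (if j = 0 then \<psi>0 (x - of_int \<nu>)
     else 1 / sqrt 2 * \<psi> (2 ^ (j - 1) * x - of_int \<nu>))"

text \<open>The wavelets are only of class \<open>C\<^sup>K\<close>, so \<open>\<langle>f, \<psi>\<^sub>j\<^sub>,\<^sub>\<nu>\<rangle>\<close> refers to the extension of \<open>f\<close> by
  continuity from \<open>C\<^sub>c\<^sup>\<infinity>\<close> to \<open>C\<^sub>c\<^sup>K\<close>. It exists, and is unique because \<open>C\<^sub>c\<^sup>\<infinity>\<close> is sequentially dense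
  in \<open>C\<^sub>c\<^sup>K\<close>, whenever \<open>f\<close> has order at most \<open>K\<close>.\<close>

definition CK_converges ::
  "nat \<Rightarrow> (nat \<Rightarrow> real \<Rightarrow> complex) \<Rightarrow> (real \<Rightarrow> complex) \<Rightarrow> bool" where
  "CK_converges K G g \<longleftrightarrow> (\<exists>R. \<forall>n x. \<bar>x\<bar> > R \<longrightarrow> G n x = 0) \<and>
     (\<forall>l\<le>K. uniform_limit UNIV (\<lambda>n. vderiv l (G n)) (vderiv l g) sequentially)"

definition CK_pairing :: "nat \<Rightarrow> distribution \<Rightarrow> (real \<Rightarrow> complex) \<Rightarrow> complex" where
  "CK_pairing K f g = (THE v. \<forall>G. (\<forall>n. test_function (G n)) \<and> CK_converges K G g
     \<longrightarrow> (\<lambda>n. f (G n)) \<longlonglongrightarrow> v)"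

definition wavelet_coeff ::
  "nat \<Rightarrow> (real \<Rightarrow> real) \<Rightarrow> (real \<Rightarrow> real) \<Rightarrow> distribution \<Rightarrow> nat \<Rightarrow> int \<Rightarrow> complex" where
  "wavelet_coeff K \<psi>0 \<psi> f j \<nu> =
     2 ^ j * CK_pairing K f (\<lambda>x. complex_of_real (wavelet \<psi>0 \<psi> j \<nu> x))"

text \<open>For every \<open>x\<close> the sum over \<open>\<nu>\<close> has only finitely many nonzero terms.\<close>

definition wavelet_layer ::
  "nat \<Rightarrow> (real \<Rightarrow> real) \<Rightarrow> (real \<Rightarrow> real) \<Rightarrow> distribution \<Rightarrow> nat \<Rightarrow> real \<Rightarrow> complex" where
  "wavelet_layer K \<psi>0 \<psi> f j x =
     (\<Sum>\<^sub>\<infinity>\<nu>. wavelet_coeff K \<psi>0 \<psi> f j \<nu> * complex_of_real (wavelet \<psi>0 \<psi> j \<nu> x))"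


section \<open>Dyadic averages\<close>

definition dyadic_interval :: "nat \<Rightarrow> int \<Rightarrow> real set" where
  "dyadic_interval N \<mu> = {of_int \<mu> / 2 ^ N ..< of_int (\<mu> + 1) / 2 ^ N}"

text \<open>The integral of the distribution \<open>f\<close> over \<open>I\<close>: the Lebesgue integral if \<open>f\<close> is locally
  integrable, and the pairing of \<open>f\<close> with the indicator function of \<open>I\<close>, given by the wavelet
  expansion of \<open>f\<close>, otherwise.\<close>

definition distribution_integral ::
  "nat \<Rightarrow> (real \<Rightarrow> real) \<Rightarrow> (real \<Rightarrow> real) \<Rightarrow> distribution \<Rightarrow> real set \<Rightarrow> complex" where
  "distribution_integral K \<psi>0 \<psi> f I =
     (if \<exists>g. represented_by f g then (LINT t:I|lborel. (SOME g. represented_by f g) t)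
      else (\<Sum>j. LINT t:I|lborel. wavelet_layer K \<psi>0 \<psi> f j t))"

definition dyadic_average ::
  "nat \<Rightarrow> (real \<Rightarrow> real) \<Rightarrow> (real \<Rightarrow> real) \<Rightarrow> nat \<Rightarrow> distribution \<Rightarrow> real \<Rightarrow> complex" where
  "dyadic_average K \<psi>0 \<psi> N f x =
     (\<Sum>\<^sub>\<infinity>\<mu>. indicator (dyadic_interval N \<mu>) x *
        (2 ^ N * distribution_integral K \<psi>0 \<psi> f (dyadic_interval N \<mu>)))"

end

theory Submission
  imports Defs "HOL-Probability.Probability" "HOL-Real_Asymp.Real_Asymp"
begin

text \<open>
Write \<open>u\<^sub>j\<close> for the Littlewood-Paley blocks of \<open>f\<close>, \<open>v\<^sub>N = u\<^sub>0 + \<dots> + u\<^sub>N\<close>, \<open>\<delta> = 2^-N\<close>, \<open>y\<^sub>\<mu> = \<mu> \<delta>\<close>,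
\<open>I\<^sub>\<mu> = [y\<^sub>\<mu>, y\<^sub>\<mu> + \<delta>)\<close>, and \<open>B\<close> for the quasi-norm of \<open>f\<close>. The Fourier support of \<open>u\<^sub>j\<close> gives it
a smooth antiderivative \<open>G\<^sub>j\<close> for \<open>j \<ge> 2\<close> (\<open>gprim\<close>), and a Plancherel-Polya inequality controls
\<open>|u\<^sub>j|\<close>, the increments of \<open>u\<^sub>j\<close> over lengths below \<open>2^-j\<close>, and \<open>2^j |G\<^sub>j|\<close> at a point by \<open>pk j\<close>, the
\<open>p\<close>-mean of \<open>u\<^sub>j\<close> around that point at scale \<open>2^-j\<close> (\<open>plancherel_polya\<close>, \<open>lp_block_pk\<close>).

\<^bold>\<open>The integral over a cell.\<close> Because \<open>s > 1/p - 1\<close>, the suprema of the \<open>|G\<^sub>j|\<close> are summable. Hence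
\<open>\<Lambda> h = \<Sum>\<^sub>j \<integral> u\<^sub>j h\<close> converges for \<open>h\<close> of bounded variation, agrees with \<open>f\<close> on test functions, and
is continuous under bounded pointwise convergence with bounded variation (\<open>cpair_limit\<close>). So it
computes every pairing of \<open>f\<close> with a wavelet, and the partial sums of the wavelet expansion,
integrated over an interval \<open>I\<close>, equal \<open>\<Lambda> (P\<^sub>J 1\<^sub>I)\<close> with \<open>P\<^sub>J\<close> the projection onto the \<open>J\<close>-th scaling
space. The variation of \<open>P\<^sub>J 1\<^sub>I\<close> is bounded in \<open>J\<close>, whence the integral of \<open>f\<close> over \<open>I\<close> is
\<open>\<Sum>\<^sub>j \<integral>\<^sub>I u\<^sub>j\<close>, also when \<open>f\<close> is a locally integrable function (\<open>distribution_integral_eq\<close>). The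
value of the average on \<open>I\<^sub>\<mu>\<close> is therefore
\<open>2^N (\<integral> v\<^sub>N over I\<^sub>\<mu> + g\<^sub>\<mu>\<^sub>+\<^sub>1 - g\<^sub>\<mu>)\<close> with \<open>g\<^sub>\<mu> = \<Sum> G\<^sub>j(y\<^sub>\<mu>) over j > N\<close> (\<open>distribution_integral_av\<close>).

\<^bold>\<open>Pointwise bounds.\<close> Let \<open>T\<^sub>\<mu> = \<Sum>\<^sub>j 2^-|j-N| (pk j y\<^sub>\<mu>\<^sub>-\<^sub>1 + pk j y\<^sub>\<mu> + pk j y\<^sub>\<mu>\<^sub>+\<^sub>1)\<close> (\<open>hsum\<close>). Up to a
constant it bounds the oscillation of \<open>v\<^sub>N\<close> within \<open>\<delta>\<close> of \<open>y\<^sub>\<mu>\<close> and the numbers \<open>2^N |g|\<close> at \<open>\<mu>\<close> and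
its neighbours. Compare the \<open>k\<close>-th block of the average with \<open>u\<^sub>k\<close> if \<open>k < N\<close> and with \<open>0\<close> otherwise,
and call the difference \<open>D\<^sub>k\<close> (\<open>defect\<close>). For \<open>k < N\<close> the block \<open>u\<^sub>k\<close> is also the \<open>k\<close>-th block of \<open>v\<^sub>N\<close>, so
\<open>D\<^sub>k\<close> integrates the kernel against the average minus \<open>v\<^sub>N\<close>. On each cell this function is the sum
of a part with integral zero and a difference quotient of \<open>g\<close>; either one allows the kernel to be
replaced by an increment over length \<open>\<delta>\<close>, so that a cell
contributes a multiple of \<open>(2^k \<delta>)\<^sup>2 T\<^sub>\<mu>\<close>. For \<open>k \<ge> N\<close> the kernel has integral zero, and summation by parts replaces the step
function by its jumps, which are bounded by multiples of \<open>T\<^sub>\<mu>\<close>. In both cases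
\<open>|D\<^sub>k x| \<le> C min(1, 4^(k-N)) \<Sum>\<^sub>\<mu> T\<^sub>\<mu> (1 + 2^k |x - y\<^sub>\<mu>|)^-m\<close> (\<open>defect_pointwise\<close>).

\<^bold>\<open>Summation.\<close> From \<open>1/p - 1 < s < 1\<close> follows \<open>\<Sum>\<^sub>\<mu> T\<^sub>\<mu>^p \<le> C 2^N (2^-Ns B)^p\<close> (\<open>hsum_Lp\<close>). Integrating
the bumps yields \<open>\<integral> (2^ks |D\<^sub>k|)^p \<le> C 2^(-\<eta>|k-N|) B^p\<close> with \<open>\<eta> = min (1 - sp) (sp + 2p - max p 1)\<close>
(\<open>defect_Lp\<close>), and \<open>\<eta> > 0\<close> since \<open>s < 1/p\<close> and \<open>s > 1/p - 1\<close>. Geometric decay away from \<open>k = N\<close> bounds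
the \<open>\<ell>\<^sub>q\<close> norm in \<open>k\<close>, whatever \<open>q\<close> is, by a weighted \<open>\<ell>\<^sub>p\<close> sum, which may be integrated term by term
(\<open>lq_norm_le_weighted\<close>). Adding back the blocks \<open>u\<^sub>k\<close> with \<open>k < N\<close> gives the theorem.
\<close>

text \<open>The binders \<open>LBNN\<close> and \<open>ZSUM\<close> stand for integrals of extended nonnegative functions over the real line and for sums of such functions over the integers; the latter are integrals for the counting measure, so that Tonelli applies to both.\<close>

abbreviation nn_lborel :: "(real => ennreal) => ennreal" (binder "LBNN " 10) where
 "nn_lborel F \<equiv> integral\<^sup>N lborel F"

abbreviation nn_int :: "(int => ennreal) => ennreal" (binder "ZSUM " 10) where
 "nn_int F \<equiv> integral\<^sup>N (count_space UNIV) F"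

abbreviation wt :: "real => real" where
 "wt x \<equiv> 1 + abs x"

lemmas lint_cong = Bochner_Integration.integral_cong
lemmas lint_diff = Bochner_Integration.integral_diff
lemmas lint_sum = Bochner_Integration.integral_sum
lemmas lint_bound = Bochner_Integration.integrable_bound

section \<open>Iterated derivatives\<close>

lemma vderiv_0 [simp]: "vderiv 0 g = g"
 by (simp add: vderiv_def)

lemma vderiv_Suc: "vderiv (Suc n) g = (%x. vector_derivative (vderiv n g) (at x))"
 by (simp add: vderiv_def)

lemma C_k_has_vderiv:
 assumes "C_k K g" "n < K"
 shows "(vderiv n g has_vector_derivative vderiv (Suc n) g x) (at x)"
 using assms unfolding C_k_def vderiv_Suc by (simp add: vector_derivative_works)

lemma C_k_continuous_vderiv:
 assumes "C_k K g" "n <= K"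
 shows "continuous_on UNIV (vderiv n g)"
proof (cases "n = K")
 case True
 then show ?thesis using assms by (simp add: C_k_def)
next
 case False
 then have "n < K" using assms by simp
 then show ?thesis using C_k_has_vderiv[OF assms(1)]
  by (meson continuous_at_imp_continuous_on has_vector_derivative_continuous)
qed

lemma C_k_intro:
 fixes D :: "nat => real => 'a::real_normed_vector"
 assumes "!!n x. n < K ==> (D n has_vector_derivative D (Suc n) x) (at x)"
 shows "n <= K ==> vderiv n (D 0) = D n"
  and "continuous_on UNIV (D K) ==> C_k K (D 0)"
proof -
 have *: "n <= K ==> vderiv n (D 0) = D n" for n
 proof (induction n)
  case (Suc n)
  then have eq: "vderiv n (D 0) = D n" by simp
  show ?case unfolding vderiv_Suc eq using assms[of n] Suc.prems
   by (auto intro!: vector_derivative_at)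
 qed simp
 show "n <= K ==> vderiv n (D 0) = D n" by (rule *)
 show "C_k K (D 0)" if "continuous_on UNIV (D K)"
  unfolding C_k_def using that assms * by (auto intro: differentiableI_vector)
qed

definition smooth :: "(real => complex) => bool" where
 "smooth g \<longleftrightarrow> (\<forall>k. C_k k g)"

lemma smooth_has_vderiv:
 "smooth g ==> (vderiv n g has_vector_derivative vderiv (Suc n) g x) (at x)"
 unfolding smooth_def using C_k_has_vderiv lessI by blast

lemma smooth_continuous: "smooth g ==> continuous_on UNIV (vderiv n g)"
 unfolding smooth_def using C_k_continuous_vderiv by blast

lemma smooth_intro:
 assumes "!!n x. (D n has_vector_derivative D (Suc n) x) (at x)"
 shows "smooth (D 0)" "vderiv n (D 0) = D n"
proof -
 have "continuous_on UNIV (D K)" for K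
  by (meson assms continuous_at_imp_continuous_on has_vector_derivative_continuous)
 then show "smooth (D 0)" unfolding smooth_def using C_k_intro(2)[of _ D] assms by blast
 show "vderiv n (D 0) = D n" using C_k_intro(1)[of n D n] assms by blast
qed

lemma smooth_closed:
 assumes "g \<in> S"
  and "!!g. g \<in> S ==> \<exists>g'\<in>S. \<forall>x. (g has_vector_derivative g' x) (at x)"
 shows "smooth g" "vderiv n g \<in> S"
proof -
 obtain d where d: "!!g. g \<in> S ==> d g \<in> S \<and> (\<forall>x. (g has_vector_derivative d g x) (at x))"
  using assms(2) by metis
 define D where "D n = (d ^^ n) g" for n
 have S: "D n \<in> S" for n by (induction n) (auto simp: D_def assms(1) d)
 have D: "(D n has_vector_derivative D (Suc n) x) (at x)" for n x
  using d[OF S[of n]] by (simp add: D_def)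
 have "D 0 = g" by (simp add: D_def)
 then show "smooth g" "vderiv n g \<in> S" using smooth_intro[of D, OF D] S by auto
qed

lemma vderiv_add_index: "vderiv n (vderiv m g) = vderiv (n + m) g"
 by (simp add: vderiv_def funpow_add)

lemma smooth_vderiv: "smooth g ==> smooth (vderiv m g)"
 using smooth_intro(1)[of "%n. vderiv (n + m) g"] smooth_has_vderiv by force

inductive_set leibniz :: "(real => complex) => (real => complex) => (real => complex) set"
 for g h where
 base: "(%x. vderiv i g x * vderiv j h x) \<in> leibniz g h"
| add: "u \<in> leibniz g h ==> v \<in> leibniz g h ==> (%x. u x + v x) \<in> leibniz g h"

lemma smooth_mult:
 assumes "smooth g" "smooth h"
 shows "smooth (%x. g x * h x)"
proof (rule smooth_closed(1))
 show "(%x. g x * h x) \<in> leibniz g h" using leibniz.base[of 0 g 0 h] by simp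
 show "\<exists>u'\<in>leibniz g h. \<forall>x. (u has_vector_derivative u' x) (at x)" if "u \<in> leibniz g h" for u
  using that
 proof induction
  case (base i j)
  show ?case
  proof
   show "(%x. vderiv i g x * vderiv (Suc j) h x + vderiv (Suc i) g x * vderiv j h x) \<in> leibniz g h"
    by (intro leibniz.intros)
   show "\<forall>x. ((%x. vderiv i g x * vderiv j h x) has_vector_derivative
    vderiv i g x * vderiv (Suc j) h x + vderiv (Suc i) g x * vderiv j h x) (at x)"
    using assms by (intro allI has_vector_derivative_mult smooth_has_vderiv)
  qed
 next
  case (add u v)
  then obtain u' v' where "u' \<in> leibniz g h" "v' \<in> leibniz g h"
   "\<forall>x. (u has_vector_derivative u' x) (at x)" "\<forall>x. (v has_vector_derivative v' x) (at x)" by blast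
  then show ?case
   by (intro bexI[of _ "%x. u' x + v' x"]) (auto intro: has_vector_derivative_add leibniz.add)
 qed
qed

lemma smooth_affine:
 assumes "smooth g"
 shows "smooth (%x. g (c * x + d))"
  and "vderiv n (%x. g (c * x + d)) = (%x. of_real (c ^ n) * vderiv n g (c * x + d))"
proof -
 define D where "D n x = of_real (c ^ n) * vderiv n g (c * x + d)" for n x
 have "(D n has_vector_derivative D (Suc n) x) (at x)" for n x
 proof -
  have "((%x. c * x + d) has_vector_derivative c) (at x)"
   by (auto intro!: derivative_eq_intros)
  from vector_diff_chain_at[OF this smooth_has_vderiv[OF assms, of n]]
  have "((%x. vderiv n g (c * x + d)) has_vector_derivative c *\<^sub>R vderiv (Suc n) g (c * x + d)) (at x)"
   by (simp add: o_def)
  then have "((%x. of_real (c ^ n) * vderiv n g (c * x + d)) has_vector_derivative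
     of_real (c ^ n) * (c *\<^sub>R vderiv (Suc n) g (c * x + d))) (at x)"
   by (rule has_vector_derivative_mult_right)
  then show ?thesis
   unfolding D_def by (simp add: scaleR_conv_of_real algebra_simps)
 qed
 from smooth_intro[of D, OF this]
 show "smooth (%x. g (c * x + d))"
  "vderiv n (%x. g (c * x + d)) = (%x. of_real (c ^ n) * vderiv n g (c * x + d))"
  unfolding D_def by auto
qed

lemma smooth_lincomb:
 assumes "smooth g" "smooth h"
 shows "smooth (%x. c * g x + d * h x)"
  and "vderiv n (%x. c * g x + d * h x) = (%x. c * vderiv n g x + d * vderiv n h x)"
proof -
 define D where "D n x = c * vderiv n g x + d * vderiv n h x" for n x
 have "(D n has_vector_derivative D (Suc n) x) (at x)" for n x
  unfolding D_def using assms
  by (intro has_vector_derivative_add has_vector_derivative_mult_right smooth_has_vderiv)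
 from smooth_intro[of D, OF this]
 show "smooth (%x. c * g x + d * h x)"
  "vderiv n (%x. c * g x + d * h x) = (%x. c * vderiv n g x + d * vderiv n h x)"
  unfolding D_def by auto
qed

lemma smooth_cnj:
 assumes "smooth g" shows "smooth (%x. cnj (g x))"
proof -
 define D where "D n x = cnj (vderiv n g x)" for n x
 have "(D n has_vector_derivative D (Suc n) x) (at x)" for n x
  unfolding D_def using smooth_has_vderiv[OF assms] has_vector_derivative_cnj by blast
 from smooth_intro(1)[of D, OF this] show ?thesis unfolding D_def by auto
qed

lemma smooth_ident: "smooth of_real"
proof -
 define D where "D n = (if n = 0 then of_real else if n = 1 then (%_. 1) else (%_::real. 0::complex))" for n :: nat
 have "(D n has_vector_derivative D (Suc n) x) (at x)" for n x
  using has_vector_derivative_of_real[of "%x. x" 1] by (auto simp: D_def)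
 from smooth_intro(1)[of D, OF this] show ?thesis unfolding D_def by auto
qed

lemma mvt_norm_bound:
 fixes g :: "real => 'a::real_normed_vector"
 assumes "!!t. t \<in> closed_segment a b ==> (g has_vector_derivative g' t) (at t)"
  and "!!t. t \<in> closed_segment a b ==> norm (g' t) <= B"
 shows "norm (g b - g a) <= B * abs (b - a)"
proof -
 have "norm (g b - g a) <= B * norm (b - a)"
 proof (rule differentiable_bound[of "closed_segment a b" g "%t x. x *\<^sub>R g' t"])
  show "(g has_derivative (%x. x *\<^sub>R g' t)) (at t within closed_segment a b)"
   if "t \<in> closed_segment a b" for t
   using assms(1)[OF that] unfolding has_vector_derivative_def
   by (rule has_derivative_at_withinI)
  show "onorm (%x. x *\<^sub>R g' t) <= B" if "t \<in> closed_segment a b" for t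
   by (rule onorm_le) (use mult_left_mono[OF assms(2)[OF that] abs_ge_zero] in \<open>simp add: mult.commute\<close>)
 qed auto
 then show ?thesis by simp
qed

text \<open>Differentiation under the integral sign: the difference quotients are dominated by \<open>2 W\<close> because of the mean value inequality.\<close>

lemma has_vector_derivative_integral:
 fixes F F' :: "real => real => complex"
 assumes F: "!!y. integrable lborel (F y)"
  and F': "!!t z. abs (t - y) <= 1 ==> ((%t. F t z) has_vector_derivative F' t z) (at t)"
  and meas: "F' y \<in> borel_measurable lborel"
  and W: "integrable lborel W" "!!z t. abs (t - y) <= 1 ==> cmod (F' t z) <= W z"
 shows "((%t. LBINT z. F t z) has_vector_derivative (LBINT z. F' y z)) (at y)"
proof -
 have F'i: "integrable lborel (F' y)"
  by (rule lint_bound[OF W(1) meas]) (use W(2)[of y] in \<open>auto intro!: AE_I2 order_trans[OF _ abs_ge_self]\<close>)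
 define q where "q t z = (F t z - F y z - (t - y) *\<^sub>R F' y z) /\<^sub>R norm (t - y)" for t z
 have "((%t. LBINT z. q t z) \<longlongrightarrow> integral\<^sup>L lborel (%z::real. 0::complex)) (at y)"
  unfolding tendsto_at_iff_sequentially
 proof (intro allI impI)
  fix X :: "nat => real" assume X: "\<forall>i. X i \<in> UNIV - {y}" "X \<longlonglongrightarrow> y"
  from X(2) have "eventually (%n. dist (X n) y < 1) sequentially"
   by (rule tendstoD) simp
  then obtain n0 where "\<forall>n\<ge>n0. dist (X n) y < 1" unfolding eventually_sequentially by blast
  then have n0: "n >= n0 ==> abs (X n - y) <= 1" for n by (force simp: dist_real_def)
  have "(%n. LBINT z. q (X (n + n0)) z) \<longlonglongrightarrow> integral\<^sup>L lborel (%z::real. 0::complex)"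
  proof (rule integral_dominated_convergence[where w = "%z. 2 * W z"])
   show "AE z in lborel. (%n. q (X (n + n0)) z) \<longlonglongrightarrow> 0"
   proof (rule AE_I2)
    fix z
    have "((%t. (F t z - F y z - (t - y) *\<^sub>R F' y z) /\<^sub>R norm (t - y)) \<longlongrightarrow> 0) (at y)"
     using F'[of y z] unfolding has_vector_derivative_def has_derivative_at_within
     by (simp add: algebra_simps)
    then have "(%n. q (X n) z) \<longlonglongrightarrow> 0"
     using X unfolding tendsto_at_iff_sequentially q_def comp_def by blast
    then show "(%n. q (X (n + n0)) z) \<longlonglongrightarrow> 0" by (rule LIMSEQ_ignore_initial_segment)
   qed
   show "AE z in lborel. cmod (q (X (n + n0)) z) <= 2 * W z" for n
   proof (rule AE_I2)
    fix z
    let ?t = "X (n + n0)"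
    have t: "abs (?t - y) <= 1" using n0[of "n + n0"] by simp
    have seg: "abs (t - y) <= 1" if "t \<in> closed_segment y ?t" for t
     using that t by (auto simp: closed_segment_eq_real_ivl split: if_splits)
    have "cmod (F ?t z - F y z) <= W z * abs (?t - y)"
     by (rule mvt_norm_bound[of y ?t "%t. F t z" "%t. F' t z"]) (auto intro: F' W(2) seg)
    moreover have "cmod ((?t - y) *\<^sub>R F' y z) <= W z * abs (?t - y)"
     using W(2)[of y z] by (simp add: mult.commute mult_right_mono)
    ultimately have "cmod (F ?t z - F y z - (?t - y) *\<^sub>R F' y z) <= 2 * W z * abs (?t - y)"
     using norm_triangle_ineq4[of "F ?t z - F y z" "(?t - y) *\<^sub>R F' y z"] by linarith
    moreover have "?t \<noteq> y" using X by auto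
    ultimately show "cmod (q ?t z) <= 2 * W z"
     by (simp add: q_def divide_simps mult.commute)
   qed
   show "(%z. q (X (n + n0)) z) \<in> borel_measurable lborel" for n
    unfolding q_def using F[THEN borel_measurable_integrable] meas by measurable
  qed (use W in auto)
  then show "((%t. LBINT z. q t z) \<circ> X) \<longlonglongrightarrow> integral\<^sup>L lborel (%z::real. 0::complex)"
   unfolding comp_def using LIMSEQ_offset[of "%n. \<integral>z. q (X n) z \<partial>lborel" n0] by simp
 qed
 moreover have "(LBINT z. q t z) =
   ((LBINT z. F t z) - (LBINT z. F y z) - (t - y) *\<^sub>R (LBINT z. F' y z)) /\<^sub>R norm (t - y)" for t
  unfolding q_def using F F'i by simp
 ultimately show ?thesis
  unfolding has_vector_derivative_def has_derivative_at_within
  by (simp add: bounded_linear_scaleR_left algebra_simps)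
qed

section \<open>Rapidly decreasing functions\<close>

lemma integral_FTC_line:
 fixes g :: "real => complex"
 assumes "!!x. (g has_vector_derivative g' x) (at x)" "continuous_on UNIV g'"
  and "integrable lborel g'"
  and "(g \<longlongrightarrow> L) at_top" "(g \<longlongrightarrow> M) at_bot"
 shows "(LBINT x. g' x) = L - M"
proof -
 have "(%n. LBINT x. indicator {- real n .. real n} x *\<^sub>R g' x) \<longlonglongrightarrow> (LBINT x. g' x)"
 proof (rule integral_dominated_convergence[where w = "%x. cmod (g' x)"])
  show "AE x in lborel. (%n. indicator {- real n .. real n} x *\<^sub>R g' x) \<longlonglongrightarrow> g' x"
  proof (rule AE_I2, rule tendsto_eventually)
   fix x :: real
   obtain n0 :: nat where "abs x <= real n0" using real_arch_simple by blast
   then show "\<forall>\<^sub>F n in sequentially. indicator {- real n .. real n} x *\<^sub>R g' x = g' x"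
    by (intro eventually_sequentiallyI[of n0]) (auto simp: indicator_def)
  qed
 qed (use assms(3) in \<open>auto simp: indicator_def\<close>)
 moreover have "(LBINT x. indicator {- real n .. real n} x *\<^sub>R g' x) = g (real n) - g (- real n)" for n
 proof (rule integral_FTC_Icc)
  show "(g has_vector_derivative g' x) (at x within {- real n..real n})" for x
   using assms(1) has_vector_derivative_at_within by blast
 qed (use assms(2) continuous_on_subset in auto)
 moreover have "(%n. g (real n) - g (- real n)) \<longlonglongrightarrow> L - M"
  by (intro tendsto_diff filterlim_compose[OF assms(4)] filterlim_compose[OF assms(5)]
    filterlim_real_sequentially filterlim_compose[OF filterlim_uminus_at_bot_at_top])
 ultimately show ?thesis using LIMSEQ_unique by auto
qed

text \<open>Faster decay than every power, which for measurable functions makes all moments finite. A Schwartz function is a smooth function all of whose derivatives are \<open>rapid\<close>.\<close>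

definition rapid :: "(real => complex) => bool" where
 "rapid a \<longleftrightarrow> (\<forall>k. \<exists>C. \<forall>x. wt x ^ k * cmod (a x) <= C)"

lemma nn_integral_weight: "(LBNN x. ennreal (1 / (wt x)\<^sup>2)) = 2"
proof -
 have half: "(LBNN x. ennreal (1 / (1 + x)\<^sup>2) * indicator {0..} x) = ennreal (0 - (- 1 / (1 + 0)))"
 proof (rule nn_integral_FTC_atLeast)
  have "((%x::real. - 1 / (1 + x)) \<longlongrightarrow> - 1 * 0) at_top"
   unfolding divide_inverse
   by (intro tendsto_intros tendsto_inverse_0_at_top filterlim_tendsto_add_at_top[OF tendsto_const] filterlim_ident)
  then show "((%x::real. - 1 / (1 + x)) \<longlongrightarrow> 0) at_top" by simp
 qed (auto intro!: derivative_eq_intros simp: power2_eq_square)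
 have "(LBNN x. ennreal (1 / (wt x)\<^sup>2)) =
   (LBNN x. ennreal (1 / (1 + x)\<^sup>2) * indicator {0..} x + ennreal (1 / (1 - x)\<^sup>2) * indicator {..<0} x)"
  by (intro nn_integral_cong) (auto simp: indicator_def)
 also have "... = (LBNN x. ennreal (1 / (1 + x)\<^sup>2) * indicator {0..} x)
   + (LBNN x. ennreal (1 / (1 - x)\<^sup>2) * indicator {..<0} x)"
  by (rule nn_integral_add) auto
 also have "(LBNN x. ennreal (1 / (1 - x)\<^sup>2) * indicator {..<0} x) =
   (LBNN x. ennreal (1 / (1 + x)\<^sup>2) * indicator {0<..} x)"
  by (subst nn_integral_real_affine[where c = "-1" and t = 0]) (auto intro!: nn_integral_cong simp: indicator_def)
 also have "... = (LBNN x. ennreal (1 / (1 + x)\<^sup>2) * indicator {0..} x)"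
 proof (rule nn_integral_cong_AE)
  have "AE x in lborel. x \<noteq> (0::real)" by (rule AE_lborel_singleton)
  then show "AE x in lborel. ennreal (1 / (1 + x)\<^sup>2) * indicator {0<..} x = ennreal (1 / (1 + x)\<^sup>2) * indicator {0..} x"
   by eventually_elim (auto simp: indicator_def)
 qed
 finally show ?thesis using half by simp
qed

lemma integrable_weight: "integrable lborel (%x::real. 1 / (wt x)\<^sup>2)"
 by (rule integrableI_bounded) (auto simp: nn_integral_weight)

lemma rapidD:
 assumes "rapid a" obtains C where "C >= 0" "!!x. cmod (a x) <= C / wt x ^ k"
proof -
 obtain C where C: "!!x. wt x ^ k * cmod (a x) <= C" using assms unfolding rapid_def by blast
 have "0 <= wt 0 ^ k * cmod (a 0)" by simp
 then have "C >= 0" using C[of 0] by linarith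
 moreover have "cmod (a x) <= C / wt x ^ k" for x
 proof -
  have "wt x ^ k > 0" by (intro zero_less_power) auto
  then show ?thesis using C[of x] by (simp add: pos_le_divide_eq mult.commute)
 qed
 ultimately show ?thesis using that by blast
qed

lemma rapidI:
 assumes "!!k. \<exists>C. \<forall>x. abs x ^ k * cmod (a x) <= C"
 shows "rapid a"
 unfolding rapid_def
proof
 fix k
 obtain C0 C where "!!x. abs x ^ 0 * cmod (a x) <= C0" "!!x. abs x ^ k * cmod (a x) <= C"
  using assms by meson
 then have *: "cmod (a x) <= C0" "abs x ^ k * cmod (a x) <= C" for x by auto
 have "wt x ^ k * cmod (a x) <= 2 ^ k * (C0 + C)" for x
 proof -
  have "wt x ^ k <= (2 * max 1 (abs x)) ^ k" by (intro power_mono) auto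
  also have "... = 2 ^ k * max 1 (abs x) ^ k" by (simp add: power_mult_distrib)
  also have "... <= 2 ^ k * (1 + abs x ^ k)" by (intro mult_left_mono) (auto simp: max_def)
  finally have "wt x ^ k * cmod (a x) <= 2 ^ k * (1 + abs x ^ k) * cmod (a x)"
   by (rule mult_right_mono) simp
  also have "... = 2 ^ k * (cmod (a x) + abs x ^ k * cmod (a x))" by (simp add: algebra_simps)
  also have "... <= 2 ^ k * (C0 + C)" using *[of x] by (intro mult_left_mono) auto
  finally show ?thesis .
 qed
 then show "\<exists>C. \<forall>x. wt x ^ k * cmod (a x) <= C" by blast
qed

lemma rapid_integrable_weighted:
 assumes "rapid a" "a \<in> borel_measurable borel"
 shows "integrable lborel (%x. wt x ^ k * cmod (a x))"
proof -
 obtain C where C: "C >= 0" "!!x. cmod (a x) <= C / wt x ^ (k + 2)"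
  using rapidD[OF assms(1), of "k + 2"] by blast
 have "integrable lborel (%x. C * (1 / (wt x)\<^sup>2))"
  by (intro integrable_mult_right integrable_weight)
 then show ?thesis
 proof (rule lint_bound)
  have "wt x ^ k * cmod (a x) <= C * (1 / (wt x)\<^sup>2)" for x
  proof -
   have "wt x ^ k * cmod (a x) <= wt x ^ k * (C / wt x ^ (k + 2))"
    by (intro mult_left_mono C(2)) auto
   also have "... = C * (1 / (wt x)\<^sup>2)"
    using add_pos_nonneg[of 1 "abs x"] unfolding power_add by simp
   finally show ?thesis .
  qed
  then show "AE x in lborel. norm (wt x ^ k * cmod (a x)) <= norm (C * (1 / (wt x)\<^sup>2))"
   using C(1) by (auto simp: abs_mult intro!: AE_I2)
 qed (use assms(2) in measurable)
qed

lemma rapid_integrable: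
 assumes "rapid a" "a \<in> borel_measurable borel"
 shows "integrable lborel a"
 by (rule integrable_norm_cancel) (use rapid_integrable_weighted[OF assms, of 0] assms(2) in simp_all)

lemma rapid_tendsto_0:
 assumes "rapid a" shows "(a \<longlongrightarrow> 0) at_top" "(a \<longlongrightarrow> 0) at_bot"
proof -
 obtain C where C: "C >= 0" "!!x. cmod (a x) <= C / wt x ^ 1" using rapidD[OF assms] by blast
 have "((%x. C / wt x ^ 1) \<longlongrightarrow> 0) at_top" by real_asymp
 then show "(a \<longlongrightarrow> 0) at_top" by (rule Lim_null_comparison[rotated]) (use C in auto)
 have "((%x. C / wt x ^ 1) \<longlongrightarrow> 0) at_bot" by real_asymp
 then show "(a \<longlongrightarrow> 0) at_bot" by (rule Lim_null_comparison[rotated]) (use C in auto)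
qed

text \<open>The weights are submultiplicative, which allows the base point of a weighted estimate to be moved at the cost of one further weight.\<close>

lemma weight_triangle: "wt x <= wt (x - y) * wt y"
proof -
 have "1 + abs x <= 1 + abs (x - y) + abs y" by linarith
 also have "... <= wt (x - y) * wt y" by (simp add: algebra_simps)
 finally show ?thesis .
qed

lemma rapid_affine:
 assumes "rapid a" "c \<noteq> 0" shows "rapid (%x. a (c * x + d))"
 unfolding rapid_def
proof
 fix k
 obtain C where C: "C >= 0" "!!x. cmod (a x) <= C / wt x ^ k" using rapidD[OF assms(1)] by blast
 define A where "A = wt d * (1 + 1 / abs c)"
 have A: "1 + abs x <= A * wt (c * x + d)" for x
 proof -
  have "1 + abs (c * x) <= wt (c * x - (c * x + d)) * wt (c * x + d)" by (rule weight_triangle)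
  then have 1: "1 + abs (c * x) <= wt d * wt (c * x + d)" by simp
  have "1 + abs x <= (1 + 1 / abs c) * wt (c * x)"
   using assms(2) by (simp add: abs_mult field_simps)
  also have "... <= (1 + 1 / abs c) * (wt d * wt (c * x + d))"
   by (intro mult_left_mono 1) auto
  finally show ?thesis by (simp add: A_def mult.commute mult.left_commute)
 qed
 have "wt x ^ k * cmod (a (c * x + d)) <= A ^ k * C" for x
 proof -
  have "wt x ^ k * cmod (a (c * x + d)) <= (A * wt (c * x + d)) ^ k * (C / wt (c * x + d) ^ k)"
   using A[of x] C by (intro mult_mono power_mono) auto
  also have "... = A ^ k * C"
   using add_pos_nonneg[of 1 "abs (c * x + d)"] by (simp add: power_mult_distrib)
  finally show ?thesis .
 qed
 then show "\<exists>C. \<forall>x. wt x ^ k * cmod (a (c * x + d)) <= C" by blast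
qed

lemma rapid_lincomb:
 assumes "rapid a" "rapid b" shows "rapid (%x. c * a x + d * b x)"
 unfolding rapid_def
proof
 fix k
 obtain A B where A: "!!x. wt x ^ k * cmod (a x) <= A" and B: "!!x. wt x ^ k * cmod (b x) <= B"
  using assms unfolding rapid_def by meson
 have "wt x ^ k * cmod (c * a x + d * b x) <= cmod c * A + cmod d * B" for x
 proof -
  have "wt x ^ k * cmod (c * a x + d * b x) <= wt x ^ k * (cmod c * cmod (a x) + cmod d * cmod (b x))"
   by (intro mult_left_mono) (auto simp: norm_mult[symmetric] norm_triangle_ineq)
  also have "... = cmod c * (wt x ^ k * cmod (a x)) + cmod d * (wt x ^ k * cmod (b x))"
   by (simp add: algebra_simps)
  also have "... <= cmod c * A + cmod d * B" by (intro add_mono mult_left_mono A B) auto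
  finally show ?thesis .
 qed
 then show "\<exists>C. \<forall>x. wt x ^ k * cmod (c * a x + d * b x) <= C" by blast
qed

lemma rapid_cmult: "rapid a ==> rapid (%x. c * a x)"
 using rapid_lincomb[of a a c 0] by simp

lemma schwartz_iff: "schwartz g \<longleftrightarrow> smooth g \<and> (\<forall>m. rapid (vderiv m g))"
proof
 assume g: "schwartz g"
 have "rapid (vderiv m g)" for m
  using g unfolding schwartz_def bdd_above_def by (intro rapidI) blast
 then show "smooth g \<and> (\<forall>m. rapid (vderiv m g))" using g by (simp add: schwartz_def smooth_def)
next
 assume g: "smooth g \<and> (\<forall>m. rapid (vderiv m g))"
 have "bdd_above (range (%x. abs x ^ k * cmod (vderiv m g x)))" for k m
 proof -
  obtain C where C: "!!x. wt x ^ k * cmod (vderiv m g x) <= C"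
   using g unfolding rapid_def by blast
  have "abs x ^ k * cmod (vderiv m g x) <= C" for x
   using order_trans[OF mult_right_mono[OF power_mono[of "abs x" "1 + abs x" k]] C[of x]] by simp
  then show ?thesis unfolding bdd_above_def by blast
 qed
 then show "schwartz g" using g by (simp add: schwartz_def smooth_def)
qed

lemma schwartz_affine: "schwartz g ==> c \<noteq> 0 ==> schwartz (%x. g (c * x + d))"
 unfolding schwartz_iff using smooth_affine(1)[of g c d] smooth_affine(2)[of g _ c d] rapid_cmult[OF rapid_affine] by simp

lemma schwartz_lincomb: "schwartz g ==> schwartz h ==> schwartz (%x. c * g x + d * h x)"
 unfolding schwartz_iff using smooth_lincomb(1)[of g h c d] smooth_lincomb(2)[of g h _ c d] rapid_lincomb by auto

lemma schwartz_cmult: "schwartz g ==> schwartz (%x. c * g x)"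
 using schwartz_lincomb[of g g c 0] by simp

lemma schwartz_vderiv: "schwartz g ==> schwartz (vderiv m g)"
 unfolding schwartz_iff using smooth_vderiv by (auto simp: vderiv_add_index)

lemma schwartz_continuous: "schwartz g ==> continuous_on UNIV (vderiv n g)"
 using schwartz_iff smooth_continuous by blast

lemma schwartz_measurable: "schwartz g ==> vderiv n g \<in> borel_measurable borel"
 using schwartz_continuous borel_measurable_continuous_onI by blast

lemma schwartz_integrable: "schwartz g ==> integrable lborel (vderiv n g)"
 using schwartz_measurable rapid_integrable schwartz_iff by blast

lemma compact_support_rapid:
 assumes "continuous_on UNIV g" "compactly_supported g"
 shows "rapid g"
 unfolding rapid_def
proof
 fix k
 obtain R where R: "!!x. abs x > R ==> g x = 0" using assms(2) unfolding compactly_supported_def by blast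
 have "compact ((%x. wt x ^ k * cmod (g x)) ` {-abs R..abs R})"
  by (intro compact_continuous_image continuous_intros continuous_on_subset[OF assms(1)]) auto
 from compact_imp_bounded[OF this] obtain C where
  "\<forall>v\<in>(%x. wt x ^ k * cmod (g x)) ` {-abs R..abs R}. norm v <= C"
  unfolding bounded_iff by blast
 then have C: "norm (wt x ^ k * cmod (g x)) <= C" if "x \<in> {-abs R..abs R}" for x
  using that by blast
 have "wt x ^ k * cmod (g x) <= max C 0" for x
  using C[of x] R[of x] by (cases "abs x <= abs R") (auto simp: abs_le_iff)
 then show "\<exists>C. \<forall>x. wt x ^ k * cmod (g x) <= C" by (intro exI allI)
qed

lemma vderiv_support:
 assumes "C_k K g" "!!x. abs x > R ==> g x = 0" "n <= K" "abs x > R"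
 shows "vderiv n g x = 0"
 using assms(3,4)
proof (induction n arbitrary: x)
 case (Suc n)
 have "open {x::real. abs x > R}" by (intro open_Collect_less continuous_intros)
 then have "((%_. 0) has_vector_derivative vderiv (Suc n) g x) (at x)"
  using C_k_has_vderiv[OF assms(1), of n x] Suc.prems
  by (rule_tac has_vector_derivative_transform_within_open[of "vderiv n g" _ x "{x. abs x > R}"])
   (simp_all add: Suc.IH)
 then show ?case using has_vector_derivative_const vector_derivative_unique_at by blast
qed (simp add: assms(2))

lemma test_function_iff: "test_function g \<longleftrightarrow> smooth g \<and> compactly_supported g"
 by (simp add: test_function_def smooth_def)

lemma test_function_vderiv: "test_function g ==> test_function (vderiv n g)"
 unfolding test_function_iff compactly_supported_def
proof (elim conjE exE, intro conjI)
 fix R assume g: "smooth g" "\<forall>x. R < abs x \<longrightarrow> g x = 0"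
 show "smooth (vderiv n g)" using g by (simp add: smooth_vderiv)
 have "vderiv n g x = 0" if "R < abs x" for x
  by (rule vderiv_support[of n g R n]) (use g that in \<open>auto simp: smooth_def\<close>)
 then show "\<exists>R. \<forall>x. R < abs x \<longrightarrow> vderiv n g x = 0" by blast
qed

lemma test_function_schwartz: "test_function g ==> schwartz g"
 unfolding schwartz_iff
proof (intro conjI allI)
 assume g: "test_function g"
 then show "smooth g" by (simp add: test_function_iff)
 show "rapid (vderiv m g)" for m
  using test_function_vderiv[OF g, of m] smooth_continuous[OF \<open>smooth g\<close>]
  by (intro compact_support_rapid) (auto simp: test_function_iff)
qed

section \<open>Fourier inversion for test functions\<close>

lemma fubini_dominated:
 fixes F :: "real => real => complex" and a b :: "real => real"
 assumes "integrable lborel a" "integrable lborel b"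
  and [measurable]: "(%(x, y). F x y) \<in> borel_measurable (lborel \<Otimes>\<^sub>M lborel)"
  and bound: "!!x y. cmod (F x y) <= a x * b y"
 shows "(LBINT x. (LBINT y. F x y)) = (LBINT y. (LBINT x. F x y))"
proof -
 have ab: "integrable (lborel \<Otimes>\<^sub>M lborel) (%(x, y). a x * b y)"
 proof (rule lborel_pair.Fubini_integrable)
  have [measurable]: "a \<in> borel_measurable lborel" "b \<in> borel_measurable lborel" using assms by auto
  show "(%(x, y). a x * b y) \<in> borel_measurable (lborel \<Otimes>\<^sub>M lborel)" by measurable
  have "integrable lborel (%x. abs (a x) * (LBINT y. abs (b y)))"
   by (intro integrable_mult_left integrable_abs assms)
  then show "integrable lborel (%x. LBINT y. norm (case (x, y) of (x, y) => a x * b y))"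
   by (simp add: abs_mult)
  show "AE x in lborel. integrable lborel (%y. case (x, y) of (x, y) => a x * b y)"
   using assms by simp
 qed
 have "integrable (lborel \<Otimes>\<^sub>M lborel) (%(x, y). F x y)"
  by (rule lint_bound[OF ab]) (auto intro!: AE_I2 order_trans[OF bound])
 then show ?thesis by (rule lborel_pair.Fubini_integral[symmetric])
qed

text \<open>The inverse Fourier transform without its factor \<open>1/(2\<pi>)\<close>.\<close>

definition fti :: "(real => complex) => real => complex" where
 "fti \<psi> x = (LBINT \<xi>. \<psi> \<xi> * cis (x * \<xi>))"

lemma cis_has_vector_derivative:
 "((%t. cis (x * t)) has_vector_derivative \<i> * of_real x * cis (x * t)) (at t)"
proof -
 have "((%z. exp (\<i> * (of_real x * z))) has_field_derivative exp (\<i> * (of_real x * of_real t)) * (\<i> * of_real x))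
  (at (of_real t))"
  by (auto intro!: derivative_eq_intros)
 from has_vector_derivative_real_field[OF this] show ?thesis
  by (simp add: cis_conv_exp mult.commute)
qed

lemma measurable_cis [measurable]: "f \<in> borel_measurable M ==> (%x. cis (f x)) \<in> borel_measurable M"
 unfolding cis_conv_exp by measurable

lemma test_function_mult: "test_function g ==> smooth h ==> test_function (%x. h x * g x)"
 unfolding test_function_iff compactly_supported_def using smooth_mult by fastforce

lemma test_function_measurable: "test_function g ==> g \<in> borel_measurable borel"
 using schwartz_measurable[of g 0] test_function_schwartz by auto

lemma test_function_integrable: "test_function g ==> integrable lborel g"
 using schwartz_integrable[of g 0] test_function_schwartz by auto

lemma integrable_mult_cis: "integrable lborel g ==> integrable lborel (%t. g t * cis (f t))"
 if [measurable]: "f \<in> borel_measurable borel"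
proof -
 assume g: "integrable lborel g"
 then have [measurable]: "g \<in> borel_measurable lborel" by auto
 show ?thesis
  by (rule lint_bound[OF g]) (auto simp: norm_mult)
qed

lemma test_function_ident_mult:
 assumes "test_function g" shows "test_function (%\<xi>. \<i> * of_real \<xi> * g \<xi>)"
proof -
 have "smooth (%x. \<i> * of_real x)"
  using smooth_lincomb(1)[OF smooth_ident smooth_ident, of \<i> 0] by simp
 from test_function_mult[OF assms this] show ?thesis by simp
qed

lemma fti_has_vector_derivative:
 assumes "test_function \<psi>"
 shows "(fti \<psi> has_vector_derivative fti (%\<xi>. \<i> * of_real \<xi> * \<psi> \<xi>) x) (at x)"
 unfolding fti_def
proof (rule has_vector_derivative_integral[where W = "%z. cmod (\<i> * of_real z * \<psi> z)"])
 note [measurable] = test_function_measurable[OF assms]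
 show "integrable lborel (%\<xi>. \<psi> \<xi> * cis (y * \<xi>))" for y
  by (intro integrable_mult_cis test_function_integrable assms) auto
 show "((%t. \<psi> z * cis (t * z)) has_vector_derivative \<i> * of_real z * \<psi> z * cis (t * z)) (at t)" for t z
  using has_vector_derivative_mult_right[OF cis_has_vector_derivative[of z t], of "\<psi> z"]
  by (simp add: mult.commute mult.left_commute)
 show "integrable lborel (%z. cmod (\<i> * of_real z * \<psi> z))"
  using test_function_integrable[OF test_function_ident_mult[OF assms]] by (rule integrable_norm)
qed (use assms test_function_measurable in \<open>auto simp: norm_mult\<close>)

text \<open>Integration by parts turns a derivative of the symbol into a factor \<open>x\<close>. This is what makes the transform of a test function decay.\<close>

lemma fti_parts:
 assumes "test_function \<psi>"
 shows "fti (vderiv 1 \<psi>) x = - \<i> * of_real x * fti \<psi> x"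
proof -
 let ?g' = "%\<xi>. \<psi> \<xi> * (\<i> * of_real x * cis (x * \<xi>)) + vderiv 1 \<psi> \<xi> * cis (x * \<xi>)"
 have sm: "smooth \<psi>" using assms test_function_iff by blast
 have i1: "integrable lborel (%\<xi>. \<psi> \<xi> * cis (x * \<xi>))" "integrable lborel (%\<xi>. vderiv 1 \<psi> \<xi> * cis (x * \<xi>))"
  using assms test_function_vderiv[OF assms] by (simp_all add: integrable_mult_cis test_function_integrable)
 have i2: "integrable lborel (%\<xi>. \<i> * of_real x * (\<psi> \<xi> * cis (x * \<xi>)))"
  using i1(1) by (rule integrable_mult_right)
 have eq: "?g' = (%\<xi>. \<i> * of_real x * (\<psi> \<xi> * cis (x * \<xi>)) + vderiv 1 \<psi> \<xi> * cis (x * \<xi>))"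
  by (simp add: fun_eq_iff algebra_simps)
 have cv: "((%\<xi>. \<psi> \<xi> * cis (x * \<xi>)) \<longlongrightarrow> 0) F" if "(\<psi> \<longlongrightarrow> 0) F" for F
  using tendsto_norm_zero[OF that] by (rule_tac tendsto_norm_zero_cancel) (simp add: norm_mult)
 have "rapid \<psi>" using test_function_schwartz[OF assms] unfolding schwartz_iff by (auto dest: spec[of _ 0])
 note lim = cv[OF rapid_tendsto_0(1)[OF this]] cv[OF rapid_tendsto_0(2)[OF this]]
 have "(LBINT \<xi>. ?g' \<xi>) = 0 - 0"
 proof (rule integral_FTC_line[OF _ _ _ lim])
  show "((%\<xi>. \<psi> \<xi> * cis (x * \<xi>)) has_vector_derivative ?g' \<xi>) (at \<xi>)" for \<xi>
   using smooth_has_vderiv[OF sm, of 0] by (intro has_vector_derivative_mult cis_has_vector_derivative) simp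
  show "continuous_on UNIV ?g'"
   using smooth_continuous[OF sm, of 0] smooth_continuous[OF sm, of 1]
   by (intro continuous_intros) auto
  show "integrable lborel ?g'" unfolding eq using i1 i2 by (intro Bochner_Integration.integrable_add)
 qed
 moreover have "(LBINT \<xi>. ?g' \<xi>) = \<i> * of_real x * fti \<psi> x + fti (vderiv 1 \<psi>) x"
  unfolding eq fti_def using i1 i2 by (subst Bochner_Integration.integral_add) auto
 ultimately show ?thesis by (simp add: add_eq_0_iff)
qed

lemma norm_fti_le: "cmod (fti \<psi> x) <= (LBINT \<xi>. cmod (\<psi> \<xi>))"
 unfolding fti_def by (rule order_trans[OF integral_norm_bound]) (simp add: norm_mult)

lemma rapid_fti: "test_function \<psi> ==> rapid (fti \<psi>)"
proof (rule rapidI)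
 fix k assume "test_function \<psi>"
 then show "\<exists>C. \<forall>x. abs x ^ k * cmod (fti \<psi> x) <= C"
 proof (induction k arbitrary: \<psi>)
  case 0
  then show ?case using norm_fti_le by auto
 next
  case (Suc k)
  from Suc.IH[OF test_function_vderiv[OF Suc.prems, of 1]] obtain C where
   "!!x. abs x ^ k * cmod (fti (vderiv 1 \<psi>) x) <= C" by blast
  moreover have "abs x ^ Suc k * cmod (fti \<psi> x) = abs x ^ k * cmod (fti (vderiv 1 \<psi>) x)" for x
   unfolding fti_parts[OF Suc.prems] by (simp add: norm_mult mult_ac)
  ultimately have "abs x ^ Suc k * cmod (fti \<psi> x) <= C" for x by presburger
  then show ?case by blast
 qed
qed

lemma schwartz_fti:
 assumes "test_function \<psi>" shows "schwartz (fti \<psi>)"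
proof -
 let ?S = "{fti \<psi> | \<psi>. test_function \<psi>}"
 have 1: "fti \<psi> \<in> ?S" using assms by blast
 have 2: "\<exists>g'\<in>?S. \<forall>x. (g has_vector_derivative g' x) (at x)" if "g \<in> ?S" for g
  using that fti_has_vector_derivative test_function_ident_mult by fast
 show ?thesis
  unfolding schwartz_iff using smooth_closed[of "fti \<psi>" ?S, OF 1] 2 rapid_fti by (smt (verit) mem_Collect_eq)
qed

lemma gaussian_fti: "(LBINT x. std_normal_density x *\<^sub>R cis (t * x)) = of_real (exp (- t\<^sup>2 / 2))"
proof -
 have "char std_normal_distribution t = of_real (exp (- t\<^sup>2 / 2))"
  by (simp add: char_std_normal_distribution)
 then show ?thesis
  unfolding char_def by (subst (asm) integral_density) (auto simp: cis_conv_exp normal_density_nonneg)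
qed

text \<open>Fourier inversion at the origin. Both sides are limits of integrals with a Gaussian factor of growing width, for which Fubini applies; the transform of the Gaussian is known from the characteristic function of the normal distribution.\<close>

lemma integral_fti:
 assumes "test_function \<psi>"
 shows "(LBINT x. fti \<psi> x) = of_real (2 * pi) * \<psi> 0"
proof -
 note [measurable] = test_function_measurable[OF assms] schwartz_measurable[OF schwartz_fti[OF assms], of 0, simplified]
 let ?g = "std_normal_density"
 have int: "integrable lborel (fti \<psi>)" using schwartz_integrable[OF schwartz_fti[OF assms], of 0] by simp
 have gint: "integrable lborel ?g" by (rule integrable_normal_density) simp
 have gb: "?g x <= 1" "0 <= ?g x" for x
 proof -
  have "1 <= sqrt (2 * pi)" using pi_gt3 by (subst real_le_rsqrt) auto
  moreover have "exp (- x\<^sup>2 / 2) <= 1" by simp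
  ultimately have "exp (- x\<^sup>2 / 2) <= sqrt (2 * pi)" by linarith
  then show "?g x <= 1" unfolding std_normal_density_def by (simp add: divide_le_eq)
  show "0 <= ?g x" by (simp add: normal_density_nonneg)
 qed
 have gcont: "isCont ?g x" for x unfolding std_normal_density_def by (intro continuous_intros) auto
 have L: "(%n. LBINT x. fti \<psi> x * ?g (x / real (Suc n))) \<longlonglongrightarrow> (LBINT x. fti \<psi> x * ?g 0)"
 proof (rule integral_dominated_convergence[where w = "%x. cmod (fti \<psi> x)"])
  show "AE x in lborel. (%n. fti \<psi> x * ?g (x / real (Suc n))) \<longlonglongrightarrow> fti \<psi> x * ?g 0"
  proof (rule AE_I2)
   fix x :: real
   have "(%n. x / real (Suc n)) \<longlonglongrightarrow> 0"
    using LIMSEQ_Suc[OF lim_const_over_n[of x]] by simp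
   then have "(%n. ?g (x / real (Suc n))) \<longlonglongrightarrow> ?g 0"
    using isCont_tendsto_compose[OF gcont] by blast
   then show "(%n. fti \<psi> x * ?g (x / real (Suc n))) \<longlonglongrightarrow> fti \<psi> x * ?g 0"
    by (intro tendsto_intros)
  qed
  show "AE x in lborel. cmod (fti \<psi> x * ?g (x / real (Suc n))) <= cmod (fti \<psi> x)" for n
   using gb by (intro AE_I2) (auto simp: norm_mult mult_left_le)
 qed (use int in \<open>auto simp: borel_measurable_normal_density\<close>)
 have E: "(LBINT x. fti \<psi> x * ?g (x / real (Suc n))) =
   (LBINT \<xi>. \<psi> (\<xi> / real (Suc n)) * of_real (exp (- \<xi>\<^sup>2 / 2)))" for n
 proof -
  let ?n = "real (Suc n)"
  have gn: "integrable lborel (%x. ?g (x / ?n))"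
   using lborel_integrable_real_affine[OF gint, of "1 / ?n" 0] by simp
  have "(LBINT x. fti \<psi> x * ?g (x / ?n)) =
    (LBINT x. (LBINT \<xi>. \<psi> \<xi> * cis (x * \<xi>) * ?g (x / ?n)))"
   unfolding fti_def by simp
  also have "... = (LBINT \<xi>. (LBINT x. \<psi> \<xi> * cis (x * \<xi>) * ?g (x / ?n)))"
  proof (rule fubini_dominated[where a = "%x. ?g (x / ?n)" and b = "%\<xi>. cmod (\<psi> \<xi>)"])
   show "integrable lborel (%\<xi>. cmod (\<psi> \<xi>))" by (intro integrable_norm test_function_integrable assms)
   show "cmod (\<psi> y * cis (x * y) * ?g (x / ?n)) <= ?g (x / ?n) * cmod (\<psi> y)" for x y
    using gb(2) by (simp add: norm_mult)
  qed (use gn in auto)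
  also have "... = (LBINT \<xi>. \<psi> \<xi> * (?n * of_real (exp (- (\<xi> * ?n)\<^sup>2 / 2))))"
  proof (intro lint_cong refl)
   fix \<xi>
   have "(LBINT x. cis (x * \<xi>) * ?g (x / ?n)) = ?n *\<^sub>R (LBINT x. cis ((?n * x) * \<xi>) * ?g (?n * x / ?n))"
    by (subst lborel_integral_real_affine[where c = ?n and t = 0]) auto
   also have "(LBINT x. cis ((?n * x) * \<xi>) * ?g (?n * x / ?n)) = (LBINT x. ?g x *\<^sub>R cis ((\<xi> * ?n) * x))"
    by (intro lint_cong) (auto simp: scaleR_conv_of_real mult_ac)
   also have "... = of_real (exp (- (\<xi> * ?n)\<^sup>2 / 2))" by (rule gaussian_fti)
   finally show "(LBINT x. \<psi> \<xi> * cis (x * \<xi>) * ?g (x / ?n)) = \<psi> \<xi> * (?n * of_real (exp (- (\<xi> * ?n)\<^sup>2 / 2)))"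
    by (simp add: mult.assoc scaleR_conv_of_real)
  qed
  also have "... = (1 / ?n) *\<^sub>R (LBINT \<xi>. \<psi> (\<xi> / ?n) * (?n * of_real (exp (- ((\<xi> / ?n) * ?n)\<^sup>2 / 2))))"
   by (subst lborel_integral_real_affine[where c = "1 / ?n" and t = 0]) auto
  also have "... = (LBINT \<xi>. \<psi> (\<xi> / ?n) * of_real (exp (- \<xi>\<^sup>2 / 2)))"
   unfolding integral_scaleR_right[symmetric]
   by (intro lint_cong) (auto simp: scaleR_conv_of_real of_nat_neq_0 simp del: of_nat_Suc)
  finally show ?thesis .
 qed
 have exp_eq: "exp (- \<xi>\<^sup>2 / 2) = sqrt (2 * pi) * ?g \<xi>" for \<xi> :: real
  unfolding std_normal_density_def by simp
 have eint: "integrable lborel (%\<xi>::real. exp (- \<xi>\<^sup>2 / 2))" unfolding exp_eq using gint by simp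
 have evalue: "integral\<^sup>L lborel (%\<xi>::real. exp (- \<xi>\<^sup>2 / 2)) = sqrt (2 * pi)"
  unfolding exp_eq using integral_normal_density[of 1 0] by simp
 obtain B where B: "!!x. cmod (\<psi> x) <= B"
  using rapidD[of \<psi> 0] test_function_schwartz[OF assms] unfolding schwartz_iff
  by (metis div_by_1 power_0 vderiv_0)
 have cont: "isCont \<psi> 0"
  using assms test_function_iff smooth_continuous[of \<psi> 0] by (simp add: continuous_on_eq_continuous_at)
 have R: "(%n. LBINT \<xi>. \<psi> (\<xi> / real (Suc n)) * of_real (exp (- \<xi>\<^sup>2 / 2)))
   \<longlonglongrightarrow> (LBINT \<xi>. \<psi> 0 * of_real (exp (- \<xi>\<^sup>2 / 2)))"
 proof (rule integral_dominated_convergence[where w = "%\<xi>. B * exp (- \<xi>\<^sup>2 / 2)"])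
  show "AE x in lborel. (%n. \<psi> (x / real (Suc n)) * of_real (exp (- x\<^sup>2 / 2))) \<longlonglongrightarrow> \<psi> 0 * of_real (exp (- x\<^sup>2 / 2))"
  proof (rule AE_I2)
   fix x :: real
   have "(%n. x / real (Suc n)) \<longlonglongrightarrow> 0"
    using LIMSEQ_Suc[OF lim_const_over_n[of x]] by simp
   then show "(%n. \<psi> (x / real (Suc n)) * of_real (exp (- x\<^sup>2 / 2))) \<longlonglongrightarrow> \<psi> 0 * of_real (exp (- x\<^sup>2 / 2))"
    by (intro tendsto_intros isCont_tendsto_compose[OF cont])
  qed
 qed (use eint B in \<open>auto simp: norm_mult mult_right_mono\<close>)
 have "(LBINT x. fti \<psi> x * ?g 0) = (LBINT \<xi>. \<psi> 0 * of_real (exp (- \<xi>\<^sup>2 / 2)))"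
  using L R unfolding E by (rule LIMSEQ_unique)
 also have "... = \<psi> 0 * of_real (sqrt (2 * pi))"
  using evalue by (simp del: of_real_exp)
 finally have "(LBINT x. fti \<psi> x) * of_real (1 / sqrt (2 * pi)) = \<psi> 0 * of_real (sqrt (2 * pi))"
  by (simp add: std_normal_density_def)
 then have "(LBINT x. fti \<psi> x) = \<psi> 0 * (of_real (sqrt (2 * pi)) * of_real (sqrt (2 * pi)))"
  by (simp add: field_simps)
 also have "of_real (sqrt (2 * pi)) * of_real (sqrt (2 * pi)) = (of_real (2 * pi) :: complex)"
  unfolding of_real_mult[symmetric] by simp
 finally show ?thesis by (simp add: mult.commute)
qed

lemma test_function_affine:
 assumes "test_function g" "c \<noteq> 0" shows "test_function (%x. g (c * x + d))"
proof -
 obtain R where R: "!!x. abs x > R ==> g x = 0"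
  using assms unfolding test_function_iff compactly_supported_def by blast
 have "g (c * x + d) = 0" if "abs x > (R + abs d) / abs c" for x
 proof (rule R)
  have "R + abs d < abs (c * x)" using that assms(2) by (simp add: pos_divide_less_eq abs_mult mult.commute)
  then show "R < abs (c * x + d)" by linarith
 qed
 then show ?thesis using assms smooth_affine(1)[of g c d] unfolding test_function_iff compactly_supported_def by blast
qed

lemma fourier_inversion:
 assumes "test_function \<psi>"
 shows "(LBINT z. fti \<psi> z * cis (- z * \<xi>)) = of_real (2 * pi) * \<psi> \<xi>"
proof -
 have "fti (%\<eta>. \<psi> (1 * \<eta> + \<xi>)) z = fti \<psi> z * cis (- z * \<xi>)" for z
 proof -
  have "fti \<psi> z = (LBINT \<eta>. \<psi> (\<xi> + 1 * \<eta>) * cis (z * (\<xi> + 1 * \<eta>)))"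
   unfolding fti_def by (subst lborel_integral_real_affine[where c = 1 and t = \<xi>]) auto
  also have "... = fti (%\<eta>. \<psi> (1 * \<eta> + \<xi>)) z * cis (z * \<xi>)"
   unfolding fti_def integral_mult_left_zero[symmetric]
   by (intro lint_cong) (auto simp: cis_mult algebra_simps)
  finally show ?thesis by (simp add: cis_mult mult.assoc)
 qed
 then show ?thesis
  using integral_fti[OF test_function_affine[OF assms, of 1 \<xi>]] by simp
qed

text \<open>The convolution theorem, read off from inversion at one point: modulation of the symbol translates the kernel.\<close>

lemma fti_convolution:
 assumes "test_function \<psi>" "test_function \<eta>"
 shows "(LBINT z. fti \<eta> z * fti \<psi> (x - z)) = of_real (2 * pi) * fti (%\<xi>. \<psi> \<xi> * \<eta> \<xi>) x"
proof -
 note [measurable] = test_function_measurable[OF assms(1)] test_function_measurable[OF assms(2)]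
  schwartz_measurable[OF schwartz_fti[OF assms(2)], of 0, simplified]
 have "(LBINT z. fti \<eta> z * fti \<psi> (x - z)) =
   (LBINT z. (LBINT \<xi>. fti \<eta> z * (\<psi> \<xi> * cis ((x - z) * \<xi>))))"
  unfolding fti_def[of \<psi>] by simp
 also have "... = (LBINT \<xi>. (LBINT z. fti \<eta> z * (\<psi> \<xi> * cis ((x - z) * \<xi>))))"
 proof (rule fubini_dominated[where a = "%z. cmod (fti \<eta> z)" and b = "%\<xi>. cmod (\<psi> \<xi>)"])
  show "integrable lborel (%\<xi>. cmod (\<psi> \<xi>))" by (intro integrable_norm test_function_integrable assms)
  show "integrable lborel (%z. cmod (fti \<eta> z))"
   using schwartz_integrable[OF schwartz_fti[OF assms(2)], of 0] by auto
 qed (auto simp: norm_mult)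
 also have "... = (LBINT \<xi>. \<psi> \<xi> * cis (x * \<xi>) * (LBINT z. fti \<eta> z * cis (- z * \<xi>)))"
  unfolding integral_mult_right_zero[symmetric]
  by (intro lint_cong refl) (auto simp: cis_mult algebra_simps)
 also have "... = (LBINT \<xi>. of_real (2 * pi) * (\<psi> \<xi> * \<eta> \<xi> * cis (x * \<xi>)))"
  unfolding fourier_inversion[OF assms(2)] by (simp add: algebra_simps)
 finally show ?thesis by (simp add: fti_def)
qed

section \<open>The low-pass kernels\<close>

text \<open>The kernel whose convolution restricts to frequencies of size at most about \<open>2^j\<close>; the Littlewood-Paley kernels are differences of consecutive ones.\<close>

definition low :: "(real => complex) => nat => real => complex" where
 "low \<phi> j x = 1 / (2 * pi) * fti (%\<xi>. \<phi> (\<xi> / 2 ^ j)) x"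

lemma lp_generator_test_function: "lp_generator \<phi> ==> test_function \<phi>"
 unfolding lp_generator_def test_function_iff schwartz_iff compactly_supported_def
 by (meson less_imp_le)

lemma test_function_dilate:
 assumes "lp_generator \<phi>" shows "test_function (%\<xi>. \<phi> (\<xi> / 2 ^ j))"
 using test_function_affine[OF lp_generator_test_function[OF assms], of "1 / 2 ^ j" 0] by simp

lemma schwartz_low: "lp_generator \<phi> ==> schwartz (low \<phi> j)"
 unfolding low_def[abs_def] by (intro schwartz_cmult schwartz_fti test_function_dilate)

lemma low_scale: "low \<phi> j x = 2 ^ j * low \<phi> 0 (2 ^ j * x)"
proof -
 have "(LBINT \<xi>. \<phi> (\<xi> / 2 ^ j) * cis (x * \<xi>)) =
  2 ^ j *\<^sub>R (LBINT \<xi>. \<phi> ((0 + 2 ^ j * \<xi>) / 2 ^ j) * cis (x * (0 + 2 ^ j * \<xi>)))"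
  by (subst lborel_integral_real_affine[where c = "2 ^ j" and t = 0]) auto
 then show ?thesis by (simp add: low_def fti_def scaleR_conv_of_real mult_ac)
qed

lemma integral_low: "lp_generator \<phi> ==> (LBINT x. low \<phi> j x) = 1"
 unfolding low_def using integral_fti[OF test_function_dilate, of \<phi> j]
 by (simp add: lp_generator_def)

text \<open>Of two distinct cutoffs the larger one equals 1 on the support of the smaller one.\<close>

lemma low_convolution:
 assumes "lp_generator \<phi>" "a \<noteq> b"
 shows "(LBINT z. low \<phi> a z * low \<phi> b (x - z)) = low \<phi> (min a b) x"
proof -
 have prod: "\<phi> (\<xi> / 2 ^ m) * \<phi> (\<xi> / 2 ^ n) = \<phi> (\<xi> / 2 ^ m)" if mn: "m < n" for m n :: nat and \<xi>
 proof (cases "abs (\<xi> / 2 ^ m) < 2")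
  case True
  obtain d where d: "n = Suc (m + d)" using less_imp_Suc_add[OF mn] by blast
  have "(2::real) ^ m * 2 <= 2 ^ n" by (simp add: d power_add)
  then have "abs \<xi> <= 2 ^ n" using True by (simp add: abs_divide pos_divide_less_eq)
  then show ?thesis using assms(1) by (simp add: lp_generator_def abs_divide)
 qed (use assms(1) in \<open>simp add: lp_generator_def\<close>)
 have "(%\<xi>. \<phi> (\<xi> / 2 ^ b) * \<phi> (\<xi> / 2 ^ a)) = (%\<xi>. \<phi> (\<xi> / 2 ^ min a b))"
  using prod[of a b] prod[of b a] assms(2) by (cases "a < b") (auto simp: fun_eq_iff mult.commute min_def)
 then show ?thesis
  using fti_convolution[OF test_function_dilate[OF assms(1), of b] test_function_dilate[OF assms(1), of a], of x]
  by (simp add: low_def)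
qed

lemma lp_kernel_0: "lp_kernel \<phi> 0 = low \<phi> 0"
 by (simp add: fun_eq_iff lp_kernel_def low_def fti_def lp_symbol_def)

lemma lp_kernel_Suc:
 assumes "lp_generator \<phi>" shows "lp_kernel \<phi> (Suc j) = (%x. low \<phi> (Suc j) x - low \<phi> j x)"
proof
 fix x
 have "lp_symbol \<phi> (Suc j) = (%\<xi>. \<phi> (\<xi> / 2 ^ Suc j) - \<phi> (\<xi> / 2 ^ j))"
  by (simp add: fun_eq_iff lp_symbol_def)
 then have "(LINT \<xi>|lborel. lp_symbol \<phi> (Suc j) \<xi> * cis (x * \<xi>)) =
  fti (%\<xi>. \<phi> (\<xi> / 2 ^ Suc j)) x - fti (%\<xi>. \<phi> (\<xi> / 2 ^ j)) x"
  unfolding fti_def using test_function_dilate[OF assms]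
  by (subst lint_diff[symmetric])
    (simp_all add: left_diff_distrib right_diff_distrib integrable_mult_cis test_function_integrable del: power_Suc)
 then show "lp_kernel \<phi> (Suc j) x = low \<phi> (Suc j) x - low \<phi> j x"
  unfolding lp_kernel_def low_def by (simp only: right_diff_distrib)
qed

lemma schwartz_lp_kernel: "lp_generator \<phi> ==> schwartz (lp_kernel \<phi> j)"
 using schwartz_low schwartz_lincomb[OF schwartz_low schwartz_low, of \<phi> \<phi> 1 j "-1" "j - 1"]
 by (cases j) (auto simp: lp_kernel_0 lp_kernel_Suc)

section \<open>Tempered distributions\<close>

lemma tempered_lincomb:
 assumes "tempered_distribution f" "schwartz g" "schwartz h"
 shows "f (%x. c * g x + d * h x) = c * f g + d * f h"
 using assms schwartz_cmult[of g c] schwartz_cmult[of h d] unfolding tempered_distribution_def by simp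

text \<open>Continuity in the form in which it is used: one weighted uniform bound on finitely many derivatives.\<close>

lemma tempered_bound:
 assumes "tempered_distribution f"
 obtains A n where "A >= 0"
  "!!g c. schwartz g ==> (!!m y. m <= n ==> (wt y) ^ n * cmod (vderiv m g y) <= c) ==> cmod (f g) <= A * c"
proof -
 from assms obtain B n where B:
  "!!g. schwartz g ==> cmod (f g) <= B * (\<Sum>k\<le>n. \<Sum>m\<le>n. schwartz_seminorm k m g)"
  unfolding tempered_distribution_def by blast
 have "cmod (f g) <= (abs B * (real (Suc n) * real (Suc n))) * c"
  if g: "schwartz g" and c: "!!m y. m <= n ==> (wt y) ^ n * cmod (vderiv m g y) <= c" for g c
 proof -
  have le: "abs y ^ k * cmod (vderiv m g y) <= c" if "k <= n" "m <= n" for k m y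
  proof -
   have "abs y ^ k <= wt y ^ k" by (rule power_mono) auto
   also have "... <= wt y ^ n" by (rule power_increasing) (use that in auto)
   finally have "abs y ^ k * cmod (vderiv m g y) <= wt y ^ n * cmod (vderiv m g y)"
    by (rule mult_right_mono) simp
   then show ?thesis using c[OF that(2), of y] by linarith
  qed
  have sn: "schwartz_seminorm k m g <= c" "0 <= schwartz_seminorm k m g" if "k <= n" "m <= n" for k m
  proof -
   show "schwartz_seminorm k m g <= c"
    unfolding schwartz_seminorm_def using le[OF that] by (intro cSUP_least) auto
   have "bdd_above (range (%x. abs x ^ k * cmod (vderiv m g x)))" using g by (simp add: schwartz_def)
   then show "0 <= schwartz_seminorm k m g"
    unfolding schwartz_seminorm_def by (intro cSUP_upper2[of _ _ 0]) auto
  qed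
  have "(\<Sum>k\<le>n. \<Sum>m\<le>n. schwartz_seminorm k m g) <= (\<Sum>k\<le>n. \<Sum>m\<le>n. c)"
   by (intro sum_mono sn) auto
  also have "... = real (Suc n) * real (Suc n) * c" by simp
  finally have S: "(\<Sum>k\<le>n. \<Sum>m\<le>n. schwartz_seminorm k m g) <= real (Suc n) * real (Suc n) * c" .
  have S0: "0 <= (\<Sum>k\<le>n. \<Sum>m\<le>n. schwartz_seminorm k m g)" by (intro sum_nonneg sn) auto
  have "cmod (f g) <= B * (\<Sum>k\<le>n. \<Sum>m\<le>n. schwartz_seminorm k m g)" by (rule B[OF g])
  also have "... <= abs B * (\<Sum>k\<le>n. \<Sum>m\<le>n. schwartz_seminorm k m g)"
   using S0 by (intro mult_right_mono) auto
  also have "... <= abs B * (real (Suc n) * real (Suc n) * c)" by (intro mult_left_mono S) auto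
  finally show ?thesis by (simp only: mult.assoc)
 qed
 then show ?thesis by (intro that[of "abs B * (real (Suc n) * real (Suc n))" n]) auto
qed

lemma schwartz_uniform_bound:
 assumes "schwartz b"
 obtains C where "C >= 0" "!!m x. m <= n ==> (wt x) ^ k * cmod (vderiv m b x) <= C"
proof -
 have "\<exists>C. \<forall>x. wt x ^ k * cmod (vderiv m b x) <= C" for m
  using assms unfolding schwartz_iff rapid_def by blast
 then obtain C where C: "!!m x. wt x ^ k * cmod (vderiv m b x) <= C m" by metis
 have pos: "0 <= C m" for m
 proof -
  have "0 <= wt 0 ^ k * cmod (vderiv m b 0)" by simp
  then show ?thesis using C[of 0 m] by linarith
 qed
 have "wt x ^ k * cmod (vderiv m b x) <= (\<Sum>m\<le>n. C m)" if "m <= n" for m x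
  using C[of x m] member_le_sum[of m "{..n}" C] pos that by fastforce
 then show ?thesis using that[of "\<Sum>m\<le>n. C m"] pos by (auto intro: sum_nonneg)
qed

lemma schwartz_reflect:
 assumes "schwartz b"
 shows "schwartz (%y. b (u - y))" "vderiv m (%y. b (u - y)) = (%y. (-1) ^ m * vderiv m b (u - y))"
 using schwartz_affine[OF assms, of "-1" u] smooth_affine(2)[of b m "-1" u] assms
 by (auto simp: schwartz_iff algebra_simps)

lemma weight_power_shift:
 "wt y ^ n <= wt (u - y) ^ n * wt u ^ n"
 using power_mono[OF weight_triangle[of y u], of n]
 by (simp add: power_mult_distrib abs_minus_commute)

definition dconv :: "distribution => (real => complex) => real => complex" where
 "dconv f b x = f (%y. b (x - y))"

text \<open>Translation is Lipschitz for the seminorms of a Schwartz function, with polynomial growth in the position; hence convolutions with tempered distributions are continuous.\<close>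

lemma schwartz_increment:
 assumes "schwartz b"
 obtains C where "C >= 0"
  "!!m u v y. m <= n ==> abs (u - v) <= 1 ==>
   wt y ^ n * cmod (vderiv m b (u - y) - vderiv m b (v - y)) <= C * (2 + abs v) ^ n * abs (u - v)"
proof -
 obtain C where C: "C >= 0" "!!m x. m <= Suc n ==> (wt x) ^ n * cmod (vderiv m b x) <= C"
  using schwartz_uniform_bound[OF assms, of "Suc n" n] by blast
 have "wt y ^ n * cmod (vderiv m b (u - y) - vderiv m b (v - y)) <= C * (2 + abs v) ^ n * abs (u - v)"
  if "m <= n" "abs (u - v) <= 1" for m u v y
 proof -
  let ?w = "wt y ^ n"
  have w: "?w > 0" by (intro zero_less_power) auto
  have "cmod (vderiv m b (u - y) - vderiv m b (v - y)) <= C * (2 + abs v) ^ n / ?w * abs ((u - y) - (v - y))"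
  proof (rule mvt_norm_bound)
   show "(vderiv m b has_vector_derivative vderiv (Suc m) b t) (at t)" for t
    using assms smooth_has_vderiv schwartz_iff by blast
   fix t assume "t \<in> closed_segment (v - y) (u - y)"
   then have t: "abs ((t + y) - v) <= 1" using that(2) by (auto simp: closed_segment_eq_real_ivl split: if_splits)
   have "wt y ^ n * cmod (vderiv (Suc m) b t) <= (wt ((t + y) - y) ^ n * wt (t + y) ^ n) * cmod (vderiv (Suc m) b t)"
    by (intro mult_right_mono weight_power_shift) auto
   also have "... = wt (t + y) ^ n * (wt t ^ n * cmod (vderiv (Suc m) b t))" by simp
   also have "... <= (2 + abs v) ^ n * C"
    using t C that(1) by (intro mult_mono power_mono) auto
   finally show "cmod (vderiv (Suc m) b t) <= C * (2 + abs v) ^ n / ?w"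
    using w by (simp add: pos_le_divide_eq mult.commute)
  qed
  then have "?w * cmod (vderiv m b (u - y) - vderiv m b (v - y)) <= ?w * (C * (2 + abs v) ^ n / ?w * abs (u - v))"
   using w by (intro mult_left_mono) auto
  also have "... = C * (2 + abs v) ^ n * abs (u - v)" using w by simp
  finally show ?thesis .
 qed
 then show ?thesis using that C(1) by blast
qed

lemma dconv_growth:
 assumes "tempered_distribution f" "schwartz b"
 obtains C n where "C >= 0" "!!x. cmod (dconv f b x) <= C * wt x ^ n"
proof -
 from tempered_bound[OF assms(1)] obtain A n where A: "A >= 0"
  "!!g c. schwartz g ==> (!!m y. m <= n ==> (wt y) ^ n * cmod (vderiv m g y) <= c) ==> cmod (f g) <= A * c"
  by metis
 from schwartz_uniform_bound[OF assms(2), of n n] obtain C where C: "C >= 0"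
  "!!m x. m <= n ==> (wt x) ^ n * cmod (vderiv m b x) <= C" by metis
 have "cmod (dconv f b x) <= A * (C * wt x ^ n)" for x
  unfolding dconv_def
 proof (rule A(2)[OF schwartz_reflect(1)[OF assms(2)]])
  fix m y assume m: "m <= n"
  have "wt y ^ n * cmod (vderiv m b (x - y)) <= (wt (x - y) ^ n * wt x ^ n) * cmod (vderiv m b (x - y))"
   by (intro mult_right_mono weight_power_shift) auto
  also have "... = wt x ^ n * (wt (x - y) ^ n * cmod (vderiv m b (x - y)))" by simp
  also have "... <= wt x ^ n * C" by (intro mult_left_mono C m) auto
  finally show "wt y ^ n * cmod (vderiv m (%y. b (x - y)) y) <= C * wt x ^ n"
   by (simp add: schwartz_reflect(2)[OF assms(2)] norm_mult norm_power mult.commute)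
 qed
 then show ?thesis using A(1) C(1) by (intro that[of "A * C" n]) (auto simp: mult.assoc)
qed

lemma dconv_increment:
 assumes "tempered_distribution f" "schwartz b"
 obtains C n where "C >= 0" "!!u v. abs (u - v) <= 1 ==> cmod (dconv f b u - dconv f b v) <= C * (2 + abs v) ^ n * abs (u - v)"
proof -
 from tempered_bound[OF assms(1)] obtain A n where A: "A >= 0"
  "!!g c. schwartz g ==> (!!m y. m <= n ==> (wt y) ^ n * cmod (vderiv m g y) <= c) ==> cmod (f g) <= A * c"
  by metis
 from schwartz_increment[OF assms(2), of n] obtain C where C: "C >= 0"
  "!!m u v y. m <= n ==> abs (u - v) <= 1 ==>
   wt y ^ n * cmod (vderiv m b (u - y) - vderiv m b (v - y)) <= C * (2 + abs v) ^ n * abs (u - v)" by metis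
 have "cmod (dconv f b u - dconv f b v) <= A * (C * (2 + abs v) ^ n * abs (u - v))" if uv: "abs (u - v) <= 1" for u v
 proof -
  let ?g = "%y. 1 * b (u - y) + (-1) * b (v - y)"
  have s: "schwartz (%y. b (u - y))" "schwartz (%y. b (v - y))" by (rule schwartz_reflect[OF assms(2)])+
  have "dconv f b u - dconv f b v = f ?g"
   unfolding dconv_def by (subst tempered_lincomb[OF assms(1) s]) simp
  also have "cmod ... <= A * (C * (2 + abs v) ^ n * abs (u - v))"
  proof (rule A(2)[OF schwartz_lincomb[OF s]])
   fix m y assume m: "m <= n"
   have "vderiv m ?g y = (-1) ^ m * (vderiv m b (u - y) - vderiv m b (v - y))"
    using s by (subst smooth_lincomb(2)) (simp_all add: schwartz_iff schwartz_reflect(2)[OF assms(2)] algebra_simps)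
   then show "wt y ^ n * cmod (vderiv m ?g y) <= C * (2 + abs v) ^ n * abs (u - v)"
    using C(2)[OF m uv, of y] by (simp add: norm_mult norm_power)
  qed
  finally show ?thesis .
 qed
 then show ?thesis using A(1) C(1) by (intro that[of "A * C" n]) (auto simp: mult.assoc)
qed

lemma dconv_continuous:
 assumes "tempered_distribution f" "schwartz b"
 shows "continuous_on UNIV (dconv f b)"
proof -
 from dconv_increment[OF assms] obtain C n where C: "C >= 0"
  "!!u v. abs (u - v) <= 1 ==> cmod (dconv f b u - dconv f b v) <= C * (2 + abs v) ^ n * abs (u - v)" by metis
 have "(dconv f b \<longlongrightarrow> dconv f b v) (at v)" for v
 proof (rule LIM_zero_cancel, rule Lim_null_comparison)
  show "\<forall>\<^sub>F u in at v. norm (dconv f b u - dconv f b v) <= C * (2 + abs v) ^ n * abs (u - v)"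
   unfolding eventually_at using C(2) by (intro exI[of _ 1]) (auto simp: dist_real_def)
  show "((%u. C * (2 + abs v) ^ n * abs (u - v)) \<longlongrightarrow> 0) (at v)"
   by (auto intro!: tendsto_eq_intros)
 qed
 then show ?thesis by (simp add: continuous_on_eq_continuous_at isCont_def)
qed

lemma convolution_schwartz:
 fixes x :: real
 assumes "rapid \<alpha>" "\<alpha> \<in> borel_measurable borel" "schwartz b"
 defines "c \<equiv> %y. \<integral>z. \<alpha> z * b (x - z - y) \<partial>lborel"
 shows "schwartz c"
  and "vderiv m c y = (LBINT z. \<alpha> z * ((-1) ^ m * vderiv m b (x - z - y)))"
  and "(!!x. wt x ^ n * cmod (vderiv m b x) <= C) ==>
   wt y ^ n * cmod (vderiv m c y) <= C * wt x ^ n * (LBINT z. wt z ^ n * cmod (\<alpha> z))"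
proof -
 note [measurable] = assms(2) schwartz_measurable[OF assms(3)]
 have \<alpha>: "integrable lborel \<alpha>" by (rule rapid_integrable[OF assms(1,2)])
 define D where "D m y = (LBINT z. \<alpha> z * ((-1) ^ m * vderiv m b (x - z - y)))" for m y
 have int: "integrable lborel (%z. \<alpha> z * ((-1) ^ m * vderiv m b (x - z - y)))" for m y
 proof -
  obtain C where C: "C >= 0" "!!m' x. m' <= m ==> (wt x) ^ 0 * cmod (vderiv m' b x) <= C"
   using schwartz_uniform_bound[OF assms(3)] by blast
  have i: "integrable lborel (%z. C * cmod (\<alpha> z))" by (intro integrable_mult_right integrable_norm \<alpha>)
  have le: "cmod (\<alpha> z * ((-1) ^ m * vderiv m b (x - z - y))) <= norm (C * cmod (\<alpha> z))" for z
  proof -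
   have "cmod (vderiv m b (x - z - y)) <= C" using C(2)[of m "x - z - y"] by simp
   from mult_left_mono[OF this norm_ge_zero[of "\<alpha> z"]] show ?thesis
    using C(1) by (simp add: norm_mult norm_power abs_mult mult.commute[of C])
  qed
  show ?thesis by (rule lint_bound[OF i _ AE_I2[OF le]]) measurable
 qed
 have der: "(D m has_vector_derivative D (Suc m) y) (at y)" for m y
 proof -
  obtain C where C: "C >= 0" "!!m' x. m' <= Suc m ==> (wt x) ^ 0 * cmod (vderiv m' b x) <= C"
   using schwartz_uniform_bound[OF assms(3)] by blast
  show ?thesis unfolding D_def
  proof (rule has_vector_derivative_integral[where W = "%z. C * cmod (\<alpha> z)"])
   show "((%t. \<alpha> z * ((- 1) ^ m * vderiv m b (x - z - t))) has_vector_derivative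
     \<alpha> z * ((- 1) ^ Suc m * vderiv (Suc m) b (x - z - t))) (at t)" for t z
   proof (intro has_vector_derivative_mult_right)
    have sb: "smooth (%y. b (x - z - y))" using schwartz_reflect(1)[OF assms(3), of "x - z"] by (simp add: schwartz_iff)
    show "((%t. (- 1) ^ m * vderiv m b (x - z - t)) has_vector_derivative
     (- 1) ^ Suc m * vderiv (Suc m) b (x - z - t)) (at t)"
     using smooth_has_vderiv[OF sb, of m t] unfolding schwartz_reflect(2)[OF assms(3)] .
   qed
   show "cmod (\<alpha> z * ((- 1) ^ Suc m * vderiv (Suc m) b (x - z - t))) <= C * cmod (\<alpha> z)" for z t
    using mult_left_mono[OF C(2)[of "Suc m" "x - z - t"] norm_ge_zero[of "\<alpha> z"]]
    by (simp add: norm_mult norm_power mult.commute[of C])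
  qed (use int \<alpha> in auto)
 qed
 have c: "c = D 0" by (simp add: c_def D_def fun_eq_iff)
 have vd: "vderiv m c y = D m y" for m y unfolding c using smooth_intro(2)[of D, OF der] by simp
 then show "vderiv m c y = (LBINT z. \<alpha> z * ((-1) ^ m * vderiv m b (x - z - y)))" by (simp add: D_def)
 have bound: "wt y ^ n * cmod (vderiv m c y) <= C * wt x ^ n * (LBINT z. wt z ^ n * cmod (\<alpha> z))"
  if C: "!!x. wt x ^ n * cmod (vderiv m b x) <= C" for m n y C
 proof -
  have C0: "C >= 0"
  proof -
   have "0 <= wt 0 ^ n * cmod (vderiv m b 0)" by simp
   then show ?thesis using C[of 0] by linarith
  qed
  have "cmod (D m y) <= (LBINT z. cmod (\<alpha> z * ((-1) ^ m * vderiv m b (x - z - y))))"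
   unfolding D_def by (rule integral_norm_bound)
  then have "wt y ^ n * cmod (D m y) <= wt y ^ n * (LBINT z. cmod (\<alpha> z * ((-1) ^ m * vderiv m b (x - z - y))))"
   by (intro mult_left_mono) auto
  also have "... = (LBINT z. wt y ^ n * cmod (\<alpha> z * ((-1) ^ m * vderiv m b (x - z - y))))" by simp
  also have "... <= (LBINT z. C * wt x ^ n * (wt z ^ n * cmod (\<alpha> z)))"
  proof (rule integral_mono)
   show "integrable lborel (%z. wt y ^ n * cmod (\<alpha> z * ((-1) ^ m * vderiv m b (x - z - y))))"
    by (intro integrable_mult_right integrable_norm int)
   show "integrable lborel (%z. C * wt x ^ n * (wt z ^ n * cmod (\<alpha> z)))"
    by (intro integrable_mult_right rapid_integrable_weighted assms)
   fix z
   have "wt y ^ n * cmod (vderiv m b (x - z - y)) \<le>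
    (wt ((x - z) - y) ^ n * wt (x - z) ^ n) * cmod (vderiv m b (x - z - y))"
    by (intro mult_right_mono weight_power_shift) auto
   also have "... = (wt (x - z - y) ^ n * cmod (vderiv m b (x - z - y))) * wt (x - z) ^ n" by simp
   also have "... <= C * wt (x - z) ^ n"
    using C by (simp add: mult_right_mono)
   also have "... <= C * (wt x ^ n * wt z ^ n)"
    using weight_power_shift[of "x - z" n x] C0 by (intro mult_left_mono) (auto simp: mult.commute)
   finally have "wt y ^ n * cmod (vderiv m b (x - z - y)) * cmod (\<alpha> z) <= C * (wt x ^ n * wt z ^ n) * cmod (\<alpha> z)"
    by (intro mult_right_mono) auto
   then show "wt y ^ n * cmod (\<alpha> z * ((-1) ^ m * vderiv m b (x - z - y))) <= C * wt x ^ n * (wt z ^ n * cmod (\<alpha> z))"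
    by (simp add: norm_mult norm_power mult_ac)
  qed
  finally show ?thesis unfolding vd by simp
 qed
 then show "(!!x. wt x ^ n * cmod (vderiv m b x) <= C) ==>
   wt y ^ n * cmod (vderiv m c y) <= C * wt x ^ n * (LBINT z. wt z ^ n * cmod (\<alpha> z))" by blast
 show "schwartz c" unfolding schwartz_iff
 proof (intro conjI allI)
  show "smooth c" unfolding c using smooth_intro(1)[of D, OF der] .
  show "rapid (vderiv m c)" for m
   unfolding rapid_def
  proof
   fix n
   from schwartz_uniform_bound[OF assms(3), of m n] obtain C where
    C: "!!m' x. m' <= m ==> (wt x) ^ n * cmod (vderiv m' b x) <= C" by metis
   then show "\<exists>C. \<forall>y. wt y ^ n * cmod (vderiv m c y) <= C" using bound[OF C[of m]] by blast
  qed
 qed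
qed

lemma integrable_indicator_Ioc: "integrable lborel (%z. B * indicator {u<..v::real} z :: real)"
 by (cases "u <= v") (auto intro!: integrable_mult_right integrable_real_indicator)

lemma indicator_integral_bound:
 fixes h :: "real => complex"
 assumes "u <= v" "B >= 0" "!!z. u < z ==> z <= v ==> cmod (h z) <= B"
 shows "cmod (LBINT z. indicator {u<..v} z * h z) <= B * (v - u)"
proof (cases "integrable lborel (%z. indicator {u<..v} z * h z)")
 case True
 have "cmod (LBINT z. indicator {u<..v} z * h z) <= (LBINT z. cmod (indicator {u<..v} z * h z))"
  by (rule integral_norm_bound)
 also have "... <= (LBINT z. B * indicator {u<..v} z)"
  using assms by (intro integral_mono integrable_norm True integrable_indicator_Ioc) (auto simp: indicator_def)
 also have "... = B * (v - u)" using assms by simp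
 finally show ?thesis .
qed (use assms in \<open>simp add: not_integrable_integral_eq\<close>)

lemma rapid_mult_bounded:
 assumes "rapid a" "!!z. cmod (g z) <= B"
 shows "rapid (%z. g z * a z)"
 unfolding rapid_def
proof
 fix k
 obtain C where C: "!!x. wt x ^ k * cmod (a x) <= C" using assms unfolding rapid_def by blast
 have B: "B >= 0" using assms(2)[of 0] norm_ge_zero[of "g 0"] by linarith
 have "wt x ^ k * cmod (g x * a x) <= B * C" for x
 proof -
  have "wt x ^ k * cmod (g x * a x) = cmod (g x) * (wt x ^ k * cmod (a x))" by (simp add: norm_mult)
  also have "... <= B * C" using assms(2) C B by (intro mult_mono) auto
  finally show ?thesis .
 qed
 then show "\<exists>C. \<forall>x. wt x ^ k * cmod (g x * a x) <= C" by blast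
qed

lemma rapid_indicator: "rapid (indicator {u<..v::real})"
 unfolding rapid_def
proof
 fix k
 have "wt x ^ k * cmod (indicator {u<..v} x) <= (1 + (abs u + abs v)) ^ k" for x
  by (auto simp: indicator_def intro!: power_mono)
 then show "\<exists>C. \<forall>x. wt x ^ k * cmod (indicator {u<..v} x) <= C" by blast
qed

lemma rapid_tail_integrals:
 assumes "rapid a" "a \<in> borel_measurable borel"
 shows "(%i. LBINT z. wt z ^ n * cmod (indicator {..- real i} z * a z)) \<longlonglongrightarrow> 0"
  and "(%i. LBINT z. wt z ^ n * cmod (indicator {real i<..} z * a z)) \<longlonglongrightarrow> 0"
proof -
 note [measurable] = assms(2)
 have lim: "(%i. LBINT z. wt z ^ n * cmod (indicator (S i) z * a z)) \<longlonglongrightarrow> 0"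
  if S: "!!i. S i \<in> sets borel" "!!i z. z \<in> S i ==> real i <= abs z" for S
 proof -
  note [measurable] = S(1)
  have "(%i. LBINT z. wt z ^ n * cmod (indicator (S i) z * a z)) \<longlonglongrightarrow> integral\<^sup>L lborel (%z::real. 0::real)"
  proof (rule integral_dominated_convergence[where w = "%z. wt z ^ n * cmod (a z)"])
   show "AE z in lborel. (%i. wt z ^ n * cmod (indicator (S i) z * a z)) \<longlonglongrightarrow> 0"
   proof (rule AE_I2, rule tendsto_eventually)
    fix z :: real
    obtain n0 :: nat where "abs z < real n0" using reals_Archimedean2 by blast
    then have "z \<notin> S i" if "i >= n0" for i using S(2)[of z i] that by force
    then show "\<forall>\<^sub>F i in sequentially. wt z ^ n * cmod (indicator (S i) z * a z) = 0"
     by (intro eventually_sequentiallyI[of n0]) auto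
   qed
  qed (use rapid_integrable_weighted[OF assms] in \<open>auto simp: indicator_def abs_mult\<close>)
  then show ?thesis by simp
 qed
 show "(%i. LBINT z. wt z ^ n * cmod (indicator {..- real i} z * a z)) \<longlonglongrightarrow> 0"
  by (rule lim) auto
 show "(%i. LBINT z. wt z ^ n * cmod (indicator {real i<..} z * a z)) \<longlonglongrightarrow> 0"
  by (rule lim) auto
qed

text \<open>A tempered distribution may be interchanged with an absolutely convergent superposition of translates of a Schwartz function. Let \<open>T \<alpha>\<close> be the difference of the two sides for the density \<open>\<alpha>\<close>. It is linear in \<open>\<alpha>\<close> and bounded by a weighted \<open>L\<^sub>1\<close> norm. For the density cut off to a short interval, moving all translates to its left end point changes both sides by at most a multiple of the squared length and makes them equal. So \<open>T\<close> of the density cut off at \<open>t\<close> has derivative zero in \<open>t\<close>, hence is constant; it is zero by the limit at minus infinity, and what remains of \<open>T\<close> beyond \<open>t\<close> vanishes in the limit at plus infinity.\<close>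

lemma weak_convolution:
 assumes tf: "tempered_distribution f" and a: "continuous_on UNIV a" "rapid a" and b: "schwartz b"
 shows "f (%y. LBINT z. a z * b (x - z - y)) = (LBINT z. a z * dconv f b (x - z))"
proof -
 note bm[measurable] = schwartz_measurable[OF b, of 0, simplified]
 have am[measurable]: "a \<in> borel_measurable borel" using a(1) by (rule borel_measurable_continuous_onI)
 have dm[measurable]: "dconv f b \<in> borel_measurable borel"
  using dconv_continuous[OF tf b] by (rule borel_measurable_continuous_onI)
 define c where "c \<alpha> y = (LBINT z. \<alpha> z * b (x - z - y))" for \<alpha> y
 define T where "T \<alpha> = f (c \<alpha>) - (LBINT z. \<alpha> z * dconv f b (x - z))" for \<alpha>
 define good where "good \<alpha> \<longleftrightarrow> rapid \<alpha> \<and> \<alpha> \<in> borel_measurable borel" for \<alpha> :: "real => complex"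
 from tempered_bound[OF tf] obtain A n where A: "A >= 0"
  "!!g c. schwartz g ==> (!!m y. m <= n ==> (wt y) ^ n * cmod (vderiv m g y) <= c) ==> cmod (f g) <= A * c"
  by metis
 from schwartz_uniform_bound[OF b, of n n] obtain C1 where C1: "C1 >= 0"
  "!!m x. m <= n ==> (wt x) ^ n * cmod (vderiv m b x) <= C1" by metis
 from dconv_growth[OF tf b] obtain C2 n2 where C2: "C2 >= 0" "!!x. cmod (dconv f b x) <= C2 * wt x ^ n2" by metis
 from schwartz_uniform_bound[OF b, of 0 0] obtain B0 where B0: "!!x. cmod (b x) <= B0"
  by (metis le_refl mult_1 power_0 vderiv_0)
 define K where "K = A * (C1 * wt x ^ n) + C2 * wt x ^ n2"
 define N where "N = max n n2"
 have K0: "K >= 0" unfolding K_def using A C1 C2 by simp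
 have cs: "schwartz (c \<alpha>)" if "good \<alpha>" for \<alpha>
  using convolution_schwartz(1)[of \<alpha> b x] that b unfolding c_def good_def by blast
 have growth: "cmod (dconv f b (x - z)) <= C2 * wt x ^ n2 * wt z ^ n2" for z
 proof -
  have "cmod (dconv f b (x - z)) <= C2 * wt (x - z) ^ n2" by (rule C2)
  also have "... <= C2 * (wt (x - (x - z)) ^ n2 * wt x ^ n2)"
   by (intro mult_left_mono weight_power_shift C2)
  finally show ?thesis by (simp add: mult_ac)
 qed
 have int2: "integrable lborel (%z. \<alpha> z * dconv f b (x - z))" if "good \<alpha>" for \<alpha>
 proof -
  have [measurable]: "\<alpha> \<in> borel_measurable borel" using that good_def by blast
  have "integrable lborel (%z. C2 * wt x ^ n2 * (wt z ^ n2 * cmod (\<alpha> z)))"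
   using that by (intro integrable_mult_right rapid_integrable_weighted) (auto simp: good_def)
  then show ?thesis
  proof (rule lint_bound)
   have "cmod (\<alpha> z * dconv f b (x - z)) <= norm (C2 * wt x ^ n2 * (wt z ^ n2 * cmod (\<alpha> z)))" for z
    using mult_left_mono[OF growth[of z] norm_ge_zero[of "\<alpha> z"]] C2(1)
    by (simp add: norm_mult abs_mult mult_ac)
   then show "AE z in lborel. cmod (\<alpha> z * dconv f b (x - z)) <= norm (C2 * wt x ^ n2 * (wt z ^ n2 * cmod (\<alpha> z)))"
    by (rule AE_I2)
  qed simp
 qed
 have wmono: "(LBINT z. wt z ^ k * cmod (\<alpha> z)) <= (LBINT z. wt z ^ N * cmod (\<alpha> z))"
  if "good \<alpha>" "k <= N" for \<alpha> k
  using that by (intro integral_mono rapid_integrable_weighted mult_right_mono power_increasing) (auto simp: good_def)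
 have Tbound: "cmod (T \<alpha>) <= K * (LBINT z. wt z ^ N * cmod (\<alpha> z))" if g: "good \<alpha>" for \<alpha>
 proof -
  have "cmod (f (c \<alpha>)) <= A * (C1 * wt x ^ n * (LBINT z. wt z ^ n * cmod (\<alpha> z)))"
  proof (rule A(2)[OF cs[OF g]])
   fix m y assume m: "m <= n"
   show "wt y ^ n * cmod (vderiv m (c \<alpha>) y) <= C1 * wt x ^ n * (LBINT z. wt z ^ n * cmod (\<alpha> z))"
    unfolding c_def using g b C1(2)[OF m] by (intro convolution_schwartz(3)) (auto simp: good_def)
  qed
  also have "... <= A * (C1 * wt x ^ n * (LBINT z. wt z ^ N * cmod (\<alpha> z)))"
   using A(1) C1(1) by (intro mult_left_mono wmono[OF g]) (auto simp: N_def)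
  finally have 1: "cmod (f (c \<alpha>)) <= ..." .
  have "cmod (LBINT z. \<alpha> z * dconv f b (x - z)) <= (LBINT z. cmod (\<alpha> z * dconv f b (x - z)))"
   by (rule integral_norm_bound)
  also have "... <= (LBINT z. C2 * wt x ^ n2 * (wt z ^ n2 * cmod (\<alpha> z)))"
  proof (rule integral_mono)
   show "integrable lborel (%z. C2 * wt x ^ n2 * (wt z ^ n2 * cmod (\<alpha> z)))"
    using g by (intro integrable_mult_right rapid_integrable_weighted) (auto simp: good_def)
   show "cmod (\<alpha> z * dconv f b (x - z)) <= C2 * wt x ^ n2 * (wt z ^ n2 * cmod (\<alpha> z))" for z
    using mult_left_mono[OF growth[of z] norm_ge_zero[of "\<alpha> z"]] by (simp add: norm_mult mult_ac)
  qed (intro integrable_norm int2 g)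
  also have "... <= C2 * wt x ^ n2 * (LBINT z. wt z ^ N * cmod (\<alpha> z))"
   using C2(1) wmono[OF g, of n2] by (auto simp: N_def intro!: mult_left_mono)
  finally have 2: "cmod (LBINT z. \<alpha> z * dconv f b (x - z)) <= ..." .
  have "cmod (T \<alpha>) <= cmod (f (c \<alpha>)) + cmod (LBINT z. \<alpha> z * dconv f b (x - z))"
   unfolding T_def by (rule norm_triangle_ineq4)
  then show ?thesis using 1 2 unfolding K_def by (simp add: algebra_simps)
 qed
 have Tlin: "T (%z. s * \<alpha> z + t * \<beta> z) = s * T \<alpha> + t * T \<beta>" if g: "good \<alpha>" "good \<beta>" for \<alpha> \<beta> s t
 proof -
  have bi: "integrable lborel (%z. \<alpha> z * b (x - z - y))" if "good \<alpha>" for \<alpha> y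
  proof -
   have "rapid (%z. b (x - z - y) * \<alpha> z)"
    using that B0 by (intro rapid_mult_bounded[of _ _ B0]) (auto simp: good_def)
   moreover have "(%z. b (x - z - y) * \<alpha> z) \<in> borel_measurable borel" using that by (auto simp: good_def)
   ultimately have "integrable lborel (%z. b (x - z - y) * \<alpha> z)" by (rule rapid_integrable)
   then show ?thesis by (simp only: mult.commute)
  qed
  have eq1: "c (%z. s * \<alpha> z + t * \<beta> z) = (%y. s * c \<alpha> y + t * c \<beta> y)"
   unfolding c_def using bi[OF g(1)] bi[OF g(2)] by (simp add: distrib_right mult.assoc fun_eq_iff)
  have eq2: "(LBINT z. (s * \<alpha> z + t * \<beta> z) * dconv f b (x - z)) =
    s * (LBINT z. \<alpha> z * dconv f b (x - z)) + t * (LBINT z. \<beta> z * dconv f b (x - z))"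
   using int2[OF g(1)] int2[OF g(2)] by (simp add: distrib_right mult.assoc)
  show ?thesis
   unfolding T_def eq1 eq2 tempered_lincomb[OF tf cs[OF g(1)] cs[OF g(2)], of s t]
   by (simp add: right_diff_distrib)
 qed
 have gia: "good (%z. indicator S z * a z)" if [measurable]: "S \<in> sets borel" for S
  unfolding good_def using a by (auto intro!: rapid_mult_bounded[of _ _ 1] simp: indicator_def)
 have Tind: "\<exists>K1. \<forall>u v. abs u <= R \<longrightarrow> abs v <= R \<longrightarrow> u <= v \<longrightarrow> v - u <= 1 \<longrightarrow>
   cmod (T (%z. indicator {u<..v} z * a z)) <= K1 * (v - u)\<^sup>2" if R: "R >= 0" for R
 proof -
  from dconv_increment[OF tf b] obtain C3 n3 where C3: "C3 >= 0"
   "!!u v. abs (u - v) <= 1 ==> cmod (dconv f b u - dconv f b v) <= C3 * (2 + abs v) ^ n3 * abs (u - v)" by metis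
  from schwartz_increment[OF b, of n] obtain C4 where C4: "C4 >= 0"
   "!!m u v y. m <= n ==> abs (u - v) <= 1 ==>
    wt y ^ n * cmod (vderiv m b (u - y) - vderiv m b (v - y)) <= C4 * (2 + abs v) ^ n * abs (u - v)" by metis
  from rapidD[OF a(2), of 0] obtain Ba where Ba: "Ba >= 0" "!!z. cmod (a z) <= Ba" by auto
  define W where "W k = (2 + (abs x + R)) ^ k" for k :: nat
  have W0: "W k >= 0" for k unfolding W_def using R by simp
  have W: "(2 + abs (x - u)) ^ k <= W k" if "abs u <= R" for u k
   unfolding W_def using that by (intro power_mono) auto
  have "cmod (T (%z. indicator {u<..v} z * a z)) <= (A * (Ba * (C4 * W n)) + Ba * (C3 * W n3)) * (v - u)\<^sup>2"
   if uv: "abs u <= R" "abs v <= R" "u <= v" "v - u <= 1" for u v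
  proof -
   let ?I = "%z. indicator {u<..v} z * a z"
   have gI: "good ?I" by (rule gia) simp
   define J where "J = (LBINT z. ?I z)"
   have I: "integrable lborel ?I" using gI by (intro rapid_integrable) (auto simp: good_def)
   have ru: "schwartz (%y. b (x - u - y))" using schwartz_reflect(1)[OF b, of "x - u"] .
   have Ib: "integrable lborel (%z. ?I z * ((-1) ^ m * vderiv m b (x - z - y)))" for m y
   proof -
    obtain C where C: "!!x. cmod (vderiv m b x) <= C"
     using schwartz_uniform_bound[OF b, of m 0] by (metis order_refl mult_1 power_0)
    note [measurable] = schwartz_measurable[OF b, of m]
    have "integrable lborel (%z. ((-1) ^ m * vderiv m b (x - z - y)) * ?I z)"
    proof (rule rapid_integrable)
     show "rapid (%z. ((-1) ^ m * vderiv m b (x - z - y)) * ?I z)"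
      by (rule rapid_mult_bounded[of ?I _ C]) (use gI C in \<open>simp_all add: good_def norm_mult norm_power\<close>)
    qed (use gI in \<open>auto simp: good_def\<close>)
    then show ?thesis by (simp only: mult.commute)
   qed
   have 1: "cmod (f (c ?I) - J * dconv f b (x - u)) <= A * (Ba * (C4 * W n * (v - u)) * (v - u))"
   proof -
    have "f (c ?I) - J * dconv f b (x - u) = f (%y. 1 * c ?I y + (- J) * b (x - u - y))"
     by (subst tempered_lincomb[OF tf cs[OF gI] ru]) (simp add: dconv_def algebra_simps)
    also have "cmod ... <= A * (Ba * (C4 * W n * (v - u)) * (v - u))"
    proof (rule A(2)[OF schwartz_lincomb[OF cs[OF gI] ru]])
     fix m y assume m: "m <= n"
     let ?d = "%z. (-1) ^ m * (vderiv m b (x - z - y) - vderiv m b (x - u - y))"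
     have w: "wt y ^ n > 0" by (intro zero_less_power) auto
     have "vderiv m (%y. 1 * c ?I y + (- J) * b (x - u - y)) y =
       vderiv m (c ?I) y - J * ((-1) ^ m * vderiv m b (x - u - y))"
      using cs[OF gI] ru by (subst smooth_lincomb(2)) (auto simp: schwartz_iff schwartz_reflect(2)[OF b] left_diff_distrib)
     also have "vderiv m (c ?I) y = (LBINT z. ?I z * ((-1) ^ m * vderiv m b (x - z - y)))"
      unfolding c_def using gI b by (intro convolution_schwartz(2)) (auto simp: good_def)
     also have "... - J * ((-1) ^ m * vderiv m b (x - u - y)) = (LBINT z. indicator {u<..v} z * (a z * ?d z))"
      unfolding J_def integral_mult_left_zero[symmetric]
      by (subst lint_diff[symmetric, OF Ib integrable_mult_left[OF I]])
       (auto simp: algebra_simps intro!: lint_cong)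
     also have "cmod ... <= (Ba * (C4 * W n * (v - u) / wt y ^ n)) * (v - u)"
     proof (rule indicator_integral_bound[OF uv(3)])
      fix z assume z: "u < z" "z <= v"
      have "wt y ^ n * cmod (vderiv m b ((x - z) - y) - vderiv m b ((x - u) - y)) <= C4 * (2 + abs (x - u)) ^ n * abs ((x - z) - (x - u))"
       using z uv by (intro C4(2) m) auto
      also have "... <= C4 * W n * (v - u)"
       using z W[OF uv(1), of n] C4(1) W0 by (intro mult_mono) auto
      finally have "cmod (?d z) <= C4 * W n * (v - u) / wt y ^ n"
       using w by (simp add: pos_le_divide_eq norm_mult norm_power mult.commute)
      then show "cmod (a z * ?d z) <= Ba * (C4 * W n * (v - u) / wt y ^ n)"
       unfolding norm_mult[of "a z"] using Ba by (intro mult_mono) auto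
     qed (use w C4 W0 uv Ba in auto)
     finally show "wt y ^ n * cmod (vderiv m (%y. 1 * c ?I y + (- J) * b (x - u - y)) y)
      <= Ba * (C4 * W n * (v - u)) * (v - u)"
      using w by (simp add: pos_le_divide_eq mult.commute)
    qed
    finally show ?thesis .
   qed
   have 2: "cmod ((LBINT z. ?I z * dconv f b (x - z)) - J * dconv f b (x - u)) <= (Ba * (C3 * W n3 * (v - u))) * (v - u)"
   proof -
    have "(LBINT z. ?I z * dconv f b (x - z)) - J * dconv f b (x - u) =
     (LBINT z. indicator {u<..v} z * (a z * (dconv f b (x - z) - dconv f b (x - u))))"
     unfolding J_def integral_mult_left_zero[symmetric]
     by (subst lint_diff[symmetric, OF int2[OF gI] integrable_mult_left[OF I]])
      (auto simp: algebra_simps intro!: lint_cong)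
    also have "cmod ... <= (Ba * (C3 * W n3 * (v - u))) * (v - u)"
    proof (rule indicator_integral_bound[OF uv(3)])
     fix z assume z: "u < z" "z <= v"
     have "cmod (dconv f b (x - z) - dconv f b (x - u)) <= C3 * (2 + abs (x - u)) ^ n3 * abs ((x - z) - (x - u))"
      using z uv by (intro C3(2)) auto
     also have "... <= C3 * W n3 * (v - u)"
      using z W[OF uv(1), of n3] C3(1) W0 by (intro mult_mono) auto
     finally show "cmod (a z * (dconv f b (x - z) - dconv f b (x - u))) <= Ba * (C3 * W n3 * (v - u))"
      unfolding norm_mult using Ba by (intro mult_mono) auto
    qed (use C3 W0 uv Ba in auto)
    finally show ?thesis .
   qed
   have "T ?I = (f (c ?I) - J * dconv f b (x - u)) - ((LBINT z. ?I z * dconv f b (x - z)) - J * dconv f b (x - u))"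
    by (simp add: T_def)
   then have "cmod (T ?I) <= A * (Ba * (C4 * W n * (v - u)) * (v - u)) + (Ba * (C3 * W n3 * (v - u))) * (v - u)"
    using 1 2 norm_triangle_ineq4 by (smt (verit))
   then show ?thesis by (simp add: algebra_simps power2_eq_square)
  qed
  then show ?thesis by blast
 qed
 have small: "\<exists>d>0. \<forall>u v. abs (u - t) < d \<longrightarrow> abs (v - t) < d \<longrightarrow> u <= v \<longrightarrow>
   cmod (T (%z. indicator {u<..v} z * a z)) <= e * (v - u)" if e: "e > 0" for e t
 proof -
  obtain K1 where K1: "!!u v. abs u <= abs t + 1 ==> abs v <= abs t + 1 ==> u <= v ==> v - u <= 1 ==>
   cmod (T (%z. indicator {u<..v} z * a z)) <= K1 * (v - u)\<^sup>2" using Tind[of "abs t + 1"] by auto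
  define d where "d = min (1 / 2) (e / (2 * wt K1))"
  have d: "d > 0" "d <= 1 / 2" "d <= e / (2 * wt K1)"
   unfolding d_def using e by (simp_all only: min.cobounded1 min.cobounded2 min_less_iff_conj) (simp add: add_pos_nonneg)
  have "cmod (T (%z. indicator {u<..v} z * a z)) <= e * (v - u)"
   if uv: "abs (u - t) < d" "abs (v - t) < d" "u <= v" for u v
  proof -
   have "cmod (T (%z. indicator {u<..v} z * a z)) <= K1 * (v - u)\<^sup>2" using uv d by (intro K1) auto
   also have "... <= (wt K1 * (v - u)) * (v - u)"
    unfolding power2_eq_square mult.assoc using uv by (intro mult_right_mono) auto
   also have "... <= e * (v - u)"
   proof (rule mult_right_mono)
    have "wt K1 * (v - u) <= wt K1 * (2 * (e / (2 * wt K1)))"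
     using uv d(3) by (intro mult_left_mono) auto
    also have "... = e"
    proof -
     have "D * (2 * (e / (2 * D))) = e" if "D > 0" for D :: real using that by simp
     then show ?thesis by (simp only: abs_ge_zero add_pos_nonneg zero_less_one)
    qed
    finally show "wt K1 * (v - u) <= e" .
   qed (use uv in simp)
   finally show ?thesis .
  qed
  then show ?thesis using d(1) by blast
 qed
  \<comment> \<open>The density is cut off to the left half-line ending at \<open>t\<close>.\<close>
 define \<Theta> where "\<Theta> t = T (%z. indicator {..t} z * a z)" for t
 have diff: "\<Theta> v - \<Theta> u = T (%z. indicator {u<..v} z * a z)" if "u <= v" for u v
 proof -
  have "T (%z. 1 * (indicator {..u} z * a z) + 1 * (indicator {u<..v} z * a z)) = 1 * \<Theta> u + 1 * T (%z. indicator {u<..v} z * a z)"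
   unfolding \<Theta>_def by (intro Tlin gia) auto
  moreover have "(%z. 1 * (indicator {..u} z * a z) + 1 * (indicator {u<..v} z * a z)) = (%z. indicator {..v} z * a z)"
   using that by (auto simp: fun_eq_iff indicator_def)
  ultimately show ?thesis by (simp add: \<Theta>_def)
 qed
 have "(\<Theta> has_derivative (%h. 0)) (at t within UNIV)" for t
  unfolding has_derivative_within_alt
 proof (intro conjI allI impI)
  fix e :: real assume "e > 0"
  from small[OF this, of t] obtain d where d: "d > 0" "!!u v. abs (u - t) < d ==> abs (v - t) < d ==> u <= v ==>
   cmod (T (%z. indicator {u<..v} z * a z)) <= e * (v - u)" by blast
  have "norm (\<Theta> y - \<Theta> t - 0) <= e * norm (y - t)" if "norm (y - t) < d" for y
   using d(2)[of y t] d(2)[of t y] diff[of y t] diff[of t y] that d(1)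
   by (cases "y <= t") (auto simp: norm_minus_commute abs_if split: if_splits)
  then show "\<exists>d>0. \<forall>y\<in>UNIV. norm (y - t) < d \<longrightarrow> norm (\<Theta> y - \<Theta> t - 0) <= e * norm (y - t)"
   using d(1) by blast
 qed simp
 from has_derivative_zero_constant[OF convex_UNIV this] obtain L where L: "!!t. \<Theta> t = L" by blast
 have "(%i. \<Theta> (- real i)) \<longlonglongrightarrow> 0"
 proof (rule Lim_null_comparison)
  show "\<forall>\<^sub>F i in sequentially. norm (\<Theta> (- real i)) <= K * (LBINT z. wt z ^ N * cmod (indicator {..- real i} z * a z))"
   unfolding \<Theta>_def by (intro always_eventually allI Tbound gia) auto
  show "(%i. K * (LBINT z. wt z ^ N * cmod (indicator {..- real i} z * a z))) \<longlonglongrightarrow> 0"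
   using tendsto_mult_left[OF rapid_tail_integrals(1)[OF a(2) am, of N], of K] by simp
 qed
 then have L0: "L = 0" unfolding L by (simp add: LIMSEQ_const_iff)
 have "(%i. T a) \<longlonglongrightarrow> 0"
 proof (rule Lim_null_comparison)
  have Ta: "T a = T (%z. indicator {real i<..} z * a z)" for i
  proof -
   have "T (%z. 1 * (indicator {..real i} z * a z) + 1 * (indicator {real i<..} z * a z)) = 1 * \<Theta> (real i) + 1 * T (%z. indicator {real i<..} z * a z)"
    unfolding \<Theta>_def by (intro Tlin gia) auto
   moreover have "(%z. 1 * (indicator {..real i} z * a z) + 1 * (indicator {real i<..} z * a z)) = a"
    by (auto simp: fun_eq_iff indicator_def)
   ultimately show ?thesis using L L0 by simp
  qed
  have "cmod (T (%z. indicator {real i<..} z * a z)) <= K * (LBINT z. wt z ^ N * cmod (indicator {real i<..} z * a z))" for i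
   by (rule Tbound[OF gia]) simp
  then show "\<forall>\<^sub>F i in sequentially. norm (T a) <= K * (LBINT z. wt z ^ N * cmod (indicator {real i<..} z * a z))"
   by (intro always_eventually allI) (simp only: Ta[symmetric])
  show "(%i. K * (LBINT z. wt z ^ N * cmod (indicator {real i<..} z * a z))) \<longlonglongrightarrow> 0"
   using tendsto_mult_left[OF rapid_tail_integrals(2)[OF a(2) am, of N], of K] by simp
 qed
 then have "T a = 0" by (simp add: LIMSEQ_const_iff)
 then show ?thesis by (simp add: T_def c_def[abs_def])
qed

section \<open>Frequency localised pieces of a distribution\<close>

lemma dconv_convolution:
 assumes "tempered_distribution f" "schwartz a" "schwartz b"
  and "!!w. (LBINT z. a z * b (w - z)) = c w"
 shows "dconv f c x = (LBINT z. a z * dconv f b (x - z))"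
proof -
 have a: "continuous_on UNIV a" "rapid a"
  using schwartz_continuous[OF assms(2), of 0] assms(2) unfolding schwartz_iff by (auto dest: spec[of _ 0])
 have "(%y. c (x - y)) = (%y. LBINT z. a z * b (x - z - y))"
  unfolding assms(4)[symmetric] by (simp add: algebra_simps)
 then show ?thesis
  using weak_convolution[OF assms(1) a assms(3), of x] unfolding dconv_def by simp
qed

lemma lp_block_eq_dconv: "lp_block \<phi> j f = dconv f (lp_kernel \<phi> j)"
 by (simp add: fun_eq_iff lp_block_def dconv_def)

lemma dconv_diff:
 assumes "tempered_distribution f" "schwartz a" "schwartz b"
 shows "dconv f (%x. a x - b x) x = dconv f a x - dconv f b x"
 using tempered_lincomb[OF assms(1) schwartz_reflect(1)[OF assms(2)] schwartz_reflect(1)[OF assms(3)], of 1 x "-1" x]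
 by (simp add: dconv_def)

lemma dconv_low_eq_sum:
 assumes "tempered_distribution f" "lp_generator \<phi>"
 shows "dconv f (low \<phi> N) x = (\<Sum>j\<le>N. lp_block \<phi> j f x)"
proof (induction N)
 case 0
 then show ?case by (simp add: lp_block_eq_dconv lp_kernel_0)
next
 case (Suc N)
 have "dconv f (low \<phi> (Suc N)) x = dconv f (low \<phi> N) x + lp_block \<phi> (Suc N) f x"
  unfolding lp_block_eq_dconv lp_kernel_Suc[OF assms(2)]
  using dconv_diff[OF assms(1) schwartz_low[OF assms(2)] schwartz_low[OF assms(2)]] by simp
 then show ?case using Suc by simp
qed

lemma schwartz_mult_integrable:
 assumes "schwartz a" "schwartz b"
 shows "integrable lborel (%z. a z * b (w - z))"
proof -
 note [measurable] = schwartz_measurable[OF assms(1), of 0, simplified] schwartz_measurable[OF assms(2), of 0, simplified]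
 from schwartz_uniform_bound[OF assms(2), of 0 0] obtain B where B: "!!x. cmod (b x) <= B"
  by (metis le_refl mult_1 power_0 vderiv_0)
 have "rapid a" using assms(1) unfolding schwartz_iff by (auto dest: spec[of _ 0])
 then have "rapid (%z. b (w - z) * a z)" by (rule rapid_mult_bounded) (rule B)
 then have "integrable lborel (%z. b (w - z) * a z)" by (rule rapid_integrable) measurable
 then show ?thesis by (simp only: mult.commute)
qed

lemma low_convolution_lp_kernel:
 assumes "lp_generator \<phi>"
 shows "j < m ==> (LBINT z. low \<phi> m z * lp_kernel \<phi> j (w - z)) = lp_kernel \<phi> j w"
  and "m + 2 <= j ==> (LBINT z. low \<phi> m z * lp_kernel \<phi> j (w - z)) = 0"
  and "j < m ==> (LBINT z. lp_kernel \<phi> j z * low \<phi> m (w - z)) = lp_kernel \<phi> j w"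
proof -
 note l = schwartz_low[OF assms] and c = low_convolution[OF assms]
 note i = schwartz_mult_integrable[OF l l]
 have s: "(LBINT z. low \<phi> m z * lp_kernel \<phi> (Suc i) (w - z)) =
   low \<phi> (min m (Suc i)) w - low \<phi> (min m i) w" if "m \<noteq> i" "m \<noteq> Suc i" for i
  unfolding lp_kernel_Suc[OF assms] right_diff_distrib
  using that i[of m "Suc i" w] i[of m i w] by (subst lint_diff) (auto simp: c)
 have s': "(LBINT z. lp_kernel \<phi> (Suc i) z * low \<phi> m (w - z)) =
   low \<phi> (min (Suc i) m) w - low \<phi> (min i m) w" if "m \<noteq> i" "m \<noteq> Suc i" for i
  unfolding lp_kernel_Suc[OF assms] left_diff_distrib
  using that i[of "Suc i" m w] i[of i m w] by (subst lint_diff) (auto simp: c)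
 show "j < m ==> (LBINT z. low \<phi> m z * lp_kernel \<phi> j (w - z)) = lp_kernel \<phi> j w"
  using s c by (cases j) (auto simp: lp_kernel_0 lp_kernel_Suc[OF assms] min_def)
 show "m + 2 <= j ==> (LBINT z. low \<phi> m z * lp_kernel \<phi> j (w - z)) = 0"
  using s[of "j - 1"] by (cases j) (auto simp: min_def)
 show "j < m ==> (LBINT z. lp_kernel \<phi> j z * low \<phi> m (w - z)) = lp_kernel \<phi> j w"
  using s' c by (cases j) (auto simp: lp_kernel_0 lp_kernel_Suc[OF assms] min_def)
qed

text \<open>Blocks do not see a low-pass filter of higher frequency, and conversely a block can be computed from any sufficiently long partial sum.\<close>

lemma lp_block_reproducing:
 assumes "tempered_distribution f" "lp_generator \<phi>" "j < m"
 shows "(LBINT z. low \<phi> m z * lp_block \<phi> j f (x - z)) = lp_block \<phi> j f x"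
  and "(LBINT z. lp_kernel \<phi> j z * dconv f (low \<phi> m) (x - z)) = lp_block \<phi> j f x"
 unfolding lp_block_eq_dconv
  apply (rule dconv_convolution[OF assms(1) schwartz_low[OF assms(2)] schwartz_lp_kernel[OF assms(2)]
   low_convolution_lp_kernel(1)[OF assms(2,3)], symmetric])
 apply (rule dconv_convolution[OF assms(1) schwartz_lp_kernel[OF assms(2)] schwartz_low[OF assms(2)]
   low_convolution_lp_kernel(3)[OF assms(2,3)], symmetric])
 done

lemma tempered_0: "tempered_distribution f ==> f (%x. 0) = 0"
proof -
 assume "tempered_distribution f"
 moreover have "test_function (%x. 0)"
  using smooth_lincomb(1)[OF smooth_ident smooth_ident, of 0 0]
  by (simp add: test_function_iff compactly_supported_def)
 ultimately show ?thesis using tempered_lincomb[of f "%x. 0" "%x. 0" 0 0] test_function_schwartz[of "%x. 0"] by simp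
qed

text \<open>A block at high frequency has no low-frequency part, since the supports of the symbols are disjoint.\<close>

lemma lp_block_annihilated:
 assumes "tempered_distribution f" "lp_generator \<phi>" "m + 2 <= j"
 shows "(LBINT z. low \<phi> m z * lp_block \<phi> j f (x - z)) = 0"
 unfolding lp_block_eq_dconv
 using dconv_convolution[OF assms(1) schwartz_low[OF assms(2)] schwartz_lp_kernel[OF assms(2)]
   low_convolution_lp_kernel(2)[OF assms(2,3)]] tempered_0[OF assms(1)] by (simp add: dconv_def)

lemma low_moment_bound:
 assumes "lp_generator \<phi>"
 shows "(LBINT z. cmod (low \<phi> J z) * (abs z * wt z ^ n))
  <= (1 / 2 ^ J) * (LBINT z. wt z ^ Suc n * cmod (low \<phi> 0 z))"
  and "integrable lborel (%z. cmod (low \<phi> J z) * (abs z * wt z ^ n))"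
proof -
 note l = schwartz_low[OF assms]
 have rm: "rapid (low \<phi> J)" "low \<phi> J \<in> borel_measurable borel" for J
  using l[of J] schwartz_measurable[OF l, of 0 J] unfolding schwartz_iff by (auto dest: spec[of _ 0])
 note [measurable] = rm(2)
 show int: "integrable lborel (%z. cmod (low \<phi> J z) * (abs z * wt z ^ n))" for J
  by (rule lint_bound[OF rapid_integrable_weighted[OF rm, of "Suc n" J]])
   (auto simp: abs_mult mult.commute intro!: mult_right_mono mult_left_mono AE_I2)
 have "(LBINT z. cmod (low \<phi> J z) * (abs z * wt z ^ n)) =
   (1 / 2 ^ J) *\<^sub>R (LBINT z. cmod (low \<phi> J (0 + (1 / 2 ^ J) * z)) * (abs (0 + (1 / 2 ^ J) * z) * wt (0 + (1 / 2 ^ J) * z) ^ n))"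
  by (subst lborel_integral_real_affine[where c = "1 / 2 ^ J" and t = 0]) auto
 also have "... = (LBINT z. (1 / 2 ^ J) * (cmod (low \<phi> J (0 + (1 / 2 ^ J) * z)) * (abs (0 + (1 / 2 ^ J) * z) * wt (0 + (1 / 2 ^ J) * z) ^ n)))"
  by simp
 also have "... <= (LBINT z. (1 / 2 ^ J) * (wt z ^ Suc n * cmod (low \<phi> 0 z)))"
 proof (rule integral_mono)
  have "integrable lborel (%z. cmod (low \<phi> J (0 + (1 / 2 ^ J) * z)) * (abs (0 + (1 / 2 ^ J) * z) * wt (0 + (1 / 2 ^ J) * z) ^ n))"
   using lborel_integrable_real_affine[OF int[of J], of "1 / 2 ^ J" 0] by simp
  then show "integrable lborel (%z. (1 / 2 ^ J) * (cmod (low \<phi> J (0 + (1 / 2 ^ J) * z)) * (abs (0 + (1 / 2 ^ J) * z) * wt (0 + (1 / 2 ^ J) * z) ^ n)))"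
   by (rule integrable_mult_right)
  show "integrable lborel (%z. (1 / 2 ^ J) * (wt z ^ Suc n * cmod (low \<phi> 0 z)))"
   by (intro integrable_mult_right rapid_integrable_weighted rm)
  fix z :: real
  let ?w = "(1 / 2 ^ J) * z"
  have w: "abs (?w) * 2 ^ J = abs z" by (simp add: abs_mult)
  have "abs (?w) * 1 <= abs (?w) * 2 ^ J" by (intro mult_left_mono) auto
  then have wz: "abs (?w) <= abs z" using w by simp
  have "cmod (low \<phi> J ?w) = 2 ^ J * cmod (low \<phi> 0 z)"
   by (subst low_scale) (simp add: norm_mult norm_power)
  then have "cmod (low \<phi> J ?w) * (abs (?w) * wt (?w) ^ n) = (abs (?w) * 2 ^ J) * wt (?w) ^ n * cmod (low \<phi> 0 z)"
   by simp
  also have "... <= wt z * wt z ^ n * cmod (low \<phi> 0 z)"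
   unfolding w using wz by (intro mult_right_mono mult_mono power_mono) auto
  finally show "(1 / 2 ^ J) * (cmod (low \<phi> J (0 + ?w)) * (abs (0 + ?w) * wt (0 + ?w) ^ n)) <= (1 / 2 ^ J) * (wt z ^ Suc n * cmod (low \<phi> 0 z))"
   by (intro mult_left_mono) auto
 qed
 finally show "(LBINT z. cmod (low \<phi> J z) * (abs z * wt z ^ n))
  <= (1 / 2 ^ J) * (LBINT z. wt z ^ Suc n * cmod (low \<phi> 0 z))" by simp
qed

text \<open>The Littlewood-Paley decomposition converges weakly to the distribution. By interchanging, the pairing becomes \<open>f\<close> applied to a mollified test function, and the first moment of the kernel of width \<open>2^-J\<close> bounds every seminorm of the error by a multiple of \<open>2^-J\<close>.\<close>

lemma calderon_reproducing:
 assumes tf: "tempered_distribution f" and lp: "lp_generator \<phi>" and \<eta>: "test_function \<eta>"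
 shows "(%J. LBINT x. \<eta> x * dconv f (low \<phi> J) x) \<longlonglongrightarrow> f \<eta>"
proof -
 note s\<eta> = test_function_schwartz[OF \<eta>] and l = schwartz_low[OF lp]
 have \<eta>r: "test_function (%z. \<eta> (- z))" using test_function_affine[OF \<eta>, of "-1" 0] by simp
 note s\<eta>r = test_function_schwartz[OF \<eta>r]
 have \<eta>c: "continuous_on UNIV (%z. \<eta> (- z))" "rapid (%z. \<eta> (- z))"
  using s\<eta>r schwartz_continuous[OF s\<eta>r, of 0] unfolding schwartz_iff by (auto dest: spec[of _ 0])
 have vr: "vderiv m (%z. \<eta> (- z)) = (%z. (-1) ^ m * vderiv m \<eta> (- z))" for m
  using schwartz_reflect(2)[OF s\<eta>, of m 0] by simp
 define c where "c J y = (LBINT z. low \<phi> J z * \<eta> (- (0 - z - y)))" for J y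
 have rm: "rapid (low \<phi> J)" "low \<phi> J \<in> borel_measurable borel" for J
  using l[of J] schwartz_measurable[OF l, of 0 J] unfolding schwartz_iff by (auto dest: spec[of _ 0])
 have il: "integrable lborel (low \<phi> J)" for J by (rule rapid_integrable[OF rm])
 have cs: "schwartz (c J)" for J unfolding c_def using convolution_schwartz(1)[OF rm s\<eta>r] .
 have cv: "vderiv m (c J) y = (LBINT z. low \<phi> J z * vderiv m \<eta> (y + z))" for m J y
  unfolding c_def convolution_schwartz(2)[OF rm s\<eta>r] vr
  by (intro lint_cong refl) (simp flip: power_mult_distrib mult.assoc add: add.commute)
 have pair: "(LBINT x. \<eta> x * dconv f (low \<phi> J) x) = f (c J)" for J
 proof -
  have "c J = (%y. LBINT z. \<eta> (- z) * low \<phi> J (0 - z - y))"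
  proof
   fix y
   have "c J y = (LBINT z. low \<phi> J (- y + (-1) * z) * \<eta> (- (0 - (- y + (-1) * z) - y)))"
    unfolding c_def by (subst lborel_integral_real_affine[where c = "-1" and t = "-y"]) auto
   then show "c J y = (LBINT z. \<eta> (- z) * low \<phi> J (0 - z - y))" by (simp add: algebra_simps)
  qed
  then have "f (c J) = (LBINT z. \<eta> (- z) * dconv f (low \<phi> J) (0 - z))"
   using weak_convolution[OF tf \<eta>c l[of J], of 0] by simp
  also have "... = (LBINT x. \<eta> x * dconv f (low \<phi> J) x)"
   by (subst lborel_integral_real_affine[where c = "-1" and t = 0]) auto
  finally show ?thesis by simp
 qed
 from tempered_bound[OF tf] obtain A n where A: "A >= 0"
  "!!g c. schwartz g ==> (!!m y. m <= n ==> (wt y) ^ n * cmod (vderiv m g y) <= c) ==> cmod (f g) <= A * c"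
  by metis
 from schwartz_uniform_bound[OF s\<eta>, of "Suc n" n] obtain C where C: "C >= 0"
  "!!m x. m <= Suc n ==> (wt x) ^ n * cmod (vderiv m \<eta> x) <= C" by metis
 define M where "M = (LBINT z. wt z ^ Suc n * cmod (low \<phi> 0 z))"
 have bound: "cmod (f (c J) - f \<eta>) <= A * (C * ((1 / 2 ^ J) * M))" for J
 proof -
  have "f (c J) - f \<eta> = f (%y. 1 * c J y + (-1) * \<eta> y)"
   using tempered_lincomb[OF tf cs s\<eta>, of 1 J "-1"] by simp
  also have "cmod ... <= A * (C * ((1 / 2 ^ J) * M))"
  proof (rule A(2)[OF schwartz_lincomb[OF cs s\<eta>]])
   fix m and y :: real assume m: "m <= n"
   let ?w = "wt y ^ n"
   have w: "?w > 0" by (intro zero_less_power) auto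
   have inc: "?w * cmod (vderiv m \<eta> (y + z) - vderiv m \<eta> y) <= C * (abs z * wt z ^ n)" for z
   proof -
    have "cmod (vderiv m \<eta> (y + z) - vderiv m \<eta> y) <= C * wt z ^ n / ?w * abs ((y + z) - y)"
    proof (rule mvt_norm_bound)
     show "(vderiv m \<eta> has_vector_derivative vderiv (Suc m) \<eta> t) (at t)" for t
      using s\<eta> smooth_has_vderiv schwartz_iff by blast
     fix t assume "t \<in> closed_segment y (y + z)"
     then have t: "abs (t - y) <= abs z" by (auto simp: closed_segment_eq_real_ivl split: if_splits)
     have "?w * cmod (vderiv (Suc m) \<eta> t) <= (wt (t - y) ^ n * wt t ^ n) * cmod (vderiv (Suc m) \<eta> t)"
      by (intro mult_right_mono weight_power_shift) auto
     also have "... = wt (t - y) ^ n * (wt t ^ n * cmod (vderiv (Suc m) \<eta> t))" by simp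
     also have "... <= wt z ^ n * C"
      using t C m by (intro mult_mono power_mono) auto
     finally show "cmod (vderiv (Suc m) \<eta> t) <= C * wt z ^ n / ?w"
      using w by (simp add: pos_le_divide_eq mult.commute)
    qed
    then have "?w * cmod (vderiv m \<eta> (y + z) - vderiv m \<eta> y) <= ?w * (C * wt z ^ n / ?w * abs z)"
     using w by (intro mult_left_mono) auto
    also have "... = C * (abs z * wt z ^ n)" using w less_imp_neq[OF w] by auto
    finally show ?thesis .
   qed
   have i1: "integrable lborel (%z. low \<phi> J z * vderiv m \<eta> (y + z))"
   proof -
    have "integrable lborel (%z. low \<phi> J z * ((-1) ^ m * vderiv m \<eta> (y + z)))"
     using schwartz_mult_integrable[OF l schwartz_vderiv[OF s\<eta>r], of J m "-y"]
     unfolding vr by (simp add: add.commute)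
    then have "integrable lborel (%z. (-1) ^ m * (low \<phi> J z * ((-1) ^ m * vderiv m \<eta> (y + z))))"
     by (rule integrable_mult_right)
    moreover have "(-1) ^ m * (low \<phi> J z * ((-1) ^ m * vderiv m \<eta> (y + z))) = low \<phi> J z * vderiv m \<eta> (y + z)" for z
     by (cases "even m") auto
    ultimately show ?thesis by simp
   qed
   have "vderiv m (%y. 1 * c J y + (-1) * \<eta> y) y = vderiv m (c J) y - vderiv m \<eta> y"
    using cs s\<eta> by (subst smooth_lincomb(2)) (auto simp: schwartz_iff)
   also have "... = (LBINT z. low \<phi> J z * vderiv m \<eta> (y + z)) - (LBINT z. low \<phi> J z * vderiv m \<eta> y)"
    unfolding cv using integral_low[OF lp] by simp
   also have "... = (LBINT z. low \<phi> J z * (vderiv m \<eta> (y + z) - vderiv m \<eta> y))"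
    unfolding right_diff_distrib
    by (rule lint_diff[symmetric]) (use i1 il in auto)
   finally have eq: "vderiv m (%y. 1 * c J y + (-1) * \<eta> y) y = ..." .
   have "?w * cmod ... <= ?w * (LBINT z. cmod (low \<phi> J z * (vderiv m \<eta> (y + z) - vderiv m \<eta> y)))"
    using w by (intro mult_left_mono integral_norm_bound) auto
   also have "... = (LBINT z. ?w * cmod (low \<phi> J z * (vderiv m \<eta> (y + z) - vderiv m \<eta> y)))" by simp
   also have "... <= (LBINT z. C * (cmod (low \<phi> J z) * (abs z * wt z ^ n)))"
   proof (rule integral_mono)
    show "integrable lborel (%z. ?w * cmod (low \<phi> J z * (vderiv m \<eta> (y + z) - vderiv m \<eta> y)))"
     unfolding right_diff_distrib
     by (intro integrable_mult_right integrable_norm Bochner_Integration.integrable_diff i1 integrable_mult_left il)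
    show "integrable lborel (%z. C * (cmod (low \<phi> J z) * (abs z * wt z ^ n)))"
     by (intro integrable_mult_right low_moment_bound(2) lp)
    show "?w * cmod (low \<phi> J z * (vderiv m \<eta> (y + z) - vderiv m \<eta> y)) <= C * (cmod (low \<phi> J z) * (abs z * wt z ^ n))" for z
     using mult_left_mono[OF inc[of z] norm_ge_zero[of "low \<phi> J z"]] by (simp add: norm_mult mult_ac)
   qed
   also have "... <= C * ((1 / 2 ^ J) * M)"
    unfolding M_def using mult_left_mono[OF low_moment_bound(1)[OF lp, of J n] C(1)] by simp
   finally show "?w * cmod (vderiv m (%y. 1 * c J y + (-1) * \<eta> y) y) <= C * ((1 / 2 ^ J) * M)"
    unfolding eq .
  qed
  finally show ?thesis .
 qed
 have "(%J. f (c J) - f \<eta>) \<longlonglongrightarrow> 0"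
 proof (rule Lim_null_comparison)
  show "\<forall>\<^sub>F J in sequentially. norm (f (c J) - f \<eta>) <= (A * C * M) * (1 / 2) ^ J"
   using bound by (intro always_eventually allI) (simp add: power_divide mult_ac)
  show "(%J. (A * C * M) * (1 / 2) ^ J) \<longlonglongrightarrow> 0"
   by (intro tendsto_mult_right_zero LIMSEQ_realpow_zero) auto
 qed
 then show ?thesis unfolding pair by (simp add: LIM_zero_iff)
qed

section \<open>Quantitative decay\<close>

lemma rapid_decay:
 assumes "rapid g"
 obtains A :: "nat => real" where "!!m. A m >= 0" "!!m x. cmod (g x) <= A m / wt x ^ m"
proof -
 have "\<forall>m. \<exists>C. C >= 0 \<and> (\<forall>x. cmod (g x) <= C / wt x ^ m)"
 proof
  fix m
  show "\<exists>C. C >= 0 \<and> (\<forall>x. cmod (g x) <= C / wt x ^ m)"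
   by (rule rapidD[OF assms, of m]) (intro exI conjI allI, assumption, simp)
 qed
 from choice[OF this] show ?thesis using that by blast
qed

lemma schwartz_rapid: "schwartz g ==> rapid g"
 unfolding schwartz_iff by (auto dest: spec[of _ 0])

lemma schwartz_borel: "schwartz g ==> g \<in> borel_measurable borel"
 using schwartz_measurable[of g 0] by simp

lemma inverse_weight_shift:
 "1 / wt y ^ m <= wt (x - y) ^ m / wt x ^ m"
proof -
 have "wt x ^ m <= wt (y - x) ^ m * wt y ^ m" by (rule weight_power_shift)
 moreover have "wt x ^ m > 0" "wt y ^ m > 0" by (auto intro!: zero_less_power)
 ultimately show ?thesis by (simp add: divide_simps abs_minus_commute)
qed

lemma schwartz_increment_decay:
 assumes "schwartz g"
 obtains A :: "nat => real" where "!!m. A m >= 0"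
  "!!m x h. abs h <= 1 ==> cmod (g (x + h) - g x) <= A m * abs h / wt x ^ m"
proof -
 have "rapid (vderiv 1 g)" using assms schwartz_iff by blast
 from rapid_decay[OF this] obtain D :: "nat => real" where D: "!!m. D m >= 0"
  "!!m x. cmod (vderiv 1 g x) <= D m / wt x ^ m" by metis
 have "cmod (g (x + h) - g x) <= (2 ^ m * D m) * abs h / wt x ^ m" if h: "abs h <= 1" for m x h
 proof -
  have "cmod (g (x + h) - g x) <= (2 ^ m * D m / wt x ^ m) * abs ((x + h) - x)"
  proof (rule mvt_norm_bound)
   show "(g has_vector_derivative vderiv 1 g t) (at t)" for t
    using assms smooth_has_vderiv[of g 0] schwartz_iff by simp
   fix t assume "t \<in> closed_segment x (x + h)"
   then have t: "abs (x - t) <= 1" using h by (auto simp: closed_segment_eq_real_ivl split: if_splits)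
   have "cmod (vderiv 1 g t) <= D m * (1 / wt t ^ m)" using D(2)[of t m] by simp
   also have "... <= D m * (wt (x - t) ^ m / wt x ^ m)"
    by (intro mult_left_mono inverse_weight_shift D)
   also have "... <= D m * (2 ^ m / wt x ^ m)"
    using t by (intro mult_left_mono divide_right_mono power_mono D) auto
   finally show "cmod (vderiv 1 g t) <= 2 ^ m * D m / wt x ^ m" by (simp add: mult.commute)
  qed
  then show ?thesis by (simp add: mult.commute)
 qed
 then show ?thesis using that[of "%m. 2 ^ m * D m"] D(1) by simp
qed

definition primitive :: "(real => complex) => real => complex" where
 "primitive g x = (LBINT z. indicator {..x} z * g z)"

lemma integrable_indicator_mult:
 fixes g :: "real => complex"
 assumes "integrable lborel g" "S \<in> sets borel"
 shows "integrable lborel (%z. indicator S z * g z)"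
 by (rule lint_bound[OF assms(1)])
  (use assms in \<open>auto simp: indicator_def intro!: AE_I2\<close>)

lemma primitive_diff:
 assumes "integrable lborel g" "a <= b"
 shows "primitive g b - primitive g a = (LBINT z. indicator {a<..b} z * g z)"
 unfolding primitive_def
 by (subst lint_diff[symmetric])
  (use assms in \<open>auto intro!: integrable_indicator_mult lint_cong split: split_indicator\<close>)

text \<open>Since the total integral is zero, the primitive can be computed from either end, and each end is a tail of a rapidly decreasing function.\<close>

lemma rapid_primitive:
 assumes "rapid g" "g \<in> borel_measurable borel" "(LBINT z. g z) = 0"
 shows "rapid (primitive g)"
 unfolding rapid_def
proof
 fix m
 let ?I = "\<integral>z. wt z ^ m * cmod (g z) \<partial>lborel"
 have ig: "integrable lborel g" by (rule rapid_integrable[OF assms(1,2)])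
 have *: "wt x ^ m * cmod (LBINT z. indicator S z * g z) <= ?I"
  if S: "S \<in> sets borel" "!!z. z \<in> S ==> abs x <= abs z" for x :: real and S
 proof -
  have "wt x ^ m * cmod (LBINT z. indicator S z * g z) <= wt x ^ m * (LBINT z. cmod (indicator S z * g z))"
   by (intro mult_left_mono integral_norm_bound) auto
  also have "... = (LBINT z. wt x ^ m * cmod (indicator S z * g z))" by simp
  also have "... <= ?I"
  proof (rule integral_mono)
   show "integrable lborel (%z. wt x ^ m * cmod (indicator S z * g z))"
    by (intro integrable_mult_right integrable_norm integrable_indicator_mult ig S)
   show "integrable lborel (%z. wt z ^ m * cmod (g z))" by (rule rapid_integrable_weighted[OF assms(1,2)])
   show "wt x ^ m * cmod (indicator S z * g z) <= wt z ^ m * cmod (g z)" for z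
    using S(2)[of z] by (cases "z \<in> S") (auto intro!: mult_right_mono power_mono)
  qed
  finally show ?thesis .
 qed
 have "wt x ^ m * cmod (primitive g x) <= ?I" for x
 proof (cases "x <= 0")
  case True
  then show ?thesis unfolding primitive_def by (intro *) auto
 next
  case False
  have "primitive g x + (LBINT z. indicator {x<..} z * g z) = (LBINT z. g z)"
   unfolding primitive_def
   by (subst Bochner_Integration.integral_add[symmetric])
    (use ig in \<open>auto intro!: integrable_indicator_mult lint_cong split: split_indicator\<close>)
  then have "primitive g x = - (LBINT z. indicator {x<..} z * g z)" using assms(3) by (simp add: add_eq_0_iff2)
  moreover have "wt x ^ m * cmod (LBINT z. indicator {x<..} z * g z) <= ?I"
   using False by (intro *) auto
  ultimately show ?thesis by simp
 qed
 then show "\<exists>C. \<forall>x. wt x ^ m * cmod (primitive g x) <= C" by blast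
qed

lemma continuous_primitive:
 assumes "integrable lborel g" "!!z. cmod (g z) <= B"
 shows "continuous_on UNIV (primitive g)"
proof -
 have B: "B >= 0" using assms(2)[of 0] norm_ge_zero[of "g 0"] by linarith
 have lip: "cmod (primitive g b - primitive g a) <= B * abs (b - a)" for a b
 proof (cases "a <= b")
  case True
  then show ?thesis using primitive_diff[OF assms(1) True] indicator_integral_bound[OF True B, of g] assms(2) by simp
 next
  case False
  then have ba: "b <= a" by simp
  show ?thesis using primitive_diff[OF assms(1) ba] indicator_integral_bound[OF ba B, of g] assms(2)
   using ba by (simp add: norm_minus_commute)
 qed
 have "(primitive g \<longlongrightarrow> primitive g a) (at a)" for a
 proof (rule LIM_zero_cancel, rule Lim_null_comparison)
  show "\<forall>\<^sub>F b in at a. norm (primitive g b - primitive g a) <= B * abs (b - a)" using lip by simp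
  show "((%b. B * abs (b - a)) \<longlongrightarrow> 0) (at a)" by (auto intro!: tendsto_eq_intros)
 qed
 then show ?thesis by (simp add: continuous_on_eq_continuous_at isCont_def)
qed

section \<open>A Hoelder inequality and its counterpart for exponents below one\<close>

lemma norm_integral_le_nn_integral:
 fixes F :: "'a => complex"
 shows "ennreal (cmod (\<integral>x. F x \<partial>M)) <= (\<integral>\<^sup>+x. ennreal (cmod (F x)) \<partial>M)"
 by (cases "integrable M F") (auto simp: integral_norm_bound_ennreal not_integrable_integral_eq)

text \<open>Hoelder's inequality up to the factor 2, from the elementary bound \<open>t \<le> l + l^(1-p) t^p\<close> with the optimal choice of \<open>l\<close>.\<close>

lemma hoelder_weight:
 fixes t w :: "'a => real"
 assumes p: "1 <= p" and [measurable]: "t \<in> borel_measurable M" "w \<in> borel_measurable M"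
  and nn: "!!x. t x >= 0" "!!x. w x >= 0"
  and W: "(\<integral>\<^sup>+x. ennreal (w x) \<partial>M) <= ennreal W" "W > 0"
  and J: "(\<integral>\<^sup>+x. ennreal (t x powr p * w x) \<partial>M) <= ennreal J" "J >= 0"
 shows "(\<integral>\<^sup>+x. ennreal (t x * w x) \<partial>M) <= ennreal (2 * W powr (1 - 1 / p) * J powr (1 / p))"
proof -
 have young: "t x * w x <= l * w x + l powr (1 - p) * (t x powr p * w x)" if l: "l > 0" for l x
 proof (cases "t x <= l")
  case True
  then have "t x * w x <= l * w x" using nn by (intro mult_right_mono) auto
  moreover have "0 <= l powr (1 - p) * (t x powr p * w x)" using nn by simp
  ultimately show ?thesis by linarith
 next
  case False
  then have t: "t x > 0" "l <= t x" using l by auto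
  have "l powr (p - 1) <= t x powr (p - 1)" using l t p by (intro powr_mono2) auto
  then have "l powr (1 - p) * t x powr p >= l powr (1 - p) * (l powr (p - 1) * t x)"
   using t p by (intro mult_left_mono) (auto simp: powr_diff field_simps)
  also have "l powr (1 - p) * (l powr (p - 1) * t x) = t x"
   using l by (simp add: mult.assoc[symmetric] powr_add[symmetric])
  finally have "t x * w x <= (l powr (1 - p) * t x powr p) * w x" using nn by (intro mult_right_mono) auto
  moreover have "0 <= l * w x" using nn l by simp
  ultimately show ?thesis by (simp add: mult.assoc)
 qed
 have main: "(\<integral>\<^sup>+x. ennreal (t x * w x) \<partial>M) <= ennreal (l * W + l powr (1 - p) * J)" if l: "l > 0" for l
 proof -
  have "(\<integral>\<^sup>+x. ennreal (t x * w x) \<partial>M) \<le>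
    (\<integral>\<^sup>+x. ennreal l * ennreal (w x) + ennreal (l powr (1 - p)) * ennreal (t x powr p * w x) \<partial>M)"
  proof (rule nn_integral_mono)
   fix x
   have "ennreal (t x * w x) <= ennreal (l * w x + l powr (1 - p) * (t x powr p * w x))"
    by (intro ennreal_leI young l)
   also have "... = ennreal l * ennreal (w x) + ennreal (l powr (1 - p)) * ennreal (t x powr p * w x)"
    using nn l by (simp add: ennreal_mult)
   finally show "ennreal (t x * w x) <= ..." .
  qed
  also have "... = ennreal l * (\<integral>\<^sup>+x. ennreal (w x) \<partial>M) + ennreal (l powr (1 - p)) * (\<integral>\<^sup>+x. ennreal (t x powr p * w x) \<partial>M)"
   by (simp add: nn_integral_add nn_integral_cmult)
  also have "... <= ennreal l * ennreal W + ennreal (l powr (1 - p)) * ennreal J"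
   by (intro add_mono mult_left_mono W J) auto
  also have "... = ennreal (l * W + l powr (1 - p) * J)"
   using l W J by (simp add: ennreal_mult)
  finally show ?thesis .
 qed
 show ?thesis
 proof (cases "J = 0")
  case False
  then have J0: "J > 0" using J by simp
  define l where "l = (J / W) powr (1 / p)"
  have l: "l > 0" using J0 W by (simp add: l_def)
  have "l powr p = J / W" using J0 W p by (simp add: l_def powr_powr)
  then have J': "J = W * l powr p" using W by simp
  have "l powr (1 - p) * J = W * (l powr (1 - p) * l powr p)" by (subst J') simp
  also have "... = W * l" using l by (simp add: powr_add[symmetric])
  finally have "l * W + l powr (1 - p) * J = 2 * (W * l)" by simp
  also have "W * l = W powr (1 - 1 / p) * J powr (1 / p)"
   using J0 W unfolding l_def by (simp add: powr_divide powr_diff)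
  finally have "l * W + l powr (1 - p) * J = 2 * W powr (1 - 1 / p) * J powr (1 / p)" by simp
  then show ?thesis using main[OF l] by simp
 next
  case True
  have le: "(\<integral>\<^sup>+x. ennreal (t x * w x) \<partial>M) <= 0 + ennreal e" if e: "e > 0" for e
   using main[of "e / W"] e W True by simp
  have "(\<integral>\<^sup>+x. ennreal (t x * w x) \<partial>M) <= 0"
   by (rule ennreal_le_epsilon) (use le in auto)
  then show ?thesis by simp
 qed
qed

text \<open>Dividing by the sum makes every term at most 1, and such a number is at most its \<open>p\<close>-th power. This takes the place of Hoelder's inequality below the exponent one.\<close>

lemma nn_integral_powr_superadditive:
 fixes t :: "'a => real"
 assumes p: "0 < p" "p <= 1" and nn: "!!i. t i >= 0"
  and X: "(\<integral>\<^sup>+i. ennreal (t i) \<partial>count_space A) = ennreal X" "X >= 0"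
 shows "ennreal (X powr p) <= (\<integral>\<^sup>+i. ennreal (t i powr p) \<partial>count_space A)"
proof (cases "X = 0")
 case False
 then have X0: "X > 0" using X by simp
 have le: "t i <= X" if "i \<in> A" for i
 proof -
  have "ennreal (t i) = (\<integral>\<^sup>+i'. ennreal (t i) * indicator {i} i' \<partial>count_space A)"
   using that by (subst nn_integral_cmult_indicator) auto
  also have "... <= (\<integral>\<^sup>+i. ennreal (t i) \<partial>count_space A)" by (intro nn_integral_mono) (auto simp: indicator_def)
  finally show ?thesis using X by simp
 qed
 have "ennreal (X powr p) = ennreal (X powr (p - 1)) * ennreal X"
  using X0 by (simp add: ennreal_mult[symmetric] powr_diff)
 also have "... = (\<integral>\<^sup>+i. ennreal (X powr (p - 1)) * ennreal (t i) \<partial>count_space A)"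
  unfolding X(1)[symmetric] by (simp add: nn_integral_cmult)
 also have "... <= (\<integral>\<^sup>+i. ennreal (t i powr p) \<partial>count_space A)"
 proof (rule nn_integral_mono)
  fix i assume "i \<in> space (count_space A)"
  then have i: "t i <= X" using le by simp
  show "ennreal (X powr (p - 1)) * ennreal (t i) <= ennreal (t i powr p)"
  proof (cases "t i = 0")
   case False
   then have t: "t i > 0" using nn[of i] by simp
   have "X powr (p - 1) * t i <= t i powr (p - 1) * t i"
    using i t p by (intro mult_right_mono powr_mono2') auto
   also have "... = t i powr p" using t by (simp add: powr_diff)
   finally show ?thesis using nn by (simp add: ennreal_mult[symmetric] ennreal_leI)
  qed simp
 qed
 finally show ?thesis .
qed simp

section \<open>The Plancherel-Polya inequality\<close>

text \<open>The case \<open>p \<le> 1\<close> of the Plancherel-Polya inequality, by the self-improvement of Peetre's maximal function \<open>S = sup |u y| (1 + |x - y|)^-m\<close>. Writing \<open>|u| = |u|^(1-p) |u|^p\<close> under the reproducing integral gives \<open>S \<le> A S^(1-p) J\<close>. Division by \<open>S^(1-p)\<close> is legitimate because polynomial growth of order \<open>m\<close> makes \<open>S\<close> finite.\<close>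

lemma peetre_self_improvement:
 fixes u :: "real => complex"
 assumes p: "0 < p" "p <= 1" and [measurable]: "u \<in> borel_measurable borel"
  and D: "!!y. cmod (u y) <= D * wt y ^ m"
  and A: "A >= 0" "!!x. ennreal (cmod (u x)) <= (LBNN z. ennreal (A / wt (x - z) ^ m * cmod (u z)))"
  and J: "(LBNN z. ennreal (cmod (u z) powr p / wt (x - z) powr (m * p))) <= ennreal J" "J >= 0"
 shows "cmod (u x) powr p <= A * J"
proof -
 define v where "v y = cmod (u y) / wt (x - y) ^ m" for y
 have pos: "wt y ^ m > 0" for y :: real by (intro zero_less_power) auto
 have D0: "D >= 0" using order_trans[OF norm_ge_zero D[of 0]] by simp
 have "v y <= D * wt x ^ m" for y
 proof -
  have "cmod (u y) <= D * wt y ^ m" by (rule D)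
  also have "... <= D * (wt (x - y) ^ m * wt x ^ m)" by (intro mult_left_mono weight_power_shift D0)
  finally show ?thesis unfolding v_def using pos[of "x - y"] by (simp add: pos_divide_le_eq mult_ac)
 qed
 then have bdd: "bdd_above (range v)" unfolding bdd_above_def by blast
 define M where "M = (SUP y. v y)"
 have vM: "v y <= M" for y unfolding M_def by (rule cSUP_upper[OF _ bdd]) auto
 have v0: "v y >= 0" for y unfolding v_def using pos[of "x - y"] by simp
 have M0: "M >= 0" using order_trans[OF v0 vM] .
 have uv: "cmod (u y) = v y * wt (x - y) ^ m" for y
  unfolding v_def using pos[of "x - y"] by simp
 have step: "v y <= A * M powr (1 - p) * J" for y
 proof -
  let ?c = "A * M powr (1 - p) * wt (x - y) ^ m"
  have c0: "?c >= 0" using A pos[of "x - y"] by simp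
  have "ennreal (cmod (u y)) <= (LBNN z. ennreal (A / wt (y - z) ^ m * cmod (u z)))" by (rule A)
  also have "... <= (LBNN z. ennreal ?c * ennreal (cmod (u z) powr p / wt (x - z) powr (m * p)))"
  proof (rule nn_integral_mono)
   fix z
   let ?W = "1 + abs (x - z)"
   have W: "?W > 0" by simp
   have "A / wt (y - z) ^ m * cmod (u z) <= ?c * (cmod (u z) powr p / ?W powr (m * p))"
   proof (cases "u z = 0")
    case False
    then have uz: "cmod (u z) > 0" by simp
    have Mz: "cmod (u z) <= M * ?W ^ m" unfolding uv using pos[of "x - z"] vM[of z] by (simp add: mult_right_mono)
    have "cmod (u z) = cmod (u z) powr p * cmod (u z) powr (1 - p)"
     using uz by (simp add: powr_add[symmetric])
    also have "... <= cmod (u z) powr p * (M * ?W ^ m) powr (1 - p)"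
     using Mz p uz by (intro mult_left_mono powr_mono2) auto
    also have "(M * ?W ^ m) powr (1 - p) = M powr (1 - p) * (?W ^ m / ?W powr (m * p))"
     using W M0 by (simp add: powr_mult powr_powr powr_realpow[symmetric] powr_diff[symmetric] right_diff_distrib)
    finally have 1: "cmod (u z) <= cmod (u z) powr p * (M powr (1 - p) * (?W ^ m / ?W powr (m * p)))" .
    have "1 / wt ((x - z) - (x - y)) ^ m <= wt ((x - z) - ((x - z) - (x - y))) ^ m / wt (x - z) ^ m"
     by (rule inverse_weight_shift)
    then have 2: "1 / wt (y - z) ^ m <= wt (x - y) ^ m / ?W ^ m" by simp
    have "A * (1 / wt (y - z) ^ m) * cmod (u z) \<le>
     A * (wt (x - y) ^ m / ?W ^ m) * (cmod (u z) powr p * (M powr (1 - p) * (?W ^ m / ?W powr (m * p))))"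
     using A(1) 1 2 uz by (intro mult_mono) auto
    also have "... = ?c * (cmod (u z) powr p / ?W powr (m * p))"
     using pos[of "x - z"] by simp
    finally show ?thesis by simp
   qed (use c0 in simp)
   then show "ennreal (A / wt (y - z) ^ m * cmod (u z)) <= ennreal ?c * ennreal (cmod (u z) powr p / ?W powr (m * p))"
    using c0 by (simp add: ennreal_mult[symmetric] ennreal_leI del: times_divide_eq_right)
  qed
  also have "... = ennreal ?c * (LBNN z. ennreal (cmod (u z) powr p / wt (x - z) powr (m * p)))"
   by (rule nn_integral_cmult) measurable
  also have "... <= ennreal ?c * ennreal J" by (intro mult_left_mono J) auto
  also have "... = ennreal (?c * J)" using c0 J by (simp add: ennreal_mult)
  finally have "cmod (u y) <= ?c * J" using c0 J by simp
  then show ?thesis unfolding v_def using pos[of "x - y"] by (simp add: pos_divide_le_eq mult_ac)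
 qed
 have "M <= A * M powr (1 - p) * J" unfolding M_def[symmetric] using step by (subst M_def) (rule cSUP_least, auto)
 then have "M powr p <= A * J"
 proof (cases "M = 0")
  case False
  then have "M > 0" using M0 by simp
  have "M powr p * M powr (1 - p) <= A * J * M powr (1 - p)"
   using \<open>M <= A * M powr (1 - p) * J\<close> \<open>M > 0\<close> by (simp add: powr_add[symmetric] mult_ac)
  then show ?thesis using \<open>M > 0\<close> by simp
 qed (use A J in simp)
 moreover have "cmod (u x) powr p <= M powr p"
  using uv[of x] vM[of x] v0[of x] p by (intro powr_mono2) auto
 ultimately show ?thesis by linarith
qed

text \<open>The \<open>p\<close>-th power of a \<open>p\<close>-mean of the function around \<open>x\<close> at unit scale, with a weight of quadratic decay.\<close>

definition qavg :: "real => (real => complex) => real => real" where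
 "qavg p u x = (LBINT z. cmod (u z) powr p / (wt (x - z))\<^sup>2)"

lemma weight_sq_ge_1: "(wt x)\<^sup>2 >= 1"
 by simp

lemma qavg_integrable:
 assumes [measurable]: "u \<in> borel_measurable borel" and "integrable lborel (%z. cmod (u z) powr p)"
 shows "integrable lborel (%z. cmod (u z) powr p / (wt (x - z))\<^sup>2)"
proof (rule lint_bound[OF assms(2)])
 have "cmod (u z) powr p / (wt (x - z))\<^sup>2 <= cmod (u z) powr p / 1" for z
  by (intro divide_left_mono weight_sq_ge_1) (auto intro!: mult_pos_pos zero_less_power)
 then show "AE z in lborel. norm (cmod (u z) powr p / (wt (x - z))\<^sup>2) <= norm (cmod (u z) powr p)"
  by (intro AE_I2) simp
qed measurable

lemma qavg_nonneg: "qavg p u x >= 0"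
 unfolding qavg_def by (rule Bochner_Integration.integral_nonneg) auto

lemma nn_qavg:
 assumes "u \<in> borel_measurable borel" "integrable lborel (%z. cmod (u z) powr p)"
 shows "(LBNN z. ennreal (cmod (u z) powr p / (wt (x - z))\<^sup>2)) = ennreal (qavg p u x)"
 unfolding qavg_def by (rule nn_integral_eq_integral[OF qavg_integrable[OF assms]]) auto

lemma qavg_shift:
 assumes "u \<in> borel_measurable borel" "integrable lborel (%z. cmod (u z) powr p)"
 shows "qavg p u y <= (wt (x - y))\<^sup>2 * qavg p u x"
 unfolding qavg_def integral_mult_right_zero[symmetric]
proof (rule integral_mono)
 fix z
 have "1 / (wt ((x - z) - (x - y)))\<^sup>2 <= (wt ((x - z) - ((x - z) - (x - y))))\<^sup>2 / (wt (x - z))\<^sup>2"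
  by (rule inverse_weight_shift)
 then have "1 / (wt (y - z))\<^sup>2 <= (wt (x - y))\<^sup>2 / (wt (x - z))\<^sup>2" by simp
 from mult_left_mono[OF this, of "cmod (u z) powr p"]
 show "cmod (u z) powr p / (wt (y - z))\<^sup>2 <= (wt (x - y))\<^sup>2 * (cmod (u z) powr p / (wt (x - z))\<^sup>2)"
  by (simp add: mult.commute)
qed (intro qavg_integrable[OF assms] integrable_mult_right)+

text \<open>A function that is reproduced by a rapidly decreasing kernel is bounded pointwise by its local \<open>p\<close>-means, uniformly in the function. For \<open>p \<le> 1\<close> the self-improvement is applied twice: the exponent given by the unknown growth order first shows that the function is bounded; a fixed exponent then yields a constant that does not depend on the growth.\<close>

theorem plancherel_polya:
 fixes A :: "nat => real"
 assumes p: "p > 0" and A: "!!m. A m >= 0"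
 obtains C where "C >= 0"
  "!!u D n x. u \<in> borel_measurable borel ==> (!!y. cmod (u y) <= D * wt y ^ n) ==>
   (!!m x. ennreal (cmod (u x)) <= (LBNN z. ennreal (A m / wt (x - z) ^ m * cmod (u z)))) ==>
   integrable lborel (%z. cmod (u z) powr p) ==> cmod (u x) powr p <= C * qavg p u x"
proof (cases "p <= 1")
 case True
 define m0 where "m0 = nat \<lceil>2 / p\<rceil>"
 have m0: "real m * p >= 2" if "m >= m0" for m
 proof -
  have "2 / p <= real m0" unfolding m0_def by linarith
  also have "... <= real m" using that by simp
  finally show ?thesis using p by (simp add: pos_divide_le_eq)
 qed
 have "cmod (u x) powr p <= A m0 * qavg p u x"
  if u[measurable]: "u \<in> borel_measurable borel" and D: "!!y. cmod (u y) <= D * wt y ^ n"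
   and hyp: "!!m x. ennreal (cmod (u x)) <= (LBNN z. ennreal (A m / wt (x - z) ^ m * cmod (u z)))"
   and int: "integrable lborel (%z. cmod (u z) powr p)" for u D n x
 proof -
  have J: "(LBNN z. ennreal (cmod (u z) powr p / wt (x - z) powr (m * p))) <= ennreal (qavg p u x)"
   if "m >= m0" for m :: nat and x
   unfolding nn_qavg[OF u int, symmetric]
  proof (rule nn_integral_mono, rule ennreal_leI, rule divide_left_mono)
   fix z
   have "(wt (x - z))\<^sup>2 = wt (x - z) powr 2"
    using powr_realpow[of "1 + abs (x - z)" 2] by simp
   also have "... <= wt (x - z) powr (m * p)" using m0[OF that] by (intro powr_mono) auto
   finally show "(wt (x - z))\<^sup>2 <= wt (x - z) powr (m * p)" .
  qed auto
  have D0: "D >= 0" using order_trans[OF norm_ge_zero D[of 0]] by simp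
  define m where "m = max n m0"
  have b1: "cmod (u x) powr p <= A m * qavg p u x" for x
  proof (rule peetre_self_improvement[OF p True u _ A hyp J qavg_nonneg])
   show "cmod (u y) <= D * wt y ^ m" for y
    using D[of y] mult_left_mono[OF power_increasing[of n m "1 + abs y"] D0] unfolding m_def by fastforce
  qed (simp add: m_def)
  define S where "S = (A m * (LBINT z. cmod (u z) powr p)) powr (1 / p)"
  have "cmod (u x) <= S * wt x ^ 0" for x
  proof -
   have "qavg p u x <= (LBINT z. cmod (u z) powr p)"
    unfolding qavg_def
   proof (rule integral_mono[OF qavg_integrable[OF u int] int])
    show "cmod (u z) powr p / (wt (x - z))\<^sup>2 <= cmod (u z) powr p" for z
     using divide_left_mono[OF weight_sq_ge_1[of "x - z"], of "cmod (u z) powr p"] by simp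
   qed
   then have "cmod (u x) powr p <= A m * (LBINT z. cmod (u z) powr p)"
    using b1[of x] mult_left_mono[OF _ A[of m]] by fastforce
   then have "(cmod (u x) powr p) powr (1 / p) <= S"
    unfolding S_def using p by (intro powr_mono2) auto
   then show ?thesis using p by (simp add: powr_powr)
  qed
  moreover have "S * wt x ^ 0 <= S * wt x ^ m0" for x
   by (rule mult_left_mono) (simp_all add: S_def)
  ultimately have bd: "cmod (u x) <= S * wt x ^ m0" for x by (rule order_trans)
  show ?thesis
   by (rule peetre_self_improvement[OF p True u bd A hyp J qavg_nonneg]) simp
 qed
 then show ?thesis using that[of "A m0"] A by blast
next
 case False
 define c where "c = 2 * 2 powr (1 - 1 / p) * (A 2 + 1)"
 have c0: "c >= 0" using A[of 2] by (simp add: c_def)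
 have "cmod (u x) powr p <= c powr p * qavg p u x"
  if u[measurable]: "u \<in> borel_measurable borel"
   and hyp: "!!m x. ennreal (cmod (u x)) <= (LBNN z. ennreal (A m / wt (x - z) ^ m * cmod (u z)))"
   and int: "integrable lborel (%z. cmod (u z) powr p)" for u x
 proof -
  have W: "(LBNN z. ennreal (1 / (wt (x - z))\<^sup>2)) <= ennreal 2"
  proof -
   have "(LBNN z. ennreal (1 / (wt z)\<^sup>2)) = (LBNN z. ennreal (1 / (wt (x + (-1) * z))\<^sup>2))"
    by (subst nn_integral_real_affine[where c = "-1" and t = x]) auto
   then show ?thesis using nn_integral_weight by simp
  qed
  have "(LBNN z. ennreal (cmod (u z) * (1 / (wt (x - z))\<^sup>2)))
    <= ennreal (2 * 2 powr (1 - 1 / p) * qavg p u x powr (1 / p))"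
  proof (rule hoelder_weight[OF _ _ _ _ _ W])
   show "(LBNN z. ennreal (cmod (u z) powr p * (1 / (wt (x - z))\<^sup>2))) <= ennreal (qavg p u x)"
    using nn_qavg[OF u int, of x] by simp
  qed (use False in \<open>auto simp: qavg_nonneg\<close>)
  then have H: "ennreal (A 2) * (LBNN z. ennreal (cmod (u z) * (1 / (wt (x - z))\<^sup>2)))
    <= ennreal (A 2) * ennreal (2 * 2 powr (1 - 1 / p) * qavg p u x powr (1 / p))"
   by (rule mult_left_mono) simp
  have "ennreal (cmod (u x)) <= (LBNN z. ennreal (A 2) * ennreal (cmod (u z) * (1 / (wt (x - z))\<^sup>2)))"
   using hyp[of x 2] A[of 2] by (simp add: ennreal_mult[symmetric] mult.commute)
  also have "... = ennreal (A 2) * (LBNN z. ennreal (cmod (u z) * (1 / (wt (x - z))\<^sup>2)))"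
   by (rule nn_integral_cmult) measurable
  also note H
  also have "ennreal (A 2) * ennreal (2 * 2 powr (1 - 1 / p) * qavg p u x powr (1 / p)) =
    ennreal (A 2 * (2 * 2 powr (1 - 1 / p) * qavg p u x powr (1 / p)))"
   using A[of 2] by (simp add: ennreal_mult)
  finally have "cmod (u x) <= A 2 * (2 * 2 powr (1 - 1 / p) * qavg p u x powr (1 / p))"
   using A[of 2] by simp
  also have "... <= c * qavg p u x powr (1 / p)"
   unfolding c_def by (simp add: algebra_simps)
  finally have "cmod (u x) powr p <= (c * qavg p u x powr (1 / p)) powr p"
   using False by (intro powr_mono2) auto
  also have "... = c powr p * qavg p u x"
   using c0 False qavg_nonneg[of p u x] by (simp add: powr_mult powr_powr)
  finally show ?thesis .
 qed
 then show ?thesis using that[of "c powr p"] by auto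
qed

section \<open>Band-limited functions at unit scale\<close>

text \<open>Functions of spectrum in a fixed ball that have a finite \<open>L\<^sub>p\<close> integral, described by the reproducing formula with the low-pass kernel.\<close>

definition band :: "(real => complex) => real => (real => complex) => bool" where
 "band \<phi> p u \<longleftrightarrow> continuous_on UNIV u \<and> (\<exists>D n. \<forall>y. cmod (u y) <= D * wt y ^ n) \<and>
   (\<forall>x. (LBINT z. low \<phi> 1 z * u (x - z)) = u x) \<and> integrable lborel (%z. cmod (u z) powr p)"

text \<open>The power of the weight at which \<open>wt x ^ wexp p\<close> dominates the \<open>(2/p)\<close>-th power of \<open>wt x\<close>, as is needed to move the base point of \<open>qavg\<close> after taking \<open>p\<close>-th roots.\<close>

definition wexp :: "real => nat" where
 "wexp p = nat \<lceil>2 / p\<rceil>"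

lemma wexp_ge: "p > 0 ==> 2 / p <= real (wexp p)"
 unfolding wexp_def by linarith

lemma band_measurable: "band \<phi> p u ==> u \<in> borel_measurable borel"
 unfolding band_def by (auto intro: borel_measurable_continuous_onI)

lemma lborel_integral_reflect:
 fixes F :: "real => complex"
 shows "(LBINT z. F z) = (LBINT z. F (x - z))"
 by (subst lborel_integral_real_affine[where c = "-1" and t = x]) auto

lemma band_pointwise:
 assumes lp: "lp_generator \<phi>" and p: "p > 0"
 obtains C where "C >= 0" "!!u x y. band \<phi> p u ==>
  cmod (u y) <= C * wt (x - y) ^ wexp p * qavg p u x powr (1 / p)"
proof -
 from rapid_decay[OF schwartz_rapid[OF schwartz_low[OF lp]], of 1] obtain A :: "nat => real"
  where A: "!!m. A m >= 0" "!!m x. cmod (low \<phi> 1 x) <= A m / wt x ^ m" by metis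
 show thesis
 proof (rule plancherel_polya[of p A, OF p A(1)])
 fix C assume C: "C >= 0"
  "!!u D n x. u \<in> borel_measurable borel ==> (!!y. cmod (u y) <= D * wt y ^ n) ==>
   (!!m x. ennreal (cmod (u x)) <= (LBNN z. ennreal (A m / wt (x - z) ^ m * cmod (u z)))) ==>
   integrable lborel (%z. cmod (u z) powr p) ==> cmod (u x) powr p <= C * qavg p u x"
 have "cmod (u y) <= C powr (1 / p) * wt (x - y) ^ wexp p * qavg p u x powr (1 / p)" if u: "band \<phi> p u" for u x y
 proof -
  have um: "u \<in> borel_measurable borel" using u by (rule band_measurable)
  have ui: "integrable lborel (%z. cmod (u z) powr p)" using u by (simp add: band_def)
  obtain D n where D: "!!y. cmod (u y) <= D * wt y ^ n" using u unfolding band_def by blast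
  have hyp: "ennreal (cmod (u x)) <= (LBNN z. ennreal (A m / wt (x - z) ^ m * cmod (u z)))" for m x
  proof -
   have "u x = (LBINT z. low \<phi> 1 z * u (x - z))" using u by (simp add: band_def)
   also have "... = (LBINT z. low \<phi> 1 (x - z) * u z)"
    by (subst lborel_integral_reflect[of _ x]) simp
   finally have eq: "u x = (LBINT z. low \<phi> 1 (x - z) * u z)" .
   have "ennreal (cmod (u x)) <= (LBNN z. ennreal (cmod (low \<phi> 1 (x - z) * u z)))"
    by (subst eq) (rule norm_integral_le_nn_integral)
   also have "... <= (LBNN z. ennreal (A m / wt (x - z) ^ m * cmod (u z)))"
    unfolding norm_mult by (intro nn_integral_mono ennreal_leI mult_right_mono A(2) norm_ge_zero)
   finally show ?thesis .
  qed
  have "cmod (u y) powr p <= C * qavg p u y" by (rule C(2)[OF um D hyp ui])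
  also have "... <= C * ((wt (x - y))\<^sup>2 * qavg p u x)" by (intro mult_left_mono qavg_shift[OF um ui] C)
  finally have "(cmod (u y) powr p) powr (1 / p) <= (C * ((wt (x - y))\<^sup>2 * qavg p u x)) powr (1 / p)"
   using p by (intro powr_mono2) auto
  also have "... = C powr (1 / p) * ((wt (x - y))\<^sup>2 powr (1 / p) * qavg p u x powr (1 / p))"
   using C(1) qavg_nonneg by (simp add: powr_mult)
  also have "(wt (x - y))\<^sup>2 powr (1 / p) = wt (x - y) powr (2 / p)"
  proof -
   have "(wt (x - y))\<^sup>2 = wt (x - y) powr 2" using powr_realpow[of "1 + abs (x - y)" 2] by simp
   then show ?thesis by (simp only: powr_powr) simp
  qed
  also have "C powr (1 / p) * (wt (x - y) powr (2 / p) * qavg p u x powr (1 / p)) \<le>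
    C powr (1 / p) * (wt (x - y) ^ wexp p * qavg p u x powr (1 / p))"
  proof (intro mult_left_mono mult_right_mono)
   have "wt (x - y) powr (2 / p) <= wt (x - y) powr real (wexp p)"
    by (intro powr_mono wexp_ge p) auto
   then show "wt (x - y) powr (2 / p) <= wt (x - y) ^ wexp p" by (simp add: powr_realpow)
  qed auto
  finally show ?thesis using p by (simp add: powr_powr mult.assoc)
 qed
 then show thesis using that[of "C powr (1 / p)"] by simp
 qed
qed

lemma integral_weight_shift:
 fixes x :: real
 shows
 "integrable lborel (%z. 1 / (wt (x - z))\<^sup>2)" "(LBINT z. 1 / (wt (x - z))\<^sup>2) = 2"
proof -
 have "ennreal (LINT z::real|lborel. 1 / (wt z)\<^sup>2) = ennreal 2"
  using nn_integral_eq_integral[OF integrable_weight] nn_integral_weight by simp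
 then have "(LINT z::real|lborel. 1 / (wt z)\<^sup>2) = 2"
  by (subst (asm) ennreal_inj) (auto intro!: Bochner_Integration.integral_nonneg)
 then show "(LBINT z. 1 / (wt (x - z))\<^sup>2) = 2"
  by (subst (asm) lborel_integral_real_affine[where c = "-1" and t = x]) auto
 show "integrable lborel (%z. 1 / (wt (x - z))\<^sup>2)"
  using lborel_integrable_real_affine[OF integrable_weight, of "-1" x] by simp
qed

lemma weighted_kernel_bound:
 fixes k u :: "real => complex"
 assumes [measurable]: "k \<in> borel_measurable borel" "u \<in> borel_measurable borel"
  and k: "!!z. cmod (k z) <= A / wt (x - z) ^ (m + 2)"
  and u: "!!z. cmod (u z) <= B * wt (x - z) ^ m"
 shows "integrable lborel (%z. k z * u z)" "cmod (LBINT z. k z * u z) <= 2 * A * B"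
proof -
 have pos: "wt y ^ j > 0" for y :: real and j by (intro zero_less_power) auto
 have A: "A >= 0" using order_trans[OF norm_ge_zero k[of x]] by simp
 have B: "B >= 0" using order_trans[OF norm_ge_zero u[of x]] by simp
 have le: "cmod (k z * u z) <= A * B * (1 / (wt (x - z))\<^sup>2)" for z
 proof -
  have "cmod (k z * u z) <= A / wt (x - z) ^ (m + 2) * (B * wt (x - z) ^ m)"
   unfolding norm_mult using A pos[of "x - z"] by (intro mult_mono k u) auto
  also have "... = A * B * (1 / (wt (x - z))\<^sup>2)"
   unfolding power_add using pos[of "x - z" m] by simp
  finally show ?thesis .
 qed
 have i: "integrable lborel (%z. A * B * (1 / (wt (x - z))\<^sup>2))"
  by (intro integrable_mult_right integral_weight_shift)
 show int: "integrable lborel (%z. k z * u z)"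
 proof (rule lint_bound[OF i])
  show "AE z in lborel. norm (k z * u z) <= norm (A * B * (1 / (wt (x - z))\<^sup>2))"
   using le A B by (intro AE_I2) (simp add: abs_mult)
 qed measurable
 have "cmod (LBINT z. k z * u z) <= (LBINT z. cmod (k z * u z))" by (rule integral_norm_bound)
 also have "... <= (LBINT z. A * B * (1 / (wt (x - z))\<^sup>2))"
  by (intro integral_mono integrable_norm int i le)
 also have "... = A * B * 2" unfolding integral_mult_right_zero integral_weight_shift ..
 finally show "cmod (LBINT z. k z * u z) <= 2 * A * B" by simp
qed

lemma band_increment:
 assumes lp: "lp_generator \<phi>" and p: "p > 0"
 obtains C where "C >= 0" "!!u x h. band \<phi> p u ==> abs h <= 1 ==>
  cmod (u (x + h) - u x) <= C * abs h * qavg p u x powr (1 / p)"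
proof -
 let ?m = "wexp p"
 from band_pointwise[OF lp p] obtain C where C: "C >= 0" "!!u x y. band \<phi> p u ==>
  cmod (u y) <= C * wt (x - y) ^ ?m * qavg p u x powr (1 / p)" by metis
 from schwartz_increment_decay[OF schwartz_low[OF lp, of 1]] obtain A :: "nat => real" where A: "!!m. A m >= 0"
  "!!m x h. abs h <= 1 ==> cmod (low \<phi> 1 (x + h) - low \<phi> 1 x) <= A m * abs h / wt x ^ m" by metis
 from rapid_decay[OF schwartz_rapid[OF schwartz_low[OF lp]], of 1] obtain A' :: "nat => real"
  where A': "!!m. A' m >= 0" "!!m x. cmod (low \<phi> 1 x) <= A' m / wt x ^ m" by metis
 have "cmod (u (x + h) - u x) <= (2 * A (?m + 2) * C) * abs h * qavg p u x powr (1 / p)"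
  if u: "band \<phi> p u" and h: "abs h <= 1" for u x h
 proof -
  note [measurable] = band_measurable[OF u] schwartz_borel[OF schwartz_low[OF lp, of 1]]
  let ?Q = "qavg p u x powr (1 / p)"
  have rep: "u y = (LBINT z. low \<phi> 1 (y - z) * u z)" for y
  proof -
   have "u y = (LBINT z. low \<phi> 1 z * u (y - z))" using u by (simp add: band_def)
   also have "... = (LBINT z. low \<phi> 1 (y - z) * u z)"
    by (subst lborel_integral_reflect[of _ y]) simp
   finally show ?thesis .
  qed
  have ub: "cmod (u z) <= (C * qavg p u y powr (1 / p)) * wt (y - z) ^ ?m" for y z
   using C(2)[OF u, of z y] by (simp add: mult_ac)
  have int: "integrable lborel (%z. low \<phi> 1 (y - z) * u z)" for y
   by (rule weighted_kernel_bound(1)[of _ _ "A' (?m + 2)" y ?m, OF _ _ _ ub]) (measurable, rule A'(2))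
  have "u (x + h) - u x = (LBINT z. (low \<phi> 1 (x + h - z) - low \<phi> 1 (x - z)) * u z)"
   unfolding left_diff_distrib by (subst lint_diff[OF int int]) (simp only: rep[symmetric])
  also have "cmod ... <= 2 * (A (?m + 2) * abs h) * (C * ?Q)"
  proof (rule weighted_kernel_bound(2)[of _ _ _ x ?m, OF _ _ _ ub])
   show "cmod (low \<phi> 1 (x + h - z) - low \<phi> 1 (x - z)) <= A (?m + 2) * abs h / wt (x - z) ^ (?m + 2)" for z
    using A(2)[OF h, of "x - z" "?m + 2"] by (simp add: algebra_simps)
  qed measurable
  finally show ?thesis by (simp add: mult_ac)
 qed
 then show ?thesis using that[of "2 * A (?m + 2) * C"] A C by simp
qed

text \<open>A kernel that reproduces functions of frequencies between fixed positive bounds and has integral zero: a low-pass kernel minus one whose bandwidth is eight times smaller. Its primitive is therefore rapidly decreasing, and convolution with that primitive is a bounded integration operator on such functions.\<close>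

definition bandk :: "(real => complex) => real => complex" where
 "bandk \<phi> z = low \<phi> 1 z - low \<phi> 0 (z / 4) / 4"

definition bprim :: "(real => complex) => (real => complex) => real => complex" where
 "bprim \<phi> u x = (LBINT z. primitive (bandk \<phi>) (x - z) * u z)"

lemma schwartz_bandk:
 assumes "lp_generator \<phi>" shows "schwartz (bandk \<phi>)"
proof -
 have "schwartz (%z. low \<phi> 0 ((1/4) * z + 0))" by (rule schwartz_affine[OF schwartz_low[OF assms]]) simp
 from schwartz_lincomb[OF schwartz_low[OF assms, of 1] this, of 1 "- 1 / 4"]
 show ?thesis unfolding bandk_def[abs_def] by simp
qed

lemma integral_bandk:
 assumes "lp_generator \<phi>" shows "(LBINT z. bandk \<phi> z) = 0"
proof -
 have i: "integrable lborel (low \<phi> j)" for j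
  using schwartz_integrable[OF schwartz_low[OF assms], of 0] by simp
 have i4: "integrable lborel (%z. low \<phi> 0 (z / 4))"
  using lborel_integrable_real_affine[OF i[of 0], of "1 / 4" 0] by simp
 have "(LBINT z. low \<phi> 0 z) = (1/4) *\<^sub>R (LBINT z. low \<phi> 0 (z / 4))"
  by (subst lborel_integral_real_affine[where c = "1/4" and t = 0]) auto
 then have "(LBINT z. low \<phi> 0 (z / 4) / 4) = 1"
  using integral_low[OF assms, of 0] by (simp add: scaleR_conv_of_real)
 then show ?thesis
  unfolding bandk_def using integral_low[OF assms, of 1] i[of 1] i4 by simp
qed

lemma bprim_bound:
 assumes lp: "lp_generator \<phi>" and p: "p > 0"
 obtains C where "C >= 0" "!!u x. band \<phi> p u ==> cmod (bprim \<phi> u x) <= C * qavg p u x powr (1 / p)"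
proof -
 let ?m = "wexp p"
 note sb = schwartz_bandk[OF lp]
 have ib: "integrable lborel (bandk \<phi>)" using schwartz_integrable[OF sb, of 0] by simp
 from rapid_decay[OF schwartz_rapid[OF sb]] obtain A0 :: "nat => real" where "!!m x. cmod (bandk \<phi> x) <= A0 m / wt x ^ m" by metis
 then have bb: "cmod (bandk \<phi> x) <= A0 0" for x by (metis div_by_1 power_0)
 have pm[measurable]: "primitive (bandk \<phi>) \<in> borel_measurable borel"
  using continuous_primitive[OF ib bb] by (rule borel_measurable_continuous_onI)
 from rapid_decay[OF rapid_primitive[OF schwartz_rapid[OF sb] schwartz_borel[OF sb] integral_bandk[OF lp]]]
 obtain A :: "nat => real" where A: "!!m. A m >= 0" "!!m x. cmod (primitive (bandk \<phi>) x) <= A m / wt x ^ m" by metis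
 from band_pointwise[OF lp p] obtain C where C: "C >= 0" "!!u x y. band \<phi> p u ==>
  cmod (u y) <= C * wt (x - y) ^ ?m * qavg p u x powr (1 / p)" by metis
 have "cmod (bprim \<phi> u x) <= 2 * A (?m + 2) * (C * qavg p u x powr (1 / p))" if u: "band \<phi> p u" for u x
  unfolding bprim_def
 proof (rule weighted_kernel_bound(2)[of _ _ _ x ?m])
  show "u \<in> borel_measurable borel" by (rule band_measurable[OF u])
  show "cmod (u z) <= (C * qavg p u x powr (1 / p)) * wt (x - z) ^ ?m" for z
   using C(2)[OF u, of z x] by (simp add: mult_ac)
 qed (measurable, rule A(2))
 then show ?thesis using that[of "2 * A (?m + 2) * C"] A C by (simp add: mult.assoc)
qed

lemma bprim_diff:
 assumes lp: "lp_generator \<phi>" and u: "u \<in> borel_measurable borel" "!!y. cmod (u y) <= D * wt y ^ n"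
  and rep: "!!x. (LBINT z. bandk \<phi> z * u (x - z)) = u x" and ab: "a <= b"
 shows "bprim \<phi> u b - bprim \<phi> u a = (LBINT t. indicator {a<..b} t * u t)"
proof -
 note sb = schwartz_bandk[OF lp]
 note [measurable] = u(1) schwartz_borel[OF sb]
 have ib: "integrable lborel (bandk \<phi>)" using schwartz_integrable[OF sb, of 0] by simp
 from rapid_decay[OF schwartz_rapid[OF sb]] obtain A0 :: "nat => real"
  where A0: "!!m. A0 m >= 0" "!!m x. cmod (bandk \<phi> x) <= A0 m / wt x ^ m" by metis
 then have bb: "cmod (bandk \<phi> x) <= A0 0" for x by (metis div_by_1 power_0)
 have pm[measurable]: "primitive (bandk \<phi>) \<in> borel_measurable borel"
  using continuous_primitive[OF ib bb] by (rule borel_measurable_continuous_onI)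
 from rapid_decay[OF rapid_primitive[OF schwartz_rapid[OF sb] schwartz_borel[OF sb] integral_bandk[OF lp]]]
 obtain A :: "nat => real" where A: "!!m. A m >= 0" "!!m x. cmod (primitive (bandk \<phi>) x) <= A m / wt x ^ m" by metis
 have D0: "D >= 0" using order_trans[OF norm_ge_zero u(2)[of 0]] by simp
 have int: "integrable lborel (%z. primitive (bandk \<phi>) (x - z) * u z)" for x
 proof (rule weighted_kernel_bound(1)[of _ _ "A (n + 2)" x n "D * wt x ^ n"])
  fix z
  have "cmod (u z) <= D * (wt (x - z) ^ n * wt x ^ n)"
   using u(2)[of z] mult_left_mono[OF weight_power_shift[of z n x] D0] by linarith
  then show "cmod (u z) <= D * wt x ^ n * wt (x - z) ^ n" by (simp add: mult_ac)
 qed (measurable, rule A(2))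
 define R where "R = abs a + abs b"
 have "bprim \<phi> u b - bprim \<phi> u a = (LBINT z. (primitive (bandk \<phi>) (b - z) - primitive (bandk \<phi>) (a - z)) * u z)"
  unfolding bprim_def left_diff_distrib by (rule lint_diff[OF int int, symmetric])
 also have "... = (LBINT z. (LBINT t. indicator {a<..b} t * bandk \<phi> (t - z) * u z))"
 proof (intro lint_cong refl)
  fix z
  have "primitive (bandk \<phi>) (b - z) - primitive (bandk \<phi>) (a - z) = (LBINT w. indicator {a - z<..b - z} w * bandk \<phi> w)"
   using ab by (intro primitive_diff ib) auto
  also have "... = (LBINT t. indicator {a - z<..b - z} (- z + 1 * t) * bandk \<phi> (- z + 1 * t))"
   by (subst lborel_integral_real_affine[where c = 1 and t = "-z"]) auto
  also have "... = (LBINT t. indicator {a<..b} t * bandk \<phi> (t - z))"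
   by (intro lint_cong refl) (auto split: split_indicator)
  finally show "(primitive (bandk \<phi>) (b - z) - primitive (bandk \<phi>) (a - z)) * u z =
    (LBINT t. indicator {a<..b} t * bandk \<phi> (t - z) * u z)" by simp
 qed
 also have "... = (LBINT t. (LBINT z. indicator {a<..b} t * bandk \<phi> (t - z) * u z))"
 proof (rule fubini_dominated[where a = "%z. (A0 (n + 2) * (1 + R) ^ (n + 2) * D) * (1 / (wt z)\<^sup>2)" and b = "%t. 1 * indicator {a<..b} t"])
  show "integrable lborel (%z. (A0 (n + 2) * (1 + R) ^ (n + 2) * D) * (1 / (wt z)\<^sup>2))"
   by (intro integrable_mult_right integrable_weight)
  show "integrable lborel (%t. 1 * indicator {a<..b} t :: real)" by (rule integrable_indicator_Ioc)
  fix z t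
  show "cmod (indicator {a<..b} t * bandk \<phi> (t - z) * u z) <= (A0 (n + 2) * (1 + R) ^ (n + 2) * D) * (1 / (wt z)\<^sup>2) * (1 * indicator {a<..b} t)"
  proof (cases "t \<in> {a<..b}")
   case True
   then have t: "abs (z - (z - t)) <= R" by (auto simp: R_def)
   have pos: "wt z ^ j > 0" for j by (intro zero_less_power) auto
   have "cmod (bandk \<phi> (t - z)) <= A0 (n + 2) * (1 / wt (z - t) ^ (n + 2))"
    using A0(2)[of "t - z" "n + 2"] by (simp add: abs_minus_commute)
   also have "... <= A0 (n + 2) * (wt (z - (z - t)) ^ (n + 2) / wt z ^ (n + 2))"
    by (intro mult_left_mono inverse_weight_shift A0)
   also have "... <= A0 (n + 2) * ((1 + R) ^ (n + 2) / wt z ^ (n + 2))"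
    using t by (intro mult_left_mono divide_right_mono power_mono A0) auto
   finally have "cmod (bandk \<phi> (t - z)) * cmod (u z) \<le>
    (A0 (n + 2) * ((1 + R) ^ (n + 2) / wt z ^ (n + 2))) * (D * wt z ^ n)"
    using A0 by (intro mult_mono u(2)) (auto simp: R_def)
   also have "... = (A0 (n + 2) * (1 + R) ^ (n + 2) * D) * (1 / (wt z)\<^sup>2)"
    unfolding power_add[of "1 + abs z"] using pos[of n] by simp
   finally show ?thesis using True by (simp add: norm_mult)
  qed simp
 qed measurable
 also have "... = (LBINT t. indicator {a<..b} t * u t)"
 proof (intro lint_cong refl)
  fix t
  have "(LBINT z. bandk \<phi> (t - z) * u z) = u t"
   unfolding rep[of t, symmetric] by (subst lborel_integral_reflect[of _ t]) simp
  then show "(LBINT z. indicator {a<..b} t * bandk \<phi> (t - z) * u z) = indicator {a<..b} t * u t"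
   by (simp add: mult.assoc)
 qed
 finally show ?thesis .
qed

section \<open>Norms with values in the extended half-line\<close>

lemma ennpowr_ennreal: "x >= 0 ==> ennpowr (ennreal x) r = ennreal (x powr r)"
 by (simp add: ennpowr_def)

lemma ennpowr_mono: "a <= b ==> r >= 0 ==> ennpowr a r <= ennpowr b r"
 by (cases a; cases b) (auto simp: ennpowr_def top_unique intro!: ennreal_leI powr_mono2)

lemma ennpowr_ennpowr: "ennpowr (ennpowr a r) t = ennpowr a (r * t)"
 by (cases a) (auto simp: ennpowr_def powr_powr)

lemma ennpowr_1: "ennpowr a 1 = a"
 by (cases a) (auto simp: ennpowr_def)

lemma lq_norm_ge_member:
 assumes "0 < q" shows "a j <= lq_norm q a"
proof (cases "q = \<infinity>")
 case True
 then show ?thesis by (simp add: lq_norm_def SUP_upper)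
next
 case False
 then have q: "enn2real q > 0" using assms by (simp add: enn2real_positive_iff less_top)
 have "a j = ennpowr (ennpowr (a j) (enn2real q)) (1 / enn2real q)"
  using q by (simp add: ennpowr_ennpowr ennpowr_1)
 also have "... <= ennpowr (\<Sum>j. ennpowr (a j) (enn2real q)) (1 / enn2real q)"
 proof (rule ennpowr_mono)
  show "ennpowr (a j) (enn2real q) <= (\<Sum>j. ennpowr (a j) (enn2real q))"
   using sum_le_suminf[of "%j. ennpowr (a j) (enn2real q)" "{j}"] by simp
 qed (use q in simp)
 finally show ?thesis using False by (simp add: lq_norm_def)
qed

lemma Lp_norm_powr: "p > 0 ==> ennpowr (Lp_norm p u) p = (LBNN  x. ennpowr (u x) p)"
 by (simp add: Lp_norm_def ennpowr_ennpowr ennpowr_1)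

lemma TL_space_block_bound:
 assumes "f \<in> TL_space \<phi> s p q" "p > 0" "q > 0" "lp_generator \<phi>"
 shows "(LBNN x. ennreal (cmod (lp_block \<phi> j f x) powr p))
  <= ennreal ((2 powr (- real j * s) * enn2real (TL_norm \<phi> s p q f)) powr p)"
proof -
 let ?a = "%x j. ennreal (2 powr (real j * s) * cmod (lp_block \<phi> j f x))"
 have fin: "TL_norm \<phi> s p q f < \<infinity>" using assms by (simp add: TL_space_def)
 then obtain B where B: "B >= 0" "TL_norm \<phi> s p q f = ennreal B" by (cases "TL_norm \<phi> s p q f") auto
 have "(LBNN x. ennreal ((2 powr (real j * s)) powr p) * ennreal (cmod (lp_block \<phi> j f x) powr p))
   = (LBNN x. ennpowr (?a x j) p)"
  by (intro nn_integral_cong) (simp add: ennpowr_ennreal powr_mult ennreal_mult[symmetric])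
 also have "... <= (LBNN x. ennpowr (lq_norm q (?a x)) p)"
  using assms by (intro nn_integral_mono ennpowr_mono lq_norm_ge_member) auto
 also have "... = ennpowr (TL_norm \<phi> s p q f) p"
  unfolding TL_norm_def using Lp_norm_powr[OF assms(2)] by simp
 also have "... = ennreal (B powr p)" using B by (simp add: ennpowr_ennreal)
 finally have *: "(LBNN x. ennreal ((2 powr (real j * s)) powr p) * ennreal (cmod (lp_block \<phi> j f x) powr p)) <= ennreal (B powr p)" .
 have [measurable]: "lp_block \<phi> j f \<in> borel_measurable borel"
  using dconv_continuous[of f "lp_kernel \<phi> j"] assms(1,4) schwartz_lp_kernel
  unfolding lp_block_eq_dconv TL_space_def by (auto intro: borel_measurable_continuous_onI)
 have "(LBNN x. ennreal (cmod (lp_block \<phi> j f x) powr p)) =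
   (LBNN x. ennreal ((2 powr (- real j * s)) powr p) * (ennreal ((2 powr (real j * s)) powr p) * ennreal (cmod (lp_block \<phi> j f x) powr p)))"
  by (intro nn_integral_cong) (simp add: ennreal_mult[symmetric] mult.assoc[symmetric] powr_powr powr_add[symmetric])
 also have "... = ennreal ((2 powr (- real j * s)) powr p) *
   (LBNN x. ennreal ((2 powr (real j * s)) powr p) * ennreal (cmod (lp_block \<phi> j f x) powr p))"
  by (rule nn_integral_cmult) measurable
 also have "... <= ennreal ((2 powr (- real j * s)) powr p) * ennreal (B powr p)"
  by (intro mult_left_mono *) auto
 also have "... = ennreal ((2 powr (- real j * s) * B) powr p)" using B by (simp add: powr_mult ennreal_mult)
 finally show ?thesis using B by simp
qed

section \<open>Lattice sums\<close>

lemma nn_integral_int_intervals: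
 fixes F :: "real => ennreal"
 assumes [measurable]: "F \<in> borel_measurable borel"
 shows "(ZSUM \<mu>. (LBNN y. F y * indicator {real_of_int \<mu>..<of_int \<mu> + 1} y)) = (LBNN y. F y)"
proof -
 have "(ZSUM \<mu>. (LBNN y. F y * indicator {real_of_int \<mu>..<of_int \<mu> + 1} y)) =
  (LBNN y. (ZSUM \<mu>. F y * indicator {real_of_int \<mu>..<of_int \<mu> + 1} y))"
  by (rule nn_integral_count_space_nn_integral[symmetric]) auto
 also have "... = (LBNN y. F y)"
 proof (rule nn_integral_cong)
  fix y :: real
  have "(ZSUM \<mu>. F y * indicator {real_of_int \<mu>..<of_int \<mu> + 1} y) =
    (\<Sum>\<mu>\<in>{\<lfloor>y\<rfloor>}. F y * indicator {real_of_int \<mu>..<of_int \<mu> + 1} y)"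
   by (rule nn_integral_count_space') (auto split: split_indicator dest: floor_unique)
  then show "(ZSUM \<mu>. F y * indicator {real_of_int \<mu>..<of_int \<mu> + 1} y) = F y"
   by (simp add: indicator_def)
 qed
 finally show ?thesis .
qed

text \<open>For spacing \<open>d \<le> 1\<close> the sum is compared with the integral, which is \<open>2/d\<close>. A coarser lattice is reduced to unit spacing.\<close>

lemma lattice_sum_bound:
 assumes d: "d > 0"
 shows "(ZSUM \<mu>. ennreal (1 / (wt (d * of_int \<mu> - s))\<^sup>2)) <= ennreal (8 * max 1 (1 / d))"
proof -
 have pos: "(wt x)\<^sup>2 > 0" for x :: real by (intro zero_less_power) auto
 have small: "(ZSUM \<mu>. ennreal (1 / (wt (d * of_int \<mu> - s))\<^sup>2)) <= ennreal (8 / d)"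
  if d: "d > 0" "d <= 1" for d s :: real
 proof -
  let ?F = "%y. ennreal (4 / (wt (d * y - s))\<^sup>2)"
  have "(ZSUM \<mu>. ennreal (1 / (wt (d * of_int \<mu> - s))\<^sup>2)) \<le>
   (ZSUM \<mu>. (LBNN y. ?F y * indicator {real_of_int \<mu>..<of_int \<mu> + 1} y))"
  proof (rule nn_integral_mono)
   fix \<mu> :: int
   let ?c = "ennreal (1 / (wt (d * of_int \<mu> - s))\<^sup>2)"
   have "?c = (LBNN y. ?c * indicator {real_of_int \<mu>..<of_int \<mu> + 1} y)"
    by (subst nn_integral_cmult_indicator) auto
   also have "... <= (LBNN y. ?F y * indicator {real_of_int \<mu>..<of_int \<mu> + 1} y)"
   proof (rule nn_integral_mono)
    fix y
    show "?c * indicator {real_of_int \<mu>..<of_int \<mu> + 1} y <= ?F y * indicator {real_of_int \<mu>..<of_int \<mu> + 1} y"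
    proof (cases "y \<in> {of_int \<mu>..<of_int \<mu> + 1}")
     case True
     then have "abs (y - of_int \<mu>) <= 1" by auto
     then have "d * abs (y - of_int \<mu>) <= 1 * 1" using d by (intro mult_mono) auto
     then have "abs (d * y - d * of_int \<mu>) <= 1" using d by (simp add: abs_mult right_diff_distrib[symmetric])
     moreover have "abs (d * y - s) <= abs (d * y - d * of_int \<mu>) + abs (d * of_int \<mu> - s)"
      by (rule order_trans[OF _ abs_triangle_ineq]) simp
     ultimately have "1 + abs (d * y - s) <= 2 + abs (d * of_int \<mu> - s)" by simp
     then have "1 + abs (d * y - s) <= 2 * wt (d * of_int \<mu> - s)" by (rule order_trans) simp
     then have "(wt (d * y - s))\<^sup>2 <= (2 * wt (d * of_int \<mu> - s))\<^sup>2" by (intro power_mono) auto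
     also have "(2 * wt (d * of_int \<mu> - s))\<^sup>2 = 4 * (wt (d * of_int \<mu> - s))\<^sup>2"
      by (subst power_mult_distrib) simp
     finally have "(wt (d * y - s))\<^sup>2 <= 4 * (wt (d * of_int \<mu> - s))\<^sup>2" .
     then have "1 / (wt (d * of_int \<mu> - s))\<^sup>2 <= 4 / (wt (d * y - s))\<^sup>2"
      using pos[of "d * y - s"] pos[of "d * of_int \<mu> - s"] by (simp add: divide_le_eq le_divide_eq mult.commute)
     then show ?thesis using True by (simp add: ennreal_leI)
    qed simp
   qed
   finally show "?c <= ..." .
  qed
  also have "... = (LBNN y. ?F y)" by (rule nn_integral_int_intervals) measurable
  also have "... = ennreal (8 / d)"
  proof -
   have "(LBNN y. ?F y) = ennreal (1 / d) * (LBNN y. ennreal (4 / (wt y)\<^sup>2))"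
    by (subst nn_integral_real_affine[where c = "1 / d" and t = "s / d"])
     (use d in \<open>auto simp: field_simps\<close>)
   also have "(LBNN y. ennreal (4 / (wt y)\<^sup>2)) = (LBNN y. ennreal 4 * ennreal (1 / (wt y)\<^sup>2))"
    by (intro nn_integral_cong) (simp add: ennreal_mult[symmetric] del: ennreal_numeral)
   also have "... = ennreal 4 * 2" by (subst nn_integral_cmult) (auto simp: nn_integral_weight)
   also have "ennreal (1 / d) * (ennreal 4 * 2) = ennreal (8 / d)"
    using d by (simp add: ennreal_mult[symmetric] del: ennreal_numeral flip: ennreal_numeral)
   finally show ?thesis .
  qed
  finally show ?thesis .
 qed
 show ?thesis
 proof (cases "d <= 1")
  case True
  then have "max 1 (1 / d) = 1 / d" using d by (intro max_absorb2) simp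
  then have eq: "8 * max 1 (1 / d) = 8 / d" by simp
  show ?thesis unfolding eq by (rule small[OF d True])
 next
  case False
  have "(ZSUM \<mu>. ennreal (1 / (wt (d * of_int \<mu> - s))\<^sup>2)) \<le>
    (ZSUM \<mu>. ennreal (1 / (wt (1 * of_int \<mu> - s / d))\<^sup>2))"
  proof (intro nn_integral_mono ennreal_leI divide_left_mono power_mono)
   fix \<mu> :: int
   have "abs (d * of_int \<mu> - s) = d * abs (of_int \<mu> - s / d)"
   proof -
    have "d * of_int \<mu> - s = d * (of_int \<mu> - s / d)" using d by (simp add: right_diff_distrib)
    then show ?thesis using d by (simp only: abs_mult abs_of_pos)
   qed
   moreover have "1 * abs (of_int \<mu> - s / d) <= d * abs (of_int \<mu> - s / d)" using False by (intro mult_right_mono) auto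
   ultimately show "1 + abs (1 * of_int \<mu> - s / d) <= 1 + abs (d * of_int \<mu> - s)" by simp
  qed (use pos in auto)
  also have "... <= ennreal (8 / 1)" by (rule small) auto
  also have "8 / 1 = 8 * max 1 (1 / d)"
   using False d by (subst max_absorb1) (auto simp: divide_le_eq)
  finally show ?thesis .
 qed
qed

section \<open>The Littlewood-Paley pieces of an element of the space\<close>

text \<open>The block rescaled to unit frequency, so that estimates at unit scale apply uniformly in \<open>j\<close>.\<close>

definition ublk :: "(real => complex) => distribution => nat => real => complex" where
 "ublk \<phi> f j t = lp_block \<phi> j f (t / 2 ^ j)"

definition TLB :: "(real => complex) => real => real => ennreal => distribution => real" where
 "TLB \<phi> s p q f = enn2real (TL_norm \<phi> s p q f)"

text \<open>The \<open>p\<close>-mean of the block around \<open>x\<close> at its natural scale \<open>2^-j\<close>.\<close>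

definition pk :: "(real => complex) => real => distribution => nat => real => real" where
 "pk \<phi> p f j x = qavg p (ublk \<phi> f j) (2 ^ j * x) powr (1 / p)"

text \<open>The antiderivative of a block that comes from the primitive of \<open>bandk\<close> at unit scale, scaled back.\<close>

definition gprim :: "(real => complex) => distribution => nat => real => complex" where
 "gprim \<phi> f j x = of_real (1 / 2 ^ j) * bprim \<phi> (ublk \<phi> f j) (2 ^ j * x)"

lemma TL_spaceD: "f \<in> TL_space \<phi> s p q ==> tempered_distribution f"
 by (simp add: TL_space_def)

lemma lp_block_continuous:
 "tempered_distribution f ==> lp_generator \<phi> ==> continuous_on UNIV (lp_block \<phi> j f)"
 unfolding lp_block_eq_dconv by (intro dconv_continuous schwartz_lp_kernel)

lemma lp_block_borel:
 "tempered_distribution f ==> lp_generator \<phi> ==> lp_block \<phi> j f \<in> borel_measurable borel"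
 using lp_block_continuous borel_measurable_continuous_onI by blast

lemma low_scale_div: "low \<phi> (j + i) (w / 2 ^ j) = 2 ^ j * low \<phi> i w"
proof -
 have "low \<phi> (j + i) (w / 2 ^ j) = 2 ^ j * (2 ^ i * low \<phi> 0 (2 ^ i * w))"
  by (subst low_scale) (simp add: power_add)
 also have "2 ^ i * low \<phi> 0 (2 ^ i * w) = low \<phi> i w" by (rule low_scale[symmetric])
 finally show ?thesis .
qed

lemma ublk_convolution:
 fixes k :: "real => complex"
 shows "(LBINT z. k z * lp_block \<phi> j f (x / 2 ^ j - z)) =
  (LBINT w. (k (w / 2 ^ j) / 2 ^ j) * ublk \<phi> f j (x - w))"
proof -
 have "(LBINT z. k z * lp_block \<phi> j f (x / 2 ^ j - z)) =
  (1 / 2 ^ j) *\<^sub>R (LBINT w. k (w / 2 ^ j) * lp_block \<phi> j f (x / 2 ^ j - w / 2 ^ j))"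
  by (subst lborel_integral_real_affine[where c = "1 / 2 ^ j" and t = 0]) auto
 also have "... = (LBINT w. (1 / 2 ^ j) *\<^sub>R (k (w / 2 ^ j) * lp_block \<phi> j f (x / 2 ^ j - w / 2 ^ j)))"
  by simp
 finally show ?thesis
  by (simp add: ublk_def diff_divide_distrib scaleR_conv_of_real)
qed

text \<open>The band condition requires a finite \<open>L\<^sub>p\<close> integral. It comes from a single summand of the quasi-norm, the factor \<open>2^j\<close> being the Jacobian of the rescaling.\<close>

lemma band_ublk:
 assumes f: "f \<in> TL_space \<phi> s p q" and p: "p > 0" and q: "q > 0" and lp: "lp_generator \<phi>"
 shows "band \<phi> p (ublk \<phi> f j)"
  and "(LBINT z. cmod (ublk \<phi> f j z) powr p) <= 2 ^ j * (2 powr (- real j * s) * TLB \<phi> s p q f) powr p"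
  and "2 <= j ==> (LBINT z. bandk \<phi> z * ublk \<phi> f j (x - z)) = ublk \<phi> f j x"
proof -
 note tf = TL_spaceD[OF f]
 note [measurable] = lp_block_borel[OF tf lp]
 have cont: "continuous_on UNIV (ublk \<phi> f j)"
  unfolding ublk_def by (intro continuous_on_compose2[OF lp_block_continuous[OF tf lp]] continuous_intros) auto
 have growth: "\<exists>D n. \<forall>y. cmod (ublk \<phi> f j y) <= D * wt y ^ n"
 proof -
  from dconv_growth[OF tf schwartz_lp_kernel[OF lp], of j] obtain D n where D: "D >= 0"
   "!!x. cmod (dconv f (lp_kernel \<phi> j) x) <= D * wt x ^ n" by metis
  have "cmod (ublk \<phi> f j y) <= D * wt y ^ n" for y
  proof -
   have "abs (y / 2 ^ j) <= abs y / 1" unfolding abs_divide by (rule divide_left_mono) auto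
   then have "D * wt (y / 2 ^ j) ^ n <= D * wt y ^ n" using D by (intro mult_left_mono power_mono) auto
   then show ?thesis using D(2)[of "y / 2 ^ j"] by (simp add: ublk_def lp_block_eq_dconv)
  qed
  then show ?thesis by blast
 qed
 have rep: "(LBINT z. low \<phi> 1 z * ublk \<phi> f j (x - z)) = ublk \<phi> f j x" for x
 proof -
  have "ublk \<phi> f j x = (LBINT z. low \<phi> (j + 1) z * lp_block \<phi> j f (x / 2 ^ j - z))"
   unfolding ublk_def by (subst lp_block_reproducing(1)[OF tf lp]) auto
  then show ?thesis unfolding ublk_convolution low_scale_div by simp
 qed
 have bound: "(LBNN z. ennreal (cmod (ublk \<phi> f j z) powr p)) \<le>
   ennreal (2 ^ j * (2 powr (- real j * s) * TLB \<phi> s p q f) powr p)"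
 proof -
  have "(LBNN z. ennreal (cmod (ublk \<phi> f j z) powr p)) =
    ennreal (2 ^ j) * (LBNN z. ennreal (cmod (lp_block \<phi> j f z) powr p))"
   unfolding ublk_def
   by (subst nn_integral_real_affine[where c = "2 ^ j" and t = 0]) auto
  also have "... <= ennreal (2 ^ j) * ennreal ((2 powr (- real j * s) * TLB \<phi> s p q f) powr p)"
   unfolding TLB_def by (intro mult_left_mono TL_space_block_bound[OF f p q lp]) auto
  finally show ?thesis by (simp add: ennreal_mult)
 qed
 have um: "(%z. cmod (ublk \<phi> f j z) powr p) \<in> borel_measurable lborel" unfolding ublk_def by measurable
 have int: "integrable lborel (%z. cmod (ublk \<phi> f j z) powr p)"
  by (rule integrableI_bounded[OF um]) (use bound in \<open>auto intro: order_le_less_trans\<close>)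
 show "band \<phi> p (ublk \<phi> f j)" unfolding band_def using cont growth rep int by blast
 show "(LBINT z. cmod (ublk \<phi> f j z) powr p) <= 2 ^ j * (2 powr (- real j * s) * TLB \<phi> s p q f) powr p"
  using bound nn_integral_eq_integral[OF int] by simp
 show "(LBINT z. bandk \<phi> z * ublk \<phi> f j (x - z)) = ublk \<phi> f j x" if j: "2 <= j"
 proof -
  obtain i where i: "j = i + 2" using j le_Suc_ex by (metis add.commute)
  have k: "low \<phi> i (w / 2 ^ j) / 2 ^ j = low \<phi> 0 (w / 4) / 4" for w
  proof -
   have "low \<phi> i (w / 2 ^ j) = low \<phi> (i + 0) ((w / 4) / 2 ^ i)" by (simp add: i power_add)
   then show ?thesis unfolding low_scale_div by (simp add: i power_add)
  qed
  have "(LBINT z. low \<phi> i z * lp_block \<phi> j f (x / 2 ^ j - z)) = 0"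
   by (rule lp_block_annihilated[OF tf lp]) (simp add: i)
  then have zero: "(LBINT w. (low \<phi> 0 (w / 4) / 4) * ublk \<phi> f j (x - w)) = 0"
   unfolding ublk_convolution k .
  obtain D n where D: "!!y. cmod (ublk \<phi> f j y) <= D * wt y ^ n" using growth by blast
  have D0: "D >= 0" using order_trans[OF norm_ge_zero D[of 0]] by simp
  have ub: "ublk \<phi> f j \<in> borel_measurable borel" using cont by (rule borel_measurable_continuous_onI)
  have int: "integrable lborel (%z. k z * ublk \<phi> f j (x - z))" if k: "schwartz k" for k
  proof -
   from rapid_decay[OF schwartz_rapid[OF k]] obtain A :: "nat => real"
    where A: "!!m x. cmod (k x) <= A m / wt x ^ m" by metis
   note [measurable] = schwartz_borel[OF k] ub
   show ?thesis
   proof (rule weighted_kernel_bound(1)[of _ _ "A (n + 2)" 0 n "D * wt x ^ n"])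
    show "cmod (k z) <= A (n + 2) / wt (0 - z) ^ (n + 2)" for z using A[of z "n + 2"] by simp
    show "cmod (ublk \<phi> f j (x - z)) <= D * wt x ^ n * wt (0 - z) ^ n" for z
     using D[of "x - z"] mult_left_mono[OF weight_power_shift[of "x - z" n x] D0] by (simp add: mult_ac)
   qed measurable
  qed
  have s4: "schwartz (%z. low \<phi> 0 (z / 4) / 4)"
   using schwartz_cmult[OF schwartz_affine[OF schwartz_low[OF lp, of 0], of "1/4" 0], of "1/4"] by simp
  show ?thesis
   unfolding bandk_def left_diff_distrib
   by (subst lint_diff[OF int[OF schwartz_low[OF lp]] int[OF s4]])
    (simp only: rep zero diff_zero)
 qed
qed

lemma powr_two_nat: "2 powr real j = 2 ^ j"
 by (simp add: powr_realpow)

lemma pk_nonneg: "pk \<phi> p f j x >= 0"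
 by (simp add: pk_def)

lemma qavg_le_integral:
 assumes "band \<phi> p u" shows "qavg p u x <= (LBINT z. cmod (u z) powr p)"
 unfolding qavg_def
proof (rule integral_mono)
 show i: "integrable lborel (%z. cmod (u z) powr p)" using assms by (simp add: band_def)
 show "integrable lborel (%z. cmod (u z) powr p / (wt (x - z))\<^sup>2)"
  by (rule qavg_integrable[OF band_measurable[OF assms] i])
 show "cmod (u z) powr p / (wt (x - z))\<^sup>2 <= cmod (u z) powr p" for z
  using divide_left_mono[OF weight_sq_ge_1[of "x - z"], of "cmod (u z) powr p"] by simp
qed

lemma TLB_nonneg: "TLB \<phi> s p q f >= 0"
 by (simp add: TLB_def)

text \<open>Bernstein's inequality: \<open>L\<^sub>p\<close> control becomes uniform control at the cost of \<open>2^(j/p)\<close>.\<close>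

lemma pk_le:
 assumes f: "f \<in> TL_space \<phi> s p q" and p: "p > 0" and q: "q > 0" and lp: "lp_generator \<phi>"
 shows "pk \<phi> p f j x <= 2 powr (real j * (1 / p - s)) * TLB \<phi> s p q f"
proof -
 have "qavg p (ublk \<phi> f j) (2 ^ j * x) <= 2 ^ j * (2 powr (- real j * s) * TLB \<phi> s p q f) powr p"
  using qavg_le_integral[OF band_ublk(1)[OF f p q lp]] band_ublk(2)[OF f p q lp] by (rule order_trans)
 then have "pk \<phi> p f j x <= (2 powr real j * (2 powr (- real j * s) * TLB \<phi> s p q f) powr p) powr (1 / p)"
  unfolding pk_def powr_two_nat using p by (intro powr_mono2) (auto simp: qavg_nonneg)
 also have "... = (2 powr real j) powr (1 / p) * (2 powr (- real j * s) * TLB \<phi> s p q f)"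
  using p by (simp add: powr_mult powr_powr TLB_nonneg)
 also have "... = 2 powr (real j * (1 / p - s)) * TLB \<phi> s p q f"
  by (simp add: powr_powr right_diff_distrib powr_diff powr_minus field_simps)
 finally show ?thesis .
qed

text \<open>The three pointwise estimates on which everything rests, with a constant that depends on \<open>\<phi>\<close> and \<open>p\<close> only.\<close>

lemma lp_block_pk:
 assumes p: "p > 0" and lp: "lp_generator \<phi>"
 obtains C where "C >= 0"
  "!!f s q j x. f \<in> TL_space \<phi> s p q ==> q > 0 ==> cmod (lp_block \<phi> j f x) <= C * pk \<phi> p f j x"
  "!!f s q j x h. f \<in> TL_space \<phi> s p q ==> q > 0 ==> abs h * 2 ^ j <= 1 ==>
    cmod (lp_block \<phi> j f (x + h) - lp_block \<phi> j f x) <= C * (2 ^ j * abs h) * pk \<phi> p f j x"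
  "!!f s q j x. f \<in> TL_space \<phi> s p q ==> q > 0 ==> cmod (gprim \<phi> f j x) <= C * (1 / 2 ^ j) * pk \<phi> p f j x"
proof -
 from band_pointwise[OF lp p] obtain C1 where C1: "C1 >= 0" "!!u x y. band \<phi> p u ==>
  cmod (u y) <= C1 * wt (x - y) ^ wexp p * qavg p u x powr (1 / p)" by metis
 from band_increment[OF lp p] obtain C2 where C2: "C2 >= 0" "!!u x h. band \<phi> p u ==> abs h <= 1 ==>
  cmod (u (x + h) - u x) <= C2 * abs h * qavg p u x powr (1 / p)" by metis
 from bprim_bound[OF lp p] obtain C3 where C3: "C3 >= 0"
  "!!u x. band \<phi> p u ==> cmod (bprim \<phi> u x) <= C3 * qavg p u x powr (1 / p)" by metis
 define C where "C = C1 + C2 + C3"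
 have C: "C >= 0" "C1 <= C" "C2 <= C" "C3 <= C" using C1 C2 C3 by (auto simp: C_def)
 show ?thesis
 proof (rule that[OF C(1)])
  fix f s q j and x :: real assume f: "f \<in> TL_space \<phi> s p q" and q: "q > (0::ennreal)"
  note b = band_ublk(1)[OF f p q lp, of j]
  have "cmod (lp_block \<phi> j f x) <= C1 * pk \<phi> p f j x"
   using C1(2)[OF b, of "2 ^ j * x" "2 ^ j * x"] by (simp add: ublk_def pk_def)
  also have "... <= C * pk \<phi> p f j x" by (intro mult_right_mono C pk_nonneg)
  finally show "cmod (lp_block \<phi> j f x) <= C * pk \<phi> p f j x" .
  have "cmod (gprim \<phi> f j x) = (1 / 2 ^ j) * cmod (bprim \<phi> (ublk \<phi> f j) (2 ^ j * x))"
   by (simp add: gprim_def norm_mult norm_divide norm_power)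
  also have "... <= (1 / 2 ^ j) * (C * pk \<phi> p f j x)"
   using C3(2)[OF b, of "2 ^ j * x"] mult_right_mono[OF C(4) pk_nonneg[of \<phi> p f j x]]
   by (intro mult_left_mono) (auto simp: pk_def)
  finally show "cmod (gprim \<phi> f j x) <= C * (1 / 2 ^ j) * pk \<phi> p f j x" by simp
  fix h :: real assume h: "abs h * 2 ^ j <= 1"
  have "cmod (ublk \<phi> f j (2 ^ j * x + 2 ^ j * h) - ublk \<phi> f j (2 ^ j * x)) <= C2 * abs (2 ^ j * h) * pk \<phi> p f j x"
   unfolding pk_def using h by (intro C2(2)[OF b]) (simp add: abs_mult mult.commute)
  also have "... <= C * abs (2 ^ j * h) * pk \<phi> p f j x" by (intro mult_right_mono C pk_nonneg) auto
  finally show "cmod (lp_block \<phi> j f (x + h) - lp_block \<phi> j f x) <= C * (2 ^ j * abs h) * pk \<phi> p f j x"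
   by (simp add: ublk_def add_divide_distrib abs_mult)
 qed
qed

lemma gprim_diff:
 assumes f: "f \<in> TL_space \<phi> s p q" and p: "p > 0" and q: "q > 0" and lp: "lp_generator \<phi>"
  and j: "2 <= j" and ab: "a <= b"
 shows "gprim \<phi> f j b - gprim \<phi> f j a = (LBINT t. indicator {a<..b} t * lp_block \<phi> j f t)"
proof -
 note b = band_ublk(1)[OF f p q lp, of j]
 obtain D n where D: "!!y. cmod (ublk \<phi> f j y) <= D * wt y ^ n" using b unfolding band_def by blast
 have "bprim \<phi> (ublk \<phi> f j) (2 ^ j * b) - bprim \<phi> (ublk \<phi> f j) (2 ^ j * a) =
   (LBINT t. indicator {2 ^ j * a<..2 ^ j * b} t * ublk \<phi> f j t)"
  by (rule bprim_diff[OF lp band_measurable[OF b] D band_ublk(3)[OF f p q lp j]]) (use ab in simp)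
 also have "... = 2 ^ j *\<^sub>R (LBINT t. indicator {2 ^ j * a<..2 ^ j * b} (0 + 2 ^ j * t) * ublk \<phi> f j (0 + 2 ^ j * t))"
  by (subst lborel_integral_real_affine[where c = "2 ^ j" and t = 0]) auto
 also have "(LBINT t. indicator {2 ^ j * a<..2 ^ j * b} (0 + 2 ^ j * t) * ublk \<phi> f j (0 + 2 ^ j * t)) =
   (LBINT t. indicator {a<..b} t * lp_block \<phi> j f t)"
  by (intro lint_cong refl) (auto simp: ublk_def split: split_indicator)
 finally show ?thesis
  unfolding gprim_def right_diff_distrib[symmetric] by (simp add: scaleR_conv_of_real)
qed

lemma gprim_derivative:
 assumes f: "f \<in> TL_space \<phi> s p q" and p: "p > 0" and q: "q > 0" and lp: "lp_generator \<phi>" and j: "2 <= j"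
 shows "(gprim \<phi> f j has_vector_derivative lp_block \<phi> j f t) (at t)"
proof -
 let ?u = "lp_block \<phi> j f" and ?G = "gprim \<phi> f j"
 have cont: "continuous_on UNIV ?u" by (rule lp_block_continuous[OF TL_spaceD[OF f] lp])
 then have um[measurable]: "?u \<in> borel_measurable borel" by (rule borel_measurable_continuous_onI)
 have main: "cmod (?G b - ?G a - of_real (b - a) * ?u t) <= e * (b - a)"
  if ab: "a <= b" and e: "e >= 0" and close: "!!z. a <= z ==> z <= b ==> cmod (?u z - ?u t) <= e" for a b e
 proof -
  let ?I = "indicator {a<..b} :: real => complex"
  have gi: "integrable lborel ?I" by (intro rapid_integrable rapid_indicator) auto
  have "?I = (%z. complex_of_real (indicator {a<..b} z))" by (auto simp: indicator_def fun_eq_iff)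
  then have "(LBINT z. ?I z) = complex_of_real (LBINT z. indicator {a<..b} z)"
   by (simp only: integral_complex_of_real)
  then have v: "(LBINT z. ?I z) = of_real (b - a)" using ab by simp
  have iu: "integrable lborel (%z. ?I z * ?u z)"
  proof (rule lint_bound[OF integrable_indicator_Ioc[of "cmod (?u t) + e" a b]])
   have "cmod (?I z * ?u z) <= norm ((cmod (?u t) + e) * indicator {a<..b} z)" for z
    using close[of z] norm_triangle_sub[of "?u z" "?u t"] e by (auto split: split_indicator)
   then show "AE z in lborel. cmod (?I z * ?u z) <= norm ((cmod (?u t) + e) * indicator {a<..b} z)" by (rule AE_I2)
  qed measurable
  have "?G b - ?G a - of_real (b - a) * ?u t = (LBINT z. ?I z * (?u z - ?u t))"
   unfolding gprim_diff[OF f p q lp j ab] v[symmetric] right_diff_distrib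
   by (subst lint_diff[OF iu]) (use gi in auto)
  also have "cmod ... <= e * (b - a)"
   by (rule indicator_integral_bound[OF ab e]) (use close in auto)
  finally show ?thesis .
 qed
 have "(?G has_derivative (%h. h *\<^sub>R ?u t)) (at t within UNIV)"
  unfolding has_derivative_within_alt
 proof (intro conjI allI impI)
  show "bounded_linear (%h. h *\<^sub>R ?u t)" by (rule bounded_linear_scaleR_left)
  fix e :: real assume e: "e > 0"
  have "isCont ?u t" using cont by (simp add: continuous_on_eq_continuous_at)
  then obtain d where d: "d > 0" "!!z. abs (z - t) < d ==> cmod (?u z - ?u t) < e"
   using e unfolding continuous_at_eps_delta dist_norm real_norm_def by blast
  have "cmod (?G y - ?G t - (y - t) *\<^sub>R ?u t) <= e * norm (y - t)" if y: "norm (y - t) < d" for y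
  proof (cases "t <= y")
   case True
   have "cmod (?G y - ?G t - of_real (y - t) * ?u t) <= e * (y - t)"
    using e y by (intro main[OF True]) (auto intro!: less_imp_le d(2))
   then show ?thesis using True by (simp add: scaleR_conv_of_real)
  next
   case False
   then have yt: "y <= t" by simp
   have "cmod (?G t - ?G y - of_real (t - y) * ?u t) <= e * (t - y)"
    using e y by (intro main[OF yt]) (auto intro!: less_imp_le d(2))
   moreover have "?G y - ?G t - (y - t) *\<^sub>R ?u t = - (?G t - ?G y - of_real (t - y) * ?u t)"
    by (simp add: scaleR_conv_of_real algebra_simps)
   ultimately show ?thesis using yt by (simp only: norm_minus_cancel) simp
  qed
  then show "\<exists>d>0. \<forall>y\<in>UNIV. norm (y - t) < d \<longrightarrow> norm (?G y - ?G t - (y - t) *\<^sub>R ?u t) <= e * norm (y - t)"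
   using d(1) by blast
 qed
 then show ?thesis by (simp add: has_vector_derivative_def)
qed

section \<open>Pairing with continuously differentiable functions\<close>

lemma integral_by_parts_compact:
 fixes G u h h' :: "real => complex"
 assumes G: "!!t. (G has_vector_derivative u t) (at t)" and u: "continuous_on UNIV u"
  and h: "!!t. (h has_vector_derivative h' t) (at t)" and h': "continuous_on UNIV h'"
  and supp: "!!t. abs t > R ==> h t = 0" "!!t. abs t > R ==> h' t = 0"
 shows "(LBINT t. u t * h t) = - (LBINT t. G t * h' t)"
proof -
 have cG: "continuous_on UNIV G" "continuous_on UNIV h"
  using G h by (meson continuous_at_imp_continuous_on has_vector_derivative_continuous)+
 have int: "integrable lborel F" if "continuous_on UNIV F" "!!t. abs t > R ==> F t = 0" for F :: "real => complex"
  using compact_support_rapid[OF that(1)] that borel_measurable_continuous_onI[OF that(1)]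
  by (intro rapid_integrable) (auto simp: compactly_supported_def)
 have i1: "integrable lborel (%t. G t * h' t)" using cG h' supp by (intro int continuous_intros) auto
 have i2: "integrable lborel (%t. u t * h t)" using cG u supp by (intro int continuous_intros) auto
 have ev: "\<forall>\<^sub>F t in at_top. G t * h t = 0" "\<forall>\<^sub>F t in at_bot. G t * h t = 0"
 proof -
  have z: "G t * h t = 0" if "abs t > R" for t using supp(1)[OF that] by simp
  show "\<forall>\<^sub>F t in at_top. G t * h t = 0"
   using eventually_gt_at_top[of "abs R"] by eventually_elim (rule z, linarith)
  show "\<forall>\<^sub>F t in at_bot. G t * h t = 0"
   using eventually_gt_at_bot[of "- abs R"] by eventually_elim (rule z, linarith)
 qed
 have "(LBINT t. G t * h' t + u t * h t) = 0 - 0"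
 proof (rule integral_FTC_line[of "%t. G t * h t"])
  show "((%t. G t * h t) has_vector_derivative G t * h' t + u t * h t) (at t)" for t
   by (intro has_vector_derivative_mult G h)
  show "continuous_on UNIV (%t. G t * h' t + u t * h t)" by (intro continuous_intros cG u h')
  show "integrable lborel (%t. G t * h' t + u t * h t)" using i1 i2 by simp
 qed (use ev in \<open>auto intro: tendsto_eventually\<close>)
 then show ?thesis using i1 i2 by (simp add: add_eq_0_iff add.commute)
qed

text \<open>The continuously differentiable functions supported in \<open>[-R, R]\<close>. The pairing below is continuous in their total variation.\<close>

definition csmooth1 :: "real => (real => complex) => bool" where
 "csmooth1 R h \<longleftrightarrow> C_k 1 h \<and> (\<forall>t. abs t > R \<longrightarrow> h t = 0)"

lemma csmooth1D:
 assumes "csmooth1 R h"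
 shows "(h has_vector_derivative vderiv 1 h t) (at t)" "continuous_on UNIV (vderiv 1 h)"
  "continuous_on UNIV h" "abs t > R ==> h t = 0" "abs t > R ==> vderiv 1 h t = 0"
  "integrable lborel h" "integrable lborel (vderiv 1 h)"
proof -
 have ck: "C_k 1 h" using assms by (simp add: csmooth1_def)
 show 1: "(h has_vector_derivative vderiv 1 h t) (at t)" using C_k_has_vderiv[OF ck, of 0] by simp
 show 2: "continuous_on UNIV (vderiv 1 h)" using C_k_continuous_vderiv[OF ck, of 1] by simp
 show 3: "continuous_on UNIV h" using C_k_continuous_vderiv[OF ck, of 0] by simp
 show "abs t > R ==> h t = 0" using assms by (simp add: csmooth1_def)
 have 5: "abs t > R ==> vderiv 1 h t = 0" for t
  using vderiv_support[OF ck, of R 1 t] assms by (simp add: csmooth1_def)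
 show "abs t > R ==> vderiv 1 h t = 0" by (rule 5)
 have cs: "compactly_supported h" "compactly_supported (vderiv 1 h)"
  using assms 5 unfolding csmooth1_def compactly_supported_def by blast+
 show "integrable lborel h" "integrable lborel (vderiv 1 h)"
  using compact_support_rapid[OF 3 cs(1)] compact_support_rapid[OF 2 cs(2)]
   borel_measurable_continuous_onI[OF 3] borel_measurable_continuous_onI[OF 2] rapid_integrable by blast+
qed

definition cpair :: "(real => complex) => distribution => (real => complex) => complex" where
 "cpair \<phi> f h = (\<Sum>j. LBINT t. lp_block \<phi> j f t * h t)"

text \<open>By Bernstein, the antiderivative of the \<open>j\<close>-th block is bounded by a multiple of \<open>2^(j (1/p - 1 - s))\<close>, and the exponent is negative. Integration by parts transfers this to pairings.\<close>

lemma lp_block_pairing_bound: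
 assumes f: "f \<in> TL_space \<phi> s p q" and p: "p > 0" and q: "q > 0" and lp: "lp_generator \<phi>"
  and s: "1 / p - 1 < s"
 obtains b where "summable b" "!!j. b j >= 0"
  "!!j h R. 2 <= j ==> csmooth1 R h ==>
   cmod (LBINT t. lp_block \<phi> j f t * h t) <= b j * (LBINT t. cmod (vderiv 1 h t))"
  "!!j x. cmod (gprim \<phi> f j x) <= b j"
  "!!j. \<exists>B. \<forall>x. cmod (lp_block \<phi> j f x) <= B"
proof -
 from lp_block_pk[OF p lp] obtain C where C: "C >= 0"
  "!!f s q j x. f \<in> TL_space \<phi> s p q ==> q > 0 ==> cmod (lp_block \<phi> j f x) <= C * pk \<phi> p f j x"
  "!!f s q j x. f \<in> TL_space \<phi> s p q ==> q > 0 ==> cmod (gprim \<phi> f j x) <= C * (1 / 2 ^ j) * pk \<phi> p f j x"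
  by metis
 define b where "b j = (C * TLB \<phi> s p q f) * (2 powr (1 / p - 1 - s)) ^ j" for j :: nat
 have gb: "cmod (gprim \<phi> f j x) <= b j" for j x
 proof -
  have "cmod (gprim \<phi> f j x) <= C * (1 / 2 ^ j) * pk \<phi> p f j x" by (rule C(3)[OF f q])
  also have "... <= C * (1 / 2 ^ j) * (2 powr (real j * (1 / p - s)) * TLB \<phi> s p q f)"
   using C(1) by (intro mult_left_mono pk_le[OF f p q lp]) auto
  also have "... = (C * TLB \<phi> s p q f) * (2 powr (real j * (1 / p - s)) / 2 powr (real j))"
   by (simp add: powr_two_nat)
  also have "2 powr (real j * (1 / p - s)) / 2 powr (real j) = (2 powr (1 / p - 1 - s)) ^ j"
   by (simp add: powr_diff[symmetric] powr_realpow[symmetric] powr_powr algebra_simps)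
  finally show ?thesis by (simp add: b_def)
 qed
 have "2 powr (1 / p - 1 - s) < 2 powr (0::real)" using s by (intro powr_less_mono) auto
 then have "summable b" unfolding b_def by (intro summable_mult summable_geometric) simp
 moreover have b0: "b j >= 0" for j unfolding b_def using C TLB_nonneg by simp
 moreover have "cmod (LBINT t. lp_block \<phi> j f t * h t) <= b j * (LBINT t. cmod (vderiv 1 h t))"
  if j: "2 <= j" and h: "csmooth1 R h" for j h R
 proof -
  note hD = csmooth1D[OF h]
  have Gd: "(gprim \<phi> f j has_vector_derivative lp_block \<phi> j f t) (at t)" for t
   by (rule gprim_derivative[OF f p q lp j])
  have "(LBINT t. lp_block \<phi> j f t * h t) = - (LBINT t. gprim \<phi> f j t * vderiv 1 h t)"
   by (rule integral_by_parts_compact[OF Gd lp_block_continuous[OF TL_spaceD[OF f] lp] hD(1,2,4,5)])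
  then have "cmod (LBINT t. lp_block \<phi> j f t * h t) <= (LBINT t. cmod (gprim \<phi> f j t * vderiv 1 h t))"
   by simp
  also have "... <= (LBINT t. b j * cmod (vderiv 1 h t))"
  proof (rule integral_mono)
   have "continuous_on UNIV (gprim \<phi> f j)"
    using Gd by (meson continuous_at_imp_continuous_on has_vector_derivative_continuous)
   then have [measurable]: "gprim \<phi> f j \<in> borel_measurable borel" by (rule borel_measurable_continuous_onI)
   have le: "cmod (gprim \<phi> f j t * vderiv 1 h t) <= b j * cmod (vderiv 1 h t)" for t
    unfolding norm_mult by (intro mult_right_mono gb) auto
   then show "cmod (gprim \<phi> f j t * vderiv 1 h t) <= b j * cmod (vderiv 1 h t)" for t .
   show i: "integrable lborel (%t. b j * cmod (vderiv 1 h t))"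
    by (intro integrable_mult_right integrable_norm hD)
   note [measurable] = borel_measurable_integrable[OF hD(7)]
   show "integrable lborel (%t. cmod (gprim \<phi> f j t * vderiv 1 h t))"
   proof (rule lint_bound[OF i])
    show "AE t in lborel. norm (cmod (gprim \<phi> f j t * vderiv 1 h t)) <= norm (b j * cmod (vderiv 1 h t))"
     using le b0 by (intro AE_I2) (simp add: abs_mult)
   qed measurable
  qed
  finally show ?thesis by simp
 qed
 moreover have "\<exists>B. \<forall>x. cmod (lp_block \<phi> j f x) <= B" for j
  using order_trans[OF C(2)[OF f q] mult_left_mono[OF pk_le[OF f p q lp] C(1)]] by blast
 ultimately show ?thesis using that[of b] gb by blast
qed

lemma integrable_bounded_mult:
 fixes u h :: "real => complex"
 assumes "u \<in> borel_measurable borel" "!!x. cmod (u x) <= B" "integrable lborel h"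
 shows "integrable lborel (%t. u t * h t)"
proof -
 have B: "B >= 0" using order_trans[OF norm_ge_zero assms(2)] .
 have i: "integrable lborel (%t. B * cmod (h t))" by (intro integrable_mult_right integrable_norm assms)
 note [measurable] = assms(1) borel_measurable_integrable[OF assms(3)]
 have le: "cmod (u t * h t) <= norm (B * cmod (h t))" for t
  unfolding norm_mult using mult_right_mono[OF assms(2)[of t] norm_ge_zero[of "h t"]] B by simp
 show ?thesis
  by (rule lint_bound[OF i _ AE_I2[OF le]]) measurable
qed

lemma csmooth1_test: "test_function \<eta> ==> \<exists>R. csmooth1 R \<eta>"
 unfolding test_function_iff smooth_def csmooth1_def compactly_supported_def by blast

text \<open>Fixes one element of the space above the critical smoothness. Constants that must be uniform in \<open>f\<close> are introduced outside this locale.\<close>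

locale TL_element =
 fixes \<phi> :: "real => complex" and s p :: real and q :: ennreal and f :: distribution
 assumes f: "f \<in> TL_space \<phi> s p q" and p: "p > 0" and q: "q > 0" and lp: "lp_generator \<phi>"
  and s: "1 / p - 1 < s"
begin

abbreviation "u \<equiv> lp_block \<phi>"

lemmas tf = TL_spaceD[OF f]
lemmas u_borel [measurable] = lp_block_borel[OF tf lp]

definition bd :: "nat => real" where
 "bd = (SOME b. summable b \<and> (\<forall>j. b j >= 0) \<and>
  (\<forall>j h R. 2 <= j \<longrightarrow> csmooth1 R h \<longrightarrow>
   cmod (LBINT t. u j f t * h t) <= b j * (LBINT t. cmod (vderiv 1 h t))) \<and>
  (\<forall>j x. cmod (gprim \<phi> f j x) <= b j))"

lemma bd: "summable bd" "bd j >= 0"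
  "2 <= j ==> csmooth1 R h ==> cmod (LBINT t. u j f t * h t) <= bd j * (LBINT t. cmod (vderiv 1 h t))"
  "cmod (gprim \<phi> f j x) <= bd j"
proof -
 have "\<exists>b. summable b \<and> (\<forall>j. b j >= 0) \<and>
  (\<forall>j h R. 2 <= j \<longrightarrow> csmooth1 R h \<longrightarrow>
   cmod (LBINT t. u j f t * h t) <= b j * (LBINT t. cmod (vderiv 1 h t))) \<and>
  (\<forall>j x. cmod (gprim \<phi> f j x) <= b j)"
  using lp_block_pairing_bound[OF f p q lp s] by metis
 from someI_ex[OF this] show "summable bd" "bd j >= 0"
  "2 <= j ==> csmooth1 R h ==> cmod (LBINT t. u j f t * h t) <= bd j * (LBINT t. cmod (vderiv 1 h t))"
  "cmod (gprim \<phi> f j x) <= bd j"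
  unfolding bd_def[symmetric] by blast+
qed

lemma u_bounded: "\<exists>B. \<forall>x. cmod (u j f x) <= B"
 using lp_block_pairing_bound[OF f p q lp s] by metis

lemma u_mult_integrable: "integrable lborel h ==> integrable lborel (%t. u j f t * h t)"
 using u_bounded[of j] integrable_bounded_mult[OF u_borel] by blast

lemma cpair_sums:
 assumes h: "csmooth1 R h"
 shows "(%j. LBINT t. u j f t * h t) sums cpair \<phi> f h"
proof -
 have "summable (%j. bd j * (LBINT t. cmod (vderiv 1 h t)))" by (intro summable_mult2 bd)
 then have "summable (%j. LBINT t. u j f t * h t)"
  by (rule summable_comparison_test[rotated]) (use bd(3)[OF _ h] in blast)
 then show ?thesis unfolding cpair_def by (rule summable_sums)
qed

lemma test_function_pairing:
 assumes \<eta>: "test_function \<eta>" shows "f \<eta> = cpair \<phi> f \<eta>"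
proof -
 obtain R where h: "csmooth1 R \<eta>" using csmooth1_test[OF \<eta>] by blast
 have "(LBINT x. \<eta> x * dconv f (low \<phi> J) x) = (\<Sum>j\<le>J. LBINT t. u j f t * \<eta> t)" for J
 proof -
  have "(LBINT x. \<eta> x * dconv f (low \<phi> J) x) = (LBINT x. (\<Sum>j\<le>J. u j f x * \<eta> x))"
   unfolding dconv_low_eq_sum[OF tf lp] by (simp add: sum_distrib_left mult.commute)
  also have "... = (\<Sum>j\<le>J. LBINT t. u j f t * \<eta> t)"
   by (intro lint_sum u_mult_integrable test_function_integrable \<eta>)
  finally show ?thesis .
 qed
 then have "(%j. LBINT t. u j f t * \<eta> t) sums f \<eta>"
  using calderon_reproducing[OF tf lp \<eta>] by (simp add: sums_def_le)
 then show ?thesis using cpair_sums[OF h] sums_unique2 by blast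
qed

lemma integrable_const_indicator: "integrable lborel (%t. B * indicator {-R..R::real} t :: real)"
 by (cases "R >= 0") (auto intro!: integrable_mult_right integrable_real_indicator)

text \<open>Dominated convergence, once for each block with the bound \<open>H\<close> and once for the series over the blocks with the bound \<open>V\<close> for the variations. The limit \<open>g\<close> may have jumps.\<close>

lemma cpair_limit:
 assumes h: "!!n. csmooth1 R (h n)" and lim: "AE t in lborel. (%n. h n t) \<longlonglongrightarrow> g t"
  and g[measurable]: "g \<in> borel_measurable borel"
  and H: "!!n t. cmod (h n t) <= H" and V: "!!n. (LBINT t. cmod (vderiv 1 (h n) t)) <= V"
 shows "(%n. cpair \<phi> f (h n)) \<longlonglongrightarrow> (\<Sum>j. LBINT t. u j f t * g t)"
proof -
 have L: "(%n. LBINT t. u j f t * h n t) \<longlonglongrightarrow> (LBINT t. u j f t * g t)" for j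
 proof -
  obtain B where B: "!!x. cmod (u j f x) <= B" using u_bounded[of j] by blast
  have B0: "B >= 0" using order_trans[OF norm_ge_zero B] .
  note [measurable] = borel_measurable_integrable[OF csmooth1D(6)[OF h]]
  show ?thesis
  proof (rule integral_dominated_convergence[where w = "%t. (B * H) * indicator {-R..R} t"])
   show "AE t in lborel. (%n. u j f t * h n t) \<longlonglongrightarrow> u j f t * g t"
    using lim by eventually_elim (intro tendsto_intros)
   show "AE t in lborel. cmod (u j f t * h n t) <= (B * H) * indicator {-R..R} t" for n
   proof (rule AE_I2)
    fix t
    show "cmod (u j f t * h n t) <= (B * H) * indicator {-R..R} t"
    proof (cases "abs t > R")
     case True
     then show ?thesis using csmooth1D(4)[OF h True, of n] by (auto simp: indicator_def)
    next
     case False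
     then have "t \<in> {-R..R}" by auto
     then show ?thesis using mult_mono[OF B[of t] H[of n t] B0] by (simp add: norm_mult)
    qed
   qed
   show "integrable lborel (%t. (B * H) * indicator {-R..R} t)" by (rule integrable_const_indicator)
   show "(%t. u j f t * g t) \<in> borel_measurable lborel" by measurable
   show "(%t. u j f t * h n t) \<in> borel_measurable lborel" for n by measurable
  qed
 qed
 have ev: "\<forall>\<^sub>F (j, n) in at_top \<times>\<^sub>F sequentially. cmod (LBINT t. u j f t * h n t) <= bd j * V"
  unfolding eventually_prod_filter
 proof (intro exI conjI allI impI)
  show "\<forall>\<^sub>F j in at_top. (2::nat) <= j" by (rule eventually_ge_at_top)
  show "\<forall>\<^sub>F n in sequentially. True" by simp
  fix j n :: nat assume j: "2 <= j"
  have "cmod (LBINT t. u j f t * h n t) <= bd j * (LBINT t. cmod (vderiv 1 (h n) t))"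
   by (rule bd(3)[OF j h])
  also have "... <= bd j * V" by (intro mult_left_mono V bd)
  finally show "case (j, n) of (j, n) => cmod (LBINT t. u j f t * h n t) <= bd j * V" by simp
 qed
 have "summable (%j. bd j * V)" by (intro summable_mult2 bd)
 from tannerys_theorem[OF L ev this] show ?thesis unfolding cpair_def by simp
qed

end

section \<open>Mollification\<close>

lemma uniformly_continuous_compact_support:
 fixes g :: "real => complex"
 assumes "continuous_on UNIV g" "!!x. abs x > R ==> g x = 0" "e > 0"
 obtains d where "d > 0" "!!x y. abs (x - y) < d ==> cmod (g x - g y) < e"
proof -
 have "uniformly_continuous_on {-(abs R+1)..abs R+1} g"
  by (intro compact_uniformly_continuous continuous_on_subset[OF assms(1)]) auto
 then obtain d where d: "d > 0" "!!x y. x \<in> {-(abs R+1)..abs R+1} ==> y \<in> {-(abs R+1)..abs R+1} ==> dist x y < d ==> dist (g x) (g y) < e"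
  using assms(3) unfolding uniformly_continuous_on_def by (metis dist_commute)
 have "cmod (g x - g y) < e" if xy: "abs (x - y) < min d 1" for x y
 proof (cases "x \<in> {-(abs R+1)..abs R+1} \<and> y \<in> {-(abs R+1)..abs R+1}")
  case True
  then show ?thesis using d(2)[of x y] xy by (simp add: dist_norm)
 next
  case False
  then have "abs x > R" "abs y > R" using xy by (auto simp: min_def split: if_splits)
  then show ?thesis using assms(2,3) by simp
 qed
 then show ?thesis using that[of "min d 1"] d(1) by simp
qed

text \<open>The square of the modulus of \<open>\<phi>\<close>, divided by its integral, is such a bump, since \<open>\<phi>\<close> itself has compact support.\<close>

lemma bump_exists:
 assumes "lp_generator \<phi>"
 obtains \<rho> where "test_function \<rho>" "(LBINT x. \<rho> x) = 1" "!!x. abs x > 2 ==> \<rho> x = 0"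
proof -
 have t\<phi>: "test_function \<phi>" by (rule lp_generator_test_function[OF assms])
 let ?g = "%x. cnj (\<phi> x) * \<phi> x"
 have tg: "test_function ?g" using test_function_mult[OF t\<phi> smooth_cnj] t\<phi> test_function_iff by blast
 have ig: "integrable lborel ?g" by (rule test_function_integrable[OF tg])
 have gr: "?g x = of_real ((cmod (\<phi> x))\<^sup>2)" for x
  by (simp only: complex_norm_square mult.commute)
 have "(LBINT x. ?g x) = of_real (LBINT x. (cmod (\<phi> x))\<^sup>2)"
  unfolding gr by (simp only: integral_complex_of_real)
 moreover have "(LBINT x. (cmod (\<phi> x))\<^sup>2) >= (LBINT x. 1 * indicator {0<..1::real} x)"
 proof (rule integral_mono)
  show "integrable lborel (%x. 1 * indicator {0<..1::real} x :: real)" by (rule integrable_indicator_Ioc)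
  show "integrable lborel (%x. (cmod (\<phi> x))\<^sup>2)" using ig unfolding gr complex_of_real_integrable_eq .
  show "1 * indicator {0<..1::real} x <= (cmod (\<phi> x))\<^sup>2" for x
   using assms by (auto simp: lp_generator_def indicator_def)
 qed
 ultimately have nz: "(LBINT x. ?g x) \<noteq> 0" by auto
 let ?c = "1 / (LBINT x. ?g x)"
 have sc: "smooth (%x. ?c)"
  using smooth_intro(1)[of "%n x. if n = 0 then ?c else 0"] by auto
 have "test_function (%x. ?c * ?g x)" by (rule test_function_mult[OF tg sc])
 moreover have "(LBINT x. ?c * ?g x) = 1" using nz by simp
 moreover have "?c * ?g x = 0" if "abs x > 2" for x using that assms by (simp add: lp_generator_def)
 ultimately show ?thesis using that by blast
qed

text \<open>Mollification. The functions are smooth because they are also convolutions with the dilated bump as Schwartz kernel, and their derivatives converge uniformly because those of \<open>h\<close> are uniformly continuous.\<close>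

lemma CK_approximation:
 assumes lp: "lp_generator \<phi>" and h: "C_k K h" "!!x. abs x > R ==> h x = 0"
 obtains G where "!!n. test_function (G n)" "CK_converges K G h"
proof -
 from bump_exists[OF lp] obtain \<rho> where \<rho>: "test_function \<rho>" "(LBINT x. \<rho> x) = 1" "!!x. abs x > 2 ==> \<rho> x = 0"
  by metis
 note [measurable] = test_function_measurable[OF \<rho>(1)]
 have i\<rho>: "integrable lborel \<rho>" by (rule test_function_integrable[OF \<rho>(1)])
 have hc: "continuous_on UNIV (vderiv l h)" if "l <= K" for l by (rule C_k_continuous_vderiv[OF h(1) that])
 have hs: "abs x > R ==> vderiv l h x = 0" if "l <= K" for l x by (rule vderiv_support[OF h(1) _ that]) (use h(2) in auto)
 have hb: "\<exists>B. \<forall>x. cmod (vderiv l h x) <= B" if l: "l <= K" for l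
 proof -
  have "rapid (vderiv l h)" using hs[OF l] by (intro compact_support_rapid hc l) (auto simp: compactly_supported_def)
  from rapidD[OF this, of 0] show ?thesis by auto
 qed
 define D where "D n l y = (LBINT w. vderiv l h (y - w / real (Suc n)) * \<rho> w)" for n l y
 define G where "G n = D n 0" for n
 have int: "integrable lborel (%w. vderiv l h (y - w / real (Suc n)) * \<rho> w)" if l: "l <= K" for l y n
 proof -
  obtain B where B: "!!x. cmod (vderiv l h x) <= B" using hb[OF l] by blast
  have [measurable]: "vderiv l h \<in> borel_measurable borel" by (rule borel_measurable_continuous_onI[OF hc[OF l]])
  show ?thesis by (rule integrable_bounded_mult[OF _ B i\<rho>]) measurable
 qed
 have der: "(D n l has_vector_derivative D n (Suc l) y) (at y)" if l: "l < K" for n l y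
 proof -
  obtain B where B: "!!x. cmod (vderiv (Suc l) h x) <= B" using hb[of "Suc l"] l by auto
  have [measurable]: "vderiv (Suc l) h \<in> borel_measurable borel"
   using l by (intro borel_measurable_continuous_onI[OF hc]) simp
  show ?thesis unfolding D_def
  proof (rule has_vector_derivative_integral[where W = "%w. B * cmod (\<rho> w)"])
   fix t z
   have "((%t. t - z / real (Suc n)) has_vector_derivative 1) (at t)" by (auto intro!: derivative_eq_intros)
   from vector_diff_chain_at[OF this C_k_has_vderiv[OF h(1) l]]
   have "((%t. vderiv l h (t - z / real (Suc n))) has_vector_derivative vderiv (Suc l) h (t - z / real (Suc n))) (at t)"
    by (simp add: o_def)
   then show "((%t. vderiv l h (t - z / real (Suc n)) * \<rho> z) has_vector_derivative
    vderiv (Suc l) h (t - z / real (Suc n)) * \<rho> z) (at t)"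
    by (rule has_vector_derivative_mult_left)
   show "cmod (vderiv (Suc l) h (t - z / real (Suc n)) * \<rho> z) <= B * cmod (\<rho> z)"
    unfolding norm_mult by (intro mult_right_mono B) auto
  qed (use int[of l] l i\<rho> in auto)
 qed
 have vG: "vderiv l (G n) = D n l" if "l <= K" for n l
  unfolding G_def using C_k_intro(1)[of K "D n", OF der that] .
 have supp: "G n x = 0" if "abs x > R + 2" for n x
 proof -
  have "vderiv 0 h (x - w / real (Suc n)) * \<rho> w = 0" for w
  proof (cases "abs w > 2")
   case False
   have "abs (w / real (Suc n)) <= abs w / 1" unfolding abs_divide by (rule divide_left_mono) auto
   then have "abs (x - w / real (Suc n)) > R" using False that by linarith
   then show ?thesis using h(2) by simp
  qed (use \<rho>(3) in simp)
  then have "(%w. vderiv 0 h (x - w / real (Suc n)) * \<rho> w) = (%w. 0)" by (rule ext)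
  then show ?thesis unfolding G_def D_def by (simp only: Bochner_Integration.integral_zero)
 qed
 have test: "test_function (G n)" for n
 proof -
  let ?n = "real (Suc n)"
  define \<alpha> where "\<alpha> z = h (- z)" for z
  define b where "b t = ?n * \<rho> (- ?n * t)" for t
  have \<alpha>c: "continuous_on UNIV \<alpha>" unfolding \<alpha>_def
   using hc[of 0] by (auto intro!: continuous_on_compose2[of UNIV h] continuous_intros)
  have r\<alpha>: "rapid \<alpha>"
   using h(2) by (intro compact_support_rapid[OF \<alpha>c]) (auto simp: compactly_supported_def \<alpha>_def intro!: exI[of _ R])
  have sb: "schwartz b"
   unfolding b_def using schwartz_cmult[OF schwartz_affine[OF test_function_schwartz[OF \<rho>(1)], of "- ?n" 0]] by simp
  have "G n y = (LBINT z. \<alpha> z * b (0 - z - y))" for y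
  proof -
   have "(LBINT z. \<alpha> z * b (0 - z - y)) = (1 / ?n) *\<^sub>R (LBINT w. \<alpha> (-y + (1 / ?n) * w) * b (0 - (-y + (1 / ?n) * w) - y))"
    by (subst lborel_integral_real_affine[where c = "1 / ?n" and t = "-y"]) auto
   also have "... = (LBINT w. (1 / ?n) *\<^sub>R (\<alpha> (-y + (1 / ?n) * w) * b (0 - (-y + (1 / ?n) * w) - y)))" by simp
   also have "... = G n y" unfolding G_def D_def
   proof (intro lint_cong refl)
    fix w
    have n0: "?n \<noteq> 0" by simp
    have "0 - (-y + (1 / ?n) * w) - y = - (w / ?n)" by simp
    moreover have "- ?n * - (w / ?n) = w" using n0 by (simp del: of_nat_Suc)
    ultimately have "b (0 - (-y + (1 / ?n) * w) - y) = of_real ?n * \<rho> w" by (simp add: b_def del: of_nat_Suc)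
    moreover have "\<alpha> (-y + (1 / ?n) * w) = h (y - w / ?n)" by (simp add: \<alpha>_def del: of_nat_Suc)
    ultimately show "(1 / ?n) *\<^sub>R (\<alpha> (-y + (1 / ?n) * w) * b (0 - (-y + (1 / ?n) * w) - y)) = vderiv 0 h (y - w / ?n) * \<rho> w"
     using n0 by (simp add: scaleR_conv_of_real del: of_nat_Suc)
   qed
   finally show ?thesis by simp
  qed
  then have "G n = (%y. LBINT z. \<alpha> z * b (0 - z - y))" by blast
  then have "schwartz (G n)"
   using convolution_schwartz(1)[OF r\<alpha> borel_measurable_continuous_onI[OF \<alpha>c] sb, of 0] by simp
  then show ?thesis
   unfolding test_function_iff schwartz_iff compactly_supported_def using supp by blast
 qed
 have unif: "uniform_limit UNIV (%n. vderiv l (G n)) (vderiv l h) sequentially" if l: "l <= K" for l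
  unfolding uniform_limit_iff
 proof (intro allI impI)
  fix e :: real assume e: "e > 0"
  define M where "M = (LBINT w. cmod (\<rho> w))"
  have M: "M >= 0" unfolding M_def by simp
  have e1: "e / (2 * (M + 1)) > 0" using e M by simp
  obtain d where d: "d > 0" "!!x y. abs (x - y) < d ==> cmod (vderiv l h x - vderiv l h y) < e / (2 * (M + 1))"
   using uniformly_continuous_compact_support[OF hc[OF l] hs[OF l] e1] by blast
  obtain n0 :: nat where n0: "2 / d < real n0" using reals_Archimedean2 by blast
  show "\<forall>\<^sub>F n in sequentially. \<forall>x\<in>UNIV. dist (vderiv l (G n) x) (vderiv l h x) < e"
  proof (rule eventually_sequentiallyI[of n0], rule ballI)
   fix n x assume n: "n0 <= n"
   have "2 / d < real (Suc n)" using n0 n by linarith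
   then have gap: "2 / real (Suc n) < d" using d(1) by (simp add: divide_less_eq mult.commute)
   have "D n l x - vderiv l h x = (LBINT w. (vderiv l h (x - w / real (Suc n)) - vderiv l h x) * \<rho> w)"
    unfolding left_diff_distrib D_def using \<rho>(2) i\<rho> by (subst lint_diff[OF int[OF l]]) auto
   also have "cmod ... <= (LBINT w. cmod ((vderiv l h (x - w / real (Suc n)) - vderiv l h x) * \<rho> w))"
    by (rule integral_norm_bound)
   also have "... <= (LBINT w. (e / (2 * (M + 1))) * cmod (\<rho> w))"
   proof (rule integral_mono)
    show "integrable lborel (%w. cmod ((vderiv l h (x - w / real (Suc n)) - vderiv l h x) * \<rho> w))"
     unfolding left_diff_distrib by (intro integrable_norm Bochner_Integration.integrable_diff int l integrable_mult_right i\<rho>)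
    show "integrable lborel (%w. (e / (2 * (M + 1))) * cmod (\<rho> w))"
     by (intro integrable_mult_right integrable_norm i\<rho>)
    fix w
    show "cmod ((vderiv l h (x - w / real (Suc n)) - vderiv l h x) * \<rho> w) <= (e / (2 * (M + 1))) * cmod (\<rho> w)"
    proof (cases "abs w > 2")
     case False
     then have "abs w / real (Suc n) <= 2 / real (Suc n)" by (intro divide_right_mono) auto
     then have "abs ((x - w / real (Suc n)) - x) < d" using gap by (simp add: abs_divide del: of_nat_Suc)
     from d(2)[OF this] show ?thesis unfolding norm_mult by (intro mult_right_mono) auto
    qed (use \<rho>(3) in simp)
   qed
   also have "... = (e / (2 * (M + 1))) * M" by (simp add: M_def)
   also have "... <= (e / (2 * (M + 1))) * (M + 1)" using e1 by (intro mult_left_mono) auto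
   also have "... = e / 2" using M by (simp add: field_simps)
   also have "... < e" using e by simp
   finally show "dist (vderiv l (G n) x) (vderiv l h x) < e" unfolding vG[OF l] dist_norm .
  qed
 qed
 have "CK_converges K G h" unfolding CK_converges_def using supp unif by blast
 then show ?thesis using that test by blast
qed

context TL_element
begin

lemma test_function_csmooth1: "test_function g ==> (!!x. abs x > R ==> g x = 0) ==> csmooth1 R g"
 by (simp add: csmooth1_def test_function_iff smooth_def)

lemma CK_converges_bounds:
 assumes G: "!!n. test_function (G n)" and conv: "CK_converges K G h" and K: "K >= 1"
  and h: "C_k K h" "!!x. abs x > R ==> h x = 0"
 obtains n0 R' H V where "!!n. csmooth1 R' (G n)" "!!t. (%n. G n t) \<longlonglongrightarrow> h t"
  "!!n t. n >= n0 ==> cmod (G n t) <= H" "!!n. n >= n0 ==> (LBINT t. cmod (vderiv 1 (G n) t)) <= V"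
proof -
 obtain R' where R': "!!n x. abs x > R' ==> G n x = 0" using conv unfolding CK_converges_def by blast
 have cs: "csmooth1 R' (G n)" for n by (rule test_function_csmooth1[OF G R'])
 have hb: "\<exists>B. \<forall>x. cmod (vderiv l h x) <= B" if l: "l <= K" for l
 proof -
  have "abs x > R ==> vderiv l h x = 0" for x by (rule vderiv_support[OF h(1) _ l]) (use h(2) in auto)
  then have "rapid (vderiv l h)" using l
   by (intro compact_support_rapid C_k_continuous_vderiv[OF h(1)]) (auto simp: compactly_supported_def)
  from rapidD[OF this, of 0] show ?thesis by auto
 qed
 obtain B0 B1 where B: "!!x. cmod (h x) <= B0" "!!x. cmod (vderiv 1 h x) <= B1"
  using hb[of 0] hb[of 1] K by auto
 have u0: "uniform_limit UNIV G h sequentially" and u1: "uniform_limit UNIV (%n. vderiv 1 (G n)) (vderiv 1 h) sequentially"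
  using conv K unfolding CK_converges_def by (force dest: spec[of _ 0], force dest: spec[of _ 1])
 have "\<forall>\<^sub>F n in sequentially. (\<forall>x\<in>UNIV. dist (G n x) (h x) < 1) \<and> (\<forall>x\<in>UNIV. dist (vderiv 1 (G n) x) (vderiv 1 h x) < 1)"
  using u0 u1 unfolding uniform_limit_iff by (intro eventually_conj) auto
 then obtain n0 where n0: "!!n x. n >= n0 ==> dist (G n x) (h x) < 1"
  "!!n x. n >= n0 ==> dist (vderiv 1 (G n) x) (vderiv 1 h x) < 1"
  unfolding eventually_sequentially by blast
 have b0: "cmod (G n t) <= B0 + 1" if "n >= n0" for n t
  using n0(1)[OF that, of t] B(1)[of t] norm_triangle_sub[of "G n t" "h t"] by (simp add: dist_norm)
 have b1: "cmod (vderiv 1 (G n) t) <= B1 + 1" if "n >= n0" for n t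
  using n0(2)[OF that, of t] B(2)[of t] norm_triangle_sub[of "vderiv 1 (G n) t" "vderiv 1 h t"] by (simp add: dist_norm)
 have V: "(LBINT t. cmod (vderiv 1 (G n) t)) <= (LBINT t. (B1 + 1) * indicator {-R'..R'} t)" if "n >= n0" for n
 proof (rule integral_mono)
  show "integrable lborel (%t. cmod (vderiv 1 (G n) t))" by (intro integrable_norm csmooth1D[OF cs])
  show "integrable lborel (%t. (B1 + 1) * indicator {-R'..R'} t)" by (rule integrable_const_indicator)
  show "cmod (vderiv 1 (G n) t) <= (B1 + 1) * indicator {-R'..R'} t" for t
   using b1[OF that, of t] csmooth1D(5)[OF cs, of t n] by (cases "abs t > R'") (auto simp: indicator_def)
 qed
 have lim: "(%n. G n t) \<longlonglongrightarrow> h t" for t using tendsto_uniform_limitI[OF u0] by simp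
 show ?thesis by (rule that[OF cs lim b0 V])
qed

lemma CK_limit:
 assumes G: "!!n. test_function (G n)" and conv: "CK_converges K G h" and K: "K >= 1"
  and h: "C_k K h" "!!x. abs x > R ==> h x = 0"
 shows "(%n. f (G n)) \<longlonglongrightarrow> cpair \<phi> f h"
proof -
 from CK_converges_bounds[OF assms] obtain n0 R' H V where
  b: "!!n. csmooth1 R' (G n)" "!!t. (%n. G n t) \<longlonglongrightarrow> h t"
  "!!n t. n >= n0 ==> cmod (G n t) <= H" "!!n. n >= n0 ==> (LBINT t. cmod (vderiv 1 (G n) t)) <= V"
  by metis
 have hm: "h \<in> borel_measurable borel"
  using C_k_continuous_vderiv[OF h(1), of 0] by (intro borel_measurable_continuous_onI) simp
 have "(%n. cpair \<phi> f (G (n + n0))) \<longlonglongrightarrow> cpair \<phi> f h"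
  unfolding cpair_def[of \<phi> f h]
 proof (rule cpair_limit[where R = R' and H = H and V = V])
  show "AE t in lborel. (%n. G (n + n0) t) \<longlonglongrightarrow> h t"
   by (rule AE_I2, rule LIMSEQ_ignore_initial_segment, rule b)
 qed (use b hm in auto)
 then have "(%n. cpair \<phi> f (G n)) \<longlonglongrightarrow> cpair \<phi> f h" by (rule LIMSEQ_offset)
 then show ?thesis using test_function_pairing[OF G] by simp
qed

text \<open>Every approximating sequence gives the value \<open>cpair\<close> in the limit, and an approximating sequence exists; so the definite description has a value, and it is this one.\<close>

lemma CK_pairing_eq_cpair:
 assumes K: "K >= 1" and h: "C_k K h" "!!x. abs x > R ==> h x = 0"
 shows "CK_pairing K f h = cpair \<phi> f h"
 unfolding CK_pairing_def
proof (rule the_equality)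
 show "\<forall>G. (\<forall>n. test_function (G n)) \<and> CK_converges K G h \<longrightarrow> (%n. f (G n)) \<longlonglongrightarrow> cpair \<phi> f h"
  using CK_limit[OF _ _ K h] by blast
 fix v assume v: "\<forall>G. (\<forall>n. test_function (G n)) \<and> CK_converges K G h \<longrightarrow> (%n. f (G n)) \<longlonglongrightarrow> v"
 obtain G where G: "!!n. test_function (G n)" "CK_converges K G h" using CK_approximation[OF lp h] by blast
 have "(%n. f (G n)) \<longlonglongrightarrow> v" using v G by blast
 then show "v = cpair \<phi> f h" using CK_limit[OF G K h] LIMSEQ_unique by blast
qed

text \<open>For a locally integrable distribution the pairing is an honest integral, so the same functional describes both cases of the definition of the integral over an interval.\<close>

lemma represented_pairing:
 assumes g: "represented_by f g" and h: "csmooth1 R h"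
 shows "(LBINT t. g t * h t) = cpair \<phi> f h"
proof -
 have h': "C_k 1 h" "!!x. abs x > R ==> h x = 0" using h by (auto simp: csmooth1_def)
 obtain G where G: "!!n. test_function (G n)" "CK_converges 1 G h" using CK_approximation[OF lp h'] by blast
 from CK_converges_bounds[OF G order_refl h'] obtain n0 R' H V where
  b: "!!n. csmooth1 R' (G n)" "!!t. (%n. G n t) \<longlonglongrightarrow> h t" "!!n t. n >= n0 ==> cmod (G n t) <= H" by metis
 have gi: "integrable lborel (%t. indicator {-R'..R'} t *\<^sub>R g t)"
  using g unfolding represented_by_def set_integrable_def by blast
 have hm[measurable]: "h \<in> borel_measurable borel"
  using C_k_continuous_vderiv[OF h'(1), of 0] by (intro borel_measurable_continuous_onI) simp
 note [measurable] = borel_measurable_integrable[OF csmooth1D(6)[OF b(1)]] borel_measurable_integrable[OF gi]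
 have cut: "g t * G n t = (indicator {-R'..R'} t *\<^sub>R g t) * G n t" for n t
  using csmooth1D(4)[OF b(1), of t n] by (cases "abs t > R'") (auto simp: indicator_def)
 have cuth: "g t * h t = (indicator {-R'..R'} t *\<^sub>R g t) * h t" for t
 proof (cases "abs t > R'")
  case True
  then have "(%n. 0) \<longlonglongrightarrow> h t" using b(2)[of t] csmooth1D(4)[OF b(1)] by simp
  then have "h t = 0" by (simp add: LIMSEQ_const_iff)
  then show ?thesis by simp
 qed (auto simp: indicator_def)
 have "(%n. LBINT t. g t * G (n + n0) t) \<longlonglongrightarrow> (LBINT t. g t * h t)"
  unfolding cut cuth
 proof (rule integral_dominated_convergence[where w = "%t. H * cmod (indicator {-R'..R'} t *\<^sub>R g t)"])
  show "integrable lborel (%t. H * cmod (indicator {-R'..R'} t *\<^sub>R g t))" using gi by (intro integrable_mult_right integrable_norm)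
  show "AE t in lborel. (%n. (indicator {-R'..R'} t *\<^sub>R g t) * G (n + n0) t) \<longlonglongrightarrow> (indicator {-R'..R'} t *\<^sub>R g t) * h t"
   by (intro AE_I2 tendsto_intros LIMSEQ_ignore_initial_segment b)
  show "AE t in lborel. cmod ((indicator {-R'..R'} t *\<^sub>R g t) * G (n + n0) t) <= H * cmod (indicator {-R'..R'} t *\<^sub>R g t)" for n
  proof (rule AE_I2)
   fix t
   have "cmod (G (n + n0) t) <= H" by (rule b(3)) simp
   then show "cmod ((indicator {-R'..R'} t *\<^sub>R g t) * G (n + n0) t) <= H * cmod (indicator {-R'..R'} t *\<^sub>R g t)"
    unfolding norm_mult[of _ "G (n + n0) t"] mult.commute[of H] by (rule mult_left_mono) simp
  qed
 qed measurable
 moreover have "f (G n) = (LBINT t. g t * G n t)" for n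
  using g G(1)[of n] unfolding represented_by_def function_distribution_def by blast
 ultimately have "(%n. f (G (n + n0))) \<longlonglongrightarrow> (LBINT t. g t * h t)" by simp
 moreover have "(%n. f (G (n + n0))) \<longlonglongrightarrow> cpair \<phi> f h"
  by (rule LIMSEQ_ignore_initial_segment[OF CK_limit[OF G order_refl h']])
 ultimately show ?thesis using LIMSEQ_unique by blast
qed

end

section \<open>Compactly supported orthogonal wavelets\<close>

lemma sum_reindex_support:
 fixes g :: "int => real"
 assumes "finite A" "finite B" "inj_on h A"
  and "!!i. i \<in> A ==> h i \<notin> B ==> g (h i) = 0"
  and "!!k. k \<in> B ==> k \<notin> h ` A ==> g k = 0"
 shows "(\<Sum>i\<in>A. g (h i)) = (\<Sum>k\<in>B. g k)"
proof -
 have "(\<Sum>i\<in>A. g (h i)) = (\<Sum>k\<in>h ` A. g k)"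
  by (simp add: sum.reindex[OF assms(3)])
 also have "... = (\<Sum>k\<in>B. g k)"
  by (rule sum.mono_neutral_cong) (use assms in auto)
 finally show ?thesis .
qed

text \<open>The consequences of the two-scale relations that make the wavelet expansion telescope. The filter is extended by zero to all integers (\<open>cI\<close>, \<open>dI\<close>), which removes the boundary terms from the index calculations.\<close>

locale daubechies_wavelet =
 fixes M K :: nat and \<psi>0 \<psi> :: "real => real"
 assumes daub: "daubechies M \<psi>0 \<psi>" and CK: "C_k K \<psi>0" "C_k K \<psi>" and K: "K >= 1"
begin

definition c :: "nat => real" where
 "c = (SOME c. (\<forall>x. \<psi>0 x = (\<Sum>k<2*M. c k * \<psi>0 (2 * x - real k))) \<and>
    (\<forall>x. \<psi> x = (\<Sum>k<2*M. (-1) ^ k * c (2*M - 1 - k) * \<psi>0 (2 * x - real k))))"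

definition D :: "int set" where "D = {0..<2 * int M}"

text \<open>The filter extended by zero to all integers, and its quadrature mirror filter.\<close>

definition cI :: "int => real" where "cI k = (if k \<in> D then c (nat k) else 0)"
definition dI :: "int => real" where "dI k = (if even k then 1 else -1) * cI (2 * int M - 1 - k)"

lemma finite_D [simp]: "finite D" by (simp add: D_def)
lemma cI_zero: "k \<notin> D ==> cI k = 0" by (simp add: cI_def)
lemma dI_zero: "k \<notin> D ==> dI k = 0" by (auto simp: dI_def cI_def D_def)

lemma refinement:
 "\<psi>0 x = (\<Sum>k\<in>D. cI k * \<psi>0 (2 * x - of_int k))"
 "\<psi> x = (\<Sum>k\<in>D. dI k * \<psi>0 (2 * x - of_int k))"
proof -
 have "\<exists>c. (\<forall>x. \<psi>0 x = (\<Sum>k<2*M. c k * \<psi>0 (2 * x - real k))) \<and>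
    (\<forall>x. \<psi> x = (\<Sum>k<2*M. (-1) ^ k * c (2*M - 1 - k) * \<psi>0 (2 * x - real k)))"
  using daub unfolding daubechies_def by blast
 from someI_ex[OF this] have c: "\<psi>0 x = (\<Sum>k<2*M. c k * \<psi>0 (2 * x - real k))"
  "\<psi> x = (\<Sum>k<2*M. (-1) ^ k * c (2*M - 1 - k) * \<psi>0 (2 * x - real k))" for x
  unfolding c_def[symmetric] by blast+
 have img: "D = int ` {..<2*M}"
  unfolding D_def using image_int_atLeastLessThan[of 0 "2 * M"] by (simp add: lessThan_atLeast0)
 have re: "(\<Sum>k\<in>D. F k) = (\<Sum>k<2*M. F (int k))" for F :: "int => real"
  unfolding img by (subst sum.reindex) auto
 show "\<psi>0 x = (\<Sum>k\<in>D. cI k * \<psi>0 (2 * x - of_int k))"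
  unfolding re c(1)[of x] by (intro sum.cong) (auto simp: cI_def D_def)
 show "\<psi> x = (\<Sum>k\<in>D. dI k * \<psi>0 (2 * x - of_int k))"
  unfolding re c(2)[of x]
 proof (intro sum.cong refl)
  fix k assume k: "k \<in> {..<2*M}"
  have "nat (2 * int M - 1 - int k) = 2 * M - 1 - k" using k by auto
  then show "(-1) ^ k * c (2*M - 1 - k) * \<psi>0 (2 * x - real k) = dI (int k) * \<psi>0 (2 * x - of_int (int k))"
   using k by (auto simp: dI_def cI_def D_def)
 qed
qed

lemma psi0_cont: "continuous_on UNIV \<psi>0" using C_k_continuous_vderiv[OF CK(1), of 0] by simp
lemma psi_cont: "continuous_on UNIV \<psi>" using C_k_continuous_vderiv[OF CK(2), of 0] by simp
lemma psi0_borel [measurable]: "\<psi>0 \<in> borel_measurable borel" by (rule borel_measurable_continuous_onI[OF psi0_cont])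

definition R :: real where
 "R = (SOME R. R >= 0 \<and> (\<forall>x. abs x > R \<longrightarrow> \<psi>0 x = 0 \<and> \<psi> x = 0))"

lemma R: "R >= 0" "abs x > R ==> \<psi>0 x = 0" "abs x > R ==> \<psi> x = 0"
proof -
 have "\<exists>R. R >= 0 \<and> (\<forall>x. abs x > R \<longrightarrow> \<psi>0 x = 0 \<and> \<psi> x = 0)"
 proof -
  obtain R0 where R0: "!!x. abs x > R0 ==> \<psi>0 x = 0"
   using daub unfolding daubechies_def compactly_supported_def by blast
  have "\<psi> x = 0" if x: "abs x > abs R0 + 2 * real M" for x
   unfolding refinement(2)[of x]
  proof (rule sum.neutral, rule ballI)
   fix k assume "k \<in> D"
   then have "abs (2 * x - of_int k) > R0" using x by (auto simp: D_def)
   then show "dI k * \<psi>0 (2 * x - of_int k) = 0" using R0 by simp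
  qed
  then show ?thesis using R0 by (intro exI[of _ "abs R0 + 2 * real M"]) auto
 qed
 from someI_ex[OF this] show "R >= 0" "abs x > R ==> \<psi>0 x = 0" "abs x > R ==> \<psi> x = 0"
  unfolding R_def[symmetric] by blast+
qed

lemma integrable_compact_support:
 fixes F :: "real => real"
 assumes "continuous_on UNIV F" "!!t. abs t > r ==> F t = 0"
 shows "integrable lborel F"
proof -
 have "continuous_on UNIV (%t. complex_of_real (F t))" using assms(1) by (intro continuous_intros)
 then have "rapid (%t. complex_of_real (F t))" "(%t. complex_of_real (F t)) \<in> borel_measurable borel"
  using assms(2) by (auto intro!: compact_support_rapid borel_measurable_continuous_onI exI[of _ r] simp: compactly_supported_def)
 then have "integrable lborel (%t. complex_of_real (F t))" by (rule rapid_integrable)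
 then show ?thesis unfolding complex_of_real_integrable_eq .
qed

lemma psi0_integrable: "integrable lborel \<psi>0"
 by (rule integrable_compact_support[OF psi0_cont R(2)])

lemma psi0_integral: "(LBINT x. \<psi>0 x) = 1"
 using daub by (simp add: daubechies_def)

lemma psi0_product_integrable: "integrable lborel (%x. \<psi>0 (a * x + b) * \<psi>0 (a' * x + b'))" if "a \<noteq> 0"
proof (rule integrable_compact_support)
 show "continuous_on UNIV (%x. \<psi>0 (a * x + b) * \<psi>0 (a' * x + b'))"
  by (intro continuous_intros continuous_on_compose2[OF psi0_cont]) auto
 fix t assume "abs t > (R + abs b) / abs a"
 then have "R + abs b < abs (a * t)" using that by (simp add: pos_divide_less_eq abs_mult mult.commute)
 then have "abs (a * t + b) > R" by linarith
 then show "\<psi>0 (a * t + b) * \<psi>0 (a' * t + b') = 0" using R(2) by simp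
qed

text \<open>Inserting the two-scale relation into the orthonormality of the translates of \<open>\<psi>0\<close>.\<close>

lemma filter_orthogonality:
 "(\<Sum>m\<in>D. cI m * cI (m + 2 * l)) = (if l = 0 then 2 else 0)"
proof -
 have one: "(LBINT x. \<psi>0 (2 * x - of_int k) * \<psi>0 (2 * x - of_int m')) = (if k = m' then 1 / 2 else 0)" for k m' :: int
 proof -
  have "(LBINT y. \<psi>0 y * \<psi>0 (y - of_int (m' - k))) =
   2 *\<^sub>R (LBINT x. \<psi>0 (- of_int k + 2 * x) * \<psi>0 (- of_int k + 2 * x - of_int (m' - k)))"
   by (subst lborel_integral_real_affine[where c = 2 and t = "- of_int k"]) auto
  also have "(%x. \<psi>0 (- of_int k + 2 * x) * \<psi>0 (- of_int k + 2 * x - of_int (m' - k))) =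
    (%x. \<psi>0 (2 * x - of_int k) * \<psi>0 (2 * x - of_int m'))" by (simp add: algebra_simps)
  finally have "2 * (LBINT x. \<psi>0 (2 * x - of_int k) * \<psi>0 (2 * x - of_int m')) =
   (LBINT y. \<psi>0 y * \<psi>0 (y - of_int (m' - k)))" by simp
  also have "... = (if m' - k = 0 then 1 else 0)" using daub unfolding daubechies_def by blast
  finally show ?thesis by (auto split: if_splits)
 qed
 have int: "integrable lborel (%x. \<psi>0 (2 * x - of_int k) * \<psi>0 (2 * x - of_int m'))" for k m' :: int
  using psi0_product_integrable[of 2 "- of_int k" 2 "- of_int m'"] by simp
 have "(if l = 0 then 1 else 0) = (LBINT x. \<psi>0 x * \<psi>0 (x - of_int l))"
  using daub unfolding daubechies_def by simp
 also have "... = (LBINT x. (\<Sum>k\<in>D. \<Sum>m\<in>D. cI k * cI m * (\<psi>0 (2 * x - of_int k) * \<psi>0 (2 * x - of_int (2 * l + m)))))"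
 proof (intro lint_cong refl)
  fix x
  have "\<psi>0 (x - of_int l) = (\<Sum>m\<in>D. cI m * \<psi>0 (2 * x - of_int (2 * l + m)))"
   unfolding refinement(1)[of "x - of_int l"] by (simp add: algebra_simps)
  then show "\<psi>0 x * \<psi>0 (x - of_int l) = (\<Sum>k\<in>D. \<Sum>m\<in>D. cI k * cI m * (\<psi>0 (2 * x - of_int k) * \<psi>0 (2 * x - of_int (2 * l + m))))"
   by (subst refinement(1)[of x]) (simp add: sum_product mult_ac)
 qed
 also have "... = (\<Sum>k\<in>D. \<Sum>m\<in>D. cI k * cI m * (if k = 2 * l + m then 1 / 2 else 0))"
  by (subst lint_sum, intro Bochner_Integration.integrable_sum integrable_mult_right int)
   (subst lint_sum, intro integrable_mult_right int, simp only: one integral_mult_right_zero)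
 also have "... = (\<Sum>m\<in>D. \<Sum>k\<in>D. cI k * cI m * (if k = 2 * l + m then 1 / 2 else 0))" by (rule sum.swap)
 also have "... = (\<Sum>m\<in>D. cI m * cI (m + 2 * l) / 2)"
 proof (intro sum.cong refl)
  fix m
  have "(\<Sum>k\<in>D. cI k * cI m * (if k = 2 * l + m then 1 / 2 else 0)) = (\<Sum>k\<in>D. if k = 2 * l + m then cI k * cI m / 2 else 0)"
   by (intro sum.cong) auto
  also have "... = cI m * cI (m + 2 * l) / 2"
   by (subst sum.delta) (auto simp: cI_zero add.commute mult.commute)
  finally show "(\<Sum>k\<in>D. cI k * cI m * (if k = 2 * l + m then 1 / 2 else 0)) = cI m * cI (m + 2 * l) / 2" .
 qed
 also have "... = (\<Sum>m\<in>D. cI m * cI (m + 2 * l)) / 2" by (simp add: sum_divide_distrib)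
 finally show ?thesis by (auto split: if_splits)
qed

lemma parity_split:
 fixes g :: "int => real"
 assumes "finite V" "!!k. k \<notin> D ==> g k = 0" "!!k. k \<in> D ==> even (k - m) ==> (m - k) div 2 \<in> V"
 shows "(\<Sum>\<nu>\<in>V. g (m - 2 * \<nu>)) = (\<Sum>k\<in>{k\<in>D. even (k - m)}. g k)"
proof (rule sum_reindex_support)
 fix k assume k: "k \<in> {k \<in> D. even (k - m)}" "k \<notin> (%\<nu>. m - 2 * \<nu>) ` V"
 have "m - 2 * ((m - k) div 2) = k" using k(1) by auto
 then have "k \<in> (%\<nu>. m - 2 * \<nu>) ` V" using assms(3)[of k] k(1) by (metis (no_types, lifting) image_eqI mem_Collect_eq)
 then show "g k = 0" using k(2) by blast
qed (use assms in \<open>auto simp: inj_on_def\<close>)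

text \<open>The two filters form a unitary filter bank: the alternating reflected filter supplies the orthogonal complement. For \<open>m - n\<close> odd the contributions of the two filters cancel; for \<open>m - n\<close> even they combine to a full autocorrelation of the filter.\<close>

lemma quadrature_mirror:
 assumes V: "V = {-L..L}" and L: "abs m + 2 * int M <= L" "abs n + 2 * int M <= L"
 shows "(\<Sum>\<nu>\<in>V. cI (m - 2 * \<nu>) * cI (n - 2 * \<nu>) + dI (m - 2 * \<nu>) * dI (n - 2 * \<nu>)) = (if m = n then 2 else 0)"
proof -
 have fV: "finite V" by (simp add: V)
 let ?e = "2 * int M - 1"
 show ?thesis
 proof (cases "even (n - m)")
  case True
  then obtain l where l: "n = m + 2 * l" by (metis add.commute diff_eq_eq evenE)
  define g where "g k = cI k * cI (k + 2 * l)" for k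
  have g0: "k \<notin> D ==> g k = 0" for k by (simp add: g_def cI_zero)
  have 1: "(\<Sum>\<nu>\<in>V. g (m - 2 * \<nu>)) = (\<Sum>k\<in>{k\<in>D. even (k - m)}. g k)"
   by (rule parity_split[OF fV g0]) (use L in \<open>auto simp: V D_def\<close>)
  have "(\<Sum>\<nu>\<in>V. g (?e - n + 2 * \<nu>)) = (\<Sum>\<nu>\<in>V. g ((?e - n) - 2 * \<nu>))"
   by (rule sum.reindex_bij_witness[of _ uminus uminus]) (auto simp: V)
  also have "... = (\<Sum>k\<in>{k\<in>D. even (k - (?e - n))}. g k)"
   by (rule parity_split[OF fV g0]) (use L in \<open>auto simp: V D_def\<close>)
  also have "{k\<in>D. even (k - (?e - n))} = {k\<in>D. odd (k - m)}" using l by auto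
  finally have 2: "(\<Sum>\<nu>\<in>V. g (?e - n + 2 * \<nu>)) = (\<Sum>k\<in>{k\<in>D. odd (k - m)}. g k)" .
  have "(\<Sum>\<nu>\<in>V. cI (m - 2 * \<nu>) * cI (n - 2 * \<nu>) + dI (m - 2 * \<nu>) * dI (n - 2 * \<nu>)) =
    (\<Sum>\<nu>\<in>V. g (m - 2 * \<nu>) + g (?e - n + 2 * \<nu>))"
  proof (intro sum.cong refl arg_cong2[where f = "(+)"])
   fix \<nu>
   show "cI (m - 2 * \<nu>) * cI (n - 2 * \<nu>) = g (m - 2 * \<nu>)" by (simp add: g_def l algebra_simps)
   have e: "?e - (n - 2 * \<nu>) = ?e - n + 2 * \<nu>" "?e - (m - 2 * \<nu>) = ?e - n + 2 * \<nu> + 2 * l" using l by auto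
   have "even (m - 2 * \<nu>) \<longleftrightarrow> even (n - 2 * \<nu>)" using l by auto
   then show "dI (m - 2 * \<nu>) * dI (n - 2 * \<nu>) = g (?e - n + 2 * \<nu>)"
    unfolding dI_def g_def e by (simp only: mult.commute split: if_split) simp
  qed
  also have "... = (\<Sum>k\<in>{k\<in>D. even (k - m)}. g k) + (\<Sum>k\<in>{k\<in>D. odd (k - m)}. g k)"
   unfolding sum.distrib 1 2 ..
  also have "... = (\<Sum>k\<in>D. g k)"
   by (subst sum.union_disjoint[symmetric]) (auto intro!: sum.cong)
  also have "... = (if l = 0 then 2 else 0)" unfolding g_def by (rule filter_orthogonality)
  finally show ?thesis using l by auto
 next
  case False
  define g where "g k = cI k * cI (k + (n - m))" for k
  have g0: "k \<notin> D ==> g k = 0" for k by (simp add: g_def cI_zero)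
  have 1: "(\<Sum>\<nu>\<in>V. g (m - 2 * \<nu>)) = (\<Sum>k\<in>{k\<in>D. even (k - m)}. g k)"
   by (rule parity_split[OF fV g0]) (use L in \<open>auto simp: V D_def\<close>)
  have "(\<Sum>\<nu>\<in>V. g (?e - n + 2 * \<nu>)) = (\<Sum>\<nu>\<in>V. g ((?e - n) - 2 * \<nu>))"
   by (rule sum.reindex_bij_witness[of _ uminus uminus]) (auto simp: V)
  also have "... = (\<Sum>k\<in>{k\<in>D. even (k - (?e - n))}. g k)"
   by (rule parity_split[OF fV g0]) (use L in \<open>auto simp: V D_def\<close>)
  also have "{k\<in>D. even (k - (?e - n))} = {k\<in>D. even (k - m)}" using False by auto
  finally have 2: "(\<Sum>\<nu>\<in>V. g (?e - n + 2 * \<nu>)) = (\<Sum>k\<in>{k\<in>D. even (k - m)}. g k)" .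
  have "(\<Sum>\<nu>\<in>V. cI (m - 2 * \<nu>) * cI (n - 2 * \<nu>) + dI (m - 2 * \<nu>) * dI (n - 2 * \<nu>)) =
    (\<Sum>\<nu>\<in>V. g (m - 2 * \<nu>) - g (?e - n + 2 * \<nu>))"
  proof (intro sum.cong refl)
   fix \<nu>
   have a: "cI (m - 2 * \<nu>) * cI (n - 2 * \<nu>) = g (m - 2 * \<nu>)" by (simp add: g_def algebra_simps)
   have e: "?e - (n - 2 * \<nu>) = ?e - n + 2 * \<nu>" "?e - (m - 2 * \<nu>) = ?e - n + 2 * \<nu> + (n - m)" by auto
   have "even (m - 2 * \<nu>) \<longleftrightarrow> odd (n - 2 * \<nu>)" using False by auto
   then have "dI (m - 2 * \<nu>) * dI (n - 2 * \<nu>) = - g (?e - n + 2 * \<nu>)"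
    unfolding dI_def g_def e by (simp only: mult.commute split: if_split) simp
   with a show "cI (m - 2 * \<nu>) * cI (n - 2 * \<nu>) + dI (m - 2 * \<nu>) * dI (n - 2 * \<nu>) = g (m - 2 * \<nu>) - g (?e - n + 2 * \<nu>)"
    by simp
  qed
  also have "... = 0" unfolding sum_subtractf 1 2 by simp
  finally show ?thesis using False by auto
 qed
qed

lemma filter_sum_shift:
 fixes a w :: "int => real"
 assumes "!!k. k \<notin> D ==> w k = 0" "!!m. m \<notin> E ==> a m = 0" "finite E"
 shows "(\<Sum>k\<in>D. w k * a (2 * \<nu> + k)) = (\<Sum>m\<in>E. w (m - 2 * \<nu>) * a m)"
proof -
 have "(\<Sum>k\<in>D. w ((2 * \<nu> + k) - 2 * \<nu>) * a (2 * \<nu> + k)) = (\<Sum>m\<in>E. w (m - 2 * \<nu>) * a m)"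
 proof (rule sum_reindex_support[where g = "%m. w (m - 2 * \<nu>) * a m" and h = "%k. 2 * \<nu> + k"])
  fix m assume m: "m \<notin> (%k. 2 * \<nu> + k) ` D"
  have "m - 2 * \<nu> \<notin> D"
  proof
   assume "m - 2 * \<nu> \<in> D"
   then have "2 * \<nu> + (m - 2 * \<nu>) \<in> (%k. 2 * \<nu> + k) ` D" by (rule imageI)
   then show False using m by simp
  qed
  then show "w (m - 2 * \<nu>) * a m = 0" using assms by simp
 qed (use assms in \<open>auto simp: inj_on_def\<close>)
 then show ?thesis by simp
qed

text \<open>The bilinear form of the quadrature mirror relations. With the interval coefficients for \<open>a\<close> and the values of the translates at a point for \<open>b\<close> it becomes the telescoping identity for the scaling projections.\<close>

lemma perfect_reconstruction:
 fixes a b :: "int => real"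
 assumes a: "!!m. abs m > N ==> a m = 0" and b: "!!m. abs m > N ==> b m = 0"
  and L: "N + 2 * int M <= L"
 shows "(\<Sum>\<nu>\<in>{-L..L}. (\<Sum>k\<in>D. cI k * a (2 * \<nu> + k)) * (\<Sum>k\<in>D. cI k * b (2 * \<nu> + k)) +
   (\<Sum>k\<in>D. dI k * a (2 * \<nu> + k)) * (\<Sum>k\<in>D. dI k * b (2 * \<nu> + k))) = 2 * (\<Sum>m\<in>{-N..N}. a m * b m)"
proof -
 let ?E = "{-N..N}"
 have a': "m \<notin> ?E ==> a m = 0" and b': "m \<notin> ?E ==> b m = 0" for m using a[of m] b[of m] by auto
 have sh: "(\<Sum>k\<in>D. w k * e (2 * \<nu> + k)) = (\<Sum>m\<in>?E. w (m - 2 * \<nu>) * e m)"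
  if "w = cI \<or> w = dI" "e = a \<or> e = b" for w e \<nu>
  by (rule filter_sum_shift) (use that a' b' cI_zero dI_zero in auto)
 note sh = sh[OF disjI1[OF refl] disjI1[OF refl]] sh[OF disjI1[OF refl] disjI2[OF refl]]
  sh[OF disjI2[OF refl] disjI1[OF refl]] sh[OF disjI2[OF refl] disjI2[OF refl]]
 have "(\<Sum>\<nu>\<in>{-L..L}. (\<Sum>k\<in>D. cI k * a (2 * \<nu> + k)) * (\<Sum>k\<in>D. cI k * b (2 * \<nu> + k)) +
   (\<Sum>k\<in>D. dI k * a (2 * \<nu> + k)) * (\<Sum>k\<in>D. dI k * b (2 * \<nu> + k))) =
  (\<Sum>\<nu>\<in>{-L..L}. \<Sum>m\<in>?E. \<Sum>n\<in>?E. a m * b n * (cI (m - 2 * \<nu>) * cI (n - 2 * \<nu>) + dI (m - 2 * \<nu>) * dI (n - 2 * \<nu>)))"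
  unfolding sh sum_product sum.distrib[symmetric]
  by (intro sum.cong refl) (simp add: algebra_simps)
 also have "... = (\<Sum>m\<in>?E. \<Sum>n\<in>?E. a m * b n * (\<Sum>\<nu>\<in>{-L..L}. cI (m - 2 * \<nu>) * cI (n - 2 * \<nu>) + dI (m - 2 * \<nu>) * dI (n - 2 * \<nu>)))"
  unfolding sum_distrib_left by (subst sum.swap, rule sum.cong[OF refl], rule sum.swap)
 also have "... = (\<Sum>m\<in>?E. \<Sum>n\<in>?E. if n = m then 2 * (a m * b n) else 0)"
  by (intro sum.cong refl, subst quadrature_mirror[OF refl]) (use L in auto)
 also have "... = (\<Sum>m\<in>?E. 2 * (a m * b m))"
  by (intro sum.cong refl, subst sum.delta) auto
 finally show ?thesis by (simp add: sum_distrib_left)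
qed

text \<open>Let \<open>E\<close> and \<open>O\<close> be the sums over the even and the odd indices. Integrating the two-scale relation gives \<open>E + O = 2\<close>, and summing the orthogonality relations gives \<open>E\<^sup>2 + O\<^sup>2 = 2\<close>; hence \<open>E = O = 1\<close>.\<close>

lemma filter_parity_sums:
 shows "(\<Sum>k\<in>{k\<in>D. even (k - m)}. cI k) = 1"
proof -
 define E where "E = (\<Sum>k\<in>{k\<in>D. even k}. cI k)"
 define O' where "O' = (\<Sum>k\<in>{k\<in>D. odd k}. cI k)"
 have tot: "E + O' = 2"
 proof -
  have half: "(LBINT x. \<psi>0 (2 * x - of_int k)) = 1 / 2" for k :: int
  proof -
   have "1 = 2 *\<^sub>R (LBINT x. \<psi>0 (- of_int k + 2 * x))"
    unfolding psi0_integral[symmetric] by (subst lborel_integral_real_affine[where c = 2 and t = "- of_int k"]) auto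
   then show ?thesis by (simp add: algebra_simps)
  qed
  have int: "integrable lborel (%x. \<psi>0 (2 * x - of_int k))" for k :: int
   using lborel_integrable_real_affine[OF psi0_integrable, of 2 "- of_int k"] by (simp add: algebra_simps)
  have "1 = (LBINT x. (\<Sum>k\<in>D. cI k * \<psi>0 (2 * x - of_int k)))"
   unfolding psi0_integral[symmetric] by (rule lint_cong[OF refl refinement(1)])
  also have "... = (\<Sum>k\<in>D. cI k * (1 / 2))"
   by (subst lint_sum) (auto simp: half intro!: integrable_mult_right int)
  finally have "(\<Sum>k\<in>D. cI k) = 2" by (simp add: sum_divide_distrib[symmetric])
  moreover have "(\<Sum>k\<in>D. cI k) = E + O'"
   unfolding E_def O'_def by (subst sum.union_disjoint[symmetric]) (auto intro!: sum.cong)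
  ultimately show ?thesis by simp
 qed
 have sq: "E\<^sup>2 + O'\<^sup>2 = 2"
 proof -
  let ?L = "{- 2 * int M..2 * int M}"
  have shift: "(\<Sum>l\<in>?L. cI (m + 2 * l)) = (\<Sum>k\<in>{k\<in>D. even (k - m)}. cI k)" if "m \<in> D" for m
  proof -
   have "(\<Sum>l\<in>?L. cI (m + 2 * l)) = (\<Sum>l\<in>?L. cI (m - 2 * l))"
    by (rule sum.reindex_bij_witness[of _ uminus uminus]) auto
   also have "... = (\<Sum>k\<in>{k\<in>D. even (k - m)}. cI k)"
    by (rule parity_split) (use that in \<open>auto simp: cI_zero D_def\<close>)
   finally show ?thesis .
  qed
  have "2 = (\<Sum>l\<in>?L. if l = 0 then 2 else (0::real))" by (subst sum.delta) auto
  also have "... = (\<Sum>l\<in>?L. \<Sum>m\<in>D. cI m * cI (m + 2 * l))" by (simp only: filter_orthogonality)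
  also have "... = (\<Sum>m\<in>D. cI m * (\<Sum>l\<in>?L. cI (m + 2 * l)))"
   unfolding sum_distrib_left by (rule sum.swap)
  also have "... = (\<Sum>m\<in>D. cI m * (if even m then E else O'))"
  proof (rule sum.cong[OF refl])
   fix m assume m: "m \<in> D"
   have "{k\<in>D. even (k - m)} = (if even m then {k\<in>D. even k} else {k\<in>D. odd k})" by auto
   then show "cI m * (\<Sum>l\<in>?L. cI (m + 2 * l)) = cI m * (if even m then E else O')"
    unfolding shift[OF m] by (simp add: E_def O'_def)
  qed
  also have "... = (\<Sum>m\<in>{m\<in>D. even m}. cI m * (if even m then E else O')) + (\<Sum>m\<in>{m\<in>D. odd m}. cI m * (if even m then E else O'))"
   by (subst sum.union_disjoint[symmetric]) (auto intro!: sum.cong)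
  also have "... = E\<^sup>2 + O'\<^sup>2"
   unfolding E_def O'_def power2_eq_square by (simp add: sum_distrib_right)
  finally show ?thesis by simp
 qed
 have "(E - O')\<^sup>2 = 2 * (E\<^sup>2 + O'\<^sup>2) - (E + O')\<^sup>2" by (simp add: power2_eq_square algebra_simps)
 then have "(E - O')\<^sup>2 = 0" unfolding sq tot by simp
 then have "E = 1" "O' = 1" using tot by auto
 then show ?thesis unfolding E_def O'_def by (cases "even m") auto
qed

lemma card_int_interval: "finite {\<nu>::int. abs (y - of_int \<nu>) <= r}" "r >= 0 ==> real (card {\<nu>::int. abs (y - of_int \<nu>) <= r}) <= 2 * r + 1"
proof -
 have eq: "{\<nu>::int. abs (y - of_int \<nu>) <= r} = {\<lceil>y - r\<rceil>..\<lfloor>y + r\<rfloor>}"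
  by (auto simp: abs_le_iff ceiling_le_iff le_floor_iff)
 show "finite {\<nu>::int. abs (y - of_int \<nu>) <= r}" unfolding eq by simp
 show "real (card {\<nu>::int. abs (y - of_int \<nu>) <= r}) <= 2 * r + 1" if "r >= 0"
  unfolding eq using that by simp linarith
qed

text \<open>The periodisation of the scaling function, written as a finite sum.\<close>

definition per :: "real => real" where
 "per y = (\<Sum>\<nu>\<in>{\<nu>::int. abs (y - of_int \<nu>) <= R}. \<psi>0 (y - of_int \<nu>))"

lemma per_eq:
 assumes "finite V" "!!\<nu>. abs (y - of_int \<nu>) <= R ==> \<nu> \<in> V"
 shows "per y = (\<Sum>\<nu>\<in>V. \<psi>0 (y - of_int \<nu>))"
 unfolding per_def using assms R(2) by (intro sum.mono_neutral_left) (auto simp: not_le)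

lemma per_double: "per y = per (2 * y)"
proof -
 obtain N :: int where N: "2 * abs y + R + 2 * of_int (int M) + 4 <= of_int N" using ex_le_of_int by blast
 let ?V = "{-N..N}"
 have "per y = (\<Sum>\<nu>\<in>?V. \<psi>0 (y - of_int \<nu>))" by (rule per_eq) (use N R(1) in auto)
 also have "... = (\<Sum>\<nu>\<in>?V. \<Sum>k\<in>D. cI k * \<psi>0 (2 * y - of_int (2 * \<nu> + k)))"
  by (intro sum.cong refl) (subst refinement(1), simp add: algebra_simps)
 also have "... = (\<Sum>\<nu>\<in>?V. \<Sum>m\<in>?V. cI (m - 2 * \<nu>) * \<psi>0 (2 * y - of_int m))"
 proof (rule sum.cong[OF refl], rule filter_sum_shift[where a = "%m. \<psi>0 (2 * y - of_int m)", OF cI_zero])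
  fix m assume "m \<notin> ?V"
  then have "abs (2 * y - of_int m) > R" using N by auto
  then show "\<psi>0 (2 * y - of_int m) = 0" by (rule R(2))
 qed auto
 also have "... = (\<Sum>m\<in>?V. (\<Sum>\<nu>\<in>?V. cI (m - 2 * \<nu>)) * \<psi>0 (2 * y - of_int m))"
  unfolding sum_distrib_right by (rule sum.swap)
 also have "... = (\<Sum>m\<in>?V. 1 * \<psi>0 (2 * y - of_int m))"
 proof (intro sum.cong refl)
  fix m assume m: "m \<in> ?V"
  show "(\<Sum>\<nu>\<in>?V. cI (m - 2 * \<nu>)) * \<psi>0 (2 * y - of_int m) = 1 * \<psi>0 (2 * y - of_int m)"
  proof (cases "abs (2 * y - of_int m) > R")
   case False
   have "(\<Sum>\<nu>\<in>?V. cI (m - 2 * \<nu>)) = (\<Sum>k\<in>{k\<in>D. even (k - m)}. cI k)"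
   proof (rule parity_split)
    fix k assume k: "k \<in> D"
    have "abs (of_int m) <= 2 * abs y + R" using False by linarith
    then have "abs m + 2 * int M <= N" using N by linarith
    then show "(m - k) div 2 \<in> ?V" using k by (auto simp: D_def)
   qed (auto simp: cI_zero)
   then have "(\<Sum>\<nu>\<in>?V. cI (m - 2 * \<nu>)) = 1" using filter_parity_sums[of m] by (rule trans)
   then show ?thesis by simp
  qed (use R(2) in simp)
 qed
 also have "... = per (2 * y)" unfolding mult_1
  by (rule per_eq[symmetric]) (use N in auto)
 finally show ?thesis .
qed

text \<open>By the parity sums, the periodisation satisfies \<open>per y = per (2 y)\<close>. A continuous function with \<open>per x = per (x / 2 ^ n)\<close> for all \<open>n\<close> is constant, and its mean over a period is the integral of \<open>\<psi>0\<close>.\<close>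

lemma partition_of_unity: "per y = 1"
proof -
 have const: "per x = per 0" for x
 proof -
  have half: "per x = per (x / 2 ^ n)" for n
  proof (induction n)
   case (Suc n)
   have "per (x / 2 ^ Suc n) = per (2 * (x / 2 ^ Suc n))" by (rule per_double)
   then show ?case using Suc by simp
  qed simp
  obtain N :: int where N: "abs x + R <= of_int N" using ex_le_of_int by blast
  define A where "A y = (\<Sum>\<nu>\<in>{-N..N}. \<psi>0 (y - of_int \<nu>))" for y
  have eq: "per y = A y" if "abs y <= abs x" for y
   unfolding A_def by (rule per_eq) (use N that in auto)
  have "continuous_on UNIV A" unfolding A_def
   by (intro continuous_intros continuous_on_compose2[OF psi0_cont]) auto
  then have cA: "isCont A 0" by (simp add: continuous_on_eq_continuous_at)
  have "(%n. x / 2 ^ n) \<longlonglongrightarrow> 0"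
   using LIMSEQ_divide_realpow_zero[of 2 x] by simp
  then have "(%n. A (x / 2 ^ n)) \<longlonglongrightarrow> A 0" by (rule isCont_tendsto_compose[OF cA])
  moreover have "A (x / 2 ^ n) = per x" for n
  proof -
   have "abs (x / 2 ^ n) <= abs x / 1" unfolding abs_divide by (rule divide_left_mono) auto
   then show ?thesis using eq[of "x / 2 ^ n"] half[of n] by simp
  qed
  ultimately have "per x = A 0" by (simp add: LIMSEQ_const_iff)
  then show ?thesis using eq[of 0] by simp
 qed
 obtain N :: int where N: "R + 1 <= of_int N" using ex_le_of_int by blast
 have N0: "N >= 0" using N R(1) by linarith
 have int: "integrable lborel (%y. indicator {0..<1} y * \<psi>0 (y - of_int \<nu>))" for \<nu> :: int
 proof -
  have "integrable lborel (%y. \<psi>0 (y - of_int \<nu>))"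
   using lborel_integrable_real_affine[OF psi0_integrable, of 1 "- of_int \<nu>"] by (simp add: algebra_simps)
  then show ?thesis by (rule lint_bound) (auto simp: indicator_def intro!: AE_I2)
 qed
 have "per 0 = (LBINT y. indicator {0..<1::real} y * per 0)" by simp
 also have "... = (LBINT y. (\<Sum>\<nu>\<in>{-N..N}. indicator {0..<1} y * \<psi>0 (y - of_int \<nu>)))"
 proof (intro lint_cong refl)
  fix y :: real
  show "indicator {0..<1} y * per 0 = (\<Sum>\<nu>\<in>{-N..N}. indicator {0..<1} y * \<psi>0 (y - of_int \<nu>))"
  proof (cases "y \<in> {0..<1}")
   case True
   have "per 0 = per y" by (rule const[symmetric])
   also have "... = (\<Sum>\<nu>\<in>{-N..N}. \<psi>0 (y - of_int \<nu>))" by (rule per_eq) (use N True in auto)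
   finally show ?thesis using True by simp
  qed simp
 qed
 also have "... = (\<Sum>\<nu>\<in>{-N..N}. LBINT y. indicator {0..<1} y * \<psi>0 (y - of_int \<nu>))"
  by (rule lint_sum) (rule int)
 also have "... = (\<Sum>\<nu>\<in>{-N..N}. LBINT y. indicator {- of_int \<nu>..< 1 - of_int \<nu>} y * \<psi>0 y)"
 proof (intro sum.cong refl)
  fix \<nu> :: int
  have "(LBINT y. indicator {- of_int \<nu>..< 1 - of_int \<nu>} y * \<psi>0 y) =
   (LBINT y. indicator {- of_int \<nu>..< 1 - of_int \<nu>} (- of_int \<nu> + 1 * y) * \<psi>0 (- of_int \<nu> + 1 * y))"
   by (subst lborel_integral_real_affine[where c = 1 and t = "- of_int \<nu>"]) auto
  also have "... = (LBINT y. indicator {0..<1} y * \<psi>0 (y - of_int \<nu>))"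
   by (intro lint_cong refl) (auto split: split_indicator)
  finally show "(LBINT y. indicator {0..<1} y * \<psi>0 (y - of_int \<nu>)) =
   (LBINT y. indicator {- of_int \<nu>..< 1 - of_int \<nu>} y * \<psi>0 y)" by simp
 qed
 also have "... = (LBINT y. (\<Sum>\<nu>\<in>{-N..N}. indicator {- of_int \<nu>..< 1 - of_int \<nu>} y * \<psi>0 y))"
  by (rule lint_sum[symmetric])
   (rule lint_bound[OF psi0_integrable], auto simp: indicator_def intro!: AE_I2)
 also have "... = (LBINT y. \<psi>0 y)"
 proof (intro lint_cong refl)
  fix y :: real
  show "(\<Sum>\<nu>\<in>{-N..N}. indicator {- of_int \<nu>..< 1 - of_int \<nu>} y * \<psi>0 y) = \<psi>0 y"
  proof (cases "abs y > R")
   case False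
   have mem: "- \<lfloor>y\<rfloor> \<in> {-N..N}" using False N by (simp add: le_floor_iff floor_le_iff) linarith
   have "(\<Sum>\<nu>\<in>{-N..N}. indicator {- of_int \<nu>..< 1 - of_int \<nu>} y * \<psi>0 y) = (\<Sum>\<nu>\<in>{-N..N}. if \<nu> = - \<lfloor>y\<rfloor> then \<psi>0 y else 0)"
   proof (intro sum.cong refl)
    fix \<nu> :: int
    have "y \<in> {- of_int \<nu>..< 1 - of_int \<nu>} \<longleftrightarrow> \<lfloor>y\<rfloor> = - \<nu>" unfolding floor_eq_iff by auto
    then show "indicator {- of_int \<nu>..< 1 - of_int \<nu>} y * \<psi>0 y = (if \<nu> = - \<lfloor>y\<rfloor> then \<psi>0 y else 0)"
     by (auto simp: indicator_def)
   qed
   also have "... = \<psi>0 y" using mem by (subst sum.delta) auto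
   finally show ?thesis .
  qed (use R(2) in simp)
 qed
 finally have "per 0 = 1" using psi0_integral by simp
 then show ?thesis using const by simp
qed

end

section \<open>The wavelet expansion of an interval\<close>

lemma C_k_mono: "C_k K h ==> l <= K ==> C_k l h"
 using C_k_continuous_vderiv[of K h l] unfolding C_k_def by auto

lemma C_k_of_real_affine:
 fixes g :: "real => real"
 assumes g: "C_k K g"
 shows "C_k K (%x. complex_of_real (a * g (c * x + d)))"
proof -
 define E where "E n x = complex_of_real (a * (c ^ n * vderiv n g (c * x + d)))" for n x
 have "(E n has_vector_derivative E (Suc n) x) (at x)" if "n < K" for n x
 proof -
  have "((%x. c * x + d) has_vector_derivative c) (at x)" by (auto intro!: derivative_eq_intros)
  from vector_diff_chain_at[OF this C_k_has_vderiv[OF g that, of "c * x + d"]]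
  have "((%x. vderiv n g (c * x + d)) has_vector_derivative c * vderiv (Suc n) g (c * x + d)) (at x)"
   by (simp add: o_def)
  then have "((%x. vderiv n g (c * x + d)) has_real_derivative c * vderiv (Suc n) g (c * x + d)) (at x)"
   by (simp add: has_real_derivative_iff_has_vector_derivative)
  then have "((%x. a * (c ^ n * vderiv n g (c * x + d))) has_real_derivative a * (c ^ n * (c * vderiv (Suc n) g (c * x + d)))) (at x)"
   by (intro DERIV_cmult)
  from has_vector_derivative_of_real[OF this] show ?thesis
   unfolding E_def by (simp add: mult_ac)
 qed
 moreover have "continuous_on UNIV (E K)"
  unfolding E_def by (intro continuous_intros continuous_on_compose2[OF C_k_continuous_vderiv[OF g, of K]]) auto
 ultimately have "C_k K (E 0)" by (rule C_k_intro(2))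
 moreover have "E 0 = (%x. complex_of_real (a * g (c * x + d)))" by (simp add: E_def fun_eq_iff)
 ultimately show ?thesis by (simp only:)
qed

locale TL_wavelet = TL_element \<phi> s p q f + daubechies_wavelet M K \<psi>0 \<psi>
 for \<phi> s p q f M K \<psi>0 \<psi>
begin

lemma cpair_lincomb:
 fixes w :: "'i => complex"
 assumes "finite A" "!!i. i \<in> A ==> \<exists>r. csmooth1 r (h i)"
 shows "cpair \<phi> f (%x. \<Sum>i\<in>A. w i * h i x) = (\<Sum>i\<in>A. w i * cpair \<phi> f (h i))"
proof -
 have "(%j. \<Sum>i\<in>A. w i * (LBINT t. u j f t * h i t)) sums (\<Sum>i\<in>A. w i * cpair \<phi> f (h i))"
  by (intro sums_sum sums_mult) (use assms(2) cpair_sums in blast)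
 moreover have "(\<Sum>i\<in>A. w i * (LBINT t. u j f t * h i t)) = (LBINT t. u j f t * (\<Sum>i\<in>A. w i * h i t))" for j
 proof -
  have int: "integrable lborel (%t. u j f t * h i t)" if "i \<in> A" for i
   using assms(2)[OF that] csmooth1D(6) u_mult_integrable by blast
  have "(LBINT t. u j f t * (\<Sum>i\<in>A. w i * h i t)) = (LBINT t. (\<Sum>i\<in>A. w i * (u j f t * h i t)))"
   by (simp add: sum_distrib_left mult_ac)
  also have "... = (\<Sum>i\<in>A. LBINT t. w i * (u j f t * h i t))"
   by (intro lint_sum integrable_mult_right int)
  finally show ?thesis by simp
 qed
 ultimately show ?thesis unfolding cpair_def[of \<phi> f "%x. \<Sum>i\<in>A. w i * h i x"] by (simp add: sums_unique[symmetric])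
qed

lemma psi_borel [measurable]: "\<psi> \<in> borel_measurable borel" by (rule borel_measurable_continuous_onI[OF psi_cont])

text \<open>Coefficients of the indicator function of \<open>[a, b)\<close> with respect to the dilated scaling function, and then with respect to the dilated wavelet. The indices up to \<open>nmax\<close> contain all nonzero ones.\<close>

definition scoeff :: "real => real => nat => int => real" where
 "scoeff a b J \<nu> = (LBINT y. indicator {a..<b} y * \<psi>0 (2 ^ J * y - of_int \<nu>))"

definition wcoeff :: "real => real => nat => int => real" where
 "wcoeff a b J \<nu> = (LBINT y. indicator {a..<b} y * \<psi> (2 ^ J * y - of_int \<nu>))"

definition nmax :: "real => real => nat => int" where
 "nmax a b J = \<lceil>2 ^ J * max (abs a) (abs b) + R\<rceil>"

text \<open>The projection of the indicator function onto the \<open>J\<close>-th scaling space.\<close>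

definition proj :: "real => real => nat => real => real" where
 "proj a b J x = (\<Sum>\<nu>\<in>{-nmax a b J..nmax a b J}. 2 ^ J * scoeff a b J \<nu> * \<psi>0 (2 ^ J * x - of_int \<nu>))"

lemma dilate_integrable:
 fixes g :: "real => real"
 assumes "integrable lborel g"
 shows "integrable lborel (%y. g (2 ^ J * y - of_int \<nu>))"
  and "(LBINT y. g (2 ^ J * y - of_int \<nu>)) = (1 / 2 ^ J) * (LBINT y. g y)"
proof -
 show "integrable lborel (%y. g (2 ^ J * y - of_int \<nu>))"
  using lborel_integrable_real_affine[OF assms, of "2 ^ J" "- of_int \<nu>"] by (simp add: algebra_simps)
 have "(LBINT y. g y) = 2 ^ J *\<^sub>R (LBINT y. g (- of_int \<nu> + 2 ^ J * y))"
  by (subst lborel_integral_real_affine[where c = "2 ^ J" and t = "- of_int \<nu>"]) auto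
 then show "(LBINT y. g (2 ^ J * y - of_int \<nu>)) = (1 / 2 ^ J) * (LBINT y. g y)"
  by (simp add: algebra_simps)
qed

lemma indicator_mult_integrable:
 fixes g :: "real => real"
 assumes "integrable lborel g" shows "integrable lborel (%y. indicator {a..<b::real} y * g y)"
 by (rule lint_bound[OF assms])
  (use assms in \<open>auto simp: indicator_def intro!: AE_I2\<close>)

lemma out_of_range:
 assumes "y \<in> {a..<b}" "abs \<nu> > nmax a b J"
 shows "abs (2 ^ J * y - of_int \<nu>) > R"
proof -
 have "abs y <= max (abs a) (abs b)" using assms(1) by auto
 then have "2 ^ J * abs y <= 2 ^ J * max (abs a) (abs b)" by (intro mult_left_mono) auto
 moreover have "2 ^ J * max (abs a) (abs b) + R < of_int (abs \<nu>)"
  using assms(2) unfolding nmax_def by (simp add: ceiling_less_iff)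
 moreover have "abs (2 ^ J * y) = 2 ^ J * abs y" by (simp add: abs_mult)
 ultimately show ?thesis by linarith
qed

lemma scoeff_zero: "abs \<nu> > nmax a b J ==> scoeff a b J \<nu> = 0"
proof -
 assume n: "abs \<nu> > nmax a b J"
 have "(%y. indicator {a..<b} y * \<psi>0 (2 ^ J * y - of_int \<nu>)) = (%y. 0)"
  using R(2) out_of_range[OF _ n] by (auto simp: fun_eq_iff indicator_def)
 then show ?thesis unfolding scoeff_def by simp
qed

lemma scoeff_refine:
 "scoeff a b J \<nu> = (\<Sum>k\<in>D. cI k * scoeff a b (Suc J) (2 * \<nu> + k))"
 "wcoeff a b J \<nu> = (\<Sum>k\<in>D. dI k * scoeff a b (Suc J) (2 * \<nu> + k))"
proof -
 have arg: "2 * (2 ^ J * y - of_int \<nu>) - of_int k = 2 ^ Suc J * y - of_int (2 * \<nu> + k)" for y :: real and k :: int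
  by simp
 have int: "integrable lborel (%y. w * (indicator {a..<b} y * \<psi>0 (2 ^ Suc J * y - of_int (2 * \<nu> + k))))" for w k
  by (intro integrable_mult_right indicator_mult_integrable dilate_integrable psi0_integrable)
 have gen: "(LBINT y. indicator {a..<b} y * (\<Sum>k\<in>D. w k * \<psi>0 (2 * (2 ^ J * y - of_int \<nu>) - of_int k))) =
   (\<Sum>k\<in>D. w k * scoeff a b (Suc J) (2 * \<nu> + k))" for w :: "int => real"
 proof -
  have "(LBINT y. indicator {a..<b} y * (\<Sum>k\<in>D. w k * \<psi>0 (2 * (2 ^ J * y - of_int \<nu>) - of_int k))) =
   (LBINT y. (\<Sum>k\<in>D. w k * (indicator {a..<b} y * \<psi>0 (2 ^ Suc J * y - of_int (2 * \<nu> + k)))))"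
   unfolding arg sum_distrib_left by (intro lint_cong refl sum.cong) simp
  also have "... = (\<Sum>k\<in>D. LBINT y. w k * (indicator {a..<b} y * \<psi>0 (2 ^ Suc J * y - of_int (2 * \<nu> + k))))"
   by (rule lint_sum) (rule int)
  finally show ?thesis unfolding scoeff_def by simp
 qed
 show "scoeff a b J \<nu> = (\<Sum>k\<in>D. cI k * scoeff a b (Suc J) (2 * \<nu> + k))"
  unfolding gen[symmetric] unfolding scoeff_def refinement(1)[of "2 ^ J * _ - of_int \<nu>", symmetric] ..
 show "wcoeff a b J \<nu> = (\<Sum>k\<in>D. dI k * scoeff a b (Suc J) (2 * \<nu> + k))"
  unfolding gen[symmetric] unfolding wcoeff_def refinement(2)[of "2 ^ J * _ - of_int \<nu>", symmetric] ..
qed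

lemma wcoeff_zero: "abs \<nu> > nmax a b J ==> wcoeff a b J \<nu> = 0"
proof -
 assume n: "abs \<nu> > nmax a b J"
 have "(%y. indicator {a..<b} y * \<psi> (2 ^ J * y - of_int \<nu>)) = (%y. 0)"
  using R(3) out_of_range[OF _ n] by (auto simp: fun_eq_iff indicator_def)
 then show ?thesis unfolding wcoeff_def by simp
qed

lemma sum_enlarge:
 fixes g :: "int => real"
 assumes "!!\<nu>. abs \<nu> > N ==> g \<nu> = 0" "N <= L"
 shows "(\<Sum>\<nu>\<in>{-N..N}. g \<nu>) = (\<Sum>\<nu>\<in>{-L..L}. g \<nu>)"
 using assms by (intro sum.mono_neutral_left) auto

text \<open>Consecutive projections differ by one wavelet layer; this is the perfect reconstruction identity with the coefficients and the point values at level \<open>J + 1\<close>.\<close>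

lemma proj_Suc:
 "proj a b (Suc J) x = proj a b J x + (\<Sum>\<nu>\<in>{-nmax a b J..nmax a b J}. 2 ^ J * wcoeff a b J \<nu> * \<psi> (2 ^ J * x - of_int \<nu>))"
proof -
 obtain N0 :: int where N0: "2 ^ Suc J * abs x + R <= of_int N0" using ex_le_of_int by blast
 define N where "N = max N0 (max (nmax a b J) (nmax a b (Suc J)))"
 define L where "L = N + 2 * int M"
 have NL: "nmax a b J <= N" "nmax a b (Suc J) <= N" "N <= L" "nmax a b J <= L" by (auto simp: N_def L_def)
 have b0: "\<psi>0 (2 ^ Suc J * x - of_int m) = 0" if "abs m > N" for m
 proof (rule R(2))
  have "2 ^ Suc J * abs x + R <= of_int N" using N0 by (simp add: N_def le_max_iff_disj)
  also have "of_int N < (of_int (abs m) :: real)" using that by (simp only: of_int_less_iff)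
  finally have "2 ^ Suc J * abs x + R < abs (of_int m)" by simp
  moreover have "abs (2 ^ Suc J * x) = 2 ^ Suc J * abs x" by (simp add: abs_mult)
  ultimately show "abs (2 ^ Suc J * x - of_int m) > R" by linarith
 qed
 have a0: "scoeff a b (Suc J) m = 0" if "abs m > N" for m using that NL by (intro scoeff_zero) auto
 have p: "\<psi>0 (2 ^ J * x - of_int \<nu>) = (\<Sum>k\<in>D. cI k * \<psi>0 (2 ^ Suc J * x - of_int (2 * \<nu> + k)))"
  "\<psi> (2 ^ J * x - of_int \<nu>) = (\<Sum>k\<in>D. dI k * \<psi>0 (2 ^ Suc J * x - of_int (2 * \<nu> + k)))" for \<nu>
 proof -
  have arg: "2 * (2 ^ J * x - of_int \<nu>) - of_int k = 2 ^ Suc J * x - of_int (2 * \<nu> + k)" for k :: int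
   by simp
  show "\<psi>0 (2 ^ J * x - of_int \<nu>) = (\<Sum>k\<in>D. cI k * \<psi>0 (2 ^ Suc J * x - of_int (2 * \<nu> + k)))"
   "\<psi> (2 ^ J * x - of_int \<nu>) = (\<Sum>k\<in>D. dI k * \<psi>0 (2 ^ Suc J * x - of_int (2 * \<nu> + k)))"
   using refinement[of "2 ^ J * x - of_int \<nu>"] unfolding arg by blast+
 qed
 have "proj a b J x + (\<Sum>\<nu>\<in>{-nmax a b J..nmax a b J}. 2 ^ J * wcoeff a b J \<nu> * \<psi> (2 ^ J * x - of_int \<nu>)) =
  (\<Sum>\<nu>\<in>{-L..L}. 2 ^ J * scoeff a b J \<nu> * \<psi>0 (2 ^ J * x - of_int \<nu>)) + (\<Sum>\<nu>\<in>{-L..L}. 2 ^ J * wcoeff a b J \<nu> * \<psi> (2 ^ J * x - of_int \<nu>))"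
  unfolding proj_def by (intro arg_cong2[where f = "(+)"] sum_enlarge NL) (auto simp: scoeff_zero wcoeff_zero)
 also have "... = 2 ^ J * (\<Sum>\<nu>\<in>{-L..L}. scoeff a b J \<nu> * \<psi>0 (2 ^ J * x - of_int \<nu>) + wcoeff a b J \<nu> * \<psi> (2 ^ J * x - of_int \<nu>))"
  unfolding sum.distrib[symmetric] sum_distrib_left by (intro sum.cong) (auto simp: algebra_simps)
 also have "... = 2 ^ J * (2 * (\<Sum>m\<in>{-N..N}. scoeff a b (Suc J) m * \<psi>0 (2 ^ Suc J * x - of_int m)))"
  unfolding p scoeff_refine(1)[of a b J] scoeff_refine(2)[of a b J]
  by (subst perfect_reconstruction[where N = N and a = "scoeff a b (Suc J)" and b = "%m. \<psi>0 (2 ^ Suc J * x - of_int m)"])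
   (use a0 b0 in \<open>auto simp: L_def\<close>)
 also have "... = (\<Sum>m\<in>{-N..N}. 2 ^ Suc J * scoeff a b (Suc J) m * \<psi>0 (2 ^ Suc J * x - of_int m))"
  by (simp add: sum_distrib_left mult_ac)
 also have "... = proj a b (Suc J) x"
  unfolding proj_def by (intro sum_enlarge[symmetric] NL) (auto simp: scoeff_zero)
 finally show ?thesis by simp
qed

abbreviation wav :: "nat => int => real => real" where "wav \<equiv> wavelet \<psi>0 \<psi>"

definition iw :: "real => real => nat => int => real" where
 "iw a b j \<nu> = (LBINT t. indicator {a..<b} t * wav j \<nu> t)"

lemma iw_eq: "iw a b 0 \<nu> = scoeff a b 0 \<nu>" "iw a b (Suc j) \<nu> = 1 / sqrt 2 * wcoeff a b j \<nu>"
proof -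
 show "iw a b 0 \<nu> = scoeff a b 0 \<nu>" by (simp add: iw_def scoeff_def wavelet_def)
 have "iw a b (Suc j) \<nu> = (LBINT t. 1 / sqrt 2 * (indicator {a..<b} t * \<psi> (2 ^ j * t - of_int \<nu>)))"
  unfolding iw_def by (intro lint_cong) (auto simp: wavelet_def)
 then show "iw a b (Suc j) \<nu> = 1 / sqrt 2 * wcoeff a b j \<nu>" unfolding wcoeff_def by simp
qed

lemma wavelet_partial_sum:
 "(\<Sum>j\<le>J. \<Sum>\<nu>\<in>{-nmax a b (j - 1)..nmax a b (j - 1)}. 2 ^ j * iw a b j \<nu> * wav j \<nu> x) = proj a b J x"
proof (induction J)
 case 0
 show ?case by (simp add: iw_eq proj_def wavelet_def)
next
 case (Suc J)
 have "(\<Sum>\<nu>\<in>{-nmax a b J..nmax a b J}. 2 ^ Suc J * iw a b (Suc J) \<nu> * wav (Suc J) \<nu> x) =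
  (\<Sum>\<nu>\<in>{-nmax a b J..nmax a b J}. 2 ^ J * wcoeff a b J \<nu> * \<psi> (2 ^ J * x - of_int \<nu>))"
  by (intro sum.cong refl) (simp add: iw_eq wavelet_def)
 then show ?case using Suc proj_Suc[of a b J x] by simp
qed

lemma wavelet_csmooth: "\<exists>r. csmooth1 r (%x. complex_of_real (wav j \<nu> x))"
 and wavelet_CK: "C_k K (%x. complex_of_real (wav j \<nu> x))"
 and wavelet_support: "abs x > R + abs (of_int \<nu>) ==> wav j \<nu> x = 0"
 and wavelet_integrable: "integrable lborel (wav j \<nu>)"
proof -
 show ck: "C_k K (%x. complex_of_real (wav j \<nu> x))"
 proof (cases j)
  case 0
  then show ?thesis using C_k_of_real_affine[OF CK(1), of 1 1 "- of_int \<nu>"] by (simp add: wavelet_def)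
 next
  case (Suc i)
  then show ?thesis using C_k_of_real_affine[OF CK(2), of "1 / sqrt 2" "2 ^ i" "- of_int \<nu>"] by (simp add: wavelet_def)
 qed
 show supp: "abs x > R + abs (of_int \<nu>) ==> wav j \<nu> x = 0" for x
 proof -
  assume x: "abs x > R + abs (of_int \<nu>)"
  have "abs (2 ^ i * x - of_int \<nu>) > R" for i
  proof -
   have "1 * abs x <= 2 ^ i * abs x" by (intro mult_right_mono) auto
   then have "abs x <= abs (2 ^ i * x)" by (simp add: abs_mult)
   then show ?thesis using x by linarith
  qed
  from this[of 0] this[of "j - 1"] show "wav j \<nu> x = 0" using R by (simp add: wavelet_def)
 qed
 have cs: "csmooth1 (R + abs (of_int \<nu>)) (%x. complex_of_real (wav j \<nu> x))"
  unfolding csmooth1_def using C_k_mono[OF ck K] supp by auto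
 then show "\<exists>r. csmooth1 r (%x. complex_of_real (wav j \<nu> x))" by blast
 show "integrable lborel (wav j \<nu>)" using csmooth1D(6)[OF cs] unfolding complex_of_real_integrable_eq .
qed

lemma wavelet_coeff_eq: "wavelet_coeff K \<psi>0 \<psi> f j \<nu> = 2 ^ j * cpair \<phi> f (%x. complex_of_real (wav j \<nu> x))"
 unfolding wavelet_coeff_def
 by (subst CK_pairing_eq_cpair[OF K wavelet_CK, of "R + abs (of_int \<nu>)"]) (auto simp: wavelet_support)

lemma wavelet_zero_on:
 assumes "t \<in> {a..<b}" "\<nu> \<notin> {-nmax a b (j - 1)..nmax a b (j - 1)}"
 shows "wav j \<nu> t = 0"
proof -
 have "abs \<nu> > nmax a b (j - 1)" using assms(2) by auto
 from out_of_range[OF assms(1) this] have "abs (2 ^ (j - 1) * t - of_int \<nu>) > R" .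
 then show ?thesis using R by (cases j) (auto simp: wavelet_def)
qed

lemma integral_wavelet_layer:
 "(LINT t:{a..<b}|lborel. wavelet_layer K \<psi>0 \<psi> f j t) =
  (\<Sum>\<nu>\<in>{-nmax a b (j - 1)..nmax a b (j - 1)}. of_real (2 ^ j * iw a b j \<nu>) * cpair \<phi> f (%x. complex_of_real (wav j \<nu> x)))"
proof -
 let ?F = "{-nmax a b (j - 1)..nmax a b (j - 1)}"
 let ?c = "wavelet_coeff K \<psi>0 \<psi> f j"
 have int: "integrable lborel (%t. ?c \<nu> * complex_of_real (indicator {a..<b} t * wav j \<nu> t))" for \<nu>
  using indicator_mult_integrable[OF wavelet_integrable, of a b j \<nu>]
  by (intro integrable_mult_right) (simp only: complex_of_real_integrable_eq)
 have "(LINT t:{a..<b}|lborel. wavelet_layer K \<psi>0 \<psi> f j t) =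
  (LBINT t. (\<Sum>\<nu>\<in>?F. ?c \<nu> * complex_of_real (indicator {a..<b} t * wav j \<nu> t)))"
  unfolding set_lebesgue_integral_def
 proof (intro lint_cong refl)
  fix t
  show "indicator {a..<b} t *\<^sub>R wavelet_layer K \<psi>0 \<psi> f j t = (\<Sum>\<nu>\<in>?F. ?c \<nu> * complex_of_real (indicator {a..<b} t * wav j \<nu> t))"
  proof (cases "t \<in> {a..<b}")
   case True
   have "wavelet_layer K \<psi>0 \<psi> f j t = infsum (%\<nu>. ?c \<nu> * complex_of_real (wav j \<nu> t)) ?F"
    unfolding wavelet_layer_def using wavelet_zero_on[OF True] by (intro infsum_cong_neutral) auto
   then show ?thesis using True by simp
  qed simp
 qed
 also have "... = (\<Sum>\<nu>\<in>?F. LBINT t. ?c \<nu> * complex_of_real (indicator {a..<b} t * wav j \<nu> t))"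
  by (rule lint_sum) (rule int)
 also have "... = (\<Sum>\<nu>\<in>?F. of_real (2 ^ j * iw a b j \<nu>) * cpair \<phi> f (%x. complex_of_real (wav j \<nu> x)))"
 proof (intro sum.cong refl)
  fix \<nu>
  have "(LBINT t. ?c \<nu> * complex_of_real (indicator {a..<b} t * wav j \<nu> t)) = ?c \<nu> * of_real (iw a b j \<nu>)"
   unfolding iw_def by (simp only: integral_mult_right_zero integral_complex_of_real)
  then show "(LBINT t. ?c \<nu> * complex_of_real (indicator {a..<b} t * wav j \<nu> t)) =
   of_real (2 ^ j * iw a b j \<nu>) * cpair \<phi> f (%x. complex_of_real (wav j \<nu> x))"
   by (simp add: wavelet_coeff_eq)
 qed
 finally show ?thesis .
qed

text \<open>Integrating a layer over the interval and pairing \<open>f\<close> with the projection use the same coefficients with the two factors exchanged.\<close>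

lemma wavelet_partial_integral:
 "(\<Sum>j\<le>J. LINT t:{a..<b}|lborel. wavelet_layer K \<psi>0 \<psi> f j t) = cpair \<phi> f (%x. complex_of_real (proj a b J x))"
proof -
 let ?F = "%j. {-nmax a b (j - 1)..nmax a b (j - 1)}"
 let ?A = "Sigma {..J} ?F"
 let ?h = "%i x. complex_of_real (wav (fst i) (snd i) x)"
 let ?k = "%i. complex_of_real (2 ^ fst i * iw a b (fst i) (snd i))"
 have "(\<Sum>j\<le>J. LINT t:{a..<b}|lborel. wavelet_layer K \<psi>0 \<psi> f j t) = (\<Sum>i\<in>?A. ?k i * cpair \<phi> f (?h i))"
  unfolding integral_wavelet_layer by (subst sum.Sigma) (auto intro!: sum.cong)
 also have "... = cpair \<phi> f (%x. \<Sum>i\<in>?A. ?k i * ?h i x)"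
  by (rule cpair_lincomb[where A = ?A and h = ?h and w = ?k, symmetric]) (use wavelet_csmooth in auto)
 also have "(%x. \<Sum>i\<in>?A. ?k i * ?h i x) = (%x. complex_of_real (proj a b J x))"
 proof
  fix x
  have "(\<Sum>i\<in>?A. ?k i * ?h i x) = complex_of_real (\<Sum>i\<in>?A. 2 ^ fst i * iw a b (fst i) (snd i) * wav (fst i) (snd i) x)"
   by simp
  also have "(\<Sum>i\<in>?A. 2 ^ fst i * iw a b (fst i) (snd i) * wav (fst i) (snd i) x) = proj a b J x"
   unfolding wavelet_partial_sum[symmetric] by (subst sum.Sigma) (auto intro!: sum.cong)
  finally show "(\<Sum>i\<in>?A. ?k i * ?h i x) = complex_of_real (proj a b J x)" .
 qed
 finally show ?thesis .
qed

section \<open>The scaling projections of an interval\<close>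

definition proj' :: "real => real => nat => real => real" where
 "proj' a b J x = (\<Sum>\<nu>\<in>{-nmax a b J..nmax a b J}. 2 ^ J * scoeff a b J \<nu> * (2 ^ J * vderiv 1 \<psi>0 (2 ^ J * x - of_int \<nu>)))"

lemma proj_derivative: "(proj a b J has_real_derivative proj' a b J x) (at x)"
proof -
 have d: "(\<psi>0 has_real_derivative vderiv 1 \<psi>0 y) (at y)" for y
  using C_k_has_vderiv[OF C_k_mono[OF CK(1) K], of 0 y] by (simp add: has_real_derivative_iff_has_vector_derivative)
 have "((%x. \<psi>0 (2 ^ J * x - of_int \<nu>)) has_real_derivative 2 ^ J * vderiv 1 \<psi>0 (2 ^ J * x - of_int \<nu>)) (at x)" for \<nu> :: int
 proof -
  have "((%x. 2 ^ J * x - of_int \<nu>) has_real_derivative 2 ^ J) (at x)" by (auto intro!: derivative_eq_intros)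
  from DERIV_chain2[OF d this] show ?thesis by (simp add: mult.commute)
 qed
 then show ?thesis unfolding proj_def[abs_def] proj'_def by (intro DERIV_sum DERIV_cmult)
qed

lemma proj'_continuous: "continuous_on UNIV (proj' a b J)"
 unfolding proj'_def
 by (intro continuous_intros continuous_on_compose2[OF C_k_continuous_vderiv[OF CK(1) K]]) auto

lemma proj_csmooth:
 assumes "abs a <= r" "abs b <= r"
 shows "csmooth1 (r + 2 * R + 1) (%x. complex_of_real (proj a b J x))"
  and "vderiv 1 (%x. complex_of_real (proj a b J x)) = (%x. complex_of_real (proj' a b J x))"
proof -
 define E where "E n x = complex_of_real (if n = 0 then proj a b J x else proj' a b J x)" for n :: nat and x
 have E: "(E n has_vector_derivative E (Suc n) x) (at x)" if "n < 1" for n x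
  using that has_vector_derivative_of_real[OF proj_derivative[of a b J x], where 'a = complex] by (simp add: E_def[abs_def])
 have cE: "continuous_on UNIV (E 1)"
  unfolding E_def using proj'_continuous by (auto intro: continuous_intros)
 have E0: "E 0 = (%x. complex_of_real (proj a b J x))" by (simp add: E_def fun_eq_iff)
 show "vderiv 1 (%x. complex_of_real (proj a b J x)) = (%x. complex_of_real (proj' a b J x))"
  using C_k_intro(1)[of 1 E 1, OF E] unfolding E0 by (simp add: E_def fun_eq_iff)
 have "proj a b J x = 0" if x: "abs x > r + 2 * R + 1" for x
  unfolding proj_def
 proof (rule sum.neutral, rule ballI)
  fix \<nu> assume "\<nu> \<in> {-nmax a b J..nmax a b J}"
  then have "abs \<nu> <= nmax a b J" by auto
  then have "abs (of_int \<nu>) <= (of_int (nmax a b J) :: real)" by linarith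
  also have "of_int (nmax a b J) <= 2 ^ J * max (abs a) (abs b) + R + 1" unfolding nmax_def by linarith
  also have "... <= 2 ^ J * r + R + 1" using assms by (intro add_mono mult_left_mono) auto
  finally have n: "abs (of_int \<nu>) <= 2 ^ J * r + R + 1" .
  have "2 ^ J * (r + 2 * R + 1) < 2 ^ J * abs x" using x by (intro mult_strict_left_mono) auto
  moreover have "1 * (2 * R + 1) <= 2 ^ J * (2 * R + 1)" using R(1) by (intro mult_right_mono) auto
  moreover have "abs (2 ^ J * x) = 2 ^ J * abs x" by (simp add: abs_mult)
  ultimately have "abs (2 ^ J * x) > 2 ^ J * r + 2 * R + 1" by (simp add: algebra_simps)
  then have "abs (2 ^ J * x - of_int \<nu>) > R" using n by linarith
  then show "2 ^ J * scoeff a b J \<nu> * \<psi>0 (2 ^ J * x - of_int \<nu>) = 0" using R(2) by simp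
 qed
 then show "csmooth1 (r + 2 * R + 1) (%x. complex_of_real (proj a b J x))"
  unfolding csmooth1_def using C_k_intro(2)[of 1 E, OF E cE] unfolding E0 by auto
qed

definition I0 :: real where "I0 = (LBINT y. abs (\<psi>0 y))"

lemma scoeff_bound: "abs (2 ^ J * scoeff a b J \<nu>) <= I0"
proof -
 have i: "integrable lborel (%y. abs (\<psi>0 y))" by (intro integrable_abs psi0_integrable)
 have "abs (scoeff a b J \<nu>) <= (LBINT y. abs (indicator {a..<b} y * \<psi>0 (2 ^ J * y - of_int \<nu>)))"
  unfolding scoeff_def by (rule integral_abs_bound)
 also have "... <= (LBINT y. abs (\<psi>0 (2 ^ J * y - of_int \<nu>)))"
  by (intro integral_mono integrable_abs indicator_mult_integrable dilate_integrable psi0_integrable)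
   (auto simp: indicator_def)
 also have "... = (1 / 2 ^ J) * I0" unfolding I0_def by (rule dilate_integrable(2)[OF i])
 finally show ?thesis by (simp add: abs_mult field_simps)
qed

lemma local_sum_bound:
 assumes g: "!!y. abs (g y) <= S" "!!y. abs y > R ==> g y = 0"
 shows "abs (\<Sum>\<nu>\<in>{-N..N}. 2 ^ J * scoeff a b J \<nu> * g (y - of_int \<nu>)) <= (2 * R + 1) * (I0 * S)"
proof -
 let ?B = "{\<nu>::int. abs (y - of_int \<nu>) <= R}"
 have S: "S >= 0" using order_trans[OF abs_ge_zero g(1)] .
 have I: "I0 >= 0" unfolding I0_def by simp
 have "abs (\<Sum>\<nu>\<in>{-N..N}. 2 ^ J * scoeff a b J \<nu> * g (y - of_int \<nu>)) <= (\<Sum>\<nu>\<in>{-N..N}. abs (2 ^ J * scoeff a b J \<nu> * g (y - of_int \<nu>)))"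
  by (rule sum_abs)
 also have "... = (\<Sum>\<nu>\<in>{-N..N} \<inter> ?B. abs (2 ^ J * scoeff a b J \<nu> * g (y - of_int \<nu>)))"
 proof (rule sum.mono_neutral_right)
  have "g (y - of_int \<nu>) = 0" if "\<nu> \<notin> ?B" for \<nu> using that by (intro g(2)) simp
  then show "\<forall>\<nu>\<in>{-N..N} - ({-N..N} \<inter> ?B). abs (2 ^ J * scoeff a b J \<nu> * g (y - of_int \<nu>)) = 0" by auto
 qed auto
 also have "... <= (\<Sum>\<nu>\<in>{-N..N} \<inter> ?B. I0 * S)"
 proof (rule sum_mono)
  fix \<nu>
  have "abs (2 ^ J * scoeff a b J \<nu>) * abs (g (y - of_int \<nu>)) <= I0 * S" by (intro mult_mono scoeff_bound g(1) I) auto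
  then show "abs (2 ^ J * scoeff a b J \<nu> * g (y - of_int \<nu>)) <= I0 * S" by (simp only: abs_mult)
 qed
 also have "... = real (card ({-N..N} \<inter> ?B)) * (I0 * S)" by simp
 also have "... <= (2 * R + 1) * (I0 * S)"
 proof (rule mult_right_mono)
  have "card ({-N..N} \<inter> ?B) <= card ?B" by (intro card_mono card_int_interval) auto
  then show "real (card ({-N..N} \<inter> ?B)) <= 2 * R + 1" using card_int_interval(2)[OF R(1), of y] by linarith
 qed (use I S in simp)
 finally show ?thesis .
qed

lemma psi0_bounds: "\<exists>S. \<forall>y. abs (\<psi>0 y) <= S" "\<exists>S. \<forall>y. abs (vderiv 1 \<psi>0 y) <= S" "abs y > R ==> vderiv 1 \<psi>0 y = 0"
proof -
 have bnd: "\<exists>S. \<forall>y. abs (g y) <= S" if "continuous_on UNIV g" "!!y. abs y > R ==> g y = 0" for g :: "real => real"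
 proof -
  have "rapid (%y. complex_of_real (g y))"
   using that by (intro compact_support_rapid continuous_intros) (auto simp: compactly_supported_def intro!: exI[of _ R])
  from rapidD[OF this, of 0] show ?thesis by auto
 qed
 show z: "abs y > R ==> vderiv 1 \<psi>0 y = 0" for y
  by (rule vderiv_support[OF CK(1) _ K]) (use R(2) in auto)
 show "\<exists>S. \<forall>y. abs (\<psi>0 y) <= S" by (rule bnd[OF psi0_cont R(2)])
 show "\<exists>S. \<forall>y. abs (vderiv 1 \<psi>0 y) <= S" by (rule bnd[OF C_k_continuous_vderiv[OF CK(1) K] z])
qed

text \<open>By the partition of unity the projection reproduces constants, and its kernel has range \<open>2 R / 2 ^ J\<close>; away from the end points it therefore sees a constant.\<close>

lemma proj_away:
 assumes x: "abs (x - a) > 2 * R / 2 ^ J" "abs (x - b) > 2 * R / 2 ^ J" and ab: "a < b"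
 shows "proj a b J x = indicator {a..<b} x"
proof -
 have near: "abs (y - x) <= 2 * R / 2 ^ J" if "abs (2 ^ J * x - of_int \<nu>) <= R" "abs (2 ^ J * y - of_int \<nu>) <= R" for y and \<nu> :: int
 proof -
  have "abs (2 ^ J * y - 2 ^ J * x) <= 2 * R" using that by linarith
  then have "2 ^ J * abs (y - x) <= 2 * R" by (simp only: right_diff_distrib[symmetric] abs_mult) simp
  then show ?thesis by (simp add: pos_le_divide_eq mult.commute)
 qed
 have rho: "2 * R / 2 ^ J >= 0" using R(1) by simp
 show ?thesis
 proof (cases "x \<in> {a..<b}")
  case True
  have A: "2 ^ J * scoeff a b J \<nu> = 1" if nu: "abs (2 ^ J * x - of_int \<nu>) <= R" for \<nu>
  proof -
   have "scoeff a b J \<nu> = (LBINT y. \<psi>0 (2 ^ J * y - of_int \<nu>))"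
    unfolding scoeff_def
   proof (intro lint_cong refl)
    fix y
    show "indicator {a..<b} y * \<psi>0 (2 ^ J * y - of_int \<nu>) = \<psi>0 (2 ^ J * y - of_int \<nu>)"
    proof (cases "abs (2 ^ J * y - of_int \<nu>) <= R")
     case True
     from near[OF nu True] have "y \<in> {a..<b}" using x \<open>x \<in> {a..<b}\<close> by auto
     then show ?thesis by simp
    qed (use R(2) in \<open>simp add: not_le\<close>)
   qed
   then show ?thesis by (simp add: dilate_integrable(2)[OF psi0_integrable] psi0_integral)
  qed
  have "proj a b J x = (\<Sum>\<nu>\<in>{-nmax a b J..nmax a b J}. \<psi>0 (2 ^ J * x - of_int \<nu>))"
   unfolding proj_def
  proof (intro sum.cong refl)
   fix \<nu>
   show "2 ^ J * scoeff a b J \<nu> * \<psi>0 (2 ^ J * x - of_int \<nu>) = \<psi>0 (2 ^ J * x - of_int \<nu>)"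
    using A[of \<nu>] R(2) by (cases "abs (2 ^ J * x - of_int \<nu>) <= R") (auto simp: not_le)
  qed
  also have "... = per (2 ^ J * x)"
  proof (rule per_eq[symmetric])
   show "\<nu> \<in> {-nmax a b J..nmax a b J}" if "abs (2 ^ J * x - of_int \<nu>) <= R" for \<nu>
    using out_of_range[OF True, of J \<nu>] that by (cases "abs \<nu> > nmax a b J") auto
  qed simp
  also have "... = 1" by (rule partition_of_unity)
  finally show ?thesis using True by simp
 next
  case False
  have "2 ^ J * scoeff a b J \<nu> * \<psi>0 (2 ^ J * x - of_int \<nu>) = 0" for \<nu>
  proof (cases "abs (2 ^ J * x - of_int \<nu>) <= R")
   case True
   have "indicator {a..<b} y * \<psi>0 (2 ^ J * y - of_int \<nu>) = 0" for y
   proof (cases "abs (2 ^ J * y - of_int \<nu>) <= R")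
    case y: True
    from near[OF True y] have "y \<notin> {a..<b}" using x False ab by auto
    then show ?thesis by simp
   qed (use R(2) in \<open>simp add: not_le\<close>)
   then have "(%y. indicator {a..<b} y * \<psi>0 (2 ^ J * y - of_int \<nu>)) = (%y. 0)" by (rule ext)
   then have "scoeff a b J \<nu> = 0" unfolding scoeff_def by (simp only: Bochner_Integration.integral_zero)
   then show ?thesis by simp
  qed (use R(2) in \<open>simp add: not_le\<close>)
  then show ?thesis using False unfolding proj_def by (simp add: sum.neutral del: mult_eq_0_iff)
 qed
qed

lemma proj'_away:
 assumes t: "abs (t - a) > 2 * R / 2 ^ J" "abs (t - b) > 2 * R / 2 ^ J" and ab: "a < b"
 shows "proj' a b J t = 0"
proof -
 define e where "e = min (abs (t - a) - 2 * R / 2 ^ J) (abs (t - b) - 2 * R / 2 ^ J)"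
 have rho: "2 * R / 2 ^ J >= 0" using R(1) by simp
 have e: "e > 0" "e <= abs (t - a) - 2 * R / 2 ^ J" "e <= abs (t - b) - 2 * R / 2 ^ J" using t by (auto simp: e_def)
 have eq: "proj a b J x = indicator {a..<b} t" if "x \<in> ball t e" for x
 proof -
  have d: "abs (x - t) < e" using that by (simp add: dist_real_def abs_minus_commute)
  then have "abs (x - a) > 2 * R / 2 ^ J" "abs (x - b) > 2 * R / 2 ^ J" using e by linarith+
  then have "proj a b J x = indicator {a..<b} x" by (rule proj_away[OF _ _ ab])
  also have "... = indicator {a..<b} t"
  proof -
   have "abs (x - t) < abs (t - a)" "abs (x - t) < abs (t - b)" using d e rho by linarith+
   then have "x \<in> {a..<b} \<longleftrightarrow> t \<in> {a..<b}" by auto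
   then show ?thesis by (simp add: indicator_def)
  qed
  finally show ?thesis .
 qed
 have "((%x. indicator {a..<b} t) has_real_derivative proj' a b J t) (at t)"
  by (rule has_field_derivative_transform_within_open[OF proj_derivative, where S = "ball t e"]) (use e eq in auto)
 then show ?thesis using DERIV_const DERIV_unique by blast
qed

text \<open>The derivative is at most of order \<open>2^J\<close> and vanishes outside two intervals of length of order \<open>2^-J\<close>.\<close>

lemma proj_total_variation:
 assumes ab: "a < b"
 shows "\<exists>V. \<forall>J. (LBINT t. cmod (complex_of_real (proj' a b J t))) <= V"
proof -
 obtain S where S: "!!y. abs (vderiv 1 \<psi>0 y) <= S" using psi0_bounds(2) by blast
 define C where "C = (2 * R + 1) * (I0 * S)"
 have bd: "abs (proj' a b J t) <= 2 ^ J * C" for J t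
 proof -
  have "proj' a b J t = 2 ^ J * (\<Sum>\<nu>\<in>{-nmax a b J..nmax a b J}. 2 ^ J * scoeff a b J \<nu> * vderiv 1 \<psi>0 (2 ^ J * t - of_int \<nu>))"
   unfolding proj'_def by (simp add: sum_distrib_left mult_ac)
  then have "abs (proj' a b J t) = 2 ^ J * abs (\<Sum>\<nu>\<in>{-nmax a b J..nmax a b J}. 2 ^ J * scoeff a b J \<nu> * vderiv 1 \<psi>0 (2 ^ J * t - of_int \<nu>))"
   by (simp add: abs_mult)
  also have "... <= 2 ^ J * C"
   unfolding C_def by (intro mult_left_mono local_sum_bound[OF S psi0_bounds(3)]) auto
  finally show ?thesis .
 qed
 have C0: "C >= 0" using order_trans[OF abs_ge_zero bd[of 0 0]] by simp
 have "(LBINT t. cmod (complex_of_real (proj' a b J t))) <= 8 * R * C" for J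
 proof -
  let ?r = "2 * R / 2 ^ J"
  have r: "?r >= 0" using R(1) by simp
  let ?w = "%t. (2 ^ J * C) * indicator {a - ?r..a + ?r} t + (2 ^ J * C) * indicator {b - ?r..b + ?r} t"
  have iw: "integrable lborel (%t. (2 ^ J * C) * indicator {x - ?r..x + ?r} t :: real)" for x
   using r by (intro integrable_mult_right integrable_real_indicator) auto
  have "(LBINT t. cmod (complex_of_real (proj' a b J t))) <= (LBINT t. ?w t)"
  proof (rule integral_mono)
   have "integrable lborel (vderiv 1 (%x. complex_of_real (proj a b J x)))"
    by (rule csmooth1D(7)[OF proj_csmooth(1)[of a "max (abs a) (abs b)" b]]) auto
   then have "integrable lborel (%t. complex_of_real (proj' a b J t))"
    using proj_csmooth(2)[of a "max (abs a) (abs b)" b] by simp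
   then show "integrable lborel (%t. cmod (complex_of_real (proj' a b J t)))" by (rule integrable_norm)
   show "integrable lborel ?w" by (intro Bochner_Integration.integrable_add iw)
   fix t
   show "cmod (complex_of_real (proj' a b J t)) <= ?w t"
   proof (cases "abs (t - a) > ?r \<and> abs (t - b) > ?r")
    case True
    then have "proj' a b J t = 0" using proj'_away[OF _ _ ab] by blast
    then show ?thesis using C0 by simp
   next
    case False
    then have "t \<in> {a - ?r..a + ?r} \<or> t \<in> {b - ?r..b + ?r}" by (auto simp: not_less abs_le_iff)
    then have "2 ^ J * C <= ?w t" using C0 by (auto simp: indicator_def)
    then show ?thesis using bd[of J t] by simp
   qed
  qed
  also have "... = (2 ^ J * C) * (2 * ?r) + (2 ^ J * C) * (2 * ?r)"
   using iw[of a] iw[of b] r by (subst Bochner_Integration.integral_add) auto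
  also have "... = 8 * R * C" by simp
  finally show ?thesis .
 qed
 then show ?thesis by blast
qed

lemma proj_converges:
 assumes ab: "a < b" and t: "t \<noteq> a" "t \<noteq> b"
 shows "(%J. proj a b J t) \<longlonglongrightarrow> indicator {a..<b} t"
proof (rule tendsto_eventually)
 have lim: "(%J. 2 * R / 2 ^ J) \<longlonglongrightarrow> 0" using LIMSEQ_divide_realpow_zero[of 2 "2 * R"] by simp
 have "\<forall>\<^sub>F J in sequentially. 2 * R / 2 ^ J < abs (t - a)" "\<forall>\<^sub>F J in sequentially. 2 * R / 2 ^ J < abs (t - b)"
  using order_tendstoD(2)[OF lim] t by auto
 then show "\<forall>\<^sub>F J in sequentially. proj a b J t = indicator {a..<b} t"
  by eventually_elim (rule proj_away[OF _ _ ab])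
qed

text \<open>Both branches of the definition are limits of \<open>cpair\<close> along the projections of the indicator function: the wavelet branch because its partial sums are these pairings, the locally integrable branch by dominated convergence.\<close>

theorem distribution_integral_eq:
 assumes ab: "a < b"
 shows "distribution_integral K \<psi>0 \<psi> f {a..<b} = (\<Sum>j. LBINT t. u j f t * indicator {a..<b} t)"
proof -
 define r where "r = max (abs a) (abs b)"
 have ar: "abs a <= r" "abs b <= r" by (auto simp: r_def)
 let ?h = "%J x. complex_of_real (proj a b J x)"
 note cs = proj_csmooth(1)[OF ar]
 obtain S where S: "!!y. abs (\<psi>0 y) <= S" using psi0_bounds(1) by blast
 define H where "H = (2 * R + 1) * (I0 * S)"
 have H: "cmod (?h J t) <= H" for J t
  unfolding H_def proj_def norm_of_real by (rule local_sum_bound[OF S R(2)])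
 obtain V where V: "!!J. (LBINT t. cmod (vderiv 1 (?h J) t)) <= V"
  using proj_total_variation[OF ab] unfolding proj_csmooth(2)[OF ar] by blast
 have lim: "AE t in lborel. (%J. ?h J t) \<longlonglongrightarrow> indicator {a..<b} t"
 proof -
  have "AE t in lborel. t \<noteq> a" "AE t in lborel. t \<noteq> b" by (rule AE_lborel_singleton)+
  then show ?thesis
  proof eventually_elim
   case (elim t)
   have "(%J. ?h J t) \<longlonglongrightarrow> complex_of_real (indicator {a..<b} t)"
    by (intro tendsto_of_real proj_converges[OF ab elim])
   then show ?case by (auto simp: indicator_def)
  qed
 qed
 have main: "(%J. cpair \<phi> f (?h J)) \<longlonglongrightarrow> (\<Sum>j. LBINT t. u j f t * indicator {a..<b} t)"
  by (rule cpair_limit[OF cs lim _ H V]) simp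
 show ?thesis
 proof (cases "\<exists>g. represented_by f g")
  case True
  define g where "g = (SOME g. represented_by f g)"
  have g: "represented_by f g" unfolding g_def by (rule someI_ex[OF True])
  define R' where "R' = r + 2 * R + 1"
  have gi: "integrable lborel (%t. indicator {-R'..R'} t *\<^sub>R g t)"
   using g unfolding represented_by_def set_integrable_def by blast
  note [measurable] = borel_measurable_integrable[OF csmooth1D(6)[OF cs]] borel_measurable_integrable[OF gi]
  have cut: "g t * ?h J t = (indicator {-R'..R'} t *\<^sub>R g t) * ?h J t" for J t
   using csmooth1D(4)[OF cs, of t J] by (cases "abs t > R'") (auto simp: indicator_def R'_def)
  have cuti: "g t * indicator {a..<b} t = (indicator {-R'..R'} t *\<^sub>R g t) * indicator {a..<b} t" for t
   using ar R(1) by (auto simp: indicator_def R'_def)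
  have "(%J. LBINT t. g t * ?h J t) \<longlonglongrightarrow> (LBINT t. g t * indicator {a..<b} t)"
   unfolding cut cuti
  proof (rule integral_dominated_convergence[where w = "%t. H * cmod (indicator {-R'..R'} t *\<^sub>R g t)"])
   show "integrable lborel (%t. H * cmod (indicator {-R'..R'} t *\<^sub>R g t))" using gi by (intro integrable_mult_right integrable_norm)
   show "AE t in lborel. (%J. (indicator {-R'..R'} t *\<^sub>R g t) * ?h J t) \<longlonglongrightarrow> (indicator {-R'..R'} t *\<^sub>R g t) * indicator {a..<b} t"
    using lim by eventually_elim (intro tendsto_intros)
   show "AE t in lborel. cmod ((indicator {-R'..R'} t *\<^sub>R g t) * ?h J t) <= H * cmod (indicator {-R'..R'} t *\<^sub>R g t)" for J
    unfolding norm_mult[of _ "?h J _"] mult.commute[of H] by (intro AE_I2 mult_left_mono H) simp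
  qed measurable
  then have "(%J. cpair \<phi> f (?h J)) \<longlonglongrightarrow> (LBINT t. g t * indicator {a..<b} t)"
   using represented_pairing[OF g cs] by simp
  then have "(LBINT t. g t * indicator {a..<b} t) = (\<Sum>j. LBINT t. u j f t * indicator {a..<b} t)"
   using main LIMSEQ_unique by blast
  moreover have "(LINT t:{a..<b}|lborel. g t) = (LBINT t. g t * indicator {a..<b} t)"
   unfolding set_lebesgue_integral_def by (intro lint_cong) (auto simp: indicator_def)
  ultimately show ?thesis using True unfolding distribution_integral_def g_def by simp
 next
  case False
  have "(%j. LINT t:{a..<b}|lborel. wavelet_layer K \<psi>0 \<psi> f j t) sums (\<Sum>j. LBINT t. u j f t * indicator {a..<b} t)"
   unfolding sums_def_le wavelet_partial_integral by (rule main)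
  then show ?thesis unfolding distribution_integral_def if_not_P[OF False] by (rule sums_unique[symmetric])
 qed
qed

end

section \<open>Two-sided geometric series\<close>

definition gap :: "nat => nat => nat" where
 "gap j N = (if j <= N then N - j else j - N)"

text \<open>An upper bound for the sum of \<open>2^(-\<alpha> n)\<close> over all integer distances \<open>n\<close>, each counted twice.\<close>

definition geo :: "real => real" where
 "geo \<alpha> = 2 / (1 - 2 powr (- \<alpha>))"

lemma powr_minus_lt_1: "\<alpha> > 0 ==> 2 powr (- \<alpha>) < (1::real)"
 using powr_less_mono[of "- \<alpha>" 0 2] by simp

lemma geo_pos: "\<alpha> > 0 ==> geo \<alpha> > 0"
 using powr_minus_lt_1[of \<alpha>] by (simp add: geo_def)

lemma two_sided_geometric:
 assumes "\<alpha> > 0"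
 shows "summable (%j. 2 powr (- \<alpha> * real (gap j N)))" "(\<Sum>j. 2 powr (- \<alpha> * real (gap j N))) <= geo \<alpha>"
proof -
 define r where "r = 2 powr (- \<alpha>)"
 have r: "0 <= r" "r < 1" using powr_minus_lt_1[OF assms] by (auto simp: r_def)
 have e: "2 powr (- \<alpha> * real n) = r ^ n" for n :: nat
 proof -
  have "r ^ n = r powr real n" by (rule powr_realpow[symmetric]) (simp add: r_def)
  moreover have "r powr real n = 2 powr (- \<alpha> * real n)" by (simp add: r_def powr_powr)
  ultimately show ?thesis by simp
 qed
 have eq: "(%j. 2 powr (- \<alpha> * real (gap (j + N) N))) = (%j. r ^ j)"
 proof
  fix j :: nat
  have "gap (j + N) N = j" by (simp add: gap_def)
  then show "2 powr (- \<alpha> * real (gap (j + N) N)) = r ^ j" by (simp only: e)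
 qed
 have "summable (%j. r ^ j)" using r by (simp add: summable_geometric)
 then show sm: "summable (%j. 2 powr (- \<alpha> * real (gap j N)))"
  using summable_iff_shift[of "%j. 2 powr (- \<alpha> * real (gap j N))" N] eq by simp
 have "(\<Sum>j. 2 powr (- \<alpha> * real (gap j N))) = (\<Sum>j. r ^ j) + (\<Sum>j<N. 2 powr (- \<alpha> * real (gap j N)))"
  using suminf_split_initial_segment[OF sm, of N] eq by simp
 also have "(\<Sum>j<N. 2 powr (- \<alpha> * real (gap j N))) = (\<Sum>j<N. r ^ (N - j))"
  by (rule sum.cong[OF refl], subst e) (simp add: gap_def)
 also have "... = (\<Sum>i<N. r ^ Suc i)"
  by (rule sum.reindex_bij_witness[of _ "%i. N - Suc i" "%j. N - Suc j"]) (auto simp: Suc_diff_Suc simp del: power_Suc)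
 also have "... <= (\<Sum>i<N. r ^ i)" using r by (intro sum_mono) (simp add: mult_left_le_one_le)
 also have "... <= (\<Sum>i. r ^ i)" using r by (intro sum_le_suminf) (auto simp: summable_geometric)
 finally show "(\<Sum>j. 2 powr (- \<alpha> * real (gap j N))) <= geo \<alpha>"
  using r by (simp add: suminf_geometric geo_def r_def)
qed

lemma two_sided_geometric_ennreal:
 assumes "\<alpha> > 0"
 shows "(\<Sum>j. ennreal (2 powr (- \<alpha> * real (gap j N)))) <= ennreal (geo \<alpha>)"
 by (subst suminf_ennreal2) (use two_sided_geometric[OF assms, of N] in \<open>auto intro: ennreal_leI\<close>)

lemma suminf_ge_member_ennreal: "f j <= (\<Sum>j. f j)" for f :: "nat => ennreal"
 using sum_le_suminf[of f "{j}"] by simp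

text \<open>A substitute for Hoelder's inequality for sums that works for all \<open>p > 0\<close>: each term is at most a geometric factor times the \<open>p\<close>-th root of the right-hand sum.\<close>

lemma sum_powr_weighted:
 assumes p: "p > 0" and e: "\<epsilon> > 0" and t: "!!j. t j >= 0" "summable t"
 shows "ennreal (suminf t powr p) <= ennreal (geo \<epsilon> powr p) * (\<Sum>j. ennreal ((2 powr (\<epsilon> * real (gap j N)) * t j) powr p))"
proof (cases "(\<Sum>j. ennreal ((2 powr (\<epsilon> * real (gap j N)) * t j) powr p))")
 case (real S)
 have le: "t j <= 2 powr (- \<epsilon> * real (gap j N)) * S powr (1 / p)" for j
 proof -
  have "ennreal ((2 powr (\<epsilon> * real (gap j N)) * t j) powr p) <= ennreal S"
   using suminf_ge_member_ennreal[of "%j. ennreal ((2 powr (\<epsilon> * real (gap j N)) * t j) powr p)" j] real by simp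
  then have "(2 powr (\<epsilon> * real (gap j N)) * t j) powr p <= S" using real by simp
  then have "((2 powr (\<epsilon> * real (gap j N)) * t j) powr p) powr (1 / p) <= S powr (1 / p)"
   using p by (intro powr_mono2) auto
  then have "2 powr (\<epsilon> * real (gap j N)) * t j <= S powr (1 / p)" using p t(1)[of j] by (simp add: powr_powr)
  then have "2 powr (- \<epsilon> * real (gap j N)) * (2 powr (\<epsilon> * real (gap j N)) * t j) <= 2 powr (- \<epsilon> * real (gap j N)) * S powr (1 / p)"
   by (intro mult_left_mono) auto
  then show ?thesis by (simp add: mult.assoc[symmetric] powr_add[symmetric])
 qed
 have "suminf t <= (\<Sum>j. 2 powr (- \<epsilon> * real (gap j N)) * S powr (1 / p))"
  by (intro suminf_le le t summable_mult2 two_sided_geometric e)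
 also have "... = (\<Sum>j. 2 powr (- \<epsilon> * real (gap j N))) * S powr (1 / p)"
  by (rule suminf_mult2[symmetric]) (rule two_sided_geometric[OF e])
 also have "... <= geo \<epsilon> * S powr (1 / p)" by (intro mult_right_mono two_sided_geometric e) auto
 finally have "suminf t powr p <= (geo \<epsilon> * S powr (1 / p)) powr p"
  using p t by (intro powr_mono2) (auto intro: suminf_nonneg)
 also have "... = geo \<epsilon> powr p * S" using p geo_pos[OF e] real by (simp add: powr_mult powr_powr)
 finally have "ennreal (suminf t powr p) <= ennreal (geo \<epsilon> powr p * S)" by (rule ennreal_leI)
 also have "... = ennreal (geo \<epsilon> powr p) * ennreal S" using real by (simp add: ennreal_mult)
 finally show ?thesis using real by simp
next
 case top
 have "geo \<epsilon> powr p > 0" using geo_pos[OF e] by simp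
 then show ?thesis unfolding top by (simp add: ennreal_mult_top)
qed

section \<open>Norms\<close>

lemma ennpowr_mult:
 assumes "r > 0" "c > 0" shows "ennpowr (ennreal c * x) r = ennreal (c powr r) * ennpowr x r"
proof (cases x)
 case (real y)
 then show ?thesis using assms
  by (simp add: ennreal_mult[symmetric] ennpowr_ennreal powr_mult)
next
 case top
 then show ?thesis using assms by (simp add: ennreal_mult_top ennpowr_def)
qed

lemma ennpowr_add:
 assumes "r > 0" shows "ennpowr (x + y) r <= ennreal (2 powr r) * (ennpowr x r + ennpowr y r)"
proof -
 have "x + y <= ennreal 2 * max x y"
 proof -
  have "x + y <= max x y + max x y" by (intro add_mono) auto
  also have "... = ennreal 2 * max x y" by (simp add: mult_2)
  finally show ?thesis .
 qed
 then have "ennpowr (x + y) r <= ennpowr (ennreal 2 * max x y) r" using assms by (intro ennpowr_mono) auto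
 also have "... = ennreal (2 powr r) * ennpowr (max x y) r" using assms by (intro ennpowr_mult) auto
 also have "ennpowr (max x y) r <= ennpowr x r + ennpowr y r"
  by (cases "x <= y") (auto simp: max_def add_increasing add_increasing2)
 finally show ?thesis by (simp add: mult_left_mono)
qed

lemma ennpowr_measurable [measurable]:
 assumes [measurable]: "f \<in> borel_measurable M"
 shows "(%x. ennpowr (f x) r) \<in> borel_measurable M"
proof -
 have [measurable]: "Measurable.pred M (%x. f x = \<infinity>)"
  using measurable_sets[OF assms, of "{\<infinity>}"] by (simp add: pred_def vimage_def Int_def conj_commute)
 show ?thesis unfolding ennpowr_def by measurable
qed

lemma lq_norm_mono: "(!!j. a j <= b j) ==> q > 0 ==> lq_norm q a <= lq_norm q b"
 unfolding lq_norm_def by (auto intro!: SUP_mono ennpowr_mono suminf_le simp: enn2real_nonneg)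

lemma lq_norm_measurable [measurable]:
 assumes [measurable]: "!!j. (%x. a x j) \<in> borel_measurable M"
 shows "(%x. lq_norm q (a x)) \<in> borel_measurable M"
 unfolding lq_norm_def by (cases "q = \<infinity>") auto

text \<open>The constant of the quasi-triangle inequality in \<open>\<ell>\<^sub>q\<close>.\<close>

definition cq :: "ennreal => real" where
 "cq q = (if q = \<infinity> then 1 else 2 * 2 powr (1 / enn2real q))"

lemma cq_pos: "cq q > 0" by (simp add: cq_def)

lemma lq_norm_add:
 assumes "q > 0" shows "lq_norm q (%j. a j + b j) <= ennreal (cq q) * (lq_norm q a + lq_norm q b)"
proof (cases "q = \<infinity>")
 case True
 have "(SUP j. a j + b j) <= (SUP j. a j) + (SUP j. b j)"
  by (intro SUP_least add_mono SUP_upper) auto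
 then show ?thesis using True by (simp add: lq_norm_def cq_def)
next
 case False
 define r where "r = enn2real q"
 have r: "r > 0" using assms False by (simp add: r_def enn2real_positive_iff less_top)
 let ?A = "\<Sum>j. ennpowr (a j) r" and ?B = "\<Sum>j. ennpowr (b j) r"
 have "(\<Sum>j. ennpowr (a j + b j) r) <= (\<Sum>j. ennreal (2 powr r) * (ennpowr (a j) r + ennpowr (b j) r))"
  by (intro suminf_le ennpowr_add r) auto
 also have "... = ennreal (2 powr r) * (?A + ?B)" by (simp add: suminf_add)
 finally have "ennpowr (\<Sum>j. ennpowr (a j + b j) r) (1 / r) <= ennpowr (ennreal (2 powr r) * (?A + ?B)) (1 / r)"
  using r by (intro ennpowr_mono) auto
 also have "... = ennreal ((2 powr r) powr (1 / r)) * ennpowr (?A + ?B) (1 / r)" using r by (intro ennpowr_mult) auto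
 also have "(2 powr r) powr (1 / r) = 2" using r by (simp add: powr_powr)
 also have "ennreal 2 * ennpowr (?A + ?B) (1 / r) <= ennreal 2 * (ennreal (2 powr (1 / r)) * (ennpowr ?A (1 / r) + ennpowr ?B (1 / r)))"
  using r by (intro mult_left_mono ennpowr_add) auto
 also have "... = ennreal (2 * 2 powr (1 / r)) * (ennpowr ?A (1 / r) + ennpowr ?B (1 / r))"
  by (simp only: mult.assoc[symmetric] ennreal_mult''[symmetric] powr_ge_zero)
 finally show ?thesis using False unfolding lq_norm_def cq_def r_def[symmetric] by simp
qed

definition cb :: "ennreal => real => real" where
 "cb q \<eta> = (if q = \<infinity> then 1 else geo (\<eta> * enn2real q) powr (1 / enn2real q))"

lemma cb_pos: "q > 0 ==> \<eta> > 0 ==> cb q \<eta> > 0"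
 using geo_pos[of "\<eta> * enn2real q"] by (auto simp: cb_def enn2real_positive_iff less_top)

text \<open>Geometric weights embed \<open>\<ell>\<^sub>p\<close> into every \<open>\<ell>\<^sub>q\<close>, since a single member of a weighted \<open>\<ell>\<^sub>p\<close> sequence is already bounded by the geometric factor times the norm.\<close>

lemma lq_norm_le_weighted:
 assumes q: "q > 0" and p: "p > 0" and \<eta>: "\<eta> > 0"
 shows "lq_norm q b <= ennreal (cb q \<eta>) * ennpowr (\<Sum>k. ennpowr (ennreal (2 powr (\<eta> * real (gap k N))) * b k) p) (1 / p)"
proof -
 define S where "S = ennpowr (\<Sum>k. ennpowr (ennreal (2 powr (\<eta> * real (gap k N))) * b k) p) (1 / p)"
 have le: "b k <= ennreal (2 powr (- \<eta> * real (gap k N))) * S" for k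
 proof -
  let ?w = "2 powr (\<eta> * real (gap k N))"
  have "ennreal ?w * b k = ennpowr (ennpowr (ennreal ?w * b k) p) (1 / p)"
   using p by (simp add: ennpowr_ennpowr ennpowr_1)
  also have "... <= S" unfolding S_def using p
   by (intro ennpowr_mono suminf_ge_member_ennreal[of "%k. ennpowr (ennreal (2 powr (\<eta> * real (gap k N))) * b k) p"]) auto
  finally have "ennreal (2 powr (- \<eta> * real (gap k N))) * (ennreal ?w * b k) <= ennreal (2 powr (- \<eta> * real (gap k N))) * S"
   by (intro mult_left_mono) auto
  then show ?thesis by (simp add: mult.assoc[symmetric] ennreal_mult[symmetric] powr_add[symmetric])
 qed
 show ?thesis
 proof (cases "q = \<infinity>")
  case True
  have "b k <= S" for k
  proof -
   have "2 powr (- \<eta> * real (gap k N)) <= 2 powr (0::real)" using \<eta> by (intro powr_mono) auto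
   then have "ennreal (2 powr (- \<eta> * real (gap k N))) * S <= 1 * S" by (intro mult_right_mono) auto
   then show ?thesis using le[of k] by simp
  qed
  then show ?thesis using True unfolding lq_norm_def cb_def S_def[symmetric] by (simp add: SUP_least)
 next
  case False
  define r where "r = enn2real q"
  have r: "r > 0" using q False by (simp add: r_def enn2real_positive_iff less_top)
  have er: "\<eta> * r > 0" using \<eta> r by simp
  have "(\<Sum>k. ennpowr (b k) r) <= (\<Sum>k. ennreal (2 powr (- (\<eta> * r) * real (gap k N))) * ennpowr S r)"
  proof (rule suminf_le)
   fix k
   have "ennpowr (b k) r <= ennpowr (ennreal (2 powr (- \<eta> * real (gap k N))) * S) r" using r by (intro ennpowr_mono le) auto
   also have "... = ennreal ((2 powr (- \<eta> * real (gap k N))) powr r) * ennpowr S r" using r by (intro ennpowr_mult) auto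
   finally show "ennpowr (b k) r <= ennreal (2 powr (- (\<eta> * r) * real (gap k N))) * ennpowr S r"
    by (simp add: powr_powr mult_ac)
  qed auto
  also have "... = (\<Sum>k. ennreal (2 powr (- (\<eta> * r) * real (gap k N)))) * ennpowr S r" by simp
  also have "... <= ennreal (geo (\<eta> * r)) * ennpowr S r"
   by (intro mult_right_mono two_sided_geometric_ennreal er) auto
  finally have "ennpowr (\<Sum>k. ennpowr (b k) r) (1 / r) <= ennpowr (ennreal (geo (\<eta> * r)) * ennpowr S r) (1 / r)"
   using r by (intro ennpowr_mono) auto
  also have "... = ennreal (geo (\<eta> * r) powr (1 / r)) * S"
   using r geo_pos[OF er] by (subst ennpowr_mult) (auto simp: ennpowr_ennpowr ennpowr_1)
  finally show ?thesis using False unfolding lq_norm_def cb_def S_def[symmetric] r_def[symmetric] by simp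
 qed
qed

section \<open>Sums of translated bumps\<close>

lemma nn_integral_weight_scaled:
 assumes l: "l > 0"
 shows "(LBNN x. ennreal (1 / (1 + l * abs (x - y))\<^sup>2)) = ennreal (2 / l)"
proof -
 have "(LBNN x. ennreal (1 / (1 + l * abs (x - y))\<^sup>2)) = ennreal (1 / l) * (LBNN x. ennreal (1 / (1 + l * abs ((y + (1 / l) * x) - y))\<^sup>2))"
  using l by (subst nn_integral_real_affine[where c = "1 / l" and t = y]) auto
 also have "(LBNN x. ennreal (1 / (1 + l * abs ((y + (1 / l) * x) - y))\<^sup>2)) = 2"
  using l nn_integral_weight by (simp add: abs_mult)
 finally show ?thesis using l by (simp add: ennreal_mult'[symmetric] ennreal_numeral[symmetric] del: ennreal_numeral)
qed

text \<open>The \<open>L\<^sub>p\<close> norm of a superposition of bumps of width \<open>1/l\<close> on a lattice of spacing \<open>d\<close>. The exponent \<open>wexp p + 2\<close> leaves quadratic decay after taking \<open>p\<close>-th powers if \<open>p \<le> 1\<close>. For \<open>p > 1\<close> Hoelder's inequality costs the number of overlapping bumps to the power \<open>p - 1\<close>.\<close>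

lemma bump_sum_Lp:
 fixes T :: "int => real" and F :: "real => real"
 assumes p: "p > 0" and l: "l > 0" and d: "d > 0" and T: "!!\<mu>. T \<mu> >= 0" "!!\<mu>. T \<mu> <= Tm"
  and F0: "!!x. F x >= 0"
  and F: "!!x. ennreal (F x) <= (ZSUM \<mu>. ennreal (T \<mu> / (1 + l * abs (x - d * of_int \<mu>)) ^ (wexp p + 2)))"
 shows "(LBNN x. ennreal (F x powr p)) \<le>
  ennreal (2 * 16 powr p * max 1 (1 / (l * d)) powr (max (p - 1) 0) * (1 / l)) * (ZSUM \<mu>. ennreal (T \<mu> powr p))"
proof -
 define m where "m = wexp p + 2"
 define q where "q x \<mu> = 1 + l * abs (x - d * of_int \<mu>)" for x and \<mu> :: int
 have q1: "q x \<mu> >= 1" for x \<mu> unfolding q_def using l by simp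
 have q0: "q x \<mu> > 0" for x \<mu> using q1[of x \<mu>] by linarith
 define W where "W = 8 * max 1 (1 / (l * d))"
 have W0: "W > 0" by (simp add: W_def)
 have lat: "(ZSUM \<mu>. ennreal (1 / (q x \<mu>)\<^sup>2)) <= ennreal W" for x
 proof -
  have "q x \<mu> = 1 + abs ((l * d) * of_int \<mu> - l * x)" for \<mu>
  proof -
   have "l * abs (x - d * of_int \<mu>) = abs (l * (x - d * of_int \<mu>))" using l by (simp add: abs_mult)
   also have "... = abs ((l * d) * of_int \<mu> - l * x)" by (simp add: right_diff_distrib abs_minus_commute mult.assoc)
   finally show ?thesis by (simp add: q_def)
  qed
  then show ?thesis unfolding W_def using lattice_sum_bound[of "l * d" "l * x"] l d by simp
 qed
 have Tm0: "Tm >= 0" using T[of 0] by linarith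
 define J where "J x = (ZSUM \<mu>. ennreal (T \<mu> powr p / (q x \<mu>)\<^sup>2))" for x
 have Jfin: "J x \<noteq> \<top>" for x
 proof -
  have "J x <= (ZSUM \<mu>. ennreal (Tm powr p) * ennreal (1 / (q x \<mu>)\<^sup>2))"
   unfolding J_def
  proof (rule nn_integral_mono)
   fix \<mu>
   have "T \<mu> powr p / (q x \<mu>)\<^sup>2 <= Tm powr p * (1 / (q x \<mu>)\<^sup>2)"
    using T p by (auto intro!: divide_right_mono powr_mono2)
   then show "ennreal (T \<mu> powr p / (q x \<mu>)\<^sup>2) <= ennreal (Tm powr p) * ennreal (1 / (q x \<mu>)\<^sup>2)"
    by (simp add: ennreal_mult[symmetric] ennreal_leI)
  qed
  also have "... = ennreal (Tm powr p) * (ZSUM \<mu>. ennreal (1 / (q x \<mu>)\<^sup>2))"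
   by (rule nn_integral_cmult) simp
  also have "... <= ennreal (Tm powr p) * ennreal W" by (intro mult_left_mono lat) auto
  also have "... < \<top>" by (simp add: ennreal_mult_less_top)
  finally show ?thesis by simp
 qed
 have main: "ennreal (F x powr p) <= ennreal (16 powr p * max 1 (1 / (l * d)) powr (max (p - 1) 0)) * J x" for x
 proof -
  obtain j where j: "j >= 0" "J x = ennreal j" using Jfin[of x] by (cases "J x") auto
  show ?thesis
  proof (cases "p <= 1")
   case True
   have fin: "(ZSUM \<mu>. ennreal (T \<mu> / q x \<mu> ^ m)) \<noteq> \<top>"
   proof -
    have "(ZSUM \<mu>. ennreal (T \<mu> / q x \<mu> ^ m)) <= (ZSUM \<mu>. ennreal Tm * ennreal (1 / (q x \<mu>)\<^sup>2))"
    proof (rule nn_integral_mono)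
     fix \<mu>
     have "T \<mu> / q x \<mu> ^ m <= Tm / (q x \<mu>)\<^sup>2"
      using T Tm0 q0[of x \<mu>] q1[of x \<mu>] by (intro frac_le power_increasing) (auto simp: m_def)
     then show "ennreal (T \<mu> / q x \<mu> ^ m) <= ennreal Tm * ennreal (1 / (q x \<mu>)\<^sup>2)"
      using Tm0 by (simp add: ennreal_mult[symmetric] ennreal_leI)
    qed
    also have "... = ennreal Tm * (ZSUM \<mu>. ennreal (1 / (q x \<mu>)\<^sup>2))"
     by (rule nn_integral_cmult) simp
    also have "... <= ennreal Tm * ennreal W" by (intro mult_left_mono lat) auto
    also have "... < \<top>" by (simp add: ennreal_mult_less_top)
    finally show ?thesis by simp
   qed
   then obtain X where X: "X >= 0" "(ZSUM \<mu>. ennreal (T \<mu> / q x \<mu> ^ m)) = ennreal X"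
    by (cases "\<integral>\<^sup>+\<mu>. ennreal (T \<mu> / q x \<mu> ^ m) \<partial>count_space UNIV") auto
   have "ennreal (F x) <= ennreal X" using F[of x] X unfolding q_def m_def by simp
   then have "F x <= X" using X by simp
   then have "ennreal (F x powr p) <= ennreal (X powr p)" using F0 p by (intro ennreal_leI powr_mono2) auto
   also have "... <= (ZSUM \<mu>. ennreal ((T \<mu> / q x \<mu> ^ m) powr p))"
    using T q0 by (intro nn_integral_powr_superadditive[OF p True _ X(2,1)]) (auto intro!: divide_nonneg_pos)
   also have "... <= J x" unfolding J_def
   proof (intro nn_integral_mono ennreal_leI)
    fix \<mu>
    have "(q x \<mu> ^ m) powr p = q x \<mu> powr (real m * p)"
     using q0[of x \<mu>] by (simp add: powr_realpow[symmetric] powr_powr)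
    moreover have "q x \<mu> powr 2 <= q x \<mu> powr (real m * p)"
    proof (rule powr_mono)
     have "2 / p <= real m" using wexp_ge[OF p] by (simp add: m_def)
     then show "2 <= real m * p" using p by (simp add: pos_divide_le_eq)
    qed (rule q1)
    moreover have "q x \<mu> powr 2 = (q x \<mu>)\<^sup>2" using q0[of x \<mu>] powr_realpow[of "q x \<mu>" 2] by simp
    ultimately have "(q x \<mu>)\<^sup>2 <= (q x \<mu> ^ m) powr p" by simp
    moreover have "(T \<mu> / q x \<mu> ^ m) powr p = T \<mu> powr p / (q x \<mu> ^ m) powr p"
     by (rule powr_divide)
    ultimately show "(T \<mu> / q x \<mu> ^ m) powr p <= T \<mu> powr p / (q x \<mu>)\<^sup>2"
     using q0[of x \<mu>] by (simp add: divide_left_mono)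
   qed
   also have "... <= ennreal (16 powr p * max 1 (1 / (l * d)) powr (max (p - 1) 0)) * J x"
   proof -
    have "1 <= (16::real) powr p" using p by (intro ge_one_powr_ge_zero) auto
    moreover have "1 <= max 1 (1 / (l * d)) powr (max (p - 1) 0)" by (intro ge_one_powr_ge_zero) auto
    ultimately have "1 * 1 <= 16 powr p * max 1 (1 / (l * d)) powr (max (p - 1) 0)" by (intro mult_mono) auto
    then have "1 * J x <= ennreal (16 powr p * max 1 (1 / (l * d)) powr (max (p - 1) 0)) * J x"
     by (intro mult_right_mono) (auto simp flip: ennreal_1 intro: ennreal_leI)
    then show ?thesis by simp
   qed
   finally show ?thesis .
  next
   case False
   then have p1: "p >= 1" "max (p - 1) 0 = p - 1" by auto
   have "ennreal (F x) <= (ZSUM \<mu>. ennreal (T \<mu> * (1 / (q x \<mu>)\<^sup>2)))"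
   proof (rule order_trans[OF F nn_integral_mono])
    fix \<mu>
    have "T \<mu> / q x \<mu> ^ m <= T \<mu> / (q x \<mu>)\<^sup>2"
     using T q0[of x \<mu>] q1[of x \<mu>] by (intro divide_left_mono power_increasing) (auto simp: m_def)
    then show "ennreal (T \<mu> / (1 + l * abs (x - d * of_int \<mu>)) ^ (wexp p + 2)) <= ennreal (T \<mu> * (1 / (q x \<mu>)\<^sup>2))"
     unfolding q_def m_def by (simp add: ennreal_leI)
   qed
   also have "... <= ennreal (2 * W powr (1 - 1 / p) * j powr (1 / p))"
   proof (rule hoelder_weight[OF p1(1) _ _ T(1) _ lat W0 _ j(1)])
    show "(ZSUM \<mu>. ennreal (T \<mu> powr p * (1 / (q x \<mu>)\<^sup>2))) <= ennreal j"
     using j(2) unfolding J_def by simp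
   qed auto
   finally have "F x <= 2 * W powr (1 - 1 / p) * j powr (1 / p)" by (simp add: ennreal_le_iff)
   then have "F x powr p <= (2 * W powr (1 - 1 / p) * j powr (1 / p)) powr p" using F0 p by (intro powr_mono2) auto
   also have "... = 2 powr p * W powr (p - 1) * j"
    using p j W0 by (simp add: powr_mult powr_powr left_diff_distrib)
   also have "W powr (p - 1) = 8 powr (p - 1) * max 1 (1 / (l * d)) powr (p - 1)"
    unfolding W_def by (rule powr_mult)
   also have "2 powr p * (8 powr (p - 1) * max 1 (1 / (l * d)) powr (p - 1)) * j \<le>
     (16 powr p * max 1 (1 / (l * d)) powr (p - 1)) * j"
   proof (rule mult_right_mono[OF _ j(1)])
    have "(2::real) powr p * 8 powr (p - 1) <= 2 powr p * 8 powr p" by (intro mult_left_mono powr_mono) auto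
    also have "... = 16 powr p" by (simp add: powr_mult[symmetric])
    finally have "2 powr p * 8 powr (p - 1) * max 1 (1 / (l * d)) powr (p - 1) <= 16 powr p * max 1 (1 / (l * d)) powr (p - 1)"
     by (intro mult_right_mono) auto
    then show "2 powr p * (8 powr (p - 1) * max 1 (1 / (l * d)) powr (p - 1)) <= 16 powr p * max 1 (1 / (l * d)) powr (p - 1)"
     by (simp add: mult.assoc)
   qed
   finally have "ennreal (F x powr p) <= ennreal ((16 powr p * max 1 (1 / (l * d)) powr (p - 1)) * j)" by (rule ennreal_leI)
   then show ?thesis unfolding p1(2) j(2) using j(1) by (simp add: ennreal_mult)
  qed
 qed
 have "(LBNN x. ennreal (F x powr p)) \<le>
  (LBNN x. ennreal (16 powr p * max 1 (1 / (l * d)) powr (max (p - 1) 0)) * J x)"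
  by (intro nn_integral_mono main)
 also have "... = ennreal (16 powr p * max 1 (1 / (l * d)) powr (max (p - 1) 0)) * (LBNN x. J x)"
 proof (rule nn_integral_cmult)
  have "(%(x, \<mu>::int). ennreal (T \<mu> powr p / (q x \<mu>)\<^sup>2)) \<in> borel_measurable (lborel \<Otimes>\<^sub>M count_space UNIV)"
   unfolding q_def split_beta'
   by (rule measurable_compose_countable'[where g = snd and I = UNIV and f = "%\<mu> z. ennreal (T \<mu> powr p / (1 + l * abs (fst z - d * of_int \<mu>))\<^sup>2)"]) auto
  then show "J \<in> borel_measurable lborel"
   unfolding J_def[abs_def] by (rule sigma_finite_measure.borel_measurable_nn_integral[OF sigma_finite_measure_count_space])
 qed
 also have "(LBNN x. J x) = (ZSUM \<mu>. LBNN x. ennreal (T \<mu> powr p / (q x \<mu>)\<^sup>2))"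
  unfolding J_def q_def by (rule nn_integral_count_space_nn_integral) auto
 also have "... = (ZSUM \<mu>. ennreal (2 / l) * ennreal (T \<mu> powr p))"
 proof (intro nn_integral_cong)
  fix \<mu> :: int
  have "(LBNN x. ennreal (T \<mu> powr p / (q x \<mu>)\<^sup>2)) = (LBNN x. ennreal (T \<mu> powr p) * ennreal (1 / (1 + l * abs (x - d * of_int \<mu>))\<^sup>2))"
   by (intro nn_integral_cong) (simp add: q_def ennreal_mult[symmetric])
  also have "... = ennreal (T \<mu> powr p) * ennreal (2 / l)"
   by (subst nn_integral_cmult) (auto simp: nn_integral_weight_scaled[OF l])
  finally show "(LBNN x. ennreal (T \<mu> powr p / (q x \<mu>)\<^sup>2)) = ennreal (2 / l) * ennreal (T \<mu> powr p)"
   by (simp add: mult.commute)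
 qed
 also have "... = ennreal (2 / l) * (ZSUM \<mu>. ennreal (T \<mu> powr p))"
  by (rule nn_integral_cmult) simp
 also have "ennreal (16 powr p * max 1 (1 / (l * d)) powr (max (p - 1) 0)) * ... =
   ennreal (2 * 16 powr p * max 1 (1 / (l * d)) powr (max (p - 1) 0) * (1 / l)) * (ZSUM \<mu>. ennreal (T \<mu> powr p))"
  using l by (simp only: mult.assoc[symmetric], subst ennreal_mult[symmetric]) (auto simp: mult_ac)
 finally show ?thesis .
qed

section \<open>Integrals against step functions\<close>

definition cell :: "real => int => real set" where
 "cell d \<mu> = {d * of_int \<mu>..<d * (of_int \<mu> + 1)}"

lemma cell_sets [measurable]: "cell d \<mu> \<in> sets borel"
 by (simp add: cell_def)

lemma mem_cell: "d > 0 ==> y \<in> cell d \<mu> \<longleftrightarrow> \<lfloor>y / d\<rfloor> = \<mu>"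
 by (auto simp: cell_def floor_eq_iff pos_le_divide_eq pos_divide_less_eq mult.commute)

lemma emeasure_cell: "d > 0 ==> emeasure lborel (cell d \<mu>) = ennreal d"
 by (simp add: cell_def distrib_left)

lemma cell_dist: "d > 0 ==> y \<in> cell d \<mu> ==> abs (y - d * of_int \<mu>) <= d"
 by (auto simp: cell_def distrib_left)

lemma cell_integral_bound:
 fixes h :: "real => complex"
 assumes d: "d > 0" and B: "B >= 0" "!!y. y \<in> cell d \<mu> ==> cmod (h y) <= B"
 shows "cmod (LBINT y. indicator (cell d \<mu>) y * h y) <= B * d"
proof -
 have "ennreal (cmod (LBINT y. indicator (cell d \<mu>) y * h y)) <= (LBNN y. ennreal (cmod (indicator (cell d \<mu>) y * h y)))"
  by (rule norm_integral_le_nn_integral)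
 also have "... <= (LBNN y. ennreal B * indicator (cell d \<mu>) y)"
  using B(2) by (intro nn_integral_mono) (auto simp: norm_mult ennreal_leI split: split_indicator)
 also have "... = ennreal (B * d)"
  using d B by (subst nn_integral_cmult_indicator) (auto simp: emeasure_cell ennreal_mult)
 finally show ?thesis using B d by simp
qed

lemma cell_indicator:
 assumes d: "d > 0"
 shows "integrable lborel (indicator (cell d \<mu>) :: real => complex)"
  "(LBINT y. (indicator (cell d \<mu>) y :: complex)) = of_real d"
proof -
 have e: "(indicator (cell d \<mu>) :: real => complex) = (%y. of_real (indicator (cell d \<mu>) y))"
  by (auto split: split_indicator)
 have i: "integrable lborel (indicator (cell d \<mu>) :: real => real)"
  by (rule integrable_real_indicator) (simp_all add: emeasure_cell d)
 show "integrable lborel (indicator (cell d \<mu>) :: real => complex)"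
  unfolding e by (rule integrable_of_real[OF i])
 have "(LBINT y. (indicator (cell d \<mu>) y :: real)) = d"
  using d by (simp add: measure_def emeasure_cell)
 then show "(LBINT y. (indicator (cell d \<mu>) y :: complex)) = of_real d"
  unfolding e by simp
qed

lemma cell_integral_one: "d > 0 ==> (LBINT y. indicator (cell d \<mu>) y * (z::complex)) = of_real d * z"
 by (simp only: integral_mult_left_zero cell_indicator(2))

text \<open>Fubini for the product of the counting measure with Lebesgue measure. Working with integrals over the integers rather than with limits of finite sums makes the summations by parts free of boundary terms.\<close>

lemma integral_step_decomposition:
 fixes h :: "real => complex"
 assumes d: "d > 0" and h: "integrable lborel h"
 shows "integrable (count_space UNIV) (%\<mu>. LBINT y. indicator (cell d \<mu>) y * h y)"
  and "(LBINT y. h y) = (\<integral>\<mu>. (LBINT y. indicator (cell d \<mu>) y * h y) \<partial>count_space UNIV)"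
proof -
 interpret pair_sigma_finite "count_space (UNIV :: int set)" "lborel :: real measure"
  by (intro pair_sigma_finite.intro sigma_finite_measure_count_space lborel.sigma_finite_measure_axioms)
 note [measurable] = borel_measurable_integrable[OF h]
 let ?F = "%(\<mu>, y). indicator (cell d \<mu>) y * h y"
 have one: "(\<integral>\<mu>. indicator (cell d \<mu>) y * h y \<partial>count_space UNIV) = h y" for y
 proof -
  have s: "{\<mu>. indicator (cell d \<mu>) y * h y \<noteq> 0} \<subseteq> {\<lfloor>y / d\<rfloor>}"
   using d by (auto simp: mem_cell split: split_indicator)
  have "(\<integral>\<mu>. indicator (cell d \<mu>) y * h y \<partial>count_space UNIV) = (\<Sum>\<mu> | indicator (cell d \<mu>) y * h y \<noteq> 0. indicator (cell d \<mu>) y * h y)"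
   using finite_subset[OF s] by (subst lebesgue_integral_count_space_finite_support) auto
  also have "... = (\<Sum>\<mu>\<in>{\<lfloor>y / d\<rfloor>}. indicator (cell d \<mu>) y * h y)"
   by (rule sum.mono_neutral_left) (use s in auto)
  also have "... = h y" using d by (simp add: mem_cell)
  finally show ?thesis .
 qed
 have m: "?F \<in> borel_measurable (count_space UNIV \<Otimes>\<^sub>M lborel)"
  by (rule measurable_pair_measure_countable1) auto
 have "(\<integral>\<^sup>+z. ennreal (norm (?F z)) \<partial>(count_space UNIV \<Otimes>\<^sub>M lborel)) = (LBNN y. ZSUM \<mu>. ennreal (norm (?F (\<mu>, y))))"
  by (rule nn_integral_snd[symmetric]) (use m in measurable)
 also have "... = (LBNN y. ennreal (norm (h y)))"
 proof (rule nn_integral_cong)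
  fix y
  have "(ZSUM \<mu>. ennreal (norm (?F (\<mu>, y)))) = (ZSUM \<mu>. ennreal (norm (h y)) * indicator {\<lfloor>y / d\<rfloor>} \<mu>)"
   using d by (intro nn_integral_cong) (auto simp: mem_cell norm_mult split: split_indicator)
  also have "... = ennreal (norm (h y))" by (subst nn_integral_cmult_indicator) auto
  finally show "(ZSUM \<mu>. ennreal (norm (?F (\<mu>, y)))) = ennreal (norm (h y))" .
 qed
 also have "... < \<infinity>" using h by (simp add: integrable_iff_bounded)
 finally have i: "integrable (count_space UNIV \<Otimes>\<^sub>M lborel) ?F" by (rule integrableI_bounded[OF m])
 show "integrable (count_space UNIV) (%\<mu>. LBINT y. indicator (cell d \<mu>) y * h y)"
  using integrable_fst[OF i] .
 show "(LBINT y. h y) = (\<integral>\<mu>. (LBINT y. indicator (cell d \<mu>) y * h y) \<partial>count_space UNIV)"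
  using Fubini_integral[OF i] unfolding one .
qed

lemma count_integrable_bounded_mult:
 fixes a c :: "int => complex"
 assumes "!!\<mu>. cmod (a \<mu>) <= B" "integrable (count_space UNIV) c"
 shows "integrable (count_space UNIV) (%\<mu>. a \<mu> * c \<mu>)"
proof (rule lint_bound[of _ "%\<mu>. B * cmod (c \<mu>)"])
 have "cmod (a \<mu> * c \<mu>) <= norm (B * cmod (c \<mu>))" for \<mu>
 proof -
  have "cmod (a \<mu> * c \<mu>) <= B * cmod (c \<mu>)" unfolding norm_mult by (intro mult_right_mono assms) auto
  then show ?thesis by simp
 qed
 then show "AE \<mu> in count_space UNIV. norm (a \<mu> * c \<mu>) <= norm (B * cmod (c \<mu>))" by simp
qed (use assms in auto)

lemma count_integral_shift:
 fixes F :: "int => complex"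
 shows "integrable (count_space UNIV) (%\<mu>. F (\<mu> + k)) \<longleftrightarrow> integrable (count_space UNIV) F"
  "(\<integral>\<mu>. F (\<mu> + k) \<partial>count_space UNIV) = (\<integral>\<mu>. F \<mu> \<partial>count_space UNIV)"
proof -
 have b: "bij_betw (%\<mu>. \<mu> + k) UNIV UNIV" by (rule bij_betwI[where g = "%\<mu>. \<mu> - k"]) auto
 show "integrable (count_space UNIV) (%\<mu>. F (\<mu> + k)) \<longleftrightarrow> integrable (count_space UNIV) F"
  by (rule integrable_bij_count_space[OF b])
 show "(\<integral>\<mu>. F (\<mu> + k) \<partial>count_space UNIV) = (\<integral>\<mu>. F \<mu> \<partial>count_space UNIV)"
  by (rule integral_bij_count_space[OF b])
qed

lemma count_summation_by_parts:
 fixes a c :: "int => complex"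
 assumes a: "!!\<mu>. cmod (a \<mu>) <= B" and c: "integrable (count_space UNIV) c"
 shows "integrable (count_space UNIV) (%\<mu>. a \<mu> * (c (\<mu> - 1) - c \<mu>))"
  "(\<integral>\<mu>. (a (\<mu> + 1) - a \<mu>) * c \<mu> \<partial>count_space UNIV) = (\<integral>\<mu>. a \<mu> * (c (\<mu> - 1) - c \<mu>) \<partial>count_space UNIV)"
proof -
 have c': "integrable (count_space UNIV) (%\<mu>. c (\<mu> - 1))" using count_integral_shift(1)[of c "-1"] c by simp
 note i = count_integrable_bounded_mult[OF a c] count_integrable_bounded_mult[OF a c'] count_integrable_bounded_mult[OF _ c, of "%\<mu>. a (\<mu> + 1)", OF a]
 show "integrable (count_space UNIV) (%\<mu>. a \<mu> * (c (\<mu> - 1) - c \<mu>))"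
  unfolding right_diff_distrib by (intro Bochner_Integration.integrable_diff i)
 show "(\<integral>\<mu>. (a (\<mu> + 1) - a \<mu>) * c \<mu> \<partial>count_space UNIV) = (\<integral>\<mu>. a \<mu> * (c (\<mu> - 1) - c \<mu>) \<partial>count_space UNIV)"
  unfolding right_diff_distrib left_diff_distrib
  using count_integral_shift(2)[of "%\<mu>. a \<mu> * c (\<mu> - 1)" 1] i
  by (simp add: lint_diff)
qed

text \<open>The data of the averaging problem: \<open>v\<close> is the smooth part of \<open>f\<close>, \<open>g\<close> collects the primitives of the rough part at the end points of the cells, \<open>a\<close> is the sequence of averages, and \<open>T\<close> bounds all local oscillations. The kernel scale is \<open>1/l\<close>. The bounds \<open>Bv\<close> and \<open>Bg\<close> provide integrability.\<close>

locale step_average =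
 fixes d l :: real and v :: "real => complex" and g a :: "int => complex" and T :: "int => real" and Bv Bg :: real
 assumes d: "d > 0" and l: "l > 0"
  and v_meas [measurable]: "v \<in> borel_measurable borel" and v_bound: "!!y. cmod (v y) <= Bv"
  and g_bound: "!!\<mu>. cmod (g \<mu>) <= Bg"
  and v_osc: "!!\<mu> y. abs (y - d * of_int \<mu>) <= d ==> cmod (v y - v (d * of_int \<mu>)) <= T \<mu>"
  and g_T: "!!\<mu>. cmod (g \<mu>) <= d * T \<mu>" "!!\<mu>. cmod (g (\<mu> + 1)) <= d * T \<mu>" "!!\<mu>. cmod (g (\<mu> - 1)) <= d * T \<mu>"
  and a: "!!\<mu>. a \<mu> = of_real (1 / d) * ((LBINT y. indicator (cell d \<mu>) y * v y) + g (\<mu> + 1) - g \<mu>)"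
begin

definition "V \<mu> = (LBINT y. indicator (cell d \<mu>) y * v y)"

definition "E y = a \<lfloor>y / d\<rfloor>"

lemma T_nonneg: "T \<mu> >= 0"
 using v_osc[of "d * of_int \<mu>" \<mu>] d by simp

lemma E_cell: "y \<in> cell d \<mu> ==> E y = a \<mu>"
 using d by (simp add: mem_cell E_def)

lemma v_cell_integrable: "integrable lborel (%y. indicator (cell d \<mu>) y * v y)"
proof -
 have "integrable lborel (%y. v y * indicator (cell d \<mu>) y)"
  by (rule integrable_bounded_mult[OF v_meas v_bound cell_indicator(1)[OF d]])
 then show ?thesis by (simp add: mult.commute)
qed

lemma one_cell_integrable: "integrable lborel (%y. indicator (cell d \<mu>) y * (z::complex))"
 by (rule integrable_mult_left) (rule cell_indicator(1)[OF d])

lemma a_bound: "cmod (a \<mu>) <= Bv + 2 * Bg / d"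
proof -
 have "Bv >= 0" using order_trans[OF norm_ge_zero v_bound] .
 then have "cmod (V \<mu>) <= Bv * d" unfolding V_def by (intro cell_integral_bound d v_bound)
 then have "cmod (V \<mu> + g (\<mu> + 1) - g \<mu>) <= Bv * d + Bg + Bg"
  by (intro norm_triangle_le_diff norm_triangle_le add_mono g_bound) auto
 then have "(1 / d) * cmod (V \<mu> + g (\<mu> + 1) - g \<mu>) <= (1 / d) * (Bv * d + Bg + Bg)"
  using d by (intro mult_left_mono) auto
 moreover have "cmod (a \<mu>) = (1 / d) * cmod (V \<mu> + g (\<mu> + 1) - g \<mu>)"
  using d unfolding a V_def norm_mult by (simp add: norm_divide)
 ultimately show ?thesis using d by (simp add: field_simps)
qed

lemma E_meas [measurable]: "E \<in> borel_measurable borel"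
proof -
 have "(%y. a \<lfloor>y / d\<rfloor>) \<in> borel_measurable borel"
  by (rule measurable_compose[where g = a and N = "count_space UNIV"]) auto
 then show ?thesis unfolding E_def[abs_def] .
qed

lemma E_bound: "cmod (E y) <= Bv + 2 * Bg / d"
 unfolding E_def by (rule a_bound)

lemma V_osc: 
 assumes "!!y. y \<in> cell d \<mu>' ==> abs (y - d * of_int \<mu>) <= d"
 shows "cmod (V \<mu>' - of_real d * v (d * of_int \<mu>)) <= T \<mu> * d"
proof -
 have "V \<mu>' - of_real d * v (d * of_int \<mu>) = (LBINT y. indicator (cell d \<mu>') y * v y - indicator (cell d \<mu>') y * v (d * of_int \<mu>))"
  by (subst lint_diff[OF v_cell_integrable one_cell_integrable]) (simp only: V_def cell_integral_one[OF d])
 also have "... = (LBINT y. indicator (cell d \<mu>') y * (v y - v (d * of_int \<mu>)))"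
  by (simp add: right_diff_distrib)
 finally show ?thesis
  using cell_integral_bound[OF d T_nonneg[of \<mu>], of \<mu>' "%y. v y - v (d * of_int \<mu>)"] assms v_osc by simp
qed

text \<open>On a cell, the difference of the averages and \<open>v\<close> is the mean of \<open>v\<close> minus \<open>v\<close>, which has integral zero, plus \<open>(g (\<mu> + 1) - g \<mu>) / d\<close>. In the first part the value of the kernel at \<open>d \<mu>\<close> may be subtracted. In the second part, summation by parts moves the difference to the integrals of the kernel over neighbouring cells. Either way only increments of the kernel over length \<open>d\<close> remain.\<close>

lemma low_frequency_bound:
 fixes G :: "real => complex"
 assumes ld: "l * d <= 1" and G: "integrable lborel G" and A: "A >= 0"
  and inc: "!!t h. abs h <= 1 ==> cmod (G (t + h) - G t) <= A * abs h / wt t ^ m"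
 shows "ennreal (cmod (LBINT y. (E y - v y) * (of_real l * G (l * (x - y))))) \<le>
  (ZSUM \<mu>. ennreal (4 * A * (l * d)\<^sup>2 * (T \<mu> / (1 + l * abs (x - d * of_int \<mu>)) ^ m)))"
proof -
 define H where "H y = of_real l * G (l * (x - y))" for y
 have H: "integrable lborel H"
 proof -
  have "integrable lborel (%y. G (l * x + (- l) * y))"
   using lborel_integrable_real_affine_iff[of "- l" G "l * x"] l G by simp
  then have "integrable lborel (%y. of_real l * G (l * x + (- l) * y))" by (rule integrable_mult_right)
  then show ?thesis unfolding H_def[abs_def] by (simp add: algebra_simps)
 qed
 note [measurable] = borel_measurable_integrable[OF H]
 define c where "c \<mu> = (LBINT y. indicator (cell d \<mu>) y * H y)" for \<mu>
  \<comment> \<open>The contribution of the oscillation of \<open>v\<close>, with the value of the kernel at \<open>d \<mu>\<close> subtracted.\<close>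
 define R where "R \<mu> = (LBINT y. indicator (cell d \<mu>) y * ((of_real (1 / d) * V \<mu> - v y) * (H y - H (d * of_int \<mu>))))" for \<mu>
 define w where "w \<mu> = (1 + l * abs (x - d * of_int \<mu>)) ^ m" for \<mu> :: int
 have w: "w \<mu> > 0" for \<mu> unfolding w_def using l by (intro zero_less_power) (simp add: add_pos_nonneg)
 have Hinc: "cmod (H y - H (d * of_int \<mu>)) <= A * (l * (l * d)) / w \<mu>" if "abs (y - d * of_int \<mu>) <= d" for y \<mu>
 proof -
  define h where "h = l * (d * of_int \<mu> - y)"
  have h: "abs h <= l * d" unfolding h_def using that l by (simp add: abs_mult abs_minus_commute)
  have "cmod (H y - H (d * of_int \<mu>)) = l * cmod (G (l * (x - d * of_int \<mu>) + h) - G (l * (x - d * of_int \<mu>)))"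
   unfolding H_def h_def right_diff_distrib[symmetric] norm_mult using l by (simp add: algebra_simps)
  also have "... <= l * (A * abs h / wt (l * (x - d * of_int \<mu>)) ^ m)"
   using l h ld by (intro mult_left_mono inc) auto
  also have "... = A * (l * abs h) / w \<mu>" using l by (simp add: w_def abs_mult)
  also have "... <= A * (l * (l * d)) / w \<mu>"
   using w[of \<mu>] l A h by (intro divide_right_mono mult_left_mono) auto
  finally show ?thesis .
 qed
 have cell_H: "integrable lborel (%y. indicator (cell d \<mu>) y * H y)" for \<mu>
  by (rule integrable_indicator_mult[OF H]) simp
 have cell_vH: "integrable lborel (%y. indicator (cell d \<mu>) y * (v y * H y))" for \<mu>
  by (rule integrable_indicator_mult[OF integrable_bounded_mult[OF v_meas v_bound H]]) simp
 have EvH: "integrable lborel (%y. (E y - v y) * H y)"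
 proof (rule integrable_bounded_mult[OF _ _ H])
  show "cmod (E y - v y) <= (Bv + 2 * Bg / d) + Bv" for y by (intro norm_triangle_le_diff add_mono E_bound v_bound)
 qed measurable
 have R: "R \<mu> = of_real (1 / d) * V \<mu> * c \<mu> - (LBINT y. indicator (cell d \<mu>) y * (v y * H y))" for \<mu>
 proof -
  have "R \<mu> = (LBINT y. (of_real (1 / d) * V \<mu>) * (indicator (cell d \<mu>) y * H y) - indicator (cell d \<mu>) y * (v y * H y) -
    (indicator (cell d \<mu>) y * (of_real (1 / d) * V \<mu> * H (d * of_int \<mu>)) - H (d * of_int \<mu>) * (indicator (cell d \<mu>) y * v y)))"
   unfolding R_def by (rule lint_cong) (auto simp: algebra_simps)
  also have "... = ((of_real (1 / d) * V \<mu>) * c \<mu> - (LBINT y. indicator (cell d \<mu>) y * (v y * H y))) -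
    (of_real d * (of_real (1 / d) * V \<mu> * H (d * of_int \<mu>)) - H (d * of_int \<mu>) * V \<mu>)"
   unfolding c_def V_def
   by (simp only: cell_integral_one[OF d] lint_diff integrable_mult_right Bochner_Integration.integrable_diff cell_H cell_vH
     one_cell_integrable v_cell_integrable integral_mult_right_zero)
  finally show ?thesis using d by simp
 qed
 have cell_int: "(LBINT y. indicator (cell d \<mu>) y * ((E y - v y) * H y)) = (of_real (1 / d) * g (\<mu> + 1) - of_real (1 / d) * g \<mu>) * c \<mu> + R \<mu>" for \<mu>
 proof -
  have "(LBINT y. indicator (cell d \<mu>) y * ((E y - v y) * H y)) =
   (LBINT y. a \<mu> * (indicator (cell d \<mu>) y * H y) - indicator (cell d \<mu>) y * (v y * H y))"
   by (rule lint_cong) (auto simp: E_cell algebra_simps split: split_indicator)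
  also have "... = a \<mu> * c \<mu> - (LBINT y. indicator (cell d \<mu>) y * (v y * H y))"
   unfolding c_def by (simp only: lint_diff integrable_mult_right cell_H cell_vH integral_mult_right_zero)
  also have "... = (of_real (1 / d) * g (\<mu> + 1) - of_real (1 / d) * g \<mu>) * c \<mu> + R \<mu>"
   unfolding R a V_def by (simp add: algebra_simps)
  finally show ?thesis .
 qed
 have ci: "integrable (count_space UNIV) c" unfolding c_def[abs_def] by (rule integral_step_decomposition(1)[OF d H])
 define b where "b \<mu> = of_real (1 / d) * g \<mu>" for \<mu>
 have b: "cmod (b \<mu>) <= Bg / d" for \<mu>
  unfolding b_def norm_mult using d g_bound[of \<mu>] by (simp add: norm_divide divide_right_mono)
 note sbp = count_summation_by_parts[OF b ci]
 have bci: "integrable (count_space UNIV) (%\<mu>. (b (\<mu> + 1) - b \<mu>) * c \<mu>)"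
 proof (rule count_integrable_bounded_mult[OF _ ci])
  show "cmod (b (\<mu> + 1) - b \<mu>) <= Bg / d + Bg / d" for \<mu> by (intro norm_triangle_le_diff add_mono b)
 qed
 have Ri: "integrable (count_space UNIV) R"
  using Bochner_Integration.integrable_diff[OF integral_step_decomposition(1)[OF d EvH] bci] unfolding cell_int b_def by simp
 have "(LBINT y. (E y - v y) * H y) = (\<integral>\<mu>. (b (\<mu> + 1) - b \<mu>) * c \<mu> + R \<mu> \<partial>count_space UNIV)"
  unfolding integral_step_decomposition(2)[OF d EvH] cell_int b_def ..
 also have "... = (\<integral>\<mu>. b \<mu> * (c (\<mu> - 1) - c \<mu>) + R \<mu> \<partial>count_space UNIV)"
  using Bochner_Integration.integral_add[OF bci Ri] Bochner_Integration.integral_add[OF sbp(1) Ri] sbp(2) by simp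
 finally have "ennreal (cmod (LBINT y. (E y - v y) * H y)) <= (ZSUM \<mu>. ennreal (cmod (b \<mu> * (c (\<mu> - 1) - c \<mu>) + R \<mu>)))"
  by (simp only: norm_integral_le_nn_integral)
 also have "... <= (ZSUM \<mu>. ennreal (4 * A * (l * d)\<^sup>2 * (T \<mu> / w \<mu>)))"
 proof (intro nn_integral_mono ennreal_leI)
  fix \<mu> :: int
  define K where "K = A * (l * (l * d)) / w \<mu>"
  have K: "K >= 0" unfolding K_def using A l d w[of \<mu>] by auto
  have "c (\<mu> - 1) = (LBINT y. indicator (cell d \<mu>) y * H (y - d))"
   unfolding c_def by (subst lborel_integral_real_affine[where c = 1 and t = "- d"])
    (auto simp: cell_def algebra_simps intro!: lint_cong split: split_indicator)
  moreover have "integrable lborel (%y. indicator (cell d \<mu>) y * H (y - d))"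
  proof (rule integrable_indicator_mult)
   show "integrable lborel (%y. H (y - d))"
    using lborel_integrable_real_affine_iff[of 1 H "- d"] H by simp
  qed simp
  ultimately have "c (\<mu> - 1) - c \<mu> = (LBINT y. indicator (cell d \<mu>) y * (H (y - d) - H y))"
   unfolding c_def right_diff_distrib using cell_H by simp
  also have "cmod ... <= (2 * K) * d"
  proof (rule cell_integral_bound[OF d])
   fix y assume y: "y \<in> cell d \<mu>"
   have "cmod ((H (y - d) - H (d * of_int \<mu>)) - (H y - H (d * of_int \<mu>))) <= K + K"
    unfolding K_def by (intro norm_triangle_le_diff add_mono Hinc) (use y d in \<open>auto simp: cell_def distrib_left\<close>)
   then show "cmod (H (y - d) - H y) <= 2 * K" by simp
  qed (use K in simp)
  finally have 1: "cmod (c (\<mu> - 1) - c \<mu>) <= 2 * K * d" .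
  have "cmod (b \<mu>) <= T \<mu>" unfolding b_def norm_mult using d g_T(1)[of \<mu>] by (simp add: norm_divide pos_divide_le_eq mult.commute)
  then have 2: "cmod (b \<mu> * (c (\<mu> - 1) - c \<mu>)) <= T \<mu> * (2 * K * d)"
   unfolding norm_mult using 1 T_nonneg by (intro mult_mono) auto
  have 3: "cmod (R \<mu>) <= (2 * T \<mu> * K) * d"
   unfolding R_def
  proof (rule cell_integral_bound[OF d])
   fix y assume y: "y \<in> cell d \<mu>"
   have "cmod (of_real (1 / d) * V \<mu> - v (d * of_int \<mu>)) = (1 / d) * cmod (V \<mu> - of_real d * v (d * of_int \<mu>))"
   proof -
    have "of_real (1 / d) * V \<mu> - v (d * of_int \<mu>) = of_real (1 / d) * (V \<mu> - of_real d * v (d * of_int \<mu>))"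
     using d by (simp add: right_diff_distrib)
    then show ?thesis using d by (simp only: norm_mult norm_of_real) simp
   qed
   also have "... <= (1 / d) * (T \<mu> * d)" using d V_osc[OF cell_dist[OF d], of \<mu>] by (intro mult_left_mono) auto
   finally have "cmod (of_real (1 / d) * V \<mu> - v (d * of_int \<mu>)) <= T \<mu>" using d by simp
   then have "cmod ((of_real (1 / d) * V \<mu> - v (d * of_int \<mu>)) - (v y - v (d * of_int \<mu>))) <= T \<mu> + T \<mu>"
    using v_osc[OF cell_dist[OF d y]] by (intro order_trans[OF norm_triangle_ineq4 add_mono])
   then have "cmod (of_real (1 / d) * V \<mu> - v y) <= 2 * T \<mu>" by simp
   then show "cmod ((of_real (1 / d) * V \<mu> - v y) * (H y - H (d * of_int \<mu>))) <= 2 * T \<mu> * K"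
    unfolding norm_mult K_def using Hinc[OF cell_dist[OF d y]] T_nonneg by (intro mult_mono) auto
  qed (use K T_nonneg in simp)
  have "cmod (b \<mu> * (c (\<mu> - 1) - c \<mu>) + R \<mu>) <= T \<mu> * (2 * K * d) + (2 * T \<mu> * K) * d"
   using 2 3 by (rule norm_triangle_mono)
  also have "... = 4 * A * (l * d)\<^sup>2 * (T \<mu> / w \<mu>)" by (simp add: K_def power2_eq_square)
  finally show "cmod (b \<mu> * (c (\<mu> - 1) - c \<mu>) + R \<mu>) <= 4 * A * (l * d)\<^sup>2 * (T \<mu> / w \<mu>)" .
 qed
 finally show ?thesis unfolding H_def w_def .
qed

text \<open>The integral of the kernel over a cell is an increment of the primitive. Summation by parts moves the difference to the averages, and \<open>|a \<mu> - a (\<mu> - 1)| \<le> 6 T \<mu>\<close>: two terms compare the means of \<open>v\<close> with \<open>v (d \<mu>)\<close>, four come from \<open>g\<close>.\<close>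

lemma high_frequency_bound:
 fixes G :: "real => complex"
 assumes G: "integrable lborel G" and m: "m >= 2"
  and dec: "!!t. cmod (primitive G t) <= A / wt t ^ m"
 shows "ennreal (cmod (LBINT y. E y * (of_real l * G (l * (x - y))))) \<le>
  (ZSUM \<mu>. ennreal (6 * A * (T \<mu> / (1 + l * abs (x - d * of_int \<mu>)) ^ m)))"
proof -
 define H where "H y = of_real l * G (l * (x - y))" for y
 define P where "P \<mu> = primitive G (l * (x - d * of_int \<mu>))" for \<mu> :: int
 have aff: "l * x + (- l) * y = l * (x - y)" for y by (simp add: algebra_simps)
 have H: "integrable lborel H"
 proof -
  have "integrable lborel (%y. G (l * x + (- l) * y))"
   using lborel_integrable_real_affine_iff[of "- l" G "l * x"] l G by simp
  then show ?thesis unfolding H_def[abs_def] aff by (rule integrable_mult_right)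
 qed
 have A: "A >= 0" using order_trans[OF norm_ge_zero dec[of 0]] by simp
 have EH: "integrable lborel (%y. E y * H y)" by (rule integrable_bounded_mult[OF E_meas E_bound H])
 have w: "(1 + l * abs (x - d * of_int \<mu>)) ^ n > 0" for \<mu> :: int and n
  using l by (intro zero_less_power) (simp add: add_pos_nonneg)
 have P: "cmod (P \<mu>) <= A / (1 + l * abs (x - d * of_int \<mu>)) ^ m" for \<mu>
  using dec[of "l * (x - d * of_int \<mu>)"] l by (simp add: P_def abs_mult)
 have Pi: "integrable (count_space UNIV) P"
 proof (rule integrableI_bounded)
  have "(ZSUM \<mu>. ennreal (norm (P \<mu>))) <= (ZSUM \<mu>. ennreal A * ennreal (1 / (wt ((l * d) * of_int \<mu> - l * x))\<^sup>2))"
  proof (rule nn_integral_mono)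
   fix \<mu> :: int
   have "l * abs (x - d * of_int \<mu>) = abs ((l * d) * of_int \<mu> - l * x)"
   proof -
    have "l * abs (x - d * of_int \<mu>) = abs (l * (x - d * of_int \<mu>))" using l by (simp add: abs_mult)
    also have "... = abs ((l * d) * of_int \<mu> - l * x)" by (simp add: right_diff_distrib abs_minus_commute mult.assoc)
    finally show ?thesis .
   qed
   moreover have "A / (1 + l * abs (x - d * of_int \<mu>)) ^ m <= A / (1 + l * abs (x - d * of_int \<mu>))\<^sup>2"
    using A l w[of \<mu> 2] w[of \<mu> m] m by (intro divide_left_mono power_increasing mult_pos_pos) auto
   ultimately have "norm (P \<mu>) <= A * (1 / (wt ((l * d) * of_int \<mu> - l * x))\<^sup>2)" using P[of \<mu>] by simp
   then show "ennreal (norm (P \<mu>)) <= ennreal A * ennreal (1 / (wt ((l * d) * of_int \<mu> - l * x))\<^sup>2)"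
    using A by (simp add: ennreal_mult[symmetric] ennreal_leI)
  qed
  also have "... = ennreal A * (ZSUM \<mu>. ennreal (1 / (wt ((l * d) * of_int \<mu> - l * x))\<^sup>2))"
   by (rule nn_integral_cmult) simp
  also have "... <= ennreal A * ennreal (8 * max 1 (1 / (l * d)))"
   using l d by (intro mult_left_mono lattice_sum_bound) auto
  also have "... < \<infinity>" by (simp add: ennreal_mult_less_top)
  finally show "(ZSUM \<mu>. ennreal (norm (P \<mu>))) < \<infinity>" .
 qed simp
 have c: "(LBINT y. indicator (cell d \<mu>) y * H y) = P \<mu> - P (\<mu> + 1)" for \<mu>
 proof -
  have "P \<mu> - P (\<mu> + 1) = (LBINT t. indicator {l * (x - d * of_int (\<mu> + 1))<..l * (x - d * of_int \<mu>)} t * G t)"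
   unfolding P_def using l d by (intro primitive_diff[OF G]) auto
  also have "... = of_real l * (LBINT y. indicator {l * (x - d * of_int (\<mu> + 1))<..l * (x - d * of_int \<mu>)} (l * (x - y)) * G (l * (x - y)))"
   by (subst lborel_integral_real_affine[where c = "- l" and t = "l * x"], use l in simp, subst aff, subst aff)
    (use l in \<open>simp add: scaleR_conv_of_real\<close>)
  also have "... = (LBINT y. indicator (cell d \<mu>) y * H y)"
   unfolding integral_mult_right_zero[symmetric] H_def
   using l by (intro lint_cong) (auto simp: cell_def split: split_indicator)
  finally show ?thesis by simp
 qed
 have cell_int: "(LBINT y. indicator (cell d \<mu>) y * (E y * H y)) = a \<mu> * (P \<mu> - P (\<mu> + 1))" for \<mu>
 proof -
  have "(LBINT y. indicator (cell d \<mu>) y * (E y * H y)) = (LBINT y. a \<mu> * (indicator (cell d \<mu>) y * H y))"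
   by (rule lint_cong) (auto simp: E_cell split: split_indicator)
  then show ?thesis by (simp add: c)
 qed
 have Pi': "integrable (count_space UNIV) (%\<mu>. P (\<mu> + 1))" using count_integral_shift(1)[of P 1] Pi by simp
 have "(LBINT y. E y * H y) = (\<integral>\<mu>. a \<mu> * (P \<mu> - P (\<mu> + 1)) \<partial>count_space UNIV)"
  unfolding integral_step_decomposition(2)[OF d EH] cell_int ..
 also have "... = (\<integral>\<mu>. (a \<mu> - a (\<mu> - 1)) * P \<mu> \<partial>count_space UNIV)"
  using count_summation_by_parts(2)[of a, OF a_bound Pi']
   count_integral_shift(2)[of "%\<mu>. (a \<mu> - a (\<mu> - 1)) * P \<mu>" 1] by simp
 finally have "ennreal (cmod (LBINT y. E y * H y)) <= (ZSUM \<mu>. ennreal (cmod ((a \<mu> - a (\<mu> - 1)) * P \<mu>)))"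
  by (simp only: norm_integral_le_nn_integral)
 also have "... <= (ZSUM \<mu>. ennreal (6 * A * (T \<mu> / (1 + l * abs (x - d * of_int \<mu>)) ^ m)))"
 proof (intro nn_integral_mono ennreal_leI)
  fix \<mu> :: int
  let ?v = "of_real d * v (d * of_int \<mu>)"
  have near: "abs (y - d * of_int \<mu>) <= d" if "y \<in> cell d (\<mu> - 1)" for y
   using that d by (auto simp: cell_def algebra_simps)
  have "cmod ((V \<mu> - ?v) - (V (\<mu> - 1) - ?v) + (g (\<mu> + 1) - g \<mu>) - (g \<mu> - g (\<mu> - 1))) \<le>
   T \<mu> * d + T \<mu> * d + (d * T \<mu> + d * T \<mu>) + (d * T \<mu> + d * T \<mu>)"
   by (intro norm_triangle_le_diff norm_triangle_le add_mono V_osc cell_dist[OF d] near g_T)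
  moreover have "a \<mu> - a (\<mu> - 1) = of_real (1 / d) * ((V \<mu> - ?v) - (V (\<mu> - 1) - ?v) + (g (\<mu> + 1) - g \<mu>) - (g \<mu> - g (\<mu> - 1)))"
   unfolding a V_def[symmetric] by (simp add: add_divide_distrib diff_divide_distrib)
  ultimately have "cmod (a \<mu> - a (\<mu> - 1)) <= (1 / d) * (6 * d * T \<mu>)"
   using d by (simp only: norm_mult norm_of_real) (auto simp: norm_divide pos_divide_le_eq mult_ac)
  then have "cmod (a \<mu> - a (\<mu> - 1)) <= 6 * T \<mu>" using d by simp
  then have "cmod ((a \<mu> - a (\<mu> - 1)) * P \<mu>) <= (6 * T \<mu>) * (A / (1 + l * abs (x - d * of_int \<mu>)) ^ m)"
   unfolding norm_mult using P[of \<mu>] T_nonneg by (intro mult_mono) auto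
  then show "cmod ((a \<mu> - a (\<mu> - 1)) * P \<mu>) <= 6 * A * (T \<mu> / (1 + l * abs (x - d * of_int \<mu>)) ^ m)"
   by (simp add: mult_ac)
 qed
 finally show ?thesis unfolding H_def .
qed

end

section \<open>Kernel profiles\<close>

text \<open>All kernels with \<open>k \<ge> 1\<close> are dilations of one another, so two profiles give bounds that are uniform in \<open>k\<close>.\<close>

definition prof :: "(real => complex) => nat => real => complex" where
 "prof \<phi> k t = (if k = 0 then low \<phi> 0 t else 1 / 2 * lp_kernel \<phi> 1 (1 / 2 * t + 0))"

lemma lp_kernel_prof:
 assumes lp: "lp_generator \<phi>"
 shows "lp_kernel \<phi> k y = of_real (2 ^ k) * prof \<phi> k (2 ^ k * y)"
proof (cases k)
 case 0
 then show ?thesis by (simp add: prof_def lp_kernel_0)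
next
 case (Suc j)
 have "prof \<phi> k (2 ^ k * y) = 1 / 2 * (low \<phi> (Suc 0) (2 ^ j * y) - low \<phi> 0 (2 ^ j * y))"
  unfolding prof_def using Suc by (simp add: lp_kernel_Suc[OF lp])
 also have "low \<phi> (Suc 0) (2 ^ j * y) = 2 * low \<phi> 0 (2 ^ k * y)"
  by (subst low_scale) (simp add: Suc mult.assoc)
 finally have p: "prof \<phi> k (2 ^ k * y) = 1 / 2 * (2 * low \<phi> 0 (2 ^ k * y) - low \<phi> 0 (2 ^ j * y))" .
 have "lp_kernel \<phi> k y = 2 ^ k * low \<phi> 0 (2 ^ k * y) - 2 ^ j * low \<phi> 0 (2 ^ j * y)"
  unfolding Suc lp_kernel_Suc[OF lp] low_scale[of \<phi> "Suc j" y] low_scale[of \<phi> j y] ..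
 then show ?thesis unfolding p by (simp add: Suc algebra_simps)
qed

lemma schwartz_prof: "lp_generator \<phi> ==> schwartz (prof \<phi> k)"
 using schwartz_low[of \<phi> 0] schwartz_cmult[OF schwartz_affine[OF schwartz_lp_kernel[of \<phi> 1], of "1 / 2" 0], of "1 / 2"]
 unfolding prof_def[abs_def] by (cases "k = 0") simp_all

lemma prof_bounds:
 assumes lp: "lp_generator \<phi>"
 obtains A where "A >= 0"
  "!!k t h. abs h <= 1 ==> cmod (prof \<phi> k (t + h) - prof \<phi> k t) <= A * abs h / wt t ^ m"
  "!!k t. k >= 1 ==> cmod (primitive (prof \<phi> k) t) <= A / wt t ^ m"
proof -
 obtain A0 :: "nat => real" where A0: "!!m. A0 m >= 0" "!!m x h. abs h <= 1 ==> cmod (prof \<phi> 0 (x + h) - prof \<phi> 0 x) <= A0 m * abs h / wt x ^ m"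
  by (rule schwartz_increment_decay[OF schwartz_prof[OF lp, of 0]]) blast
 obtain A1 :: "nat => real" where A1: "!!m. A1 m >= 0" "!!m x h. abs h <= 1 ==> cmod (prof \<phi> 1 (x + h) - prof \<phi> 1 x) <= A1 m * abs h / wt x ^ m"
  by (rule schwartz_increment_decay[OF schwartz_prof[OF lp, of 1]]) blast
 have k1: "prof \<phi> k = prof \<phi> 1" if "k >= 1" for k using that by (auto simp: prof_def fun_eq_iff)
 have "(LBINT t. prof \<phi> 1 t) = (LBINT x. lp_kernel \<phi> 1 x)"
  by (subst (2) lborel_integral_real_affine[where c = "1 / 2" and t = 0]) (auto simp: prof_def[abs_def] scaleR_conv_of_real)
 also have "... = (LBINT x. low \<phi> 1 x - low \<phi> 0 x)" using lp_kernel_Suc[OF lp, of 0] by simp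
 also have "... = 0"
  using schwartz_integrable[OF schwartz_low[OF lp], of 0] by (subst lint_diff) (simp_all add: integral_low[OF lp])
 finally have z: "(LBINT t. prof \<phi> 1 t) = 0" .
 obtain A2 where A2: "A2 >= 0" "!!x. cmod (primitive (prof \<phi> 1) x) <= A2 / wt x ^ m"
  using rapidD[OF rapid_primitive[OF schwartz_rapid[OF schwartz_prof[OF lp]] schwartz_borel[OF schwartz_prof[OF lp]] z], of m] by blast
 define A where "A = A0 m + A1 m + A2"
 have A: "A0 m <= A" "A1 m <= A" "A2 <= A" "A >= 0" using A0(1)[of m] A1(1)[of m] A2(1) by (auto simp: A_def)
 have pos: "wt t ^ m > 0" for t by (intro zero_less_power) auto
 show ?thesis
 proof (rule that[OF A(4)])
  fix k :: nat and t h :: real assume h: "abs h <= 1"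
  show "cmod (prof \<phi> k (t + h) - prof \<phi> k t) <= A * abs h / wt t ^ m"
  proof (cases "k = 0")
   case True
   have "A0 m * abs h / wt t ^ m <= A * abs h / wt t ^ m" using A pos by (intro divide_right_mono mult_right_mono) (auto intro: less_imp_le)
   then show ?thesis using A0(2)[OF h, of t m] True by simp
  next
   case False
   have "A1 m * abs h / wt t ^ m <= A * abs h / wt t ^ m" using A pos by (intro divide_right_mono mult_right_mono) (auto intro: less_imp_le)
   then show ?thesis using A1(2)[OF h, of t m] k1[of k] False by simp
  qed
 next
  fix k :: nat and t assume "k >= 1"
  moreover have "A2 / wt t ^ m <= A / wt t ^ m" using A pos by (intro divide_right_mono) (auto intro: less_imp_le)
  ultimately show "cmod (primitive (prof \<phi> k) t) <= A / wt t ^ m" using A2(2)[of t] k1[of k] by simp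
 qed
qed

section \<open>The control sequence\<close>

definition pks :: "(real => complex) => real => distribution => nat => int => nat => real" where
 "pks \<phi> p f N \<mu> j = (\<Sum>i\<in>{-1, 0, 1::int}. pk \<phi> p f j (1 / 2 ^ N * of_int (\<mu> + i)))"

text \<open>The control sequence: the means of all blocks at a lattice point and its two neighbours, damped by the distance of the frequency from \<open>N\<close>.\<close>

definition hsum :: "(real => complex) => real => distribution => nat => int => real" where
 "hsum \<phi> p f N \<mu> = (\<Sum>j. 2 powr (- real (gap j N)) * pks \<phi> p f N \<mu> j)"

text \<open>The primitive of the part of \<open>f\<close> above frequency \<open>2^N\<close>, sampled on the lattice.\<close>

definition gsum :: "(real => complex) => distribution => nat => int => complex" where
 "gsum \<phi> f N \<mu> = (\<Sum>j. gprim \<phi> f (j + Suc N) (1 / 2 ^ N * of_int \<mu>))"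

text \<open>A fixed choice of the constant from \<open>lp_block_pk\<close>, so that later bounds are visibly independent of \<open>f\<close>.\<close>

definition blockC :: "(real => complex) => real => real" where
 "blockC \<phi> p = (SOME C. C >= 0 \<and> (\<forall>f s q j x h. f \<in> TL_space \<phi> s p q \<longrightarrow> q > 0 \<longrightarrow>
   (abs h * 2 ^ j <= 1 \<longrightarrow> cmod (lp_block \<phi> j f (x + h) - lp_block \<phi> j f x) <= C * (2 ^ j * abs h) * pk \<phi> p f j x) \<and>
   cmod (gprim \<phi> f j x) <= C * (1 / 2 ^ j) * pk \<phi> p f j x))"

lemma blockC:
 assumes p: "p > 0" and lp: "lp_generator \<phi>"
 shows "blockC \<phi> p >= 0"
  "f \<in> TL_space \<phi> s p q ==> q > 0 ==> abs h * 2 ^ j <= 1 ==>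
    cmod (lp_block \<phi> j f (x + h) - lp_block \<phi> j f x) <= blockC \<phi> p * (2 ^ j * abs h) * pk \<phi> p f j x"
  "f \<in> TL_space \<phi> s p q ==> q > 0 ==> cmod (gprim \<phi> f j x) <= blockC \<phi> p * (1 / 2 ^ j) * pk \<phi> p f j x"
proof -
 have "\<exists>C. C >= 0 \<and> (\<forall>f s q j x h. f \<in> TL_space \<phi> s p q \<longrightarrow> q > 0 \<longrightarrow>
   (abs h * 2 ^ j <= 1 \<longrightarrow> cmod (lp_block \<phi> j f (x + h) - lp_block \<phi> j f x) <= C * (2 ^ j * abs h) * pk \<phi> p f j x) \<and>
   cmod (gprim \<phi> f j x) <= C * (1 / 2 ^ j) * pk \<phi> p f j x)"
  by (rule lp_block_pk[OF p lp]) blast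
 from someI_ex[OF this] show "blockC \<phi> p >= 0"
  "f \<in> TL_space \<phi> s p q ==> q > 0 ==> abs h * 2 ^ j <= 1 ==>
    cmod (lp_block \<phi> j f (x + h) - lp_block \<phi> j f x) <= blockC \<phi> p * (2 ^ j * abs h) * pk \<phi> p f j x"
  "f \<in> TL_space \<phi> s p q ==> q > 0 ==> cmod (gprim \<phi> f j x) <= blockC \<phi> p * (1 / 2 ^ j) * pk \<phi> p f j x"
  unfolding blockC_def[symmetric] by blast+
qed

lemma pks_nonneg: "pks \<phi> p f N \<mu> j >= 0"
 unfolding pks_def by (intro sum_nonneg pk_nonneg)

lemma pk_le_pks: "i \<in> {-1, 0, 1} ==> pk \<phi> p f j (1 / 2 ^ N * of_int (\<mu> + i)) <= pks \<phi> p f N \<mu> j"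
 unfolding pks_def by (rule member_le_sum) (auto simp: pk_nonneg)

lemma sum3_powr_le:
 fixes a b e :: real
 assumes "a >= 0" "b >= 0" "e >= 0" "p > 0"
 shows "(a + b + e) powr p <= 3 powr p * (a powr p + b powr p + e powr p)"
proof -
 define m where "m = max a (max b e)"
 have m: "m >= 0" "a + b + e <= 3 * m" using assms by (auto simp: m_def)
 have "(a + b + e) powr p <= (3 * m) powr p" using assms m by (intro powr_mono2) auto
 also have "... = 3 powr p * m powr p" by (rule powr_mult)
 also have "m powr p <= a powr p + b powr p + e powr p" unfolding m_def max_def by auto
 finally show ?thesis by simp
qed

context TL_element
begin

lemma hsum_summable:
 shows "summable (%j. 2 powr (- real (gap j N)) * pks \<phi> p f N \<mu> j)" (is "summable ?t")
  and "hsum \<phi> p f N \<mu> <= 3 * TLB \<phi> s p q f * 2 ^ N * (\<Sum>j. (2 powr (1 / p - s - 1)) ^ j)"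
proof -
 define r where "r = (2::real) powr (1 / p - s - 1)"
 have r: "0 < r" "r < 1" using powr_less_mono[of "1 / p - s - 1" 0 2] s by (auto simp: r_def)
 have le: "?t j <= (3 * TLB \<phi> s p q f * 2 ^ N) * r ^ j" for j
 proof -
  have "pks \<phi> p f N \<mu> j <= (\<Sum>i\<in>{-1, 0, 1::int}. 2 powr (real j * (1 / p - s)) * TLB \<phi> s p q f)"
   unfolding pks_def by (intro sum_mono pk_le[OF f p q lp])
  then have 1: "pks \<phi> p f N \<mu> j <= 3 * (2 powr (real j * (1 / p - s)) * TLB \<phi> s p q f)" by simp
  have 2: "2 powr (- real (gap j N)) <= 2 powr (real N - real j)" by (intro powr_mono) (auto simp: gap_def)
  have "?t j <= 2 powr (real N - real j) * (3 * (2 powr (real j * (1 / p - s)) * TLB \<phi> s p q f))"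
   by (intro mult_mono 1 2) (auto simp: pks_nonneg)
  also have "... = 3 * TLB \<phi> s p q f * (2 powr (real N - real j) * 2 powr (real j * (1 / p - s)))" by simp
  also have "2 powr (real N - real j) * 2 powr (real j * (1 / p - s)) = 2 powr real N * (2 powr (1 / p - s - 1)) powr real j"
   by (simp add: powr_add[symmetric] powr_powr algebra_simps)
  also have "... = 2 ^ N * r ^ j" using r by (simp add: powr_two_nat r_def[symmetric] powr_realpow)
  finally show ?thesis by simp
 qed
 have gsm: "summable (%j. (3 * TLB \<phi> s p q f * 2 ^ N) * r ^ j)" using r by (intro summable_mult summable_geometric) auto
 show sm: "summable ?t"
  by (rule summable_comparison_test'[OF gsm, of 0]) (use le in \<open>auto simp: pks_nonneg\<close>)
 show "hsum \<phi> p f N \<mu> <= 3 * TLB \<phi> s p q f * 2 ^ N * (\<Sum>j. (2 powr (1 / p - s - 1)) ^ j)"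
  unfolding hsum_def r_def[symmetric] using suminf_le[OF le sm gsm] suminf_mult[of "%j. r ^ j" "3 * TLB \<phi> s p q f * 2 ^ N"] r
  by (simp add: summable_geometric)
qed

lemma hsum_nonneg: "hsum \<phi> p f N \<mu> >= 0"
 unfolding hsum_def by (intro suminf_nonneg hsum_summable) (auto simp: pks_nonneg)

text \<open>The primitive of block \<open>j\<close> has size \<open>2^-j pk j = 2^-N 2^-(j-N) pk j\<close>, and \<open>j > N\<close> in the sum.\<close>

lemma gsum_bound:
 assumes i: "i \<in> {-1, 0, 1}"
 shows "cmod (gsum \<phi> f N (\<mu> + i)) <= 1 / 2 ^ N * (blockC \<phi> p * hsum \<phi> p f N \<mu>)"
proof -
 let ?y = "1 / 2 ^ N * real_of_int (\<mu> + i)" and ?t = "%j. 2 powr (- real (gap j N)) * pks \<phi> p f N \<mu> j"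
 have le: "cmod (gprim \<phi> f (j + Suc N) ?y) <= 1 / 2 ^ N * (blockC \<phi> p * ?t (j + Suc N))" for j
 proof -
  have e: "2 powr (- real (gap (j + Suc N) N)) = 1 / 2 ^ Suc j"
   using powr_two_nat[of "Suc j"] powr_minus_divide[of 2 "real (Suc j)"] by (simp add: gap_def)
  have "cmod (gprim \<phi> f (j + Suc N) ?y) <= blockC \<phi> p * (1 / 2 ^ (j + Suc N)) * pk \<phi> p f (j + Suc N) ?y"
   by (rule blockC(3)[OF p lp f q])
  also have "... <= blockC \<phi> p * (1 / 2 ^ (j + Suc N)) * pks \<phi> p f N \<mu> (j + Suc N)"
   by (intro mult_left_mono pk_le_pks i) (use blockC(1)[OF p lp] in auto)
  also have "... = 1 / 2 ^ N * (blockC \<phi> p * ?t (j + Suc N))" unfolding e by (simp add: power_add)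
  finally show ?thesis .
 qed
 have sm: "summable (%j. ?t (j + Suc N))" using hsum_summable(1) by (rule summable_ignore_initial_segment)
 have "cmod (gsum \<phi> f N (\<mu> + i)) <= (\<Sum>j. 1 / 2 ^ N * (blockC \<phi> p * ?t (j + Suc N)))"
  unfolding gsum_def by (rule norm_suminf_le[OF le]) (intro summable_mult sm)
 also have "... = 1 / 2 ^ N * (blockC \<phi> p * (\<Sum>j. ?t (j + Suc N)))"
  using suminf_mult[OF sm, of "blockC \<phi> p"] suminf_mult[OF summable_mult[OF sm, of "blockC \<phi> p"], of "1 / 2 ^ N"] by simp
 also have "... <= 1 / 2 ^ N * (blockC \<phi> p * hsum \<phi> p f N \<mu>)"
 proof -
  have "0 <= (\<Sum>j<Suc N. ?t j)" by (intro sum_nonneg) (auto simp: pks_nonneg)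
  then have "(\<Sum>j. ?t (j + Suc N)) <= hsum \<phi> p f N \<mu>"
   unfolding hsum_def using suminf_split_initial_segment[OF hsum_summable(1)[of N \<mu>], of "Suc N"] by linarith
  then show ?thesis using blockC(1)[OF p lp] by (intro mult_left_mono) auto
 qed
 finally show ?thesis .
qed

text \<open>Over length \<open>2^-N\<close> the block \<open>j \<le> N\<close> varies by at most a multiple of \<open>2^(j-N) pk j\<close>.\<close>

lemma low_frequency_oscillation:
 assumes y: "abs (y - 1 / 2 ^ N * of_int \<mu>) <= 1 / 2 ^ N"
 shows "cmod (dconv f (low \<phi> N) y - dconv f (low \<phi> N) (1 / 2 ^ N * of_int \<mu>)) <= blockC \<phi> p * hsum \<phi> p f N \<mu>"
proof -
 let ?y = "1 / 2 ^ N * real_of_int \<mu>" and ?t = "%j. 2 powr (- real (gap j N)) * pks \<phi> p f N \<mu> j"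
 have le: "cmod (u j f y - u j f ?y) <= blockC \<phi> p * ?t j" if j: "j <= N" for j
 proof -
  have e: "2 powr (- real (gap j N)) = 2 ^ j * (1 / 2 ^ N)"
   using j by (simp add: gap_def of_nat_diff powr_diff powr_two_nat)
  have h: "2 ^ j * abs (y - ?y) <= 2 ^ j * (1 / 2 ^ N)" using y by (intro mult_left_mono) auto
  have "2 ^ j * (1 / 2 ^ N) <= (1::real)" using j by simp
  with h have h1: "abs (y - ?y) * 2 ^ j <= 1" by (simp only: mult.commute order_trans)
  have "cmod (u j f (?y + (y - ?y)) - u j f ?y) <= blockC \<phi> p * (2 ^ j * abs (y - ?y)) * pk \<phi> p f j ?y"
   by (rule blockC(2)[OF p lp f q h1])
  also have "... <= blockC \<phi> p * (2 ^ j * (1 / 2 ^ N)) * pks \<phi> p f N \<mu> j"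
   using pk_le_pks[of 0 \<phi> p f j N \<mu>] blockC(1)[OF p lp] h by (intro mult_mono[OF mult_left_mono[OF h]]) (auto simp: pk_nonneg)
  finally show ?thesis by (simp add: e)
 qed
 have "cmod (dconv f (low \<phi> N) y - dconv f (low \<phi> N) ?y) = cmod (\<Sum>j\<le>N. u j f y - u j f ?y)"
  by (simp add: dconv_low_eq_sum[OF tf lp] sum_subtractf)
 also have "... <= (\<Sum>j\<le>N. blockC \<phi> p * ?t j)" by (rule sum_norm_le) (use le in auto)
 also have "... = blockC \<phi> p * (\<Sum>j\<le>N. ?t j)" by (rule sum_distrib_left[symmetric])
 also have "... <= blockC \<phi> p * hsum \<phi> p f N \<mu>"
  unfolding hsum_def by (intro mult_left_mono blockC(1) p lp sum_le_suminf hsum_summable) (auto simp: pks_nonneg)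
 finally show ?thesis .
qed

definition "av N \<mu> = of_real (1 / (1 / 2 ^ N)) * ((LBINT y. indicator (cell (1 / 2 ^ N) \<mu>) y * dconv f (low \<phi> N) y) + gsum \<phi> f N (\<mu> + 1) - gsum \<phi> f N \<mu>)"

lemma step_average_av:
 obtains Bv Bg where "!!l. l > 0 ==> step_average (1 / 2 ^ N) l (dconv f (low \<phi> N)) (gsum \<phi> f N) (av N) (%\<mu>. blockC \<phi> p * hsum \<phi> p f N \<mu>) Bv Bg"
proof -
 have "\<forall>j. \<exists>B. \<forall>x. cmod (u j f x) <= B" using u_bounded by blast
 then obtain B where B: "!!j x. cmod (u j f x) <= B j" by metis
 have v: "cmod (dconv f (low \<phi> N) y) <= (\<Sum>j\<le>N. B j)" for y
  unfolding dconv_low_eq_sum[OF tf lp] by (rule sum_norm_le) (rule B)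
 have g: "cmod (gsum \<phi> f N \<mu>) <= (\<Sum>j. bd (j + Suc N))" for \<mu>
  unfolding gsum_def by (rule norm_suminf_le[OF bd(4)]) (intro summable_ignore_initial_segment bd(1))
 show ?thesis
 proof (rule that, unfold_locales)
  show "dconv f (low \<phi> N) \<in> borel_measurable borel"
   by (rule borel_measurable_continuous_onI[OF dconv_continuous[OF tf schwartz_low[OF lp]]])
 qed (use v g gsum_bound[of 0 N] gsum_bound[of 1 N] gsum_bound[of "-1" N] low_frequency_oscillation in \<open>auto simp: av_def\<close>)
qed

abbreviation "Eav N \<equiv> step_average.E (1 / 2 ^ N) (av N)"

end

text \<open>Summing the local means over a lattice gives at most the \<open>L\<^sub>p\<close> integral times the larger of 1 and the density of the lattice, by Tonelli.\<close>

lemma nn_integral_lattice_qavg: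
 assumes [measurable]: "w \<in> borel_measurable borel" and i: "integrable lborel (%z. cmod (w z) powr p)" and e: "e > 0"
 shows "(ZSUM \<mu>. ennreal (qavg p w (e * of_int \<mu> + t))) <= ennreal (8 * max 1 (1 / e) * (LBINT z. cmod (w z) powr p))"
proof -
 have "(ZSUM \<mu>. ennreal (qavg p w (e * of_int \<mu> + t))) =
  (ZSUM \<mu>. LBNN z. ennreal (cmod (w z) powr p / (wt (e * real_of_int \<mu> + t - z))\<^sup>2))"
  by (simp only: nn_qavg[OF assms(1,2)])
 also have "... = (LBNN z. ZSUM \<mu>. ennreal (cmod (w z) powr p / (wt (e * real_of_int \<mu> + t - z))\<^sup>2))"
  by (rule nn_integral_count_space_nn_integral[symmetric]) auto
 also have "... <= (LBNN z. ennreal (8 * max 1 (1 / e)) * ennreal (cmod (w z) powr p))"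
 proof (rule nn_integral_mono)
  fix z
  have "(ZSUM \<mu>. ennreal (cmod (w z) powr p / (wt (e * real_of_int \<mu> + t - z))\<^sup>2)) =
   (ZSUM \<mu>. ennreal (cmod (w z) powr p) * ennreal (1 / (wt (e * real_of_int \<mu> - (z - t)))\<^sup>2))"
   by (intro nn_integral_cong) (simp add: ennreal_mult[symmetric] algebra_simps)
  also have "... = ennreal (cmod (w z) powr p) * (ZSUM \<mu>. ennreal (1 / (wt (e * real_of_int \<mu> - (z - t)))\<^sup>2))"
   by (rule nn_integral_cmult) simp
  also have "... <= ennreal (cmod (w z) powr p) * ennreal (8 * max 1 (1 / e))"
   by (intro mult_left_mono lattice_sum_bound e) auto
  finally show "(ZSUM \<mu>. ennreal (cmod (w z) powr p / (wt (e * real_of_int \<mu> + t - z))\<^sup>2)) <= ennreal (8 * max 1 (1 / e)) * ennreal (cmod (w z) powr p)"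
   by (simp add: mult.commute)
 qed
 also have "... = ennreal (8 * max 1 (1 / e)) * ennreal (LBINT z. cmod (w z) powr p)"
  using nn_integral_eq_integral[OF i] by (subst nn_integral_cmult) auto
 also have "... = ennreal (8 * max 1 (1 / e) * (LBINT z. cmod (w z) powr p))"
  by (rule ennreal_mult[symmetric]) (auto intro: Bochner_Integration.integral_nonneg)
 finally show ?thesis .
qed

text \<open>Half of the room that the two conditions \<open>s < 1\<close> and \<open>s > 1/p - 1\<close> leave for the two tails of \<open>hsum\<close>.\<close>

definition eps :: "real => real => real" where
 "eps s p = min (1 - s) (s + 1 - 1 / p) / 2"

definition hC :: "real => real => real" where
 "hC s p = geo (eps s p) powr p * (3 powr p * 24 * geo (p * eps s p))"

context TL_element
begin

text \<open>Block \<open>j\<close> contributes \<open>max(2^j, 2^N) (2^-js B)^p\<close> to the lattice sum. Relative to the right-hand side and with the damping \<open>2^-p|j-N|\<close>, this decays as \<open>j\<close> decreases from \<open>N\<close> because \<open>s < 1\<close>, and as \<open>j\<close> increases from \<open>N\<close> because \<open>s > 1/p - 1\<close>.\<close>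

lemma hsum_Lp:
 assumes s1: "s < 1"
 shows "(ZSUM \<mu>. ennreal (hsum \<phi> p f N \<mu> powr p)) \<le>
  ennreal (hC s p * (2 ^ N * (2 powr (- real N * s) * TLB \<phi> s p q f) powr p))"
proof -
 define e where "e = eps s p"
 have e: "e > 0" "2 * e <= 1 - s" "2 * e <= s + 1 - 1 / p" using s s1 by (auto simp: e_def eps_def)
 define B where "B = TLB \<phi> s p q f"
 have B: "B >= 0" by (simp add: B_def TLB_nonneg)
 let ?t = "%\<mu> j. 2 powr (- real (gap j N)) * pks \<phi> p f N \<mu> j"
 let ?w = "%j. (2 powr ((e - 1) * real (gap j N))) powr p"
 define Q where "Q = 2 ^ N * (2 powr (- real N * s) * B) powr p"
 have Q: "Q >= 0" by (simp add: Q_def)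
 have pk3: "(ZSUM \<mu>. ennreal (pks \<phi> p f N \<mu> j powr p)) \<le>
  ennreal (3 powr p * 24 * (max 1 (1 / (2 ^ j * (1 / 2 ^ N))) * (2 ^ j * (2 powr (- real j * s) * B) powr p)))" for j
 proof -
  note b = band_ublk(1)[OF f p q lp, of j]
  have ib: "integrable lborel (%z. cmod (ublk \<phi> f j z) powr p)" using b by (simp add: band_def)
  let ?X = "8 * max 1 (1 / (2 ^ j * (1 / 2 ^ N))) * (2 ^ j * (2 powr (- real j * s) * B) powr p)"
  have X: "?X >= 0" by (intro mult_nonneg_nonneg) auto
  have one: "(ZSUM \<mu>. ennreal (pk \<phi> p f j (1 / 2 ^ N * of_int (\<mu> + i)) powr p)) <= ennreal ?X" for i :: int
  proof -
   have "(ZSUM \<mu>. ennreal (pk \<phi> p f j (1 / 2 ^ N * of_int (\<mu> + i)) powr p)) =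
    (ZSUM \<mu>. ennreal (qavg p (ublk \<phi> f j) ((2 ^ j * (1 / 2 ^ N)) * of_int \<mu> + (2 ^ j * (1 / 2 ^ N)) * of_int i)))"
    by (intro nn_integral_cong) (use p in \<open>simp add: pk_def powr_powr qavg_nonneg distrib_left add_divide_distrib\<close>)
   also have "... <= ennreal (8 * max 1 (1 / (2 ^ j * (1 / 2 ^ N))) * (LBINT z. cmod (ublk \<phi> f j z) powr p))"
    by (rule nn_integral_lattice_qavg[OF band_measurable[OF b] ib]) simp
   also have "... <= ennreal ?X"
    unfolding B_def by (intro ennreal_leI mult_left_mono band_ublk(2)[OF f p q lp]) auto
   finally show ?thesis .
  qed
  have "(ZSUM \<mu>. ennreal (pks \<phi> p f N \<mu> j powr p)) \<le>
   (ZSUM \<mu>. ennreal (3 powr p) * (\<Sum>i\<in>{-1, 0, 1::int}. ennreal (pk \<phi> p f j (1 / 2 ^ N * of_int (\<mu> + i)) powr p)))"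
  proof (rule nn_integral_mono)
   fix \<mu> :: int
   let ?P = "%i::int. pk \<phi> p f j (1 / 2 ^ N * of_int (\<mu> + i))"
   have "pks \<phi> p f N \<mu> j powr p <= 3 powr p * (\<Sum>i\<in>{-1, 0, 1::int}. ?P i powr p)"
    using sum3_powr_le[of "?P (-1)" "?P 0" "?P 1" p] p by (simp add: pks_def pk_nonneg add.assoc)
   then have "ennreal (pks \<phi> p f N \<mu> j powr p) <= ennreal (3 powr p * (\<Sum>i\<in>{-1, 0, 1::int}. ?P i powr p))" by (rule ennreal_leI)
   also have "... = ennreal (3 powr p) * (\<Sum>i\<in>{-1, 0, 1::int}. ennreal (?P i powr p))"
    by (subst sum_ennreal, simp, rule ennreal_mult) (simp_all add: sum_nonneg)
   finally show "ennreal (pks \<phi> p f N \<mu> j powr p) <= ennreal (3 powr p) * (\<Sum>i\<in>{-1, 0, 1::int}. ennreal (?P i powr p))" .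
  qed
  also have "... = ennreal (3 powr p) * (\<Sum>i\<in>{-1, 0, 1::int}. ZSUM \<mu>. ennreal (pk \<phi> p f j (1 / 2 ^ N * of_int (\<mu> + i)) powr p))"
   by (subst nn_integral_cmult, simp, subst nn_integral_sum) auto
  also have "... <= ennreal (3 powr p) * (\<Sum>i\<in>{-1, 0, 1::int}. ennreal ?X)"
   by (intro mult_left_mono sum_mono one) auto
  also have "... = ennreal (3 powr p * (3 * ?X))"
   using X by (subst sum_ennreal) (simp_all add: ennreal_mult)
  finally show ?thesis by (simp add: mult_ac)
 qed
 have ex: "?w j * (max 1 (1 / (2 ^ j * (1 / 2 ^ N))) * (2 ^ j * (2 powr (- real j * s) * B) powr p)) <= 2 powr (- (p * e) * real (gap j N)) * Q" for j
 proof -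
  let ?n = "real (gap j N)"
  define m where "m = (if j <= N then real N else real j)"
  have mx: "max 1 (1 / (2 ^ j * (1 / 2 ^ N))) * 2 ^ j = 2 powr m"
  proof (cases "j <= N")
   case True
   then have "(2::real) ^ j <= 2 ^ N" by simp
   then have "max 1 (1 / (2 ^ j * (1 / 2 ^ N))) = (2::real) ^ N / 2 ^ j" by (simp add: max_def)
   then show ?thesis using True by (simp add: m_def powr_two_nat)
  next
   case False
   then have "(2::real) ^ N <= 2 ^ j" by simp
   then have "max 1 (1 / (2 ^ j * (1 / 2 ^ N))) = (1::real)" by (simp add: max_def)
   then show ?thesis using False by (simp add: m_def powr_two_nat)
  qed
  have "?w j * (max 1 (1 / (2 ^ j * (1 / 2 ^ N))) * (2 ^ j * (2 powr (- real j * s) * B) powr p)) =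
   2 powr ((e - 1) * ?n * p) * 2 powr m * 2 powr (- real j * s * p) * B powr p"
   unfolding mx[symmetric] using B by (simp add: powr_mult powr_powr mult_ac)
  also have "... = 2 powr ((e - 1) * ?n * p + m - real j * s * p) * B powr p"
   by (simp add: powr_add[symmetric])
  also have "... <= 2 powr (- (p * e) * ?n + real N - real N * s * p) * B powr p"
  proof (intro mult_right_mono powr_mono)
   show "(e - 1) * ?n * p + m - real j * s * p <= - (p * e) * ?n + real N - real N * s * p"
   proof (cases "j <= N")
    case True
    have "0 <= (p * ?n) * (1 - s - 2 * e)" using e p by (intro mult_nonneg_nonneg) auto
    then show ?thesis using True by (simp add: m_def gap_def of_nat_diff algebra_simps)
   next
    case False
    have "0 <= ?n * (p * (s + 1 - 1 / p - 2 * e))" using e p by (intro mult_nonneg_nonneg) auto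
    moreover have "p * (s + 1 - 1 / p - 2 * e) = p * s + p - 1 - 2 * (e * p)" using p by (simp add: algebra_simps)
    ultimately have "0 <= ?n * (p * s + p - 1 - 2 * (e * p))" by simp
    then show ?thesis using False by (simp add: m_def gap_def of_nat_diff algebra_simps)
   qed
  qed auto
  also have "... = 2 powr (- (p * e) * ?n) * Q"
  proof -
   have "Q = 2 powr real N * (2 powr (- real N * s * p) * B powr p)" by (simp add: Q_def powr_mult powr_powr powr_two_nat)
   then show ?thesis by (simp add: mult.assoc[symmetric] powr_add[symmetric] diff_diff_eq add.commute)
  qed
  finally show ?thesis .
 qed
 have "(ZSUM \<mu>. ennreal (hsum \<phi> p f N \<mu> powr p)) \<le>
  (ZSUM \<mu>. ennreal (geo e powr p) * (\<Sum>j. ennreal (?w j) * ennreal (pks \<phi> p f N \<mu> j powr p)))"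
 proof (rule nn_integral_mono)
  fix \<mu>
  have "ennreal (hsum \<phi> p f N \<mu> powr p) <= ennreal (geo e powr p) * (\<Sum>j. ennreal ((2 powr (e * real (gap j N)) * ?t \<mu> j) powr p))"
   unfolding hsum_def by (rule sum_powr_weighted[OF p e(1) _ hsum_summable(1)]) (simp add: pks_nonneg)
  also have "(%j. ennreal ((2 powr (e * real (gap j N)) * ?t \<mu> j) powr p)) = (%j. ennreal (?w j) * ennreal (pks \<phi> p f N \<mu> j powr p))"
  proof
   fix j
   have "2 powr (e * real (gap j N)) * ?t \<mu> j = 2 powr ((e - 1) * real (gap j N)) * pks \<phi> p f N \<mu> j"
    by (simp add: mult.assoc[symmetric] powr_add[symmetric] left_diff_distrib)
   then show "ennreal ((2 powr (e * real (gap j N)) * ?t \<mu> j) powr p) = ennreal (?w j) * ennreal (pks \<phi> p f N \<mu> j powr p)"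
    by (simp only: powr_mult ennreal_mult powr_ge_zero)
  qed
  finally show "ennreal (hsum \<phi> p f N \<mu> powr p) <= ennreal (geo e powr p) * (\<Sum>j. ennreal (?w j) * ennreal (pks \<phi> p f N \<mu> j powr p))" .
 qed
 also have "... = ennreal (geo e powr p) * (\<Sum>j. ennreal (?w j) * (ZSUM \<mu>. ennreal (pks \<phi> p f N \<mu> j powr p)))"
  by (subst nn_integral_cmult, simp, subst nn_integral_suminf, simp, subst nn_integral_cmult) auto
 also have "... <= ennreal (geo e powr p) * (\<Sum>j. ennreal (3 powr p * 24 * Q) * ennreal (2 powr (- (p * e) * real (gap j N))))"
 proof (intro mult_left_mono suminf_le)
  fix j
  have "ennreal (?w j) * (ZSUM \<mu>. ennreal (pks \<phi> p f N \<mu> j powr p)) \<le>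
   ennreal (?w j) * ennreal (3 powr p * 24 * (max 1 (1 / (2 ^ j * (1 / 2 ^ N))) * (2 ^ j * (2 powr (- real j * s) * B) powr p)))"
   by (intro mult_left_mono pk3) auto
  also have "... = ennreal (3 powr p * 24 * (?w j * (max 1 (1 / (2 ^ j * (1 / 2 ^ N))) * (2 ^ j * (2 powr (- real j * s) * B) powr p))))"
   by (subst ennreal_mult'[symmetric]) (auto simp: mult_ac)
  also have "... <= ennreal (3 powr p * 24 * (2 powr (- (p * e) * real (gap j N)) * Q))"
   by (intro ennreal_leI mult_left_mono ex) auto
  also have "... = ennreal (3 powr p * 24 * Q) * ennreal (2 powr (- (p * e) * real (gap j N)))"
   using Q by (subst ennreal_mult[symmetric]) (auto simp: mult_ac)
  finally show "ennreal (?w j) * (ZSUM \<mu>. ennreal (pks \<phi> p f N \<mu> j powr p)) <= ennreal (3 powr p * 24 * Q) * ennreal (2 powr (- (p * e) * real (gap j N)))" .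
 qed auto
 also have "... <= ennreal (geo e powr p) * (ennreal (3 powr p * 24 * Q) * ennreal (geo (p * e)))"
  unfolding ennreal_suminf_cmult using p e by (intro mult_left_mono two_sided_geometric_ennreal) auto
 also have "... = ennreal (hC s p * Q)"
  using Q geo_pos[of "p * e"] p e by (simp add: hC_def e_def[symmetric] ennreal_mult[symmetric] mult_ac)
 finally show ?thesis unfolding Q_def B_def .
qed

end

section \<open>The blocks of the averages\<close>

lemma tempered_function_distribution:
 assumes [measurable]: "E \<in> borel_measurable borel" and B: "!!y. cmod (E y) <= B"
 shows "tempered_distribution (function_distribution E)"
proof -
 have i: "integrable lborel (%x. E x * \<eta> x)" if "schwartz \<eta>" for \<eta>
  using integrable_bounded_mult[OF assms(1) B, of \<eta>] schwartz_integrable[OF that, of 0] by simp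
 have B0: "B >= 0" using order_trans[OF norm_ge_zero B] .
 have bound: "cmod (function_distribution E \<eta>) <= 4 * B * (\<Sum>k\<le>2. \<Sum>m\<le>2. schwartz_seminorm k m \<eta>)" if s: "schwartz \<eta>" for \<eta>
 proof -
  define S where "S = schwartz_seminorm 0 0 \<eta> + schwartz_seminorm 2 0 \<eta>"
  have bdd: "bdd_above (range (%x. abs x ^ k * cmod (vderiv m \<eta> x)))" for k m
   using s by (simp add: schwartz_def)
  have sn: "abs x ^ k * cmod (vderiv m \<eta> x) <= schwartz_seminorm k m \<eta>" for k m x
   unfolding schwartz_seminorm_def by (rule cSUP_upper[OF _ bdd]) simp
  have sn0: "schwartz_seminorm k m \<eta> >= 0" for k m
   by (rule order_trans[OF _ sn[where x = 0]]) simp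
  have S0: "S >= 0" using sn0 by (simp add: S_def)
  have le: "cmod (\<eta> x) <= 2 * S * (1 / (wt x)\<^sup>2)" for x
  proof -
   have "(wt x)\<^sup>2 <= 2 * (1 + (abs x)\<^sup>2)" using sum_squares_bound[of 1 "abs x"] by (simp add: power2_eq_square algebra_simps)
   then have "(wt x)\<^sup>2 * cmod (\<eta> x) <= 2 * (1 + (abs x)\<^sup>2) * cmod (\<eta> x)" by (rule mult_right_mono) simp
   also have "... <= 2 * S" using sn[of x 0 0] sn[of x 2 0] by (simp add: S_def distrib_right)
   finally show ?thesis using weight_sq_ge_1[of x] by (simp add: pos_le_divide_eq mult.commute)
  qed
  have "cmod (function_distribution E \<eta>) <= (LBINT x. cmod (E x * \<eta> x))"
   unfolding function_distribution_def by (rule integral_norm_bound)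
  also have "... <= (LBINT x. (B * (2 * S)) * (1 / (wt (0 - x))\<^sup>2))"
  proof (rule integral_mono[OF integrable_norm[OF i[OF s]] integrable_mult_right[OF integral_weight_shift(1)]])
   fix x
   have "cmod (E x * \<eta> x) <= B * (2 * S * (1 / (wt x)\<^sup>2))"
    unfolding norm_mult using B le B0 by (intro mult_mono) auto
   then show "cmod (E x * \<eta> x) <= (B * (2 * S)) * (1 / (wt (0 - x))\<^sup>2)" by (simp add: mult_ac)
  qed
  also have "... = 4 * B * S" unfolding integral_mult_right_zero integral_weight_shift(2) by simp
  also have "... <= 4 * B * (\<Sum>k\<le>2. \<Sum>m\<le>2. schwartz_seminorm k m \<eta>)"
   using sn0 B0 by (intro mult_left_mono) (auto simp: S_def numeral_2_eq_2 intro!: add_nonneg_nonneg)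
  finally show ?thesis .
 qed
 show ?thesis unfolding tempered_distribution_def
 proof (intro conjI allI impI)
  fix \<phi> \<eta> assume "schwartz \<phi>" "schwartz \<eta>"
  then show "function_distribution E (%x. \<phi> x + \<eta> x) = function_distribution E \<phi> + function_distribution E \<eta>"
   unfolding function_distribution_def distrib_left by (intro Bochner_Integration.integral_add i)
 next
  fix z \<phi>
  show "function_distribution E (%x. z * \<phi> x) = z * function_distribution E \<phi>"
   unfolding function_distribution_def by (simp add: mult.left_commute[of _ z])
 next
  show "\<exists>B n. \<forall>\<phi>. schwartz \<phi> \<longrightarrow> cmod (function_distribution E \<phi>) <= B * (\<Sum>k\<le>n. \<Sum>m\<le>n. schwartz_seminorm k m \<phi>)"
   using bound by blast
 qed
qed

text \<open>The rate of decay of the defect away from \<open>k = N\<close>: the first entry for \<open>k > N\<close>, the second one for \<open>k < N\<close>.\<close>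

definition eta :: "real => real => real" where
 "eta s p = min (1 - s * p) (s * p + 2 * p - max p 1)"

context TL_element
begin

lemma Eav_props:
 shows "Eav N \<in> borel_measurable borel" "\<exists>B. \<forall>y. cmod (Eav N y) <= B"
  "Eav N y = av N \<lfloor>y / (1 / 2 ^ N)\<rfloor>"
proof -
 obtain Bv Bg where *: "!!l. l > 0 ==> step_average (1 / 2 ^ N) l (dconv f (low \<phi> N)) (gsum \<phi> f N) (av N) (%\<mu>. blockC \<phi> p * hsum \<phi> p f N \<mu>) Bv Bg"
  using step_average_av[of N] by blast
 interpret st: step_average "1 / 2 ^ N" 1 "dconv f (low \<phi> N)" "gsum \<phi> f N" "av N" "%\<mu>. blockC \<phi> p * hsum \<phi> p f N \<mu>" Bv Bg
  by (rule *) simp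
 show "Eav N \<in> borel_measurable borel" by (rule st.E_meas)
 show "\<exists>B. \<forall>y. cmod (Eav N y) <= B" using st.E_bound by blast
 show "Eav N y = av N \<lfloor>y / (1 / 2 ^ N)\<rfloor>" by (rule st.E_def)
qed

lemma tempered_Eav: "tempered_distribution (function_distribution (Eav N))"
 using Eav_props(2)[of N] tempered_function_distribution[OF Eav_props(1)[of N]] by blast

definition "defect N k x = lp_block \<phi> k (function_distribution (Eav N)) x - (if k < N then u k f x else 0)"

lemma defect_pointwise:
 assumes A: "A >= 0" "!!k t h. abs h <= 1 ==> cmod (prof \<phi> k (t + h) - prof \<phi> k t) <= A * abs h / wt t ^ (wexp p + 2)"
  "!!k t. k >= 1 ==> cmod (primitive (prof \<phi> k) t) <= A / wt t ^ (wexp p + 2)"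
  and N: "N >= 1"
 shows "ennreal (cmod (defect N k x)) \<le>
  (ZSUM \<mu>. ennreal ((6 * A * blockC \<phi> p * (if k < N then (2 ^ k / 2 ^ N)\<^sup>2 else 1) * hsum \<phi> p f N \<mu>) /
   (1 + 2 ^ k * abs (x - 1 / 2 ^ N * of_int \<mu>)) ^ (wexp p + 2)))"
proof -
 obtain Bv Bg where *: "!!l. l > 0 ==> step_average (1 / 2 ^ N) l (dconv f (low \<phi> N)) (gsum \<phi> f N) (av N) (%\<mu>. blockC \<phi> p * hsum \<phi> p f N \<mu>) Bv Bg"
  using step_average_av[of N] by blast
 interpret st: step_average "1 / 2 ^ N" "2 ^ k" "dconv f (low \<phi> N)" "gsum \<phi> f N" "av N" "%\<mu>. blockC \<phi> p * hsum \<phi> p f N \<mu>" Bv Bg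
  by (rule *) simp
 let ?v = "dconv f (low \<phi> N)" and ?H = "%y. of_real (2 ^ k) * prof \<phi> k (2 ^ k * (x - y))"
 let ?W = "%\<mu>. (1 + 2 ^ k * abs (x - 1 / 2 ^ N * of_int \<mu>)) ^ (wexp p + 2)"
 have gi: "integrable lborel (prof \<phi> k)" using schwartz_integrable[OF schwartz_prof[OF lp], of 0 k] by simp
 have Hk: "?H y = lp_kernel \<phi> k (x - y)" for y by (rule lp_kernel_prof[OF lp, symmetric])
 have Hi: "integrable lborel ?H"
 proof -
  have "integrable lborel (%y. lp_kernel \<phi> k (x + (- 1) * y))"
   using lborel_integrable_real_affine_iff[of "- 1" "lp_kernel \<phi> k" x] schwartz_integrable[OF schwartz_lp_kernel[OF lp], of 0 k] by simp
  then show ?thesis unfolding Hk by simp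
 qed
 have E: "lp_block \<phi> k (function_distribution (Eav N)) x = (LBINT y. Eav N y * ?H y)"
  unfolding Hk by (simp add: lp_block_def function_distribution_def)
 have w: "?W \<mu> >= 0" for \<mu> by (intro zero_le_power) simp
 show ?thesis
 proof (cases "k < N")
  case True
  have "u k f x = (LBINT z. lp_kernel \<phi> k z * ?v (x - z))" by (rule lp_block_reproducing(2)[OF tf lp True, symmetric])
  also have "... = (LBINT y. ?v y * ?H y)"
   unfolding Hk by (subst lborel_integral_reflect[of _ x]) (simp add: mult.commute)
  finally have "defect N k x = (LBINT y. Eav N y * ?H y) - (LBINT y. ?v y * ?H y)"
   using True by (simp only: defect_def E if_True)
  also have "... = (LBINT y. (Eav N y - ?v y) * ?H y)"
   unfolding left_diff_distrib
   by (rule lint_diff[symmetric]; rule integrable_bounded_mult[OF _ _ Hi])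
     (rule st.E_meas st.E_bound st.v_meas st.v_bound)+
  finally have D: "defect N k x = (LBINT y. (Eav N y - ?v y) * ?H y)" .
  have ld: "2 ^ k * (1 / 2 ^ N) <= (1::real)" using True by simp
  have "ennreal (cmod (defect N k x)) <= (ZSUM \<mu>. ennreal (4 * A * (2 ^ k * (1 / 2 ^ N))\<^sup>2 * (blockC \<phi> p * hsum \<phi> p f N \<mu> / ?W \<mu>)))"
   unfolding D by (rule st.low_frequency_bound[OF ld gi A(1,2)])
  also have "... <= (ZSUM \<mu>. ennreal ((6 * A * blockC \<phi> p * (if k < N then (2 ^ k / 2 ^ N)\<^sup>2 else 1) * hsum \<phi> p f N \<mu>) / ?W \<mu>))"
  proof (intro nn_integral_mono ennreal_leI)
   fix \<mu> :: int
   define Z where "Z = A * (2 ^ k / 2 ^ N)\<^sup>2 * (blockC \<phi> p * hsum \<phi> p f N \<mu> / ?W \<mu>)"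
   have Z: "0 <= Z" unfolding Z_def using A(1) w[of \<mu>] blockC(1)[OF p lp] hsum_nonneg[of N \<mu>] by (intro mult_nonneg_nonneg divide_nonneg_nonneg) auto
   have 4: "4 * A * (2 ^ k * (1 / 2 ^ N))\<^sup>2 * (blockC \<phi> p * hsum \<phi> p f N \<mu> / ?W \<mu>) = 4 * Z" by (simp add: Z_def)
   have 6: "(6 * A * blockC \<phi> p * (if k < N then (2 ^ k / 2 ^ N)\<^sup>2 else 1) * hsum \<phi> p f N \<mu>) / ?W \<mu> = 6 * Z"
    using True by (simp add: Z_def mult_ac)
   show "4 * A * (2 ^ k * (1 / 2 ^ N))\<^sup>2 * (blockC \<phi> p * hsum \<phi> p f N \<mu> / ?W \<mu>) \<le>
    (6 * A * blockC \<phi> p * (if k < N then (2 ^ k / 2 ^ N)\<^sup>2 else 1) * hsum \<phi> p f N \<mu>) / ?W \<mu>"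
    unfolding 4 6 using Z by simp
  qed
  finally show ?thesis .
 next
  case False
  then have k: "k >= 1" using N by simp
  have D: "defect N k x = (LBINT y. Eav N y * ?H y)" using False by (simp add: defect_def E)
  have "ennreal (cmod (defect N k x)) <= (ZSUM \<mu>. ennreal (6 * A * (blockC \<phi> p * hsum \<phi> p f N \<mu> / ?W \<mu>)))"
   unfolding D by (rule st.high_frequency_bound[OF gi _ A(3)[OF k]]) simp
  then show ?thesis using False by (simp add: mult_ac)
 qed
qed

text \<open>The powers of 2 are collected in terms of \<open>n = |k - N|\<close>. For \<open>k < N\<close> the pointwise gain \<open>2^-2n\<close> competes with the overlap of the bumps, for \<open>k \<ge> N\<close> the loss \<open>2^nsp\<close> with the thinness \<open>2^-n\<close> of the bumps.\<close>

lemma defect_Lp: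
 assumes A: "A >= 0" "!!k t h. abs h <= 1 ==> cmod (prof \<phi> k (t + h) - prof \<phi> k t) <= A * abs h / wt t ^ (wexp p + 2)"
  "!!k t. k >= 1 ==> cmod (primitive (prof \<phi> k) t) <= A / wt t ^ (wexp p + 2)"
  and N: "N >= 1" and s1: "s < 1"
 shows "(LBNN x. ennreal (cmod (defect N k x) powr p)) \<le>
  ennreal (2 * 16 powr p * (6 * A * blockC \<phi> p) powr p * hC s p * (2 powr (- real k * s * p - eta s p * real (gap k N)) * TLB \<phi> s p q f powr p))"
proof -
 define B where "B = TLB \<phi> s p q f"
 have B: "B >= 0" by (simp add: B_def TLB_nonneg)
 define \<theta> :: real where "\<theta> = (if k < N then (2 ^ k / 2 ^ N)\<^sup>2 else 1)"
 define a where "a = 6 * A * blockC \<phi> p"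
 define mx :: real where "mx = max 1 (1 / (2 ^ k * (1 / 2 ^ N)))"
 have a: "a >= 0" using A(1) blockC(1)[OF p lp] by (simp add: a_def)
 have \<theta>: "\<theta> >= 0" by (simp add: \<theta>_def)
 have hC: "hC s p >= 0"
 proof -
  have "eps s p > 0" using s s1 by (auto simp: eps_def)
  then show ?thesis using geo_pos[of "p * eps s p"] p by (simp add: hC_def)
 qed
 obtain Tm where Tm: "!!\<mu>. hsum \<phi> p f N \<mu> <= Tm" using hsum_summable(2)[of N] by blast
 have "(LBNN x. ennreal (cmod (defect N k x) powr p)) \<le>
  ennreal (2 * 16 powr p * max 1 (1 / (2 ^ k * (1 / 2 ^ N))) powr (max (p - 1) 0) * (1 / 2 ^ k)) *
   (ZSUM \<mu>. ennreal ((a * \<theta> * hsum \<phi> p f N \<mu>) powr p))"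
 proof (rule bump_sum_Lp[OF p])
  show "a * \<theta> * hsum \<phi> p f N \<mu> <= a * \<theta> * Tm" for \<mu> using a \<theta> Tm[of \<mu>] by (intro mult_left_mono) auto
  show "ennreal (cmod (defect N k x)) <= (ZSUM \<mu>. ennreal (a * \<theta> * hsum \<phi> p f N \<mu> / (1 + 2 ^ k * abs (x - 1 / 2 ^ N * of_int \<mu>)) ^ (wexp p + 2)))" for x
   using defect_pointwise[OF A N, of k x] unfolding a_def \<theta>_def .
 qed (use a \<theta> hsum_nonneg in auto)
 also have "(ZSUM \<mu>. ennreal ((a * \<theta> * hsum \<phi> p f N \<mu>) powr p)) =
   ennreal ((a * \<theta>) powr p) * (ZSUM \<mu>. ennreal (hsum \<phi> p f N \<mu> powr p))"
  unfolding powr_mult[of "a * \<theta>"] by (simp add: ennreal_mult nn_integral_cmult)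
 also have "... <= ennreal ((a * \<theta>) powr p) * ennreal (hC s p * (2 ^ N * (2 powr (- real N * s) * B) powr p))"
  unfolding B_def by (intro mult_left_mono hsum_Lp s1) auto
 finally have "(LBNN x. ennreal (cmod (defect N k x) powr p)) \<le>
  ennreal (2 * 16 powr p * mx powr (max (p - 1) 0) * (1 / 2 ^ k)) * (ennreal ((a * \<theta>) powr p) * ennreal (hC s p * (2 ^ N * (2 powr (- real N * s) * B) powr p)))"
  unfolding mx_def by (simp add: mult_left_mono)
 also have "... = ennreal (2 * 16 powr p * a powr p * hC s p * (\<theta> powr p * mx powr (max (p - 1) 0) * (1 / 2 ^ k) * (2 ^ N * (2 powr (- real N * s) * B) powr p)))"
  unfolding powr_mult[of a \<theta>] using hC by (simp add: ennreal_mult[symmetric] mult_ac)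
 also have "... <= ennreal (2 * 16 powr p * a powr p * hC s p * (2 powr (- real k * s * p - eta s p * real (gap k N)) * B powr p))"
 proof (intro ennreal_leI mult_left_mono)
  define n where "n = real (gap k N)"
  define e\<theta> where "e\<theta> = (if k < N then - 2 * n else 0)"
  define em where "em = (if k < N then n else 0)"
  have kN: "(2::real) ^ k / 2 ^ N = 2 powr (real k - real N)" "1 / (2 ^ k * (1 / 2 ^ N)) = 2 powr (real N - real k)"
   by (simp_all add: powr_diff powr_two_nat)
  have \<theta>e: "\<theta> = 2 powr e\<theta>"
  proof (cases "k < N")
   case True
   have "\<theta> = (2 powr (real k - real N)) powr 2" 
    using True powr_realpow[of "2 powr (real k - real N)" 2] by (simp only: \<theta>_def kN(1) if_True) simp
   then show ?thesis using True by (simp add: powr_powr e\<theta>_def n_def gap_def of_nat_diff algebra_simps)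
  qed (simp add: \<theta>_def e\<theta>_def)
  have mxe: "mx = 2 powr em"
  proof (cases "k < N")
   case True
   then have "1 <= 2 powr (real N - real k)" by (intro ge_one_powr_ge_zero) auto
   then show ?thesis using True by (simp only: mx_def kN(2)) (simp add: em_def n_def gap_def of_nat_diff)
  next
   case False
   then have "2 powr (real N - real k) <= 2 powr (0::real)" by (intro powr_mono) auto
   then show ?thesis using False by (simp only: mx_def kN(2)) (simp add: em_def)
  qed
  have "\<theta> powr p * mx powr (max (p - 1) 0) * (1 / 2 ^ k) * (2 ^ N * (2 powr (- real N * s) * B) powr p) =
   2 powr (e\<theta> * p) * 2 powr (em * max (p - 1) 0) * 2 powr (- real k) * 2 powr (real N) * 2 powr (- real N * s * p) * B powr p"
  proof -
   have "(2 powr (- real N * s) * B) powr p = 2 powr (- real N * s * p) * B powr p" by (simp only: powr_mult powr_powr)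
   moreover have "1 / 2 ^ k = (2::real) powr (- real k)" by (simp add: powr_minus_divide powr_two_nat)
   ultimately show ?thesis unfolding \<theta>e mxe by (simp only: powr_powr powr_two_nat mult.assoc)
  qed
  also have "... = 2 powr (e\<theta> * p + em * max (p - 1) 0 + (- real k) + real N + (- real N * s * p)) * B powr p"
   by (simp only: powr_add)
  also have "... <= 2 powr (- real k * s * p - eta s p * n) * B powr p"
  proof (intro mult_right_mono powr_mono)
   show "e\<theta> * p + em * max (p - 1) 0 + (- real k) + real N + (- real N * s * p) <= - real k * s * p - eta s p * n"
   proof (cases "k < N")
    case True
    then have n: "real N = real k + n" "n >= 0" by (auto simp: n_def gap_def)
    have "eta s p * n <= (s * p + 2 * p - max p 1) * n" using n by (intro mult_right_mono) (auto simp: eta_def)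
    moreover have mp: "max p 1 = max (p - 1) 0 + 1" by auto
    ultimately show ?thesis using True unfolding mp by (simp add: e\<theta>_def em_def n(1) algebra_simps)
   next
    case False
    then have n: "real k = real N + n" "n >= 0" by (auto simp: n_def gap_def)
    have "eta s p * n <= (1 - s * p) * n" using n by (intro mult_right_mono) (auto simp: eta_def)
    then show ?thesis using False by (simp add: e\<theta>_def em_def n(1) algebra_simps)
   qed
  qed auto
  finally show "\<theta> powr p * mx powr (max (p - 1) 0) * (1 / 2 ^ k) * (2 ^ N * (2 powr (- real N * s) * B) powr p) \<le>
   2 powr (- real k * s * p - eta s p * real (gap k N)) * B powr p" unfolding n_def .
 qed (use hC in auto)
 finally show ?thesis unfolding a_def B_def .
qed

lemma defect_borel: "defect N k \<in> borel_measurable borel"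
 unfolding defect_def[abs_def] using lp_block_borel[OF tempered_Eav[of N] lp, of k] by (cases "k < N") auto

text \<open>Half of the decay rate is spent on passing from \<open>\<ell>\<^sub>q\<close> to a weighted \<open>\<ell>\<^sub>p\<close> sum, and the other half on summing the series.\<close>

lemma TL_norm_average_le:
 assumes A: "A >= 0" "!!k t h. abs h <= 1 ==> cmod (prof \<phi> k (t + h) - prof \<phi> k t) <= A * abs h / wt t ^ (wexp p + 2)"
  "!!k t. k >= 1 ==> cmod (primitive (prof \<phi> k) t) <= A / wt t ^ (wexp p + 2)"
  and N: "N >= 1" and s1: "s < 1" "s * p < 1"
  and C1: "C1 = 2 * 16 powr p * (6 * A * blockC \<phi> p) powr p * hC s p"
  and C2: "C2 = cq q powr p * 2 powr p * (cb q (eta s p / (2 * p)) powr p * (C1 * geo (eta s p / 2)) + 1)"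
 shows "TL_norm \<phi> s p q (function_distribution (Eav N)) <= ennreal (C2 powr (1 / p)) * TL_norm \<phi> s p q f"
proof -
 define B where "B = TLB \<phi> s p q f"
 have fin: "TL_norm \<phi> s p q f < \<infinity>" using f by (simp add: TL_space_def)
 have Bn: "TL_norm \<phi> s p q f = ennreal B" using fin by (simp add: B_def TLB_def)
 have B: "B >= 0" by (simp add: B_def TLB_nonneg)
 define \<eta> where "\<eta> = eta s p"
 have \<eta>: "\<eta> > 0"
 proof -
  have "1 - p < s * p" using s p by (simp add: field_simps)
  then show ?thesis using s1 p by (auto simp: \<eta>_def eta_def max_def)
 qed
 have eps: "eps s p > 0" using s s1 by (auto simp: eps_def)
 have C1n: "C1 >= 0" unfolding C1 using geo_pos[of "p * eps s p"] p eps by (simp add: hC_def)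
 let ?e = "%g x j. ennreal (2 powr (real j * s) * cmod (lp_block \<phi> j g x))"
 let ?F = "function_distribution (Eav N)"
 define b where "b x k = ennreal (2 powr (real k * s) * cmod (defect N k x))" for x k
 note [measurable] = defect_borel lp_block_borel[OF tempered_Eav lp] u_borel
 have Ib: "(LBNN x. ennpowr (lq_norm q (b x)) p) <= ennreal (cb q (\<eta> / (2 * p)) powr p * (C1 * geo (\<eta> / 2)) * B powr p)"
 proof -
  let ?w = "%k. 2 powr (\<eta> / (2 * p) * real (gap k N))"
  have cbp: "cb q (\<eta> / (2 * p)) > 0" using q \<eta> p by (intro cb_pos) auto
  have "(LBNN x. ennpowr (lq_norm q (b x)) p) \<le>
   (LBNN x. ennreal (cb q (\<eta> / (2 * p)) powr p) * (\<Sum>k. ennreal ((?w k * 2 powr (real k * s)) powr p) * ennreal (cmod (defect N k x) powr p)))"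
  proof (rule nn_integral_mono)
   fix x
   have "lq_norm q (b x) <= ennreal (cb q (\<eta> / (2 * p))) * ennpowr (\<Sum>k. ennpowr (ennreal (?w k) * b x k) p) (1 / p)"
    using q p \<eta> by (intro lq_norm_le_weighted) auto
   then have "ennpowr (lq_norm q (b x)) p <= ennpowr (ennreal (cb q (\<eta> / (2 * p))) * ennpowr (\<Sum>k. ennpowr (ennreal (?w k) * b x k) p) (1 / p)) p"
    using p by (intro ennpowr_mono) auto
   also have "... = ennreal (cb q (\<eta> / (2 * p)) powr p) * (\<Sum>k. ennpowr (ennreal (?w k) * b x k) p)"
    using p cbp by (subst ennpowr_mult) (auto simp: ennpowr_ennpowr ennpowr_1)
   also have "(%k. ennpowr (ennreal (?w k) * b x k) p) = (%k. ennreal ((?w k * 2 powr (real k * s)) powr p) * ennreal (cmod (defect N k x) powr p))"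
   proof
    fix k
    have "ennreal (?w k) * b x k = ennreal ((?w k * 2 powr (real k * s)) * cmod (defect N k x))"
     unfolding b_def by (subst ennreal_mult[symmetric]) (auto simp: mult.assoc)
    then have "ennpowr (ennreal (?w k) * b x k) p = ennreal (((?w k * 2 powr (real k * s)) * cmod (defect N k x)) powr p)"
     by (simp only: ennpowr_ennreal mult_nonneg_nonneg powr_ge_zero norm_ge_zero)
    then show "ennpowr (ennreal (?w k) * b x k) p = ennreal ((?w k * 2 powr (real k * s)) powr p) * ennreal (cmod (defect N k x) powr p)"
     by (simp only: powr_mult[of _ "cmod (defect N k x)"] ennreal_mult powr_ge_zero)
   qed
   finally show "ennpowr (lq_norm q (b x)) p <= ennreal (cb q (\<eta> / (2 * p)) powr p) * (\<Sum>k. ennreal ((?w k * 2 powr (real k * s)) powr p) * ennreal (cmod (defect N k x) powr p))" .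
  qed
  also have "... = ennreal (cb q (\<eta> / (2 * p)) powr p) * (\<Sum>k. ennreal ((?w k * 2 powr (real k * s)) powr p) * (LBNN x. ennreal (cmod (defect N k x) powr p)))"
   by (simp add: nn_integral_cmult nn_integral_suminf)
  also have "... <= ennreal (cb q (\<eta> / (2 * p)) powr p) * (\<Sum>k. ennreal (C1 * B powr p) * ennreal (2 powr (- (\<eta> / 2) * real (gap k N))))"
  proof (intro mult_left_mono suminf_le)
   fix k
   have e: "(?w k * 2 powr (real k * s)) powr p * 2 powr (- real k * s * p - \<eta> * real (gap k N)) = 2 powr (- (\<eta> / 2) * real (gap k N))"
   proof -
    have "(\<eta> / (2 * p) * real (gap k N) + real k * s) * p + (- real k * s * p - \<eta> * real (gap k N)) = - (\<eta> / 2) * real (gap k N)"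
     using p by (simp add: field_simps)
    then show ?thesis by (simp only: powr_add[symmetric] powr_powr)
   qed
   have "ennreal ((?w k * 2 powr (real k * s)) powr p) * (LBNN x. ennreal (cmod (defect N k x) powr p)) \<le>
     ennreal ((?w k * 2 powr (real k * s)) powr p) * ennreal (C1 * (2 powr (- real k * s * p - \<eta> * real (gap k N)) * B powr p))"
    unfolding C1 \<eta>_def B_def by (intro mult_left_mono defect_Lp A N s1) auto
   also have "... = ennreal ((C1 * B powr p) * ((?w k * 2 powr (real k * s)) powr p * 2 powr (- real k * s * p - \<eta> * real (gap k N))))"
    using C1n by (subst ennreal_mult[symmetric]) (auto simp: mult_ac)
   also have "... = ennreal (C1 * B powr p) * ennreal (2 powr (- (\<eta> / 2) * real (gap k N)))"
    unfolding e using C1n by (simp add: ennreal_mult)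
   finally show "ennreal ((?w k * 2 powr (real k * s)) powr p) * (LBNN x. ennreal (cmod (defect N k x) powr p)) \<le>
     ennreal (C1 * B powr p) * ennreal (2 powr (- (\<eta> / 2) * real (gap k N)))" .
  qed auto
  also have "... <= ennreal (cb q (\<eta> / (2 * p)) powr p) * (ennreal (C1 * B powr p) * ennreal (geo (\<eta> / 2)))"
   unfolding ennreal_suminf_cmult using \<eta> by (intro mult_left_mono two_sided_geometric_ennreal) auto
  also have "... = ennreal (cb q (\<eta> / (2 * p)) powr p * (C1 * geo (\<eta> / 2)) * B powr p)"
   using C1n geo_pos[of "\<eta> / 2"] \<eta> by (simp add: ennreal_mult[symmetric] mult_ac)
  finally show ?thesis .
 qed
 have If: "(LBNN x. ennpowr (lq_norm q (?e f x)) p) = ennreal (B powr p)"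
  using Lp_norm_powr[OF p, of "%x. lq_norm q (?e f x)"] Bn B unfolding TL_norm_def[symmetric] by (simp add: ennpowr_ennreal)
 have "(LBNN x. ennpowr (lq_norm q (?e ?F x)) p) \<le>
  (LBNN x. ennreal (cq q powr p * 2 powr p) * (ennpowr (lq_norm q (b x)) p + ennpowr (lq_norm q (?e f x)) p))"
 proof (rule nn_integral_mono)
  fix x
  have "lq_norm q (?e ?F x) <= lq_norm q (%k. b x k + ?e f x k)"
  proof (rule lq_norm_mono[OF _ q])
   fix k
   have "lp_block \<phi> k ?F x = defect N k x + (if k < N then u k f x else 0)" by (simp add: defect_def)
   then have "cmod (lp_block \<phi> k ?F x) <= cmod (defect N k x) + cmod (u k f x)"
    using norm_triangle_ineq[of "defect N k x" "u k f x"] by (auto split: if_splits)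
   then have "2 powr (real k * s) * cmod (lp_block \<phi> k ?F x) <= 2 powr (real k * s) * cmod (defect N k x) + 2 powr (real k * s) * cmod (u k f x)"
    unfolding distrib_left[symmetric] by (rule mult_left_mono) simp
   then show "?e ?F x k <= b x k + ?e f x k"
    unfolding b_def by (simp add: ennreal_plus[symmetric] ennreal_leI del: ennreal_plus)
  qed
  also have "... <= ennreal (cq q) * (lq_norm q (b x) + lq_norm q (?e f x))" by (rule lq_norm_add[OF q])
  finally have "ennpowr (lq_norm q (?e ?F x)) p <= ennpowr (ennreal (cq q) * (lq_norm q (b x) + lq_norm q (?e f x))) p"
   using p by (intro ennpowr_mono) auto
  also have "... = ennreal (cq q powr p) * ennpowr (lq_norm q (b x) + lq_norm q (?e f x)) p"
   using p cq_pos by (intro ennpowr_mult)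
  also have "... <= ennreal (cq q powr p) * (ennreal (2 powr p) * (ennpowr (lq_norm q (b x)) p + ennpowr (lq_norm q (?e f x)) p))"
   using p by (intro mult_left_mono ennpowr_add) auto
  finally show "ennpowr (lq_norm q (?e ?F x)) p <= ennreal (cq q powr p * 2 powr p) * (ennpowr (lq_norm q (b x)) p + ennpowr (lq_norm q (?e f x)) p)"
   by (simp add: ennreal_mult mult.assoc)
 qed
 also have "... = ennreal (cq q powr p * 2 powr p) * ((LBNN x. ennpowr (lq_norm q (b x)) p) + (LBNN x. ennpowr (lq_norm q (?e f x)) p))"
  unfolding b_def by (subst nn_integral_cmult, measurable, subst nn_integral_add) (auto intro!: ennpowr_measurable lq_norm_measurable)
 also have "... <= ennreal (cq q powr p * 2 powr p) * (ennreal (cb q (\<eta> / (2 * p)) powr p * (C1 * geo (\<eta> / 2)) * B powr p) + ennreal (B powr p))"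
  unfolding If by (intro mult_left_mono add_mono Ib) auto
 also have "... = ennreal (C2 * B powr p)"
  using C1n geo_pos[of "\<eta> / 2"] \<eta> unfolding C2 \<eta>_def[symmetric]
  by (simp add: ennreal_mult[symmetric] ennreal_plus[symmetric] distrib_left distrib_right mult_ac del: ennreal_plus)
 finally have "TL_norm \<phi> s p q ?F <= ennpowr (ennreal (C2 * B powr p)) (1 / p)"
  unfolding TL_norm_def Lp_norm_def using p by (intro ennpowr_mono) auto
 also have "... = ennreal (C2 powr (1 / p) * B)"
 proof -
  have "C2 >= 0" unfolding C2 \<eta>_def[symmetric] using C1n geo_pos[of "\<eta> / 2"] \<eta> by simp
  then show ?thesis using p B by (simp add: ennpowr_ennreal powr_mult powr_powr)
 qed
 finally show ?thesis unfolding Bn using B by (simp add: ennreal_mult)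
qed

end

context TL_wavelet
begin

text \<open>The blocks with \<open>j \<le> N\<close> are summed to the low-pass part, the others are integrated by their primitives; \<open>N \<ge> 1\<close> ensures that these have index at least 2.\<close>

lemma distribution_integral_av:
 assumes N: "N >= 1"
 shows "2 ^ N * distribution_integral K \<psi>0 \<psi> f (dyadic_interval N \<mu>) = av N \<mu>"
proof -
 define a b where "a = 1 / 2 ^ N * real_of_int \<mu>" and "b = 1 / 2 ^ N * real_of_int (\<mu> + 1)"
 have ab: "a < b" by (simp add: a_def b_def divide_strict_right_mono)
 have I: "dyadic_interval N \<mu> = {a..<b}" by (simp add: dyadic_interval_def a_def b_def)
 have cl: "cell (1 / 2 ^ N) \<mu> = {a..<b}" by (simp add: cell_def a_def b_def)
 let ?t = "%j. \<integral>t. u j f t * indicator {a..<b} t \<partial>lborel"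
 have tail: "?t (j + Suc N) = gprim \<phi> f (j + Suc N) b - gprim \<phi> f (j + Suc N) a" for j
 proof -
  have "?t (j + Suc N) = (LBINT t. indicator {a<..b} t * u (j + Suc N) f t)"
  proof (rule integral_cong_AE)
   show "AE t in lborel. u (j + Suc N) f t * indicator {a..<b} t = indicator {a<..b} t * u (j + Suc N) f t"
    using AE_lborel_singleton[of a] AE_lborel_singleton[of b] by eventually_elim (auto split: split_indicator)
  qed measurable
  then show ?thesis using gprim_diff[OF f p q lp _ less_imp_le[OF ab], of "j + Suc N"] N by simp
 qed
 have geo: "summable (%j. gprim \<phi> f (j + Suc N) x)" for x
  by (rule summable_norm_cancel, rule summable_comparison_test'[of "%j. bd (j + Suc N)" 0])
    (auto intro!: summable_ignore_initial_segment bd simp del: add_Suc_right)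
 have tails: "summable (%j. ?t (j + Suc N))" "(\<Sum>j. ?t (j + Suc N)) = gsum \<phi> f N (\<mu> + 1) - gsum \<phi> f N \<mu>"
  unfolding tail gsum_def a_def[symmetric] b_def[symmetric]
  by (intro summable_diff geo) (rule suminf_diff[OF geo geo, symmetric])
 have ii: "integrable lborel (%t. u j f t * indicator {a..<b} t)" for j
  using u_mult_integrable[OF cell_indicator(1)[of "1 / 2 ^ N" \<mu>], of j] by (simp add: cl)
 have "distribution_integral K \<psi>0 \<psi> f (dyadic_interval N \<mu>) = (\<Sum>j. ?t j)"
  unfolding I by (rule distribution_integral_eq[OF ab])
 also have "... = (\<Sum>j. ?t (j + Suc N)) + (\<Sum>j<Suc N. ?t j)"
  by (rule suminf_split_initial_segment) (use tails(1) summable_iff_shift[of ?t "Suc N"] in blast)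
 also have "(\<Sum>j<Suc N. ?t j) = (LBINT y. indicator {a..<b} y * dconv f (low \<phi> N) y)"
  unfolding dconv_low_eq_sum[OF tf lp] lessThan_Suc_atMost
  by (subst lint_sum[symmetric]) (auto simp: ii sum_distrib_left mult.commute)
 finally have e: "distribution_integral K \<psi>0 \<psi> f (dyadic_interval N \<mu>) = gsum \<phi> f N (\<mu> + 1) - gsum \<phi> f N \<mu> +
  (LBINT y. indicator {a..<b} y * dconv f (low \<phi> N) y)" unfolding tails(2) .
 show ?thesis unfolding av_def cl e by (simp add: algebra_simps)
qed

lemma dyadic_average_eq:
 assumes N: "N >= 1"
 shows "dyadic_average K \<psi>0 \<psi> N f = Eav N"
proof
 fix x :: real
 define \<mu>0 where "\<mu>0 = \<lfloor>x / (1 / 2 ^ N)\<rfloor>"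
 have m: "x \<in> dyadic_interval N \<mu> \<longleftrightarrow> \<mu> = \<mu>0" for \<mu>
  using mem_cell[of "1 / 2 ^ N" x \<mu>] by (auto simp: \<mu>0_def cell_def dyadic_interval_def)
 have "dyadic_average K \<psi>0 \<psi> N f x = (\<Sum>\<^sub>\<infinity>\<mu>\<in>{\<mu>0}. av N \<mu>)"
  unfolding dyadic_average_def distribution_integral_av[OF N]
  by (rule infsum_cong_neutral) (auto simp: m)
 then show "dyadic_average K \<psi>0 \<psi> N f x = Eav N x" by (simp add: Eav_props(3) \<mu>0_def)
qed

end

section \<open>Boundedness of the dyadic averages\<close>

theorem theorem1p1:
  fixes p s :: real and q :: ennreal and \<phi> :: "real \<Rightarrow> complex"
  assumes "1 / 2 < p" and "0 < q" and "1 / p - 1 < s" and "s < min (1 / p) 1"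
    and "lp_generator \<phi>"
  shows "\<exists>C::real. C > 0 \<and> (\<exists>K0 L0. \<forall>K\<ge>K0. \<forall>L\<ge>L0. \<forall>M \<psi>0 \<psi>.
    daubechies M \<psi>0 \<psi> \<and> C_k K \<psi>0 \<and> C_k K \<psi> \<and> vanishing_moments L \<psi> \<longrightarrow>
    (\<forall>f \<in> TL_space \<phi> s p q.
       (\<forall>N\<ge>1. function_distribution (dyadic_average K \<psi>0 \<psi> N f) \<in> TL_space \<phi> s p q) \<and>
       (SUP N\<in>{1..}. TL_norm \<phi> s p q (function_distribution (dyadic_average K \<psi>0 \<psi> N f)))
         \<le> ennreal C * TL_norm \<phi> s p q f))"
proof -
 have p: "p > 0" using assms(1) by simp
 have s1: "s < 1" "s * p < 1" using assms(4) p by (auto simp: pos_less_divide_eq)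
 note lp = assms(5)
 obtain A where A: "A >= 0"
  "!!k t h. abs h <= 1 ==> cmod (prof \<phi> k (t + h) - prof \<phi> k t) <= A * abs h / wt t ^ (wexp p + 2)"
  "!!k t. k >= 1 ==> cmod (primitive (prof \<phi> k) t) <= A / wt t ^ (wexp p + 2)"
  using prof_bounds[OF lp, of "wexp p + 2"] by blast
 define C1 where "C1 = 2 * 16 powr p * (6 * A * blockC \<phi> p) powr p * hC s p"
 define C2 where "C2 = cq q powr p * 2 powr p * (cb q (eta s p / (2 * p)) powr p * (C1 * geo (eta s p / 2)) + 1)"
 define C where "C = C2 powr (1 / p) + 1"
 have main: "function_distribution (dyadic_average K \<psi>0 \<psi> N f) \<in> TL_space \<phi> s p q \<and>
   TL_norm \<phi> s p q (function_distribution (dyadic_average K \<psi>0 \<psi> N f)) <= ennreal C * TL_norm \<phi> s p q f"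
  if "K >= 1" "daubechies M \<psi>0 \<psi>" "C_k K \<psi>0" "C_k K \<psi>" "f \<in> TL_space \<phi> s p q" "N >= 1" for K M N \<psi>0 \<psi> f
 proof -
  interpret TL_wavelet \<phi> s p q f M K \<psi>0 \<psi>
   by unfold_locales (use that assms p in auto)
  have "TL_norm \<phi> s p q (function_distribution (Eav N)) <= ennreal (C2 powr (1 / p)) * TL_norm \<phi> s p q f"
   by (rule TL_norm_average_le[OF A that(6) s1 C1_def C2_def])
  also have "... <= ennreal C * TL_norm \<phi> s p q f"
   unfolding C_def by (intro mult_right_mono ennreal_leI) auto
  finally have le: "TL_norm \<phi> s p q (function_distribution (Eav N)) <= ennreal C * TL_norm \<phi> s p q f" .
  also have "... < \<infinity>" using that(5) by (simp add: TL_space_def ennreal_mult_less_top)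
  finally have "function_distribution (Eav N) \<in> TL_space \<phi> s p q"
   using tempered_Eav by (simp add: TL_space_def)
  then show ?thesis using le unfolding dyadic_average_eq[OF that(6)] by simp
 qed
 have "C > 0" unfolding C_def by (simp add: add_nonneg_pos)
  \<comment> \<open>One continuous derivative gives the wavelets bounded variation, which is what pairing with \<open>f\<close> requires.\<close>
 then show ?thesis
  by (intro exI[of _ C] conjI exI[of _ 1] exI[of _ 0] allI impI ballI SUP_least) (use main in auto)
qed

end
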